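(* Let $U\subset\mathbb C$ be a connected open set, let $h$ be a Gaussian free field on $U$, and let $(h,D)$ be a coupling of $h$ with a random continuous length metric $D$ on $U$ which is a local metric for $h$. Assume that $D$ is determined by $h$ up to bi-Lipschitz equivalence in the following sense: if we condition on $h$ and let $D,\widetilde D$ be conditionally i.i.d. samples from the conditional law of $D$ given $h$, then there is a random constant $C=C_h>1$, depending only on $h$, such that almost surely $\widetilde D(z,w)\le C\,D(z,w)$ for all $z,w\in U$. Then $D$ is almost surely determined by $h$ (i.e., $D$ is a.s. equal to a measurable function of $h$; equivalently one can take $C=1$).
   Context: Metrics. For a metric space $(X,D)$ and a curve $P:[a,b]\to X$, the $D$-length is $\operatorname{len}(P;D)=\sup\sum_{i}D(P(t_i),P(t_{i-1}))$, the supremum being over all partitions $a=t_0<\dots<t_n=b$ of $[a,b]$. For $Y\subset X$ the internal metric of $D$ on $Y$ is $D(x,y;Y)=\inf_P\operatorname{len}(P;D)$, $x,y\in Y$, the infimum being over all paths $P$ in $Y$ from $x$ to $y$ (it may be $\infty$). $D$ is a length metric if for all $x,y\in X$ and $\varepsilon>0$ there is a curve from $x$ to $y$ of $D$-length at most $D(x,y)+\varepsilon$. A continuous metric on an open set $U\subset\mathbb C$ is a metric on $U$ inducing the Euclidean topology; $D(u,v)=\infty$ is allowed if $u,v$ lie in different connected components of $U$. The space of continuous metrics on $U$ carries the local uniform topology for functions on $U\times U$ (where $D^n\to D$ also requires that for large $n$, $D^n(u,v)=\infty$ iff $D(u,v)=\infty$) and its Borel $\sigma$-algebra. Gaussian free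 field (GFF). With $(\phi,\psi)_\nabla=\frac1{2\pi}\int\nabla\phi\cdot\nabla\psi$, a zero-boundary GFF on $U$ (with harmonically non-trivial boundary) is the centered Gaussian random distribution with $\mathbb E[(h,\phi)_\nabla(h,\psi)_\nabla]=(\phi,\psi)_\nabla$ for $\phi,\psi$ in the Hilbert space completion of $C_c^\infty(U)$. The whole-plane GFF is defined analogously on $\mathbb C$, modulo additive constant, which is fixed by requiring that the average of $h$ over some fixed circle is zero. "A GFF on $U$" means a zero-boundary GFF on $U$, or the whole-plane GFF if $U=\mathbb C$, or the restriction to $U$ of a normalized whole-plane GFF. For open $V\subset U$, $h|_V$ is the restriction of $\phi\mapsto(h,\phi)$ to test functions supported in $V$. For a relatively closed $K\subset U$, the $\sigma$-algebra generated by $h|_K$ is $\bigcap_{\varepsilon>0}\sigma(h|_{B_\varepsilon(K)})$, where $B_\varepsilon(K)$ is the Euclidean $\varepsilon$-neighborhood of $K$ in $U$. Local metric. Let $(h,D)$ be a coupling of a GFF on a connected open set $U$ and a random continuous length metric on $U$. $D$ is a local metric for $h$ if for every open $V\subset U$, the internal metric $D(\cdot,\cdot;V)$ is conditionally independent from the pair $\left(h|_{U\setminus V},D(\cdot,\cdot;U\setminus\overline V)\right)$ given $h|_V$ (if $U\setminus\overline V=\emptyset$, $D(\cdot,\cdot;U\setminus\overline V)$ is by convention a trivial constant). *)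

theory Defs
  imports "HOL-Probability.Probability"
begin

section \<open>Continuous metrics and internal metrics\<close>

text \<open>A metric on \<open>U\<close> is a function on \<open>U \<times> U\<close>, extensional so that each metric has exactly one
  representing function. In particular there is exactly one metric on the empty set, which is the
  trivial constant used as \<open>D(\<cdot>,\<cdot>;U - closure V)\<close> when \<open>U - closure V\<close> is empty.\<close>

definition continuous_metrics :: "complex set \<Rightarrow> (complex \<times> complex \<Rightarrow> ennreal) set" where
  "continuous_metrics U = {D \<in> extensional (U \<times> U).
     (\<forall>x\<in>U. \<forall>y\<in>U. D (x, y) = 0 \<longleftrightarrow> x = y) \<and>
     (\<forall>x\<in>U. \<forall>y\<in>U. D (x, y) = D (y, x)) \<and>
     (\<forall>x\<in>U. \<forall>y\<in>U. \<forall>z\<in>U. D (x, z) \<le> D (x, y) + D (y, z)) \<and>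
     (\<forall>x\<in>U. \<forall>y\<in>U. connected_component U x y \<longrightarrow> D (x, y) < \<infinity>) \<and>
     (\<forall>S\<subseteq>U. openin (top_of_set U) S \<longleftrightarrow> (\<forall>x\<in>S. \<exists>e>0. \<forall>y\<in>U. D (x, y) < e \<longrightarrow> y \<in> S))}"

text \<open>For finite \<open>e\<close> the two inequalities below express \<open>\<bar>D p - D' p\<bar> \<le> e\<close> where both values are finite,
  and are compatible with \<open>D p = \<infinity>\<close> only if \<open>D' p = \<infinity>\<close>.\<close>

definition metric_nbhd ::
    "complex set \<Rightarrow> (complex \<times> complex \<Rightarrow> ennreal) \<Rightarrow> (complex \<times> complex) set \<Rightarrow> real
      \<Rightarrow> (complex \<times> complex \<Rightarrow> ennreal) set" where
  "metric_nbhd U D K e = {D' \<in> continuous_metrics U.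
     (\<forall>p\<in>U \<times> U. D' p = \<infinity> \<longleftrightarrow> D p = \<infinity>) \<and>
     (\<forall>p\<in>K. D p \<le> D' p + ennreal e \<and> D' p \<le> D p + ennreal e)}"

definition metric_topology :: "complex set \<Rightarrow> (complex \<times> complex \<Rightarrow> ennreal) topology" where
  "metric_topology U = topology (\<lambda>W. W \<subseteq> continuous_metrics U \<and>
     (\<forall>D\<in>W. \<exists>K e. compact K \<and> K \<subseteq> U \<times> U \<and> e > 0 \<and> metric_nbhd U D K e \<subseteq> W))"

lemma openin_metric_topology:
  "openin (metric_topology U) W \<longleftrightarrow> W \<subseteq> continuous_metrics U \<and>
     (\<forall>D\<in>W. \<exists>K e. compact K \<and> K \<subseteq> U \<times> U \<and> e > 0 \<and> metric_nbhd U D K e \<subseteq> W)"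
proof -
  let ?P = "\<lambda>W. W \<subseteq> continuous_metrics U \<and>
     (\<forall>D\<in>W. \<exists>K e. compact K \<and> K \<subseteq> U \<times> U \<and> e > 0 \<and> metric_nbhd U D K e \<subseteq> W)"
  have "?P (S \<inter> T)" if S: "?P S" and T: "?P T" for S T
  proof (intro conjI ballI)
    show "S \<inter> T \<subseteq> continuous_metrics U" using S by blast
    fix D assume D: "D \<in> S \<inter> T"
    obtain K e where K: "compact K" "K \<subseteq> U \<times> U" "e > 0" "metric_nbhd U D K e \<subseteq> S"
      using S D by blast
    obtain L d where L: "compact L" "L \<subseteq> U \<times> U" "d > 0" "metric_nbhd U D L d \<subseteq> T"
      using T D by blast
    have a: "x \<le> y + ennreal (min e d) \<Longrightarrow> x \<le> y + ennreal e \<and> x \<le> y + ennreal d" for x y :: ennreal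
      by (auto elim!: order_trans intro!: add_left_mono ennreal_leI)
    have "metric_nbhd U D (K \<union> L) (min e d) \<subseteq> metric_nbhd U D K e \<inter> metric_nbhd U D L d"
      unfolding metric_nbhd_def using a by blast
    then show "\<exists>K e. compact K \<and> K \<subseteq> U \<times> U \<and> e > 0 \<and> metric_nbhd U D K e \<subseteq> S \<inter> T"
      using K L by (intro exI[of _ "K \<union> L"] exI[of _ "min e d"]) auto
  qed
  moreover have "?P (\<Union>\<W>)" if "\<forall>W\<in>\<W>. ?P W" for \<W>
  proof (intro conjI ballI)
    show "\<Union>\<W> \<subseteq> continuous_metrics U" using that by blast
    fix D assume "D \<in> \<Union>\<W>"
    then obtain W where W: "W \<in> \<W>" "D \<in> W" by blast
    have "\<exists>K e. compact K \<and> K \<subseteq> U \<times> U \<and> e > 0 \<and> metric_nbhd U D K e \<subseteq> W"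
      using that[rule_format, OF W(1)] W(2) by (blast dest: bspec)
    then obtain K e where "compact K \<and> K \<subseteq> U \<times> U \<and> e > 0 \<and> metric_nbhd U D K e \<subseteq> W"
      by blast
    then show "\<exists>K e. compact K \<and> K \<subseteq> U \<times> U \<and> e > 0 \<and> metric_nbhd U D K e \<subseteq> \<Union>\<W>"
      using W by (intro exI[of _ K] exI[of _ e]) auto
  qed
  ultimately have "istopology ?P"
    unfolding istopology_def by blast
  then show ?thesis
    unfolding metric_topology_def by (simp add: topology_inverse')
qed

definition metric_space_borel :: "complex set \<Rightarrow> (complex \<times> complex \<Rightarrow> ennreal) measure" where
  "metric_space_borel U = sigma (continuous_metrics U) {W. openin (metric_topology U) W}"

text \<open>Curves are parametrized by \<open>[0,1]\<close>; the length does not depend on the parametrization.\<close>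

definition metric_length :: "(complex \<times> complex \<Rightarrow> ennreal) \<Rightarrow> (real \<Rightarrow> complex) \<Rightarrow> ennreal" where
  "metric_length D P =
     (SUP (n, t) \<in> {(n :: nat, t :: nat \<Rightarrow> real). t 0 = 0 \<and> t n = 1 \<and> (\<forall>i<n. t i < t (Suc i))}.
        \<Sum>i<n. D (P (t (Suc i)), P (t i)))"

definition curves_in :: "complex set \<Rightarrow> complex \<Rightarrow> complex \<Rightarrow> (real \<Rightarrow> complex) set" where
  "curves_in Y x y = {P. path P \<and> path_image P \<subseteq> Y \<and> pathstart P = x \<and> pathfinish P = y}"

definition internal_metric ::
    "(complex \<times> complex \<Rightarrow> ennreal) \<Rightarrow> complex set \<Rightarrow> complex \<times> complex \<Rightarrow> ennreal" where
  "internal_metric D Y = (\<lambda>(x, y)\<in>Y \<times> Y. INF P\<in>curves_in Y x y. metric_length D P)"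

definition length_metric :: "complex set \<Rightarrow> (complex \<times> complex \<Rightarrow> ennreal) \<Rightarrow> bool" where
  "length_metric U D \<longleftrightarrow>
     (\<forall>x\<in>U. \<forall>y\<in>U. \<forall>e>0. \<exists>P\<in>curves_in U x y. metric_length D P \<le> D (x, y) + ennreal e)"


section \<open>Test functions and distributions\<close>

text \<open>\<open>partials [b\<^sub>1, \<dots>, b\<^sub>k] f\<close> is the iterated directional derivative; the directions in \<open>Basis\<close>
  are \<open>1\<close> and \<open>\<i>\<close>, that is, \<open>\<partial>\<^sub>x\<close> and \<open>\<partial>\<^sub>y\<close>.\<close>

primrec partials :: "complex list \<Rightarrow> (complex \<Rightarrow> real) \<Rightarrow> complex \<Rightarrow> real" where
  "partials [] f = f"
| "partials (b # bs) f = (\<lambda>z. frechet_derivative (partials bs f) (at z) b)"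

definition test_functions :: "complex set \<Rightarrow> (complex \<Rightarrow> real) set" where
  "test_functions U = {f.
     (\<forall>bs. set bs \<subseteq> Basis \<longrightarrow> (\<forall>z. partials bs f differentiable (at z))) \<and>
     compact (closure {z. f z \<noteq> 0}) \<and> closure {z. f z \<noteq> 0} \<subseteq> U}"

definition test_null_sequence :: "complex set \<Rightarrow> (nat \<Rightarrow> complex \<Rightarrow> real) \<Rightarrow> bool" where
  "test_null_sequence U f \<longleftrightarrow> (\<forall>n. f n \<in> test_functions U) \<and>
     (\<exists>K. compact K \<and> K \<subseteq> U \<and> (\<forall>n. {z. f n z \<noteq> 0} \<subseteq> K)) \<and>
     (\<forall>bs. set bs \<subseteq> Basis \<longrightarrow> uniform_limit UNIV (\<lambda>n. partials bs (f n)) (\<lambda>_. 0) sequentially)"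

definition distributions :: "complex set \<Rightarrow> ((complex \<Rightarrow> real) \<Rightarrow> real) set" where
  "distributions U = {T \<in> extensional (test_functions U).
     (\<forall>f\<in>test_functions U. \<forall>g\<in>test_functions U. T (\<lambda>z. f z + g z) = T f + T g) \<and>
     (\<forall>f\<in>test_functions U. \<forall>c. T (\<lambda>z. c * f z) = c * T f) \<and>
     (\<forall>f. test_null_sequence U f \<longrightarrow> (\<lambda>n. T (f n)) \<longlonglongrightarrow> 0)}"

definition distribution_space :: "complex set \<Rightarrow> ((complex \<Rightarrow> real) \<Rightarrow> real) measure" where
  "distribution_space U =
     restrict_space (\<Pi>\<^sub>M f\<in>test_functions U. (borel :: real measure)) (distributions U)"


section \<open>The Hilbert space completion of the test functions\<close>

definition dirichlet :: "(complex \<Rightarrow> real) \<Rightarrow> (complex \<Rightarrow> real) \<Rightarrow> real" where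
  "dirichlet f g =
     1 / (2 * pi) * (\<integral>z. (\<Sum>b\<in>Basis. partials [b] f z * partials [b] g z) \<partial>lborel)"

text \<open>Elements of the completion are represented by Cauchy sequences of test functions; sequences at
  distance \<open>0\<close> represent the same element and are not identified.\<close>

definition dirichlet_completion :: "complex set \<Rightarrow> (nat \<Rightarrow> complex \<Rightarrow> real) set" where
  "dirichlet_completion U = {f. (\<forall>n. f n \<in> test_functions U) \<and>
     (\<forall>e>0. \<exists>N. \<forall>m\<ge>N. \<forall>n\<ge>N. dirichlet (\<lambda>z. f m z - f n z) (\<lambda>z. f m z - f n z) < e)}"

definition completion_inner ::
    "(nat \<Rightarrow> complex \<Rightarrow> real) \<Rightarrow> (nat \<Rightarrow> complex \<Rightarrow> real) \<Rightarrow> real" where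
  "completion_inner f g = lim (\<lambda>n. dirichlet (f n) (g n))"

text \<open>\<open>- \<Delta> f = 2 \<pi> \<rho>\<close> in the weak sense on \<open>U\<close>, after integration by parts in
  \<open>(f, \<psi>)\<^sub>\<nabla> = - 1 / (2 \<pi>) \<integral> \<Delta> f \<psi>\<close>.\<close>

definition weak_poisson ::
    "complex set \<Rightarrow> (nat \<Rightarrow> complex \<Rightarrow> real) \<Rightarrow> (complex \<Rightarrow> real) \<Rightarrow> bool" where
  "weak_poisson U f \<rho> \<longleftrightarrow>
     (\<forall>\<psi>\<in>test_functions U. completion_inner f (\<lambda>_. \<psi>) = (\<integral>z. \<rho> z * \<psi> z \<partial>lborel))"


section \<open>The Gaussian free field\<close>

definition centered_gaussian :: "'w measure \<Rightarrow> ('w \<Rightarrow> real) \<Rightarrow> bool" where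
  "centered_gaussian M X \<longleftrightarrow> X \<in> borel_measurable M \<and>
     ((AE \<omega> in M. X \<omega> = 0) \<or> (\<exists>s>0. distributed M lborel X (normal_density 0 s)))"

text \<open>\<open>W f\<close> is \<open>(h, f)\<^sub>\<nabla>\<close>, for all \<open>f\<close> in the completion. It is tied to the distribution \<open>h\<close> by
  \<open>(h, f)\<^sub>\<nabla> = - 1 / (2 \<pi>) (h, \<Delta> f) = (h, \<rho>)\<close> whenever \<open>- \<Delta> f = 2 \<pi> \<rho>\<close>. The isometry property makes
  \<open>W\<close> almost surely linear, so that the family is jointly Gaussian.\<close>

definition gff_pairing ::
    "'w measure \<Rightarrow> complex set \<Rightarrow> (complex \<Rightarrow> real) set \<Rightarrow> ('w \<Rightarrow> (complex \<Rightarrow> real) \<Rightarrow> real) \<Rightarrow> bool" where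
  "gff_pairing M U R h \<longleftrightarrow> (\<exists>W.
     (\<forall>f\<in>dirichlet_completion U. centered_gaussian M (W f)) \<and>
     (\<forall>f\<in>dirichlet_completion U. \<forall>g\<in>dirichlet_completion U.
        (\<integral>\<omega>. W f \<omega> * W g \<omega> \<partial>M) = completion_inner f g) \<and>
     (\<forall>f\<in>dirichlet_completion U. \<forall>\<rho>\<in>R. weak_poisson U f \<rho> \<longrightarrow> (AE \<omega> in M. W f \<omega> = h \<omega> \<rho>)))"

definition planar_brownian_motion ::
    "'b measure \<Rightarrow> (real \<Rightarrow> 'b \<Rightarrow> complex) \<Rightarrow> complex \<Rightarrow> bool" where
  "planar_brownian_motion N B z \<longleftrightarrow> prob_space N \<and>
     (\<forall>t\<ge>0. B t \<in> borel_measurable N) \<and>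
     (\<forall>\<omega>\<in>space N. B 0 \<omega> = z \<and> continuous_on {0..} (\<lambda>t. B t \<omega>)) \<and>
     (\<forall>n. \<forall>t :: nat \<Rightarrow> real. 0 \<le> t 0 \<and> (\<forall>i<n. t i < t (Suc i)) \<longrightarrow>
        prob_space.indep_vars N (\<lambda>_. borel) (\<lambda>i \<omega>. B (t (Suc i)) \<omega> - B (t i) \<omega>) {..<n}) \<and>
     (\<forall>s\<ge>0. \<forall>t>s.
        prob_space.indep_var N
          borel (\<lambda>\<omega>. Re (B t \<omega> - B s \<omega>)) borel (\<lambda>\<omega>. Im (B t \<omega> - B s \<omega>)) \<and>
        distributed N lborel (\<lambda>\<omega>. Re (B t \<omega> - B s \<omega>)) (normal_density 0 (sqrt (t - s))) \<and>
        distributed N lborel (\<lambda>\<omega>. Im (B t \<omega> - B s \<omega>)) (normal_density 0 (sqrt (t - s))))"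

text \<open>The harmonic measure of the boundary is positive seen from every point of \<open>U\<close>: Brownian motion
  leaves \<open>U\<close> with positive probability. Brownian motion is realized on the space of paths.\<close>

definition harmonically_nontrivial_boundary :: "complex set \<Rightarrow> bool" where
  "harmonically_nontrivial_boundary U \<longleftrightarrow> (\<forall>z\<in>U. \<exists>N :: (real \<Rightarrow> complex) measure.
     planar_brownian_motion N (\<lambda>t \<omega>. \<omega> t) z \<and>
     measure N {\<omega> \<in> space N. \<exists>t\<ge>0. \<omega> t \<notin> U} > 0)"

definition zero_boundary_gff ::
    "'w measure \<Rightarrow> complex set \<Rightarrow> ('w \<Rightarrow> (complex \<Rightarrow> real) \<Rightarrow> real) \<Rightarrow> bool" where
  "zero_boundary_gff M U h \<longleftrightarrow> prob_space M \<and> h \<in> M \<rightarrow>\<^sub>M distribution_space U \<and>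
     harmonically_nontrivial_boundary U \<and> gff_pairing M U (test_functions U) h"

text \<open>The uniform measure on the circle of radius \<open>r\<close> around \<open>z\<close>, convolved with the mollifier
  \<open>w \<mapsto> \<eta> (w / d) / d\<^sup>2\<close>.\<close>

definition mollified_circle ::
    "(complex \<Rightarrow> real) \<Rightarrow> complex \<Rightarrow> real \<Rightarrow> real \<Rightarrow> complex \<Rightarrow> real" where
  "mollified_circle \<eta> z r d =
     (\<lambda>w. 1 / (2 * pi) *
        integral {0..2 * pi} (\<lambda>\<theta>. \<eta> ((w - (z + of_real r * cis \<theta>)) / of_real d) / d\<^sup>2))"

text \<open>A circle average is not the pairing with a smooth function; it is the limit in probability of the
  pairings with mollifications of the uniform measure on the circle.\<close>

definition is_circle_average ::
    "'w measure \<Rightarrow> ('w \<Rightarrow> (complex \<Rightarrow> real) \<Rightarrow> real) \<Rightarrow> complex \<Rightarrow> real \<Rightarrow> ('w \<Rightarrow> real) \<Rightarrow> bool" where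
  "is_circle_average M h z r A \<longleftrightarrow>
     (\<forall>\<eta>\<in>test_functions UNIV. (\<integral>w. \<eta> w \<partial>lborel) = 1 \<longrightarrow> (\<forall>e>0.
        ((\<lambda>d. measure M {\<omega> \<in> space M. \<bar>h \<omega> (mollified_circle \<eta> z r d) - A \<omega>\<bar> > e}) \<longlongrightarrow> 0)
          (at_right 0)))"

text \<open>The field modulo additive constant is its restriction to test functions of mean zero.\<close>

definition whole_plane_gff ::
    "'w measure \<Rightarrow> ('w \<Rightarrow> (complex \<Rightarrow> real) \<Rightarrow> real) \<Rightarrow> bool" where
  "whole_plane_gff M h \<longleftrightarrow> prob_space M \<and> h \<in> M \<rightarrow>\<^sub>M distribution_space UNIV \<and>
     gff_pairing M UNIV {\<rho> \<in> test_functions UNIV. (\<integral>z. \<rho> z \<partial>lborel) = 0} h \<and>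
     (\<exists>z r. r > 0 \<and> is_circle_average M h z r (\<lambda>_. 0))"

text \<open>The last alternative is in terms of the law of \<open>h\<close>, so that the whole-plane field need not be
  defined on the given probability space.\<close>

definition gff ::
    "'w measure \<Rightarrow> complex set \<Rightarrow> ('w \<Rightarrow> (complex \<Rightarrow> real) \<Rightarrow> real) \<Rightarrow> bool" where
  "gff M U h \<longleftrightarrow> prob_space M \<and> h \<in> M \<rightarrow>\<^sub>M distribution_space U \<and>
     (zero_boundary_gff M U h \<or>
      (U = UNIV \<and> whole_plane_gff M h) \<or>
      (\<exists>N. whole_plane_gff N (\<lambda>T. T) \<and>
         distr M (distribution_space U) h =
         distr N (distribution_space U) (\<lambda>T. restrict T (test_functions U))))"


section \<open>Local metrics\<close>

definition field_algebra ::
    "'w measure \<Rightarrow> ('w \<Rightarrow> (complex \<Rightarrow> real) \<Rightarrow> real) \<Rightarrow> complex set \<Rightarrow> 'w measure" where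
  "field_algebra M h V =
     vimage_algebra (space M) (\<lambda>\<omega>. restrict (h \<omega>) (test_functions V))
       (\<Pi>\<^sub>M f\<in>test_functions V. (borel :: real measure))"

definition field_algebra_closed ::
    "'w measure \<Rightarrow> complex set \<Rightarrow> ('w \<Rightarrow> (complex \<Rightarrow> real) \<Rightarrow> real) \<Rightarrow> complex set \<Rightarrow> 'w measure" where
  "field_algebra_closed M U h K =
     sigma (space M) (\<Inter>e\<in>{0<..}. sets (field_algebra M h (U \<inter> (\<Union>z\<in>K. ball z e))))"

definition internal_metric_algebra ::
    "'w measure \<Rightarrow> ('w \<Rightarrow> complex \<times> complex \<Rightarrow> ennreal) \<Rightarrow> complex set \<Rightarrow> 'w measure" where
  "internal_metric_algebra M D V =
     vimage_algebra (space M) (\<lambda>\<omega>. internal_metric (D \<omega>) V) (metric_space_borel V)"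

definition join_algebra :: "'w measure \<Rightarrow> 'w measure \<Rightarrow> 'w measure" where
  "join_algebra F G = sigma (space F) (sets F \<union> sets G)"

definition cond_indep_algebras ::
    "'w measure \<Rightarrow> 'w measure \<Rightarrow> 'w measure \<Rightarrow> 'w measure \<Rightarrow> bool" where
  "cond_indep_algebras M F G H \<longleftrightarrow>
     subalgebra M F \<and> subalgebra M G \<and> subalgebra M H \<and>
     (\<forall>A\<in>sets G. \<forall>B\<in>sets H. AE \<omega> in M.
        real_cond_exp M F (indicator (A \<inter> B)) \<omega> =
        real_cond_exp M F (indicator A) \<omega> * real_cond_exp M F (indicator B) \<omega>)"

definition local_metric ::
    "'w measure \<Rightarrow> complex set \<Rightarrow> ('w \<Rightarrow> (complex \<Rightarrow> real) \<Rightarrow> real)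
      \<Rightarrow> ('w \<Rightarrow> complex \<times> complex \<Rightarrow> ennreal) \<Rightarrow> bool" where
  "local_metric M U h D \<longleftrightarrow> (\<forall>V. open V \<and> V \<subseteq> U \<longrightarrow>
     cond_indep_algebras M (field_algebra M h V)
       (internal_metric_algebra M D V)
       (join_algebra (field_algebra_closed M U h (U - V))
                     (internal_metric_algebra M D (U - closure V))))"


section \<open>Conditional laws\<close>

definition conditional_law ::
    "'w measure \<Rightarrow> 'a measure \<Rightarrow> ('w \<Rightarrow> 'a) \<Rightarrow> 'b measure \<Rightarrow> ('w \<Rightarrow> 'b) \<Rightarrow> ('a \<Rightarrow> 'b measure) \<Rightarrow> bool" where
  "conditional_law M S X T Y \<kappa> \<longleftrightarrow> \<kappa> \<in> S \<rightarrow>\<^sub>M prob_algebra T \<and>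
     (\<forall>A\<in>sets S. \<forall>B\<in>sets T.
        measure M {\<omega> \<in> space M. X \<omega> \<in> A \<and> Y \<omega> \<in> B} =
        (\<integral>\<omega>. indicator A (X \<omega>) * measure (\<kappa> (X \<omega>)) B \<partial>M))"

end

theory Submission
  imports Defs
begin

text \<open>Condition on \<open>h\<close>, let \<open>D\<^sub>0\<close> be a fixed metric with \<open>D \<le> C D\<^sub>0\<close> and \<open>D\<^sub>0 \<le> C D\<close> almost surely, and cut the plane into small
  squares. The field does not charge the lines between them, so by locality the internal metrics of \<open>D\<close> on the squares
  are conditionally independent. Approximate \<open>D (z, w)\<close> by the infimum over chains from \<open>z\<close> to \<open>w\<close>, where a step inside
  a square costs its internal length there, but no more than \<open>C D\<^sub>0\<close>, and every other step costs \<open>C D\<^sub>0\<close>. Forgetting one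
  square changes this by an amount controlled by the part of a nearly optimal chain inside that square. These parts
  add up to at most about \<open>D (z, w)\<close>, and each is at most about \<open>C\<close> times the \<open>D\<^sub>0\<close>-diameter of its square, so the
  Efron--Stein inequality shows that the variance tends to \<open>0\<close> with the mesh size. Averaged over \<open>k\<close> shifted grids the
  approximation is within a factor \<open>1 + O(1/k)\<close> of \<open>D (z, w)\<close>, as a short step crosses a line of at most two of them.
  Thus each \<open>D (z, w)\<close> is almost surely constant given \<open>h\<close>.\<close>

section \<open>Test functions\<close>

text \<open>Locality conditions on \<open>h\<close> near an open set, the theorem on all of
  \<open>h\<close>. The bridge is that \<open>h\<close> is recovered, up to null sets, from its
  restrictions to two disjoint open sets covering \<open>U\<close> up to finitely many lines. Each
  such statement has its own null set, so cells, points and thresholds are rational and curves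
  become chains of rational points: one null set of fields is discarded once, and from then on the
  conditional law of \<open>D\<close> is a fixed measure \<open>\<mu>\<close>. The metric
  \<open>D\<^sub>0\<close> is itself a typical sample of \<open>\<mu>\<close>, by Fubini. Both
  comparisons matter: \<open>D \<le> C D\<^sub>0\<close> is the only information on a step across a
  cell boundary, and \<open>D\<^sub>0 \<le> C D\<close> returns its price to the scale of
  \<open>D\<close>, so that a blocked step is overpaid by a factor of at most
  \<open>C\<^sup>2\<close>. This is not small, and a shortest curve might run along the lines of a
  fixed grid; but a point is near the lines of few of the \<open>k\<close> shifted grids, so in the
  average the overpayment is of order \<open>C\<^sup>2 / k\<close>. The variance, in contrast, is
  small for any \<open>C\<close>, because it carries the \<open>D\<^sub>0\<close>-diameter
  \<open>\<delta>\<close> of the cells as a factor.\<close>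

lemma partials_snoc: "partials (bs @ [b]) f = partials bs (partials [b] f)"
  by (induction bs) auto

definition smooth :: "(complex \<Rightarrow> real) \<Rightarrow> bool" where
  "smooth f \<longleftrightarrow> (\<forall>bs. set bs \<subseteq> Basis \<longrightarrow> (\<forall>z. partials bs f differentiable (at z)))"

text \<open>In \<open>partials (b # bs)\<close> the head is the outermost derivative, while a class
  closed under single derivatives absorbs the innermost one; hence the induction from the end of the
  list. The closure properties below reduce to finding a class that is stable under one
  derivative.\<close>

lemma smooth_coinduct:
  assumes "f \<in> \<C>"
    and step: "\<And>g. g \<in> \<C> \<Longrightarrow> (\<forall>z. g differentiable (at z)) \<and> (\<forall>b\<in>Basis. partials [b] g \<in> \<C>)"
  shows "smooth f"
proof -
  have "\<forall>g\<in>\<C>. partials bs g \<in> \<C>" if "set bs \<subseteq> Basis" for bs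
    using that
  proof (induction bs rule: rev_induct)
    case (snoc b bs)
    then show ?case using step by (auto simp: partials_snoc simp del: partials.simps(2))
  qed auto
  with assms show ?thesis unfolding smooth_def by blast
qed

lemma smooth_differentiable: "smooth f \<Longrightarrow> f differentiable (at z)"
  unfolding smooth_def by (metis empty_subsetI list.set(1) partials.simps(1))

lemma smooth_partials1: "smooth f \<Longrightarrow> b \<in> Basis \<Longrightarrow> smooth (partials [b] f)"
  unfolding smooth_def
  by (metis Un_insert_right partials_snoc insert_subset list.set(1) list.set(2) set_append sup_bot.right_neutral)

lemma smooth_continuous: "smooth f \<Longrightarrow> continuous_on A f"
  by (meson continuous_at_imp_continuous_on differentiable_imp_continuous_within smooth_differentiable)

lemma smooth_has_derivative: "smooth f \<Longrightarrow> (f has_derivative frechet_derivative f (at z)) (at z)"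
  using frechet_derivative_works smooth_differentiable by blast

lemma partials1_eqI: "(f has_derivative f') (at z) \<Longrightarrow> partials [b] f z = f' b"
  using frechet_derivative_at by fastforce

lemma partials1_add:
  assumes "f differentiable (at z)" "g differentiable (at z)"
  shows "partials [b] (\<lambda>z. f z + g z) z = partials [b] f z + partials [b] g z"
  using assms unfolding frechet_derivative_works
  by (subst partials1_eqI[OF has_derivative_add]) auto

lemma partials1_mult:
  assumes "f differentiable (at z)" "g differentiable (at z)"
  shows "partials [b] (\<lambda>z. f z * g z) z = partials [b] f z * g z + f z * partials [b] g z"
  using assms unfolding frechet_derivative_works
  by (subst partials1_eqI[OF has_derivative_mult]) auto

lemma partials1_cmult:
  assumes "f differentiable (at z)"
  shows "partials [b] (\<lambda>z. c * f z) z = c * partials [b] f z"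
  using assms unfolding frechet_derivative_works
  by (subst partials1_eqI[OF has_derivative_mult_right]) auto

lemma partials1_const: "partials [b] (\<lambda>z. c) z = 0"
  by (subst partials1_eqI[OF has_derivative_const]) auto

lemma smooth_const: "smooth (\<lambda>z. c)"
proof (rule smooth_coinduct[where \<C>="{g. \<exists>c. g = (\<lambda>z. c)}"])
  fix g :: "complex \<Rightarrow> real" assume "g \<in> {g. \<exists>c. g = (\<lambda>z. c)}"
  then obtain c where g: "g = (\<lambda>z. c)" by blast
  have "partials [b] g = (\<lambda>z. 0)" for b unfolding g using partials1_const by (intro ext)
  then show "(\<forall>z. g differentiable at z) \<and> (\<forall>b\<in>Basis. partials [b] g \<in> {g. \<exists>c. g = (\<lambda>z. c)})"
    unfolding g by auto
qed auto

lemma smooth_add: assumes "smooth f" "smooth g" shows "smooth (\<lambda>z. f z + g z)"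
proof (rule smooth_coinduct[where \<C>="{\<lambda>z. f z + g z | f g. smooth f \<and> smooth g}"])
  fix k assume "k \<in> {\<lambda>z. f z + g z | f g. smooth f \<and> smooth g}"
  then obtain f g where k: "k = (\<lambda>z. f z + g z)" "smooth f" "smooth g" by blast
  have "partials [b] k = (\<lambda>z. partials [b] f z + partials [b] g z)" for b
    unfolding k using k by (intro ext partials1_add smooth_differentiable)
  then show "(\<forall>z. k differentiable (at z)) \<and> (\<forall>b\<in>Basis. partials [b] k \<in> {\<lambda>z. f z + g z | f g. smooth f \<and> smooth g})"
    using k smooth_partials1[of f] smooth_partials1[of g] smooth_differentiable
    by (auto intro!: derivative_intros simp del: partials.simps(2)) blast
qed (use assms in blast)

text \<open>The Leibniz rule leads from one product to a sum of two, so products alone are not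
  stable under derivatives; their finite sums are the stable class for the coinduction.\<close>

inductive_set prod_sums :: "(complex \<Rightarrow> real) set" where
  mult: "smooth f \<Longrightarrow> smooth g \<Longrightarrow> (\<lambda>z. f z * g z) \<in> prod_sums"
| add: "f \<in> prod_sums \<Longrightarrow> g \<in> prod_sums \<Longrightarrow> (\<lambda>z. f z + g z) \<in> prod_sums"

lemma smooth_mult: assumes "smooth f" "smooth g" shows "smooth (\<lambda>z. f z * g z)"
proof (rule smooth_coinduct[where \<C>=prod_sums])
  fix k assume "k \<in> prod_sums"
  then show "(\<forall>z. k differentiable (at z)) \<and> (\<forall>b\<in>Basis. partials [b] k \<in> prod_sums)"
  proof induction
    case (mult f g)
    have "partials [b] (\<lambda>z. f z * g z) = (\<lambda>z. partials [b] f z * g z + f z * partials [b] g z)" for b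
      using mult by (intro ext partials1_mult smooth_differentiable)
    then show ?case using mult smooth_differentiable
      by (auto intro!: derivative_intros prod_sums.intros smooth_partials1 simp del: partials.simps(2))
  next
    case (add f g)
    have "partials [b] (\<lambda>z. f z + g z) = (\<lambda>z. partials [b] f z + partials [b] g z)" for b
      using add by (intro ext partials1_add) auto
    then show ?case using add
      by (auto intro!: derivative_intros prod_sums.intros simp del: partials.simps(2))
  qed
qed (use assms prod_sums.mult in blast)

lemma smooth_cmult: "smooth f \<Longrightarrow> smooth (\<lambda>z. c * f z)"
  using smooth_mult[OF smooth_const] .

lemma partials_add:
  assumes "smooth f" "smooth g" "set bs \<subseteq> Basis"
  shows "partials bs (\<lambda>z. f z + g z) = (\<lambda>z. partials bs f z + partials bs g z)"
  using assms
proof (induction bs arbitrary: f g rule: rev_induct)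
  case (snoc b bs)
  have "partials [b] (\<lambda>z. f z + g z) = (\<lambda>z. partials [b] f z + partials [b] g z)"
    using snoc.prems by (intro ext partials1_add smooth_differentiable)
  then show ?case using snoc smooth_partials1 by (simp add: partials_snoc del: partials.simps(2))
qed auto

lemma partials_cmult:
  assumes "smooth f" "set bs \<subseteq> Basis"
  shows "partials bs (\<lambda>z. c * f z) = (\<lambda>z. c * partials bs f z)"
  using assms
proof (induction bs arbitrary: f rule: rev_induct)
  case (snoc b bs)
  have "partials [b] (\<lambda>z. c * f z) = (\<lambda>z. c * partials [b] f z)"
    using snoc.prems by (intro ext partials1_cmult smooth_differentiable)
  then show ?case using snoc smooth_partials1 by (simp add: partials_snoc del: partials.simps(2))
qed auto

lemma closure_support_partials1: "closure {z. partials [b] f z \<noteq> 0} \<subseteq> closure {z. f z \<noteq> (0::real)}"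
proof (rule closure_minimal)
  show "{z. partials [b] f z \<noteq> 0} \<subseteq> closure {z. f z \<noteq> 0}"
  proof (rule ccontr)
    assume "\<not> ?thesis"
    then obtain z where z: "partials [b] f z \<noteq> 0" "z \<in> - closure {z. f z \<noteq> 0}" by blast
    have "(f has_derivative (\<lambda>_. 0)) (at z)"
      by (rule has_derivative_transform_within_open[OF _ _ z(2), of "\<lambda>_. 0"])
        (use closure_subset[of "{z. f z \<noteq> 0}"] in auto)
    then show False using partials1_eqI z by blast
  qed
qed simp

lemma closure_support_partials: "closure {z. partials bs f z \<noteq> 0} \<subseteq> closure {z. f z \<noteq> (0::real)}"
proof (induction bs arbitrary: f rule: rev_induct)
  case (snoc b bs)
  show ?case unfolding partials_snoc using snoc closure_support_partials1 by blast
qed auto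

lemma partials_zero_outside:
  assumes "{z. f z \<noteq> 0} \<subseteq> K" "closed K" "z \<notin> K"
  shows "partials bs f z = (0::real)"
proof -
  have "z \<notin> closure {z. partials bs f z \<noteq> 0}"
    using closure_support_partials[of bs f] closure_minimal[OF assms(1,2)] assms(3) by (meson subsetD)
  then have "z \<notin> {z. partials bs f z \<noteq> 0}" using closure_subset by (meson subsetD)
  then show ?thesis by simp
qed

text \<open>Any compact set around the support serves as a witness, which spares computing closures
  of supports of sums, products and derivatives.\<close>

lemma test_functions_iff:
  "f \<in> test_functions U \<longleftrightarrow> smooth f \<and> (\<exists>K. compact K \<and> K \<subseteq> U \<and> {z. f z \<noteq> 0} \<subseteq> K)"
proof -
  have "compact (closure S) \<and> closure S \<subseteq> U \<longleftrightarrow> (\<exists>K. compact K \<and> K \<subseteq> U \<and> S \<subseteq> K)" for S :: "complex set"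
    by (metis (no_types, lifting) closure_minimal closure_subset compact_closure bounded_subset
        compact_imp_bounded compact_imp_closed order_trans)
  then show ?thesis unfolding test_functions_def smooth_def by auto
qed

lemma test_functions_mono: "U \<subseteq> V \<Longrightarrow> test_functions U \<subseteq> test_functions V"
  unfolding test_functions_def by auto

lemma test_functions_smooth: "f \<in> test_functions U \<Longrightarrow> smooth f"
  by (simp add: test_functions_iff)

lemma test_functions_partials1: "f \<in> test_functions U \<Longrightarrow> b \<in> Basis \<Longrightarrow> partials [b] f \<in> test_functions U"
proof -
  assume f: "f \<in> test_functions U" and b: "b \<in> Basis"
  obtain K where K: "compact K" "K \<subseteq> U" "{z. f z \<noteq> 0} \<subseteq> K" using f test_functions_iff by metis
  then have "{z. partials [b] f z \<noteq> 0} \<subseteq> K"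
    using partials_zero_outside[OF K(3) compact_imp_closed[OF K(1)]] by blast
  then show ?thesis using K f b smooth_partials1 unfolding test_functions_iff by blast
qed

lemma test_functions_mult: "f \<in> test_functions U \<Longrightarrow> smooth g \<Longrightarrow> (\<lambda>z. f z * g z) \<in> test_functions U"
  unfolding test_functions_iff using smooth_mult by (auto simp: subset_iff)

lemma test_functions_cmult: "f \<in> test_functions U \<Longrightarrow> (\<lambda>z. c * f z) \<in> test_functions U"
  using test_functions_mult[OF _ smooth_const, of f U c] by (simp add: mult.commute)

lemma test_functions_support:
  assumes "f \<in> test_functions U"
  obtains K where "compact K" "K \<subseteq> U" "{z. f z \<noteq> 0} \<subseteq> K"
  using assms that unfolding test_functions_iff by metis

lemma test_functions_add:
  assumes "f \<in> test_functions U" "g \<in> test_functions U"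
  shows "(\<lambda>z. f z + g z) \<in> test_functions U"
proof -
  obtain K where K: "compact K" "K \<subseteq> U" "{z. f z \<noteq> 0} \<subseteq> K" using assms(1) by (rule test_functions_support)
  obtain L where L: "compact L" "L \<subseteq> U" "{z. g z \<noteq> 0} \<subseteq> L" using assms(2) by (rule test_functions_support)
  have "compact (K \<union> L)" "K \<union> L \<subseteq> U" using K L by auto
  moreover have "{z. f z + g z \<noteq> 0} \<subseteq> K \<union> L" using K(3) L(3) by force
  ultimately show ?thesis using assms smooth_add unfolding test_functions_iff by blast
qed
lemma test_functions_bounded:
  assumes "f \<in> test_functions U" obtains B where "B > 0" "\<And>z. \<bar>f z\<bar> \<le> B"
proof -
  obtain K where K: "compact K" "{z. f z \<noteq> 0} \<subseteq> K" using assms by (rule test_functions_support)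
  have "bounded (f ` K)"
    using K assms by (meson compact_continuous_image compact_imp_bounded smooth_continuous test_functions_smooth)
  then obtain B where B: "B > 0" "\<forall>x\<in>f ` K. norm x \<le> B" using bounded_pos by blast
  show ?thesis by (rule that[OF B(1)]) (metis (mono_tags, lifting) B K(2) abs_zero imageI less_eq_real_def
    mem_Collect_eq real_norm_def subset_iff)
qed

lemma test_functions_integrable:
  assumes "f \<in> test_functions U" shows "integrable lborel f"
proof -
  obtain K where K: "compact K" "{z. f z \<noteq> 0} \<subseteq> K" using assms by (rule test_functions_support)
  have "integrable lborel (\<lambda>x. indicator K x *\<^sub>R f x)"
    using borel_integrable_compact[OF K(1)] smooth_continuous[OF test_functions_smooth[OF assms]] by blast
  also have "(\<lambda>x. indicator K x *\<^sub>R f x) = f"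
    using K(2) by (auto simp: fun_eq_iff indicator_def)
  finally show ?thesis .
qed

lemma test_functions_directional_deriv:
  assumes "f \<in> test_functions U" 
  shows "((\<lambda>t. f (z + of_real t * b)) has_real_derivative partials [b] f (z + of_real t * b)) (at t)"
proof -
  have "(f has_derivative frechet_derivative f (at (z + of_real t * b))) (at (z + of_real t * b))"
    using assms smooth_has_derivative test_functions_smooth by blast
  then have 1: "((\<lambda>t. f (z + of_real t * b)) has_derivative (\<lambda>s. frechet_derivative f (at (z + of_real t * b)) (of_real s * b))) (at t)"
    by (auto intro!: derivative_eq_intros has_derivative_compose[of "\<lambda>t. z + of_real t * b" _ _ _ f])
  have "linear (frechet_derivative f (at (z + of_real t * b)))"
    using assms by (meson linear_frechet_derivative smooth_differentiable test_functions_smooth)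
  then have L: "frechet_derivative f (at (z + of_real t * b)) (of_real s * b) = s * partials [b] f (z + of_real t * b)" for s
    by (metis linear_cmul partials.simps scaleR_conv_of_real real_scaleR_def)
  have "(\<lambda>s. frechet_derivative f (at (z + of_real t * b)) (of_real s * b)) = (*) (partials [b] f (z + of_real t * b))"
    by (rule ext, subst L, rule mult.commute)
  with 1 show ?thesis unfolding has_field_derivative_def by simp
qed

text \<open>The integral of a difference quotient vanishes by translation invariance.\<close>

lemma integral_partials1:
  assumes f: "f \<in> test_functions U" and b: "b \<in> Basis"
  shows "(\<integral>z. partials [b] f z \<partial>lborel) = 0"
proof -
  obtain K where K: "compact K" "{z. f z \<noteq> 0} \<subseteq> K" using f by (rule test_functions_support)
  obtain B where B: "B > 0" "\<And>z. \<bar>partials [b] f z\<bar> \<le> B"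
    using test_functions_bounded[OF test_functions_partials1[OF f b]] by metis
  obtain R where R: "R > 0" "\<And>z. z \<in> K \<Longrightarrow> norm z \<le> R"
    using compact_imp_bounded[OF K(1)] bounded_pos by metis
  have nb: "norm b = 1" using b by simp
  define q where "q n z = (f (z + of_real (1 / Suc n) * b) - f z) / (1 / Suc n)" for n z
  have meas: "f \<in> borel_measurable borel" "partials [b] f \<in> borel_measurable borel"
    using f b by (auto intro!: borel_measurable_continuous_onI smooth_continuous dest!: test_functions_smooth
        intro: smooth_partials1 simp del: partials.simps(2))
  have sm: "smooth (partials [b] f)" using f b test_functions_smooth smooth_partials1 by blast
  have lim: "(\<lambda>n. q n z) \<longlonglongrightarrow> partials [b] f z" for z
  proof -
    have "((\<lambda>t. (f (z + of_real (0 + t) * b) - f (z + of_real 0 * b)) / t) \<longlongrightarrow> partials [b] f z) (at 0)"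
      using test_functions_directional_deriv[OF f, of z b 0] unfolding DERIV_def by (simp del: partials.simps(2))
    then have "((\<lambda>t. (f (z + of_real t * b) - f z) / t) \<longlongrightarrow> partials [b] f z) (at 0)" by simp
    moreover have "filterlim (\<lambda>n. 1 / real (Suc n)) (at 0) sequentially"
      using lim_inverse_n' LIMSEQ_inverse_real_of_nat
      by (auto simp: filterlim_at inverse_eq_divide intro!: eventuallyI)
    ultimately show ?thesis unfolding q_def using filterlim_compose by blast
  qed
  \<comment> \<open>An integrable majorant: the mean value theorem bounds the quotients by the
    supremum of the derivative, and a shift by at most \<open>1\<close> keeps them supported in the
    ball of radius \<open>R + 1\<close>.\<close>
  have bound: "norm (q n z) \<le> B * indicator (cball 0 (R + 1)) z" for n z
  proof (cases "norm z \<le> R + 1")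
    case True
    have "\<exists>t. t > 0 \<and> t < 1 / Suc n \<and> f (z + of_real (1 / Suc n) * b) - f (z + of_real 0 * b) = (1 / Suc n - 0) * partials [b] f (z + of_real t * b)"
      by (rule MVT2[of 0 "1 / Suc n" "\<lambda>t. f (z + of_real t * b)"]) (use test_functions_directional_deriv[OF f] in auto)
    then obtain t where "f (z + of_real (1 / Suc n) * b) - f z = (1 / Suc n) * partials [b] f (z + of_real t * b)" by auto
    then have "q n z = partials [b] f (z + of_real t * b)" unfolding q_def by (simp del: partials.simps(2))
    then show ?thesis using B(2) True by (simp del: partials.simps(2))
  next
    case False
    have "norm z - norm (of_real (1 / Suc n) * b) \<le> norm (z + of_real (1 / Suc n) * b)"
      by (rule norm_diff_ineq)
    moreover have "norm (of_real (1 / Suc n) * b) \<le> 1"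
      using nb by (simp add: norm_mult del: of_real_divide of_nat_Suc)
    ultimately have "norm (z + of_real (1 / Suc n) * b) > R" using False by linarith
    then have "f (z + of_real (1 / Suc n) * b) = 0" "f z = 0"
      using K R False by (force, force)
    then show ?thesis using B by (simp add: q_def)
  qed
  have qm: "q n \<in> borel_measurable borel" for n
    unfolding q_def using meas(1) by measurable
  have q0: "(\<integral>z. q n z \<partial>lborel) = 0" for n
  proof -
    have i: "integrable lborel f" using test_functions_integrable[OF f] .
    have "distr lborel borel ((+) (of_real (1 / Suc n) * b)) = (lborel :: complex measure)"
      using lborel_distr_plus by blast
    then have "(\<integral>z. f (of_real (1 / Suc n) * b + z) \<partial>lborel) = (\<integral>z. f z \<partial>lborel)"
      "integrable lborel (\<lambda>z. f (of_real (1 / Suc n) * b + z))"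
      using meas(1) i integral_distr[of "(+) (of_real (1 / Suc n) * b)" lborel borel f]
        integrable_distr_eq[of "(+) (of_real (1 / Suc n) * b)" lborel borel f] by auto
    then show ?thesis unfolding q_def using i by (simp add: add.commute)
  qed
  have "(\<lambda>n. \<integral>z. q n z \<partial>lborel) \<longlonglongrightarrow> (\<integral>z. partials [b] f z \<partial>lborel)"
  proof (rule integral_dominated_convergence[where w="\<lambda>z. B * indicator (cball 0 (R + 1)) z"])
    show "integrable lborel (\<lambda>z. B * indicator (cball 0 (R + 1)) (z::complex))"
      by (intro integrable_mult_right integrable_real_indicator) (use emeasure_bounded_finite[OF bounded_cball] in auto)
  qed (use meas qm lim bound in auto)
  then show ?thesis unfolding q0 using LIMSEQ_unique tendsto_const by metis
qed

section \<open>Smooth functions of one real variable and cutoffs with small antiderivatives\<close>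

definition smooth1 :: "(real \<Rightarrow> real) \<Rightarrow> bool" where
  "smooth1 f \<longleftrightarrow> (\<exists>G :: nat \<Rightarrow> real \<Rightarrow> real. G 0 = f \<and> (\<forall>k x. (G k has_real_derivative G (Suc k) x) (at x)))"

lemma smooth1_coinduct:
  assumes "f \<in> \<C>" and step: "\<And>g. g \<in> \<C> \<Longrightarrow> \<exists>g'\<in>\<C>. \<forall>x. (g has_real_derivative g' x) (at x)"
  shows "smooth1 f"
proof -
  obtain s where s: "\<And>g. g \<in> \<C> \<Longrightarrow> s g \<in> \<C> \<and> (\<forall>x. (g has_real_derivative s g x) (at x))"
    using step by metis
  have "(s ^^ k) f \<in> \<C>" for k using assms(1) s by (induction k) auto
  then show ?thesis unfolding smooth1_def using s by (intro exI[of _ "\<lambda>k. (s ^^ k) f"]) auto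
qed

lemma smooth1_deriv:
  assumes "smooth1 f" obtains f' where "smooth1 f'" "\<And>x. (f has_real_derivative f' x) (at x)"
proof -
  obtain G where G: "G 0 = f" "\<And>k x. (G k has_real_derivative G (Suc k) x) (at x)"
    using assms smooth1_def by metis
  have "smooth1 (G (Suc 0))"
    unfolding smooth1_def by (intro exI[of _ "\<lambda>k. G (Suc k)"]) (use G in auto)
  with G that show ?thesis by metis
qed

lemma smooth1_antideriv:
  assumes "smooth1 f" "\<And>x. (F has_real_derivative f x) (at x)" shows "smooth1 F"
proof (rule smooth1_coinduct[where \<C>="insert F (Collect smooth1)"])
  fix g assume "g \<in> insert F (Collect smooth1)"
  then consider "g = F" | "smooth1 g" by blast
  then show "\<exists>g'\<in>insert F (Collect smooth1). \<forall>x. (g has_real_derivative g' x) (at x)"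
  proof cases
    case 1 then show ?thesis using assms by (intro bexI[of _ f]) auto
  next
    case 2
    then obtain g' where "smooth1 g'" "\<And>x. (g has_real_derivative g' x) (at x)" by (rule smooth1_deriv) blast
    then show ?thesis by (intro bexI[of _ g']) auto
  qed
qed simp

lemma smooth1_isCont: "smooth1 f \<Longrightarrow> isCont f x"
  using smooth1_deriv DERIV_isCont by metis

lemma smooth1_affine:
  assumes "smooth1 f" shows "smooth1 (\<lambda>x. c * f (a * x + b))"
proof (rule smooth1_coinduct[where \<C>="{\<lambda>x. c * f (a * x + b) | c f. smooth1 f}"])
  fix g assume "g \<in> {\<lambda>x. c * f (a * x + b) | c f. smooth1 f}"
  then obtain c f where g: "g = (\<lambda>x. c * f (a * x + b))" "smooth1 f" by blast
  obtain f' where f': "smooth1 f'" "\<And>x. (f has_real_derivative f' x) (at x)" using smooth1_deriv g(2) by blast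
  have "(g has_real_derivative (c * a) * f' (a * x + b)) (at x)" for x
    unfolding g by (auto intro!: derivative_eq_intros DERIV_chain2[OF f'(2)])
  with f'(1) show "\<exists>g'\<in>{\<lambda>x. c * f (a * x + b) | c f. smooth1 f}. \<forall>x. (g has_real_derivative g' x) (at x)"
    by (intro bexI[of _ "\<lambda>x. (c * a) * f' (a * x + b)"]) blast+
qed (use assms in blast)

inductive_set prod_sums1 :: "(real \<Rightarrow> real) set" where
  mult: "smooth1 f \<Longrightarrow> smooth1 g \<Longrightarrow> (\<lambda>z. f z * g z) \<in> prod_sums1"
| add: "f \<in> prod_sums1 \<Longrightarrow> g \<in> prod_sums1 \<Longrightarrow> (\<lambda>z. f z + g z) \<in> prod_sums1"

lemma smooth1_mult: assumes "smooth1 f" "smooth1 g" shows "smooth1 (\<lambda>z. f z * g z)"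
proof (rule smooth1_coinduct[where \<C>=prod_sums1])
  fix k assume "k \<in> prod_sums1"
  then show "\<exists>k'\<in>prod_sums1. \<forall>x. (k has_real_derivative k' x) (at x)"
  proof induction
    case (mult f g)
    obtain f' g' where f': "smooth1 f'" "\<And>x. (f has_real_derivative f' x) (at x)"
      and g': "smooth1 g'" "\<And>x. (g has_real_derivative g' x) (at x)"
      using smooth1_deriv mult by metis
    have "((\<lambda>z. f z * g z) has_real_derivative f x * g' x + f' x * g x) (at x)" for x
      using DERIV_mult'[OF f'(2) g'(2)] .
    moreover have "(\<lambda>x. f x * g' x + f' x * g x) \<in> prod_sums1"
      using mult f'(1) g'(1) by (intro prod_sums1.intros)
    ultimately show ?case by (intro bexI[of _ "\<lambda>x. f x * g' x + f' x * g x"]) auto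
  next
    case (add f g)
    then obtain f' g' where f': "f' \<in> prod_sums1" "\<And>x. (f has_real_derivative f' x) (at x)"
      and g': "g' \<in> prod_sums1" "\<And>x. (g has_real_derivative g' x) (at x)"
      by blast
    have "((\<lambda>z. f z + g z) has_real_derivative f' x + g' x) (at x)" for x
      using DERIV_add[OF f'(2) g'(2)] .
    moreover have "(\<lambda>x. f' x + g' x) \<in> prod_sums1"
      using f'(1) g'(1) by (intro prod_sums1.intros)
    ultimately show ?case by (intro bexI[of _ "\<lambda>x. f' x + g' x"]) auto
  qed
qed (use assms prod_sums1.mult in blast)

definition flat_exp :: "real poly \<Rightarrow> real \<Rightarrow> real" where
  "flat_exp p x = (if x > 0 then poly p (1 / x) * exp (- (1 / x)) else 0)"

lemma poly_exp_tendsto_0: "((\<lambda>y::real. poly p y * exp (- y)) \<longlongrightarrow> 0) at_top"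
proof -
  have "((\<lambda>y::real. \<Sum>i\<le>degree p. coeff p i * (y ^ i / exp y)) \<longlongrightarrow> (\<Sum>i\<le>degree p. coeff p i * 0)) at_top"
    by (intro tendsto_sum tendsto_mult_left tendsto_power_div_exp_0)
  moreover have "(\<lambda>y::real. \<Sum>i\<le>degree p. coeff p i * (y ^ i / exp y)) = (\<lambda>y. poly p y * exp (- y))"
    by (simp add: poly_altdef sum_distrib_right exp_minus divide_inverse mult.assoc)
  ultimately show ?thesis by simp
qed

lemma flat_exp_right: "(flat_exp p \<longlongrightarrow> 0) (at_right 0)"
proof -
  have "((\<lambda>x. poly p (inverse x) * exp (- (inverse x))) \<longlongrightarrow> 0) (at_right (0::real))"
    by (rule filterlim_compose[OF poly_exp_tendsto_0 filterlim_inverse_at_top_right])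
  then show ?thesis
    by (rule Lim_transform_eventually)
      (auto simp: eventually_at_right_field flat_exp_def inverse_eq_divide intro!: exI[of _ 1])
qed

lemma flat_exp_DERIV:
  "(flat_exp p has_real_derivative flat_exp ([:0, 0, 1:] * (p - pderiv p)) x) (at x)"
proof (rule linorder_cases[of x 0])
  assume x: "x < 0"
  have "(flat_exp p has_real_derivative 0) (at x)"
    by (rule has_field_derivative_transform_within_open[of "\<lambda>_. 0" _ _ "{..<0}"])
       (use x in \<open>auto simp: flat_exp_def\<close>)
  with x show ?thesis by (simp add: flat_exp_def)
next
  assume x: "x > 0"
  have "((\<lambda>x. poly p (1 / x) * exp (- (1 / x))) has_real_derivative
        flat_exp ([:0, 0, 1:] * (p - pderiv p)) x) (at x)"
    using x by (auto intro!: derivative_eq_intros DERIV_chain2[OF poly_DERIV] simp: flat_exp_def field_simps power2_eq_square)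
  then show ?thesis
    by (rule has_field_derivative_transform_within_open[of _ _ _ "{0<..}"])
       (use x in \<open>auto simp: flat_exp_def\<close>)
next
  assume x: "x = 0"
  have "((\<lambda>h. (flat_exp p (0 + h) - flat_exp p 0) / h) \<longlongrightarrow> 0) (at 0)"
  proof (rule filterlim_split_at_real)
    show "((\<lambda>h. (flat_exp p (0 + h) - flat_exp p 0) / h) \<longlongrightarrow> 0) (at_left 0)"
      by (rule Lim_transform_eventually[OF tendsto_const])
         (auto simp: eventually_at_left_field flat_exp_def intro!: exI[of _ "-1"])
    \<comment> \<open>From the right the difference quotient at \<open>0\<close> is again in the
      family, with \<open>y * p y\<close>, that is \<open>pCons 0 p\<close>, in place of
      \<open>p\<close>.\<close>
    show "((\<lambda>h. (flat_exp p (0 + h) - flat_exp p 0) / h) \<longlongrightarrow> 0) (at_right 0)"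
      by (rule Lim_transform_eventually[OF flat_exp_right[of "pCons 0 p"]])
         (auto simp: eventually_at_right_field flat_exp_def intro!: exI[of _ 1])
  qed
  then show ?thesis unfolding x DERIV_def by (simp add: flat_exp_def)
qed

lemma smooth1_flat_exp: "smooth1 (flat_exp p)"
  by (rule smooth1_coinduct[where \<C>="range flat_exp"]) (use flat_exp_DERIV in blast)+

lemma antiderivative_exists:
  assumes "\<And>x. isCont f (x::real)"
  obtains F :: "real \<Rightarrow> real" where "\<And>x. (F has_real_derivative f x) (at x)" "F 0 = 0"
proof -
  have "\<exists>F. \<forall>x :: real. -\<infinity> < ereal x \<longrightarrow> ereal x < \<infinity> \<longrightarrow> (F has_vector_derivative f x) (at x)"
    by (rule einterval_antiderivative) (use assms in auto)
  then obtain F where F: "\<And>x. (F has_real_derivative f x) (at x)"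
    by (auto simp: has_real_derivative_iff_has_vector_derivative)
  have "((\<lambda>x. F x - F 0) has_real_derivative f x) (at x)" for x
    using F by (auto intro!: derivative_eq_intros)
  then show ?thesis by (rule that) simp
qed

text \<open>The step is the antiderivative of the bump
  \<open>flat_exp 1 x * flat_exp 1 (1 - x)\<close>, which is positive exactly between
  \<open>0\<close> and \<open>1\<close>, divided by its total increase.\<close>

lemma smooth_step:
  obtains b where "smooth1 b" "\<And>x. x \<le> 0 \<Longrightarrow> b x = 0" "\<And>x. x \<ge> 1 \<Longrightarrow> b x = 1"
proof -
  define \<beta> where "\<beta> x = flat_exp 1 x * flat_exp 1 (1 - x)" for x
  have sm: "smooth1 \<beta>" unfolding \<beta>_def
    using smooth1_mult[OF smooth1_flat_exp smooth1_affine[OF smooth1_flat_exp, of 1 1 "-1" 1], of 1] by simp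
  obtain B where B: "\<And>x. (B has_real_derivative \<beta> x) (at x)" "B 0 = 0"
    using antiderivative_exists smooth1_isCont[OF sm] by metis
  have smB: "smooth1 B" using smooth1_antideriv[OF sm B(1)] .
  have "\<exists>c. \<forall>x\<in>{..0}. B x = c"
  proof (rule has_field_derivative_zero_constant)
    fix x :: real assume "x \<in> {..0}"
    then have "\<beta> x = 0" by (simp add: \<beta>_def flat_exp_def)
    then show "(B has_field_derivative 0) (at x within {..0})" using B(1)[of x] has_field_derivative_at_within by fastforce
  qed simp
  then have 0: "B x = 0" if "x \<le> 0" for x using B(2) that by auto
  have "\<exists>c. \<forall>x\<in>{1..}. B x = c"
  proof (rule has_field_derivative_zero_constant)
    fix x :: real assume "x \<in> {1..}"
    then have "\<beta> x = 0" by (simp add: \<beta>_def flat_exp_def)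
    then show "(B has_field_derivative 0) (at x within {1..})" using B(1)[of x] has_field_derivative_at_within by fastforce
  qed simp
  then have 1: "B x = B 1" if "x \<ge> 1" for x using that by auto
  have "B 0 < B 1"
  proof (rule DERIV_pos_imp_increasing_open[where f=B and a=0 and b=1])
    fix x :: real assume "0 < x" "x < 1"
    then have "\<beta> x > 0" by (simp add: \<beta>_def flat_exp_def)
    then show "\<exists>y. (B has_real_derivative y) (at x) \<and> y > 0" using B(1) by blast
  next
    show "continuous_on {0..1} B" using smooth1_isCont[OF smB] by (simp add: continuous_at_imp_continuous_on)
  qed simp
  then have pos: "B 1 > 0" using B(2) by simp
  show ?thesis
  proof (rule that[of "\<lambda>x. B x / B 1"])
    show "smooth1 (\<lambda>x. B x / B 1)" using smooth1_affine[OF smB, of "1 / B 1" 1 0] by simp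
    show "B x / B 1 = 0" if "x \<le> 0" for x using 0[OF that] by simp
    show "B x / B 1 = 1" if "x \<ge> 1" for x using 1[OF that] pos by simp
  qed
qed

lemma antiderivative_bound:
  fixes F :: "real \<Rightarrow> real"
  assumes "\<And>x. (F has_real_derivative f x) (at x)" "F 0 = 0" "\<And>x. \<bar>f x\<bar> \<le> c * \<bar>x\<bar> ^ k"
  shows "\<bar>F x\<bar> \<le> c * \<bar>x\<bar> ^ Suc k"
proof (cases "x = 0")
  case False
  have "c \<ge> 0" using order_trans[OF abs_ge_zero assms(3)[of 1]] by simp
  obtain t where t: "\<bar>t\<bar> \<le> \<bar>x\<bar>" "F x - F 0 = x * f t"
  proof (cases "x > 0")
    case True
    then obtain t where "t > 0" "t < x" "F x - F 0 = (x - 0) * f t" using MVT2[of 0 x F f] assms(1) by metis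
    then show ?thesis using that[of t] by simp
  next
    case F: False
    then obtain t where "t > x" "t < 0" "F 0 - F x = (0 - x) * f t" using MVT2[of x 0 F f] assms(1) False
      by (metis linorder_neqE_linordered_idom)
    then show ?thesis using that[of t] by (simp add: algebra_simps)
  qed
  have "\<bar>F x\<bar> = \<bar>x\<bar> * \<bar>f t\<bar>" using t(2) assms(2) by (simp add: abs_mult)
  also have "\<dots> \<le> \<bar>x\<bar> * (c * \<bar>x\<bar> ^ k)"
    using assms(3)[of t] power_mono[OF t(1), of k] \<open>c \<ge> 0\<close>
    by (intro mult_left_mono) (auto elim!: order_trans intro!: mult_left_mono)
  finally show ?thesis by (simp add: algebra_simps)
qed (use assms in simp)

text \<open>\<open>A n 0\<close> is a cutoff at scale \<open>1/(n+1)\<close> and \<open>A n k\<close> is its \<open>k\<close>-fold antiderivative.\<close>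

lemma cutoff_family:
  obtains A :: "nat \<Rightarrow> nat \<Rightarrow> real \<Rightarrow> real" and c :: real where
    "\<And>n k. smooth1 (A n k)" "\<And>n k x. (A n (Suc k) has_real_derivative A n k x) (at x)"
    "\<And>n k x. \<bar>A n (Suc k) x\<bar> \<le> c * \<bar>x\<bar> ^ k / Suc n"
    "\<And>n x. \<bar>x\<bar> \<le> 1 / Suc n \<Longrightarrow> A n 0 x = 1" "c > 0"
proof -
  obtain b where b: "smooth1 b" "\<And>x. x \<le> 0 \<Longrightarrow> b x = 0" "\<And>x. x \<ge> 1 \<Longrightarrow> b x = 1"
    using smooth_step by blast
  \<comment> \<open>A plateau: equal to \<open>1\<close> where \<open>\<bar>x\<bar> \<le> 1\<close>,
    and \<open>0\<close> where \<open>\<bar>x\<bar> \<ge> 2\<close>.\<close>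
  define \<eta> where "\<eta> x = b (2 - x) * b (2 + x)" for x
  have sm: "smooth1 \<eta>" unfolding \<eta>_def
    using smooth1_mult[OF smooth1_affine[OF b(1), of 1 "-1" 2] smooth1_affine[OF b(1), of 1 1 2]]
    by (simp add: add.commute)
  have \<eta>1: "\<eta> x = 1" if "\<bar>x\<bar> \<le> 1" for x using that b by (auto simp: \<eta>_def)
  have \<eta>0: "\<eta> x = 0" if "\<bar>x\<bar> \<ge> 2" for x using that b by (cases "x \<ge> 2") (auto simp: \<eta>_def)
  define I where "I f = (SOME F. (\<forall>x. (F has_real_derivative f x) (at x)) \<and> F 0 = (0::real))" for f :: "real \<Rightarrow> real"
  have I: "(\<forall>x. (I f has_real_derivative f x) (at x)) \<and> I f 0 = 0" if f: "smooth1 f" for f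
  proof -
    obtain F where "\<And>x. (F has_real_derivative f x) (at x)" "F 0 = 0"
      by (rule antiderivative_exists[OF smooth1_isCont[OF f]]) blast
    then show ?thesis unfolding I_def by (intro someI_ex[of "\<lambda>F. (\<forall>x. (F has_real_derivative f x) (at x)) \<and> F 0 = 0"]) blast
  qed
  define a where "a k = (I ^^ k) \<eta>" for k
  have sma: "smooth1 (a k)" for k
  proof (induction k)
    case (Suc k)
    then show ?case using smooth1_antideriv[OF Suc] I[OF Suc] by (simp add: a_def)
  qed (simp add: a_def sm)
  have aS: "(a (Suc k) has_real_derivative a k x) (at x)" "a (Suc k) 0 = 0" for k x
    using I[OF sma[of k]] by (auto simp: a_def)
  have "bounded (a 1 ` {-2..2})"
    by (intro compact_imp_bounded compact_continuous_image continuous_at_imp_continuous_on)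
       (use smooth1_isCont[OF sma] in auto)
  then obtain c where c: "c > 0" "\<And>x. x \<in> {-2..2} \<Longrightarrow> \<bar>a 1 x\<bar> \<le> c" unfolding bounded_pos by auto
  have "\<exists>d. \<forall>x\<in>{2..}. a 1 x = d"
  proof (rule has_field_derivative_zero_constant)
    fix x :: real assume "x \<in> {2..}"
    then show "(a 1 has_field_derivative 0) (at x within {2..})"
      using aS(1)[of 0 x] \<eta>0[of x] has_field_derivative_at_within by (auto simp: a_def)
  qed simp
  then have r: "a 1 x = a 1 2" if "x \<ge> 2" for x using that by auto
  have "\<exists>d. \<forall>x\<in>{..-2}. a 1 x = d"
  proof (rule has_field_derivative_zero_constant)
    fix x :: real assume "x \<in> {..-2}"
    then show "(a 1 has_field_derivative 0) (at x within {..-2})"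
      using aS(1)[of 0 x] \<eta>0[of x] has_field_derivative_at_within by (auto simp: a_def)
  qed simp
  then have l: "a 1 x = a 1 (-2)" if "x \<le> -2" for x using that by auto
  have b1: "\<bar>a 1 x\<bar> \<le> c" for x
  proof -
    consider "x \<ge> 2" | "x \<le> -2" | "x \<in> {-2..2}" by fastforce
    then show ?thesis
    proof cases
      case 1 show ?thesis unfolding r[OF 1] using c(2)[of 2] by simp
    next
      case 2 show ?thesis unfolding l[OF 2] using c(2)[of "-2"] by simp
    qed (rule c(2))
  qed
  \<comment> \<open>The first antiderivative is bounded, being constant on either side of the
    support of \<open>\<eta>\<close>; every further integration from \<open>0\<close> costs one
    power of \<open>\<bar>x\<bar>\<close>.\<close>
  have bk: "\<bar>a (Suc k) x\<bar> \<le> c * \<bar>x\<bar> ^ k" for k x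
  proof (induction k arbitrary: x)
    case 0 then show ?case using b1 by simp
  next
    case (Suc k) then show ?case by (intro antiderivative_bound[OF aS])
  qed
  \<comment> \<open>Rescaling the argument by \<open>n + 1\<close> multiplies a derivative by
    \<open>n + 1\<close>; the division by the \<open>k\<close>-th power undoes this, so that level
    \<open>k\<close> remains the derivative of level \<open>k + 1\<close>. At level
    \<open>k + 1\<close> the bound \<open>c * \<bar>x\<bar> ^ k\<close> keeps exactly one surplus
    factor \<open>1 / (n + 1)\<close>.\<close>
  define A where "A n k x = (1 / real (Suc n) ^ k) * a k (real (Suc n) * x + 0)" for n k and x :: real
  show ?thesis
  proof (rule that[of A c])
    show "smooth1 (A n k)" for n k unfolding A_def[abs_def] by (rule smooth1_affine[OF sma])
    show "(A n (Suc k) has_real_derivative A n k x) (at x)" for n k x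
    proof -
      define N where "N = real (Suc n)"
      have "N > 0" by (simp add: N_def)
      have "((\<lambda>x. (1 / N ^ Suc k) * a (Suc k) (N * x + 0)) has_real_derivative (1 / N ^ Suc k) * (a k (N * x + 0) * N)) (at x)"
        by (rule DERIV_cmult, rule DERIV_chain2[OF aS(1)]) (auto intro!: derivative_eq_intros)
      moreover have "(1 / N ^ Suc k) * (a k (N * x + 0) * N) = (1 / N ^ k) * a k (N * x + 0)"
        using \<open>N > 0\<close> by simp
      ultimately show ?thesis unfolding A_def[abs_def] N_def by (simp only:)
    qed
    show "\<bar>A n (Suc k) x\<bar> \<le> c * \<bar>x\<bar> ^ k / Suc n" for n k x
    proof -
      have "\<bar>A n (Suc k) x\<bar> = (1 / real (Suc n) ^ Suc k) * \<bar>a (Suc k) (real (Suc n) * x)\<bar>"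
        by (simp add: A_def abs_mult del: of_nat_Suc)
      also have "\<dots> \<le> (1 / real (Suc n) ^ Suc k) * (c * \<bar>real (Suc n) * x\<bar> ^ k)"
        by (intro mult_left_mono bk) auto
      also have "\<dots> = c * \<bar>x\<bar> ^ k / Suc n"
        by (simp add: abs_mult power_mult_distrib field_simps del: of_nat_Suc)
      finally show ?thesis .
    qed
    show "A n 0 x = 1" if "\<bar>x\<bar> \<le> 1 / Suc n" for n x
      using that \<eta>1[of "Suc n * x"] by (simp add: A_def a_def abs_mult field_simps del: of_nat_Suc)
  qed (use c in auto)
qed

section \<open>The field near a line\<close>

definition laplacian :: "(complex \<Rightarrow> real) \<Rightarrow> complex \<Rightarrow> real" where
  "laplacian f z = (\<Sum>b\<in>Basis. partials [b, b] f z)"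

lemma test_functions_sum:
  assumes "finite I" "\<And>i. i \<in> I \<Longrightarrow> f i \<in> test_functions U"
  shows "(\<lambda>z. \<Sum>i\<in>I. f i z) \<in> test_functions U"
  using assms
proof (induction I rule: finite_induct)
  case empty
  have "{z. 0 \<noteq> (0::real)} \<subseteq> {}" by auto
  then show ?case unfolding test_functions_iff using smooth_const[of 0] by auto
next
  case (insert i I)
  then show ?case using test_functions_add[of "f i" U "\<lambda>z. \<Sum>i\<in>I. f i z"] by simp
qed

lemma test_functions_partials:
  assumes "f \<in> test_functions U" "set bs \<subseteq> Basis" shows "partials bs f \<in> test_functions U"
  using assms
proof (induction bs arbitrary: f rule: rev_induct)
  case (snoc b bs)
  have "partials [b] f \<in> test_functions U" by (rule test_functions_partials1) (use snoc.prems in auto)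
  from snoc.IH[OF this] show ?case using snoc.prems(2) by (simp add: partials_snoc del: partials.simps(2))
qed simp

lemma test_functions_laplacian: "f \<in> test_functions U \<Longrightarrow> laplacian f \<in> test_functions U"
  unfolding laplacian_def[abs_def] by (intro test_functions_sum test_functions_partials) auto

text \<open>Green's formula: \<open>partials [b] f * g\<close> is again a test function, so the
  integral of its derivative vanishes.\<close>

lemma dirichlet_laplacian:
  assumes f: "f \<in> test_functions U" and g: "g \<in> test_functions U"
  shows "dirichlet f g = (\<integral>z. - 1 / (2 * pi) * laplacian f z * g z \<partial>lborel)"
proof -
  have sm: "smooth f" "smooth g" using f g test_functions_smooth by auto
  have i1: "integrable lborel (\<lambda>z. partials [b, b] f z * g z)"
    and i2: "integrable lborel (\<lambda>z. partials [b] f z * partials [b] g z)"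
    and eq: "(\<integral>z. partials [b] f z * partials [b] g z \<partial>lborel) = - (\<integral>z. partials [b, b] f z * g z \<partial>lborel)"
    if b: "b \<in> Basis" for b
  proof -
    have fb: "partials [b] f \<in> test_functions U" "smooth (partials [b] f)"
      using test_functions_partials1[OF f b] test_functions_smooth by blast+
    have fbb: "partials [b, b] f \<in> test_functions U"
      by (rule test_functions_partials[OF f]) (use b in auto)
    show i1: "integrable lborel (\<lambda>z. partials [b, b] f z * g z)"
      by (intro test_functions_integrable[OF test_functions_mult[OF fbb sm(2)]])
    show i2: "integrable lborel (\<lambda>z. partials [b] f z * partials [b] g z)"
      by (intro test_functions_integrable[OF test_functions_mult[OF fb(1) smooth_partials1[OF sm(2) b]]])
    have "partials [b] (\<lambda>z. partials [b] f z * g z) = (\<lambda>z. partials [b, b] f z * g z + partials [b] f z * partials [b] g z)"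
      using partials1_mult[OF smooth_differentiable[OF fb(2)] smooth_differentiable[OF sm(2)], of b]
      by (intro ext) simp
    then have "(\<integral>z. partials [b, b] f z * g z + partials [b] f z * partials [b] g z \<partial>lborel) = 0"
      using integral_partials1[OF test_functions_mult[OF fb(1) sm(2)] b] by simp
    then show "(\<integral>z. partials [b] f z * partials [b] g z \<partial>lborel) = - (\<integral>z. partials [b, b] f z * g z \<partial>lborel)"
      unfolding Bochner_Integration.integral_add[OF i1 i2] by simp
  qed
  have "(\<integral>z. - 1 / (2 * pi) * laplacian f z * g z \<partial>lborel)
      = (\<integral>z. - 1 / (2 * pi) * (\<Sum>b\<in>Basis. partials [b, b] f z * g z) \<partial>lborel)"
    by (simp add: laplacian_def sum_distrib_right mult.assoc del: partials.simps(2))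
  also have "\<dots> = - 1 / (2 * pi) * (\<Sum>b\<in>Basis. \<integral>z. partials [b, b] f z * g z \<partial>lborel)"
    by (subst integral_mult_right_zero, subst Bochner_Integration.integral_sum) (use i1 in auto)
  also have "\<dots> = 1 / (2 * pi) * (\<Sum>b\<in>Basis. \<integral>z. partials [b] f z * partials [b] g z \<partial>lborel)"
    using eq by (simp add: sum_negf del: partials.simps(2))
  also have "\<dots> = dirichlet f g"
    unfolding dirichlet_def by (subst Bochner_Integration.integral_sum) (use i2 in auto)
  finally show ?thesis by simp
qed

lemma integral_laplacian: "f \<in> test_functions U \<Longrightarrow> (\<integral>z. laplacian f z \<partial>lborel) = 0"
proof -
  assume f: "f \<in> test_functions U"
  have "(\<integral>z. partials [b, b] f z \<partial>lborel) = 0" "integrable lborel (\<lambda>z. partials [b, b] f z)" if b: "b \<in> Basis" for b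
  proof -
    have "partials [b] (partials [b] f) = partials [b, b] f" by simp
    then show "(\<integral>z. partials [b, b] f z \<partial>lborel) = 0"
      using integral_partials1[OF test_functions_partials1[OF f b] b] by metis
    show "integrable lborel (\<lambda>z. partials [b, b] f z)"
      by (rule test_functions_integrable[OF test_functions_partials[OF f]]) (use b in auto)
  qed
  then show ?thesis unfolding laplacian_def by (subst Bochner_Integration.integral_sum) auto
qed

text \<open>The constant sequence \<open>\<psi>\<close> represents an element of the completion, and
  it solves the weak Poisson equation with right-hand side
  \<open>- laplacian \<psi> / (2 pi)\<close>. The Gaussian law enters here only through the
  finiteness of the second moment, which lets the Bochner integral in \<open>gff_pairing\<close> be
  read as a nonnegative one.\<close>

lemma gff_pairing_second_moment:
  assumes pair: "gff_pairing M U R h" and \<psi>: "\<psi> \<in> test_functions U"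
    and R: "(\<lambda>z. - 1 / (2 * pi) * laplacian \<psi> z) \<in> R"
  shows "(\<integral>\<^sup>+\<omega>. ennreal ((h \<omega> (\<lambda>z. - 1 / (2 * pi) * laplacian \<psi> z))\<^sup>2) \<partial>M) = ennreal (dirichlet \<psi> \<psi>)"
proof -
  let ?\<rho> = "\<lambda>z. - 1 / (2 * pi) * laplacian \<psi> z"
  obtain W where W1: "\<And>f. f \<in> dirichlet_completion U \<Longrightarrow> centered_gaussian M (W f)"
    and W2: "\<And>f g. f \<in> dirichlet_completion U \<Longrightarrow> g \<in> dirichlet_completion U \<Longrightarrow>
        (\<integral>\<omega>. W f \<omega> * W g \<omega> \<partial>M) = completion_inner f g"
    and W3: "\<And>f \<rho>. f \<in> dirichlet_completion U \<Longrightarrow> \<rho> \<in> R \<Longrightarrow> weak_poisson U f \<rho> \<Longrightarrow> (AE \<omega> in M. W f \<omega> = h \<omega> \<rho>)"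
    using pair unfolding gff_pairing_def by blast
  let ?f = "\<lambda>n::nat. \<psi>"
  have ci: "completion_inner ?f (\<lambda>_. \<phi>) = dirichlet \<psi> \<phi>" for \<phi>
    unfolding completion_inner_def by (simp add: lim_const)
  have "partials [b] (\<lambda>z. 0) = (\<lambda>z. 0)" for b by (intro ext partials1_const)
  then have "dirichlet (\<lambda>z. 0) (\<lambda>z. 0) = 0" unfolding dirichlet_def by simp
  then have f: "?f \<in> dirichlet_completion U" unfolding dirichlet_completion_def using \<psi> by simp
  have wp: "weak_poisson U ?f ?\<rho>" unfolding weak_poisson_def ci using dirichlet_laplacian[OF \<psi>] by blast
  have AE: "AE \<omega> in M. W ?f \<omega> = h \<omega> ?\<rho>" using W3[OF f R wp] .
  have int: "integrable M (\<lambda>\<omega>. W ?f \<omega> * W ?f \<omega>)"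
    using W1[OF f] unfolding centered_gaussian_def
  proof (elim conjE disjE exE)
    assume m: "W ?f \<in> borel_measurable M" and "AE \<omega> in M. W ?f \<omega> = 0"
    then have "AE \<omega> in M. W ?f \<omega> * W ?f \<omega> = 0" by auto
    then show ?thesis using m by (subst integrable_cong_AE[where g="\<lambda>_. 0"]) auto
  next
    fix s :: real assume s: "0 < s" "distributed M lborel (W ?f) (\<lambda>x. ennreal (normal_density 0 s x))"
    show ?thesis
      using distributed_integrable[OF s(2), of "\<lambda>x. x * x"] integrable_normal_moment[OF s(1), of 0 2]
      by (simp add: power2_eq_square)
  qed
  have "(\<integral>\<^sup>+\<omega>. ennreal ((h \<omega> ?\<rho>)\<^sup>2) \<partial>M) = (\<integral>\<^sup>+\<omega>. ennreal (W ?f \<omega> * W ?f \<omega>) \<partial>M)"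
    by (rule nn_integral_cong_AE) (use AE in \<open>auto simp: power2_eq_square\<close>)
  also have "\<dots> = ennreal (\<integral>\<omega>. W ?f \<omega> * W ?f \<omega> \<partial>M)"
    by (rule nn_integral_eq_integral[OF int]) auto
  also have "\<dots> = ennreal (dirichlet \<psi> \<psi>)" unfolding W2[OF f f] ci ..
  finally show ?thesis .
qed

lemma test_null_sequence_mono:
  assumes "U \<subseteq> V" "test_null_sequence U f" shows "test_null_sequence V f"
  using assms test_functions_mono[OF assms(1)] unfolding test_null_sequence_def by blast

lemma restrict_distributions:
  assumes "T \<in> distributions V" "U \<subseteq> V" shows "restrict T (test_functions U) \<in> distributions U"
proof -
  note sub = test_functions_mono[OF assms(2)]
  have "(\<lambda>n. restrict T (test_functions U) (f n)) \<longlonglongrightarrow> 0" if "test_null_sequence U f" for f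
  proof -
    have "(\<lambda>n. T (f n)) \<longlonglongrightarrow> 0"
      using assms test_null_sequence_mono[OF assms(2) that] unfolding distributions_def by blast
    moreover have "f n \<in> test_functions U" for n using that unfolding test_null_sequence_def by blast
    ultimately show ?thesis by simp
  qed
  moreover have "T (\<lambda>z. f z + g z) = T f + T g" if "f \<in> test_functions U" "g \<in> test_functions U" for f g
    using assms(1) that sub unfolding distributions_def by blast
  moreover have "T (\<lambda>z. c * f z) = c * T f" if "f \<in> test_functions U" for f c
    using assms(1) that sub unfolding distributions_def by blast
  ultimately show ?thesis
    unfolding distributions_def using test_functions_add test_functions_cmult by auto
qed

lemma space_distribution_space: "space (distribution_space U) = distributions U"
  unfolding distribution_space_def by (auto simp: space_restrict_space space_PiM distributions_def extensional_def)

lemma measurable_eval_distribution: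
  "f \<in> test_functions U \<Longrightarrow> (\<lambda>T. T f) \<in> borel_measurable (distribution_space U)"
  unfolding distribution_space_def by (intro measurable_restrict_space1 measurable_component_singleton)

lemma measurable_distribution_spaceI:
  assumes "\<And>\<omega>. \<omega> \<in> space M \<Longrightarrow> h \<omega> \<in> distributions U"
    and "\<And>f. f \<in> test_functions U \<Longrightarrow> (\<lambda>\<omega>. h \<omega> f) \<in> borel_measurable M"
  shows "h \<in> M \<rightarrow>\<^sub>M distribution_space U"
  unfolding distribution_space_def
proof (rule measurable_restrict_space2)
  show "h \<in> M \<rightarrow>\<^sub>M Pi\<^sub>M (test_functions U) (\<lambda>f. borel)"
    by (rule measurable_PiM_single') (use assms in \<open>auto simp: distributions_def extensional_funcset_def\<close>)
qed (use assms in auto)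

lemma distribution_cmult: "T \<in> distributions U \<Longrightarrow> f \<in> test_functions U \<Longrightarrow> T (\<lambda>z. c * f z) = c * T f"
  unfolding distributions_def by blast

lemma distribution_add: "T \<in> distributions U \<Longrightarrow> f \<in> test_functions U \<Longrightarrow> g \<in> test_functions U \<Longrightarrow>
    T (\<lambda>z. f z + g z) = T f + T g"
  unfolding distributions_def by blast

text \<open>One formula for the three kinds of field. Laplacians of test functions have integral
  \<open>0\<close>, so they are admissible in the whole-plane case as well and do not see the
  additive constant; in the last case the statement is transported through the law of
  \<open>h\<close>.\<close>

lemma gff_second_moment:
  assumes gff: "gff M U h" and \<psi>: "\<psi> \<in> test_functions U"
  shows "(\<integral>\<^sup>+\<omega>. ennreal ((h \<omega> (laplacian \<psi>))\<^sup>2) \<partial>M) = ennreal (4 * pi\<^sup>2 * dirichlet \<psi> \<psi>)"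
proof -
  let ?\<rho> = "\<lambda>z. - 1 / (2 * pi) * laplacian \<psi> z"
  have hm: "h \<in> M \<rightarrow>\<^sub>M distribution_space U" using gff unfolding gff_def by blast
  have \<rho>: "?\<rho> \<in> test_functions U" by (intro test_functions_cmult test_functions_laplacian \<psi>)
  have \<psi>': "\<psi> \<in> test_functions UNIV" "?\<rho> \<in> test_functions UNIV" using \<psi> \<rho> test_functions_mono[of U UNIV] by auto
  have 0: "(\<integral>z. ?\<rho> z \<partial>lborel) = 0" using integral_laplacian[OF \<psi>] by simp
  have main: "(\<integral>\<^sup>+\<omega>. ennreal ((h \<omega> ?\<rho>)\<^sup>2) \<partial>M) = ennreal (dirichlet \<psi> \<psi>)"
  proof -
    consider "zero_boundary_gff M U h" | "U = UNIV" "whole_plane_gff M h"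
      | N where "whole_plane_gff N (\<lambda>T. T)"
         "distr M (distribution_space U) h = distr N (distribution_space U) (\<lambda>T. restrict T (test_functions U))"
      using gff unfolding gff_def by blast
    then show ?thesis
    proof cases
      case 1
      then show ?thesis unfolding zero_boundary_gff_def
        using gff_pairing_second_moment[OF _ \<psi> \<rho>, of M h] by blast
    next
      case 2
      then show ?thesis unfolding whole_plane_gff_def
        using gff_pairing_second_moment[OF _ \<psi>'(1), of M _ h] \<psi>'(2) 0 by blast
    next
      case 3
      have e: "(\<lambda>T. ennreal ((T ?\<rho>)\<^sup>2)) \<in> borel_measurable (distribution_space U)"
        using measurable_eval_distribution[OF \<rho>] by measurable
      have N: "(\<lambda>T. T) \<in> N \<rightarrow>\<^sub>M distribution_space UNIV" "gff_pairing N UNIV {\<rho> \<in> test_functions UNIV. (\<integral>z. \<rho> z \<partial>lborel) = 0} (\<lambda>T. T)"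
        using 3(1) unfolding whole_plane_gff_def by blast+
      have r: "(\<lambda>T. restrict T (test_functions U)) \<in> N \<rightarrow>\<^sub>M distribution_space U"
      proof (rule measurable_compose[OF N(1)], rule measurable_distribution_spaceI)
        show "restrict T (test_functions U) \<in> distributions U" if "T \<in> space (distribution_space UNIV)" for T
          using restrict_distributions[of T UNIV U] that unfolding space_distribution_space by simp
        show "(\<lambda>T. restrict T (test_functions U) f) \<in> borel_measurable (distribution_space UNIV)" if "f \<in> test_functions U" for f
          using measurable_eval_distribution[of f UNIV] that test_functions_mono[of U UNIV] by auto
      qed
      have "(\<integral>\<^sup>+\<omega>. ennreal ((h \<omega> ?\<rho>)\<^sup>2) \<partial>M) = (\<integral>\<^sup>+T. ennreal ((T ?\<rho>)\<^sup>2) \<partial>distr M (distribution_space U) h)"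
        using hm e by (subst nn_integral_distr) auto
      also have "\<dots> = (\<integral>\<^sup>+T. ennreal ((restrict T (test_functions U) ?\<rho>)\<^sup>2) \<partial>N)"
        unfolding 3(2) using r e by (subst nn_integral_distr) auto
      also have "\<dots> = (\<integral>\<^sup>+T. ennreal ((T ?\<rho>)\<^sup>2) \<partial>N)" using \<rho> by simp
      also have "\<dots> = ennreal (dirichlet \<psi> \<psi>)"
        using gff_pairing_second_moment[OF N(2) \<psi>'(1)] \<psi>'(2) 0 by blast
      finally show ?thesis .
    qed
  qed
  have "h \<omega> (laplacian \<psi>) = - (2 * pi) * h \<omega> ?\<rho>" if "\<omega> \<in> space M" for \<omega>
  proof -
    have "h \<omega> \<in> distributions U" using measurable_space[OF hm that] space_distribution_space by blast
    from distribution_cmult[OF this \<rho>, of "- (2 * pi)"] show ?thesis by simp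
  qed
  then have "(\<integral>\<^sup>+\<omega>. ennreal ((h \<omega> (laplacian \<psi>))\<^sup>2) \<partial>M) = (\<integral>\<^sup>+\<omega>. ennreal (4 * pi\<^sup>2) * ennreal ((h \<omega> ?\<rho>)\<^sup>2) \<partial>M)"
    by (intro nn_integral_cong) (simp add: power_mult_distrib flip: ennreal_mult)
  also have "\<dots> = ennreal (4 * pi\<^sup>2) * ennreal (dirichlet \<psi> \<psi>)"
  proof -
    have [measurable]: "(\<lambda>\<omega>. h \<omega> ?\<rho>) \<in> borel_measurable M"
      using measurable_compose[OF hm measurable_eval_distribution[OF \<rho>]] .
    show ?thesis unfolding main[symmetric] by (rule nn_integral_cmult) measurable
  qed
  also have "\<dots> = ennreal (4 * pi\<^sup>2 * dirichlet \<psi> \<psi>)" by (simp add: ennreal_mult')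
  finally show ?thesis .
qed

text \<open>The classical argument for finite order on a compact set: if no \<open>m\<close> worked,
  there would be functions on which \<open>T\<close> is at least \<open>1\<close> in absolute value
  although their derivatives up to order \<open>m\<close> are at most \<open>1 / (m + 1)\<close>;
  running through all \<open>m\<close> they form a null sequence of test functions on which
  \<open>T\<close> does not tend to \<open>0\<close>.\<close>

lemma distribution_finite_order:
  assumes T: "T \<in> distributions U" and K: "compact K" "K \<subseteq> U"
  shows "\<exists>m. \<forall>g. (\<forall>n. g n \<in> test_functions U) \<longrightarrow> (\<forall>n. {z. g n z \<noteq> 0} \<subseteq> K) \<longrightarrow>
     (\<forall>bs. set bs \<subseteq> Basis \<longrightarrow> length bs \<le> m \<longrightarrow> uniform_limit UNIV (\<lambda>n. partials bs (g n)) (\<lambda>_. 0) sequentially) \<longrightarrow>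
     (\<lambda>n. T (g n)) \<longlonglongrightarrow> 0"
proof (rule ccontr)
  assume neg: "\<not> ?thesis"
  have "\<exists>\<phi>. \<phi> \<in> test_functions U \<and> {z. \<phi> z \<noteq> 0} \<subseteq> K \<and> \<bar>T \<phi>\<bar> \<ge> 1 \<and>
      (\<forall>bs. set bs \<subseteq> Basis \<longrightarrow> length bs \<le> m \<longrightarrow> (\<forall>z. \<bar>partials bs \<phi> z\<bar> \<le> 1 / Suc m))" for m
  proof -
    obtain g where g: "\<And>n. g n \<in> test_functions U" "\<And>n. {z. g n z \<noteq> 0} \<subseteq> K"
      "\<And>bs. set bs \<subseteq> Basis \<Longrightarrow> length bs \<le> m \<Longrightarrow> uniform_limit UNIV (\<lambda>n. partials bs (g n)) (\<lambda>_. 0) sequentially"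
      "\<not> (\<lambda>n. T (g n)) \<longlonglongrightarrow> 0" using neg by blast
    from g(4) obtain \<delta> where \<delta>: "\<delta> > 0" "\<not> (\<forall>\<^sub>F n in sequentially. \<bar>T (g n)\<bar> < \<delta>)"
      unfolding tendsto_iff dist_real_def by auto
    have fin: "finite {bs. set bs \<subseteq> (Basis :: complex set) \<and> length bs \<le> m}"
      by (rule finite_lists_length_le) simp
    \<comment> \<open>Only finitely many lists have length at most \<open>m\<close>, so eventually
      all these derivatives are small at once, and this coincides with one of the infinitely many
      indices at which \<open>T (g n)\<close> stays away from \<open>0\<close>. The scale
      \<open>\<delta> / Suc m\<close> anticipates the division by \<open>\<delta>\<close>.\<close>
    have "\<forall>\<^sub>F n in sequentially. \<forall>bs\<in>{bs. set bs \<subseteq> Basis \<and> length bs \<le> m}. \<forall>z. \<bar>partials bs (g n) z\<bar> < \<delta> / Suc m"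
    proof (rule eventually_ball_finite[OF fin], rule ballI)
      fix bs :: "complex list" assume "bs \<in> {bs. set bs \<subseteq> Basis \<and> length bs \<le> m}"
      then have "uniform_limit UNIV (\<lambda>n. partials bs (g n)) (\<lambda>_. 0) sequentially" using g(3) by blast
      moreover have "\<delta> / Suc m > 0" using \<delta> by simp
      ultimately have "\<forall>\<^sub>F n in sequentially. \<forall>z\<in>UNIV. dist (partials bs (g n) z) 0 < \<delta> / Suc m"
        by (rule uniform_limitD)
      then show "\<forall>\<^sub>F n in sequentially. \<forall>z. \<bar>partials bs (g n) z\<bar> < \<delta> / Suc m" by simp
    qed
    moreover have "\<exists>\<^sub>F n in sequentially. \<not> \<bar>T (g n)\<bar> < \<delta>" using \<delta>(2) by (simp add: not_eventually)
    ultimately have "\<exists>\<^sub>F n in sequentially. (\<forall>bs\<in>{bs. set bs \<subseteq> Basis \<and> length bs \<le> m}. \<forall>z. \<bar>partials bs (g n) z\<bar> < \<delta> / Suc m) \<and> \<not> \<bar>T (g n)\<bar> < \<delta>"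
      by (rule frequently_eventually_conj[rotated]) 
    from frequently_ex[OF this] obtain n where "\<forall>bs\<in>{bs. set bs \<subseteq> Basis \<and> length bs \<le> m}. \<forall>z. \<bar>partials bs (g n) z\<bar> < \<delta> / Suc m"
      "\<not> \<bar>T (g n)\<bar> < \<delta>"
      by (elim exE conjE)
    then have n: "\<And>bs z. set bs \<subseteq> Basis \<Longrightarrow> length bs \<le> m \<Longrightarrow> \<bar>partials bs (g n) z\<bar> < \<delta> / Suc m" "\<bar>T (g n)\<bar> \<ge> \<delta>"
      by auto
    define \<phi> where "\<phi> = (\<lambda>z. (1 / \<delta>) * g n z)"
    have 1: "\<phi> \<in> test_functions U" unfolding \<phi>_def by (intro test_functions_cmult g(1))
    have 2: "{z. \<phi> z \<noteq> 0} \<subseteq> K" using g(2)[of n] by (auto simp: \<phi>_def)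
    have "T \<phi> = (1 / \<delta>) * T (g n)" unfolding \<phi>_def using distribution_cmult[OF T g(1)] .
    then have "\<bar>T \<phi>\<bar> = \<bar>T (g n)\<bar> / \<delta>" using \<delta>(1) by (simp add: abs_mult)
    then have 3: "\<bar>T \<phi>\<bar> \<ge> 1" using n(2) \<delta>(1) by simp
    have "\<bar>partials bs \<phi> z\<bar> \<le> 1 / Suc m" if "set bs \<subseteq> Basis" "length bs \<le> m" for bs z
    proof -
      have "partials bs \<phi> z = (1 / \<delta>) * partials bs (g n) z"
        unfolding \<phi>_def using partials_cmult[OF test_functions_smooth[OF g(1)] that(1)] by (rule fun_cong)
      then have "\<bar>partials bs \<phi> z\<bar> = (1 / \<delta>) * \<bar>partials bs (g n) z\<bar>" using \<delta>(1) by (simp add: abs_mult)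
      also have "\<dots> \<le> (1 / \<delta>) * (\<delta> / Suc m)" using n(1)[OF that, of z] \<delta>(1) by (intro mult_left_mono) auto
      finally show ?thesis using \<delta>(1) by simp
    qed
    with 1 2 3 show ?thesis by blast
  qed
  then obtain \<phi> where \<phi>: "\<And>m. \<phi> m \<in> test_functions U" "\<And>m. {z. \<phi> m z \<noteq> 0} \<subseteq> K" "\<And>m. \<bar>T (\<phi> m)\<bar> \<ge> 1"
    "\<And>m bs z. set bs \<subseteq> Basis \<Longrightarrow> length bs \<le> m \<Longrightarrow> \<bar>partials bs (\<phi> m) z\<bar> \<le> 1 / Suc m"
    by metis
  have "uniform_limit UNIV (\<lambda>n. partials bs (\<phi> n)) (\<lambda>_. 0) sequentially" if "set bs \<subseteq> Basis" for bs
  proof (rule uniform_limitI)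
    fix e :: real assume "e > 0"
    then obtain N where N: "1 / Suc N < e" using nat_approx_posE by blast
    show "\<forall>\<^sub>F n in sequentially. \<forall>x\<in>UNIV. dist (partials bs (\<phi> n) x) 0 < e"
    proof (rule eventually_sequentiallyI[of "max N (length bs)"], rule ballI)
      fix n x assume n: "max N (length bs) \<le> n"
      have "\<bar>partials bs (\<phi> n) x\<bar> \<le> 1 / Suc n" using \<phi>(4)[OF that] n by simp
      also have "\<dots> \<le> 1 / Suc N" using n by (intro divide_left_mono) auto
      finally show "dist (partials bs (\<phi> n) x) 0 < e" using N by simp
    qed
  qed
  then have "test_null_sequence U \<phi>" unfolding test_null_sequence_def using \<phi> K by blast
  then have "(\<lambda>n. T (\<phi> n)) \<longlonglongrightarrow> 0" using T unfolding distributions_def by blast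
  then have "\<forall>\<^sub>F n in sequentially. \<bar>T (\<phi> n)\<bar> < 1" using tendstoD[of _ 0 _ 1] by (force simp: dist_real_def)
  then obtain n where "\<bar>T (\<phi> n)\<bar> < 1" unfolding eventually_sequentially by blast
  then show False using \<phi>(3)[of n] by linarith
qed

section \<open>Cutoffs around a coordinate line\<close>

lemma partials1_inner:
  assumes "\<And>x. (g has_real_derivative g' x) (at x)"
  shows "((\<lambda>z. g (z \<bullet> b - s)) has_derivative (\<lambda>v. (v \<bullet> b) * g' (z \<bullet> b - s))) (at z)"
    and "partials [b'] (\<lambda>z. g (z \<bullet> b - s)) z = (b' \<bullet> b) * g' (z \<bullet> b - s)"
proof -
  have "((\<lambda>z. g (z \<bullet> b - s)) has_derivative (\<lambda>v. g' (z \<bullet> b - s) * (v \<bullet> b))) (at z)"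
    by (rule has_derivative_compose[of "\<lambda>z. z \<bullet> b - s" "\<lambda>v. v \<bullet> b" z UNIV g])
       (use assms in \<open>auto intro!: derivative_eq_intros simp: has_field_derivative_def\<close>)
  then show 1: "((\<lambda>z. g (z \<bullet> b - s)) has_derivative (\<lambda>v. (v \<bullet> b) * g' (z \<bullet> b - s))) (at z)"
    by (simp add: mult.commute)
  show "partials [b'] (\<lambda>z. g (z \<bullet> b - s)) z = (b' \<bullet> b) * g' (z \<bullet> b - s)"
    by (rule partials1_eqI[OF 1])
qed

lemma smooth_inner:
  assumes "smooth1 g" shows "smooth (\<lambda>z. g (z \<bullet> b - s))"
proof -
  have "smooth (\<lambda>z. 1 * g (z \<bullet> b - s))"
  proof (rule smooth_coinduct[where \<C>="{\<lambda>z. c * g (z \<bullet> b - s) | c g. smooth1 g}"])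
    fix f assume "f \<in> {\<lambda>z. c * g (z \<bullet> b - s) | c g. smooth1 g}"
    then obtain c g where f: "f = (\<lambda>z. c * g (z \<bullet> b - s))" "smooth1 g" by blast
    obtain g' where g': "smooth1 g'" "\<And>x. (g has_real_derivative g' x) (at x)" using smooth1_deriv[OF f(2)] by blast
    have d: "(\<lambda>z. g (z \<bullet> b - s)) differentiable (at z)" for z
      using partials1_inner(1)[OF g'(2)] differentiableI by blast
    have "partials [b'] f = (\<lambda>z. (c * (b' \<bullet> b)) * g' (z \<bullet> b - s))" for b'
      unfolding f by (intro ext, subst partials1_cmult[OF d]) (simp add: partials1_inner(2)[OF g'(2)] del: partials.simps(2))
    with g'(1) have "partials [b'] f \<in> {\<lambda>z. c * g (z \<bullet> b - s) | c g. smooth1 g}" for b' by blast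
    moreover have "f differentiable (at z)" for z unfolding f(1) by (intro differentiable_mult differentiable_const d)
    ultimately show "(\<forall>z. f differentiable (at z)) \<and> (\<forall>b'\<in>Basis. partials [b'] f \<in> {\<lambda>z. c * g (z \<bullet> b - s) | c g. smooth1 g})" by blast
  qed (use assms in blast)
  then show ?thesis by simp
qed

lemma uniform_limit_0_bound:
  assumes "\<And>n z. \<bar>f n z\<bar> \<le> C / Suc n"
  shows "uniform_limit UNIV f (\<lambda>_. 0 :: real) sequentially"
proof (rule uniform_limitI)
  fix e :: real assume "e > 0"
  have "(\<lambda>n. C * (1 / Suc n)) \<longlonglongrightarrow> C * 0" by (intro tendsto_mult_left LIMSEQ_Suc[OF lim_1_over_n])
  then have "\<forall>\<^sub>F n in sequentially. C / Suc n < e" using \<open>e > 0\<close> order_tendstoD(2)[of _ "C * 0" sequentially e] by simp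
  then show "\<forall>\<^sub>F n in sequentially. \<forall>x\<in>UNIV. dist (f n x) 0 < e"
    by eventually_elim (use assms in \<open>auto intro: le_less_trans simp: dist_real_def\<close>)
qed

text \<open>The second moments are summable, so by monotone convergence the sum of all squares has
  finite integral and is finite almost everywhere; its terms then tend to \<open>0\<close>.\<close>

lemma AE_tendsto_0_of_second_moments:
  fixes X :: "nat \<Rightarrow> 'w \<Rightarrow> real"
  assumes m: "\<And>n. X n \<in> borel_measurable M"
    and b: "\<And>n. (\<integral>\<^sup>+\<omega>. ennreal ((X n \<omega>)\<^sup>2) \<partial>M) \<le> ennreal (E * (1 / real (Suc n) ^ 2))"
  shows "AE \<omega> in M. (\<lambda>n. X n \<omega>) \<longlonglongrightarrow> 0"
proof -
  have s: "summable (\<lambda>n. \<bar>E\<bar> * (1 / real (Suc n) ^ 2))"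
    using inverse_power_summable[of 2, where 'a=real] summable_Suc_iff[of "\<lambda>n. inverse (real n ^ 2)"]
    by (intro summable_mult) (simp add: inverse_eq_divide)
  have "(\<integral>\<^sup>+\<omega>. (\<Sum>n. ennreal ((X n \<omega>)\<^sup>2)) \<partial>M) = (\<Sum>n. \<integral>\<^sup>+\<omega>. ennreal ((X n \<omega>)\<^sup>2) \<partial>M)"
    using m by (intro nn_integral_suminf) measurable
  also have "\<dots> \<le> (\<Sum>n. ennreal (\<bar>E\<bar> * (1 / real (Suc n) ^ 2)))"
    by (intro suminf_le allI order_trans[OF b] ennreal_leI mult_right_mono) auto
  also have "\<dots> < \<infinity>" using s by (subst suminf_ennreal2) auto
  finally have "(\<integral>\<^sup>+\<omega>. (\<Sum>n. ennreal ((X n \<omega>)\<^sup>2)) \<partial>M) \<noteq> \<infinity>" by simp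
  moreover have "(\<lambda>\<omega>. \<Sum>n. ennreal ((X n \<omega>)\<^sup>2)) \<in> borel_measurable M" using m by measurable
  ultimately have "AE \<omega> in M. (\<Sum>n. ennreal ((X n \<omega>)\<^sup>2)) \<noteq> \<infinity>" by (intro nn_integral_PInf_AE)
  then show ?thesis
  proof eventually_elim
    case (elim \<omega>)
    then have "summable (\<lambda>n. (X n \<omega>)\<^sup>2)" by (intro summable_suminf_not_top) auto
    then have "(\<lambda>n. (X n \<omega>)\<^sup>2) \<longlonglongrightarrow> 0" by (rule summable_LIMSEQ_zero)
    then show ?case using tendsto_null_power[of "\<lambda>n. X n \<omega>" _ 2] by (simp add: tendsto_power_zero)
  qed
qed


lemma distribution_sum:
  assumes T: "T \<in> distributions U" and "finite I" "\<And>i. i \<in> I \<Longrightarrow> f i \<in> test_functions U"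
  shows "T (\<lambda>z. \<Sum>i\<in>I. f i z) = (\<Sum>i\<in>I. T (f i))"
  using assms(2,3)
proof (induction I rule: finite_induct)
  case empty
  have "(\<lambda>z. 0) \<in> test_functions U" using test_functions_sum[of "{}"] by simp
  from distribution_cmult[OF T this, of 0] show ?case by simp
next
  case (insert i I)
  then have "(\<lambda>z. \<Sum>i\<in>I. f i z) \<in> test_functions U" by (intro test_functions_sum) auto
  with insert distribution_add[OF T, of "f i" "\<lambda>z. \<Sum>i\<in>I. f i z"] show ?case by simp
qed

text \<open>The line is \<open>{z. z \<bullet> b = s}\<close>. The bound starts at level
  \<open>1\<close>: the cutoff itself, at level \<open>0\<close>, is not small, and only its
  antiderivatives across the line are.\<close>

locale cutoffs =
  fixes A :: "nat \<Rightarrow> nat \<Rightarrow> real \<Rightarrow> real" and c :: real and b :: complex and s :: real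
  assumes A_smooth: "smooth1 (A n k)"
    and A_deriv: "(A n (Suc k) has_real_derivative A n k x) (at x)"
    and A_bound: "\<bar>A n (Suc k) x\<bar> \<le> c * \<bar>x\<bar> ^ k / Suc n"
    and b: "b \<in> Basis" and c: "c > 0"
begin

definition \<alpha> :: "nat \<Rightarrow> nat \<Rightarrow> complex \<Rightarrow> real" where "\<alpha> n k z = A n k (z \<bullet> b - s)"

lemma smooth_\<alpha>: "smooth (\<alpha> n k)"
  unfolding \<alpha>_def[abs_def] by (rule smooth_inner[OF A_smooth])

lemma partials1_\<alpha>: "partials [b'] (\<alpha> n (Suc k)) z = (b' \<bullet> b) * \<alpha> n k z"
  unfolding \<alpha>_def[abs_def] by (rule partials1_inner(2)[OF A_deriv])

lemma partials1_mult_\<alpha>: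
  assumes "smooth \<phi>"
  shows "partials [b'] (\<lambda>z. \<phi> z * \<alpha> n (Suc k) z) =
    (\<lambda>z. partials [b'] \<phi> z * \<alpha> n (Suc k) z + ((b' \<bullet> b) * \<phi> z) * \<alpha> n k z)"
proof
  fix z
  have "partials [b'] (\<lambda>z. \<phi> z * \<alpha> n (Suc k) z) z = partials [b'] \<phi> z * \<alpha> n (Suc k) z + \<phi> z * partials [b'] (\<alpha> n (Suc k)) z"
    by (rule partials1_mult[OF smooth_differentiable[OF assms] smooth_differentiable[OF smooth_\<alpha>]])
  also have "\<dots> = partials [b'] \<phi> z * \<alpha> n (Suc k) z + ((b' \<bullet> b) * \<phi> z) * \<alpha> n k z"
    unfolding partials1_\<alpha> by (simp only: mult_ac)
  finally show "partials [b'] (\<lambda>z. \<phi> z * \<alpha> n (Suc k) z) z = partials [b'] \<phi> z * \<alpha> n (Suc k) z + ((b' \<bullet> b) * \<phi> z) * \<alpha> n k z" .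
qed

lemma mult_\<alpha>_bound:
  assumes "\<phi> \<in> test_functions U"
  obtains G where "\<And>n z. \<bar>\<phi> z * \<alpha> n (Suc k) z\<bar> \<le> G / Suc n"
proof -
  obtain K where K: "compact K" "{z. \<phi> z \<noteq> 0} \<subseteq> K" using assms by (rule test_functions_support)
  obtain B where B: "B > 0" "\<And>z. \<bar>\<phi> z\<bar> \<le> B" using test_functions_bounded[OF assms] by blast
  obtain R where R: "R > 0" "\<And>z. z \<in> K \<Longrightarrow> norm z \<le> R"
    using compact_imp_bounded[OF K(1)] bounded_pos by metis
  have "\<bar>\<phi> z * \<alpha> n (Suc k) z\<bar> \<le> (B * (c * (R + \<bar>s\<bar>) ^ k)) / Suc n" for n z
  proof (cases "z \<in> K")
    case True
    have "\<bar>z \<bullet> b\<bar> \<le> R" using Basis_le_norm[OF b, of z] R(2)[OF True] by linarith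
    then have "\<bar>z \<bullet> b - s\<bar> \<le> R + \<bar>s\<bar>" by linarith
    then have "\<bar>z \<bullet> b - s\<bar> ^ k \<le> (R + \<bar>s\<bar>) ^ k" by (intro power_mono) auto
    then have "\<bar>\<alpha> n (Suc k) z\<bar> \<le> c * (R + \<bar>s\<bar>) ^ k / Suc n"
      unfolding \<alpha>_def using c by (intro order_trans[OF A_bound] divide_right_mono mult_left_mono) auto
    then have "\<bar>\<phi> z\<bar> * \<bar>\<alpha> n (Suc k) z\<bar> \<le> B * (c * (R + \<bar>s\<bar>) ^ k / Suc n)"
      using B by (intro mult_mono) auto
    then show ?thesis by (simp add: abs_mult)
  next
    case False
    then have "\<phi> z = 0" using K by blast
    then show ?thesis using B c R by (auto intro!: divide_nonneg_nonneg mult_nonneg_nonneg)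
  qed
  then show ?thesis by (rule that)
qed

text \<open>By the Leibniz rule each derivative lowers the level by at most one, and from level
  \<open>1\<close> upwards everything is of order \<open>1 / n\<close> on compact sets. Level
  \<open>k + 1\<close> therefore tolerates \<open>k\<close> derivatives.\<close>

lemma uniform_limit_partials_mult_\<alpha>:
  assumes "\<phi> \<in> test_functions U" "set bs \<subseteq> Basis" "length bs \<le> k"
  shows "uniform_limit UNIV (\<lambda>n. partials bs (\<lambda>z. \<phi> z * \<alpha> n (Suc k) z)) (\<lambda>_. 0) sequentially"
  using assms
proof (induction bs arbitrary: \<phi> k rule: rev_induct)
  case Nil
  obtain G where "\<And>n z. \<bar>\<phi> z * \<alpha> n (Suc k) z\<bar> \<le> G / Suc n" using mult_\<alpha>_bound[OF Nil(1)] by blast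
  then show ?case unfolding partials.simps by (rule uniform_limit_0_bound)
next
  case (snoc b' bs)
  have b': "b' \<in> Basis" "set bs \<subseteq> Basis" using snoc.prems(2) by auto
  obtain j where k: "k = Suc j" "length bs \<le> j" "length bs \<le> k" using snoc.prems(3) by (cases k) auto
  have sm: "smooth \<phi>" using snoc.prems(1) test_functions_smooth by blast
  have 1: "partials [b'] \<phi> \<in> test_functions U" by (rule test_functions_partials1[OF snoc.prems(1) b'(1)])
  have 2: "(\<lambda>z. (b' \<bullet> b) * \<phi> z) \<in> test_functions U" by (rule test_functions_cmult[OF snoc.prems(1)])
  have eq: "partials (bs @ [b']) (\<lambda>z. \<phi> z * \<alpha> n (Suc k) z) =
     (\<lambda>z. partials bs (\<lambda>z. partials [b'] \<phi> z * \<alpha> n (Suc k) z) z + partials bs (\<lambda>z. ((b' \<bullet> b) * \<phi> z) * \<alpha> n (Suc j) z) z)" for n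
    unfolding partials_snoc partials1_mult_\<alpha>[OF sm] k(1)
    by (rule partials_add) (use b' in \<open>auto intro!: smooth_mult smooth_\<alpha> test_functions_smooth[OF 1] smooth_const sm simp del: partials.simps(2)\<close>)
  have "uniform_limit UNIV (\<lambda>n z. partials bs (\<lambda>z. partials [b'] \<phi> z * \<alpha> n (Suc k) z) z + partials bs (\<lambda>z. ((b' \<bullet> b) * \<phi> z) * \<alpha> n (Suc j) z) z)
      (\<lambda>_. 0 + 0) sequentially"
    by (intro uniform_limit_add snoc.IH 1 2 b' k)
  then show ?case unfolding eq by simp
qed

text \<open>One derivative of a function at level \<open>k + 2\<close> still leaves level at least
  \<open>1\<close>, so the gradient is of order \<open>1 / n\<close> on the support of
  \<open>\<phi>\<close>. The energy is then of order \<open>1 / n^2\<close>, which is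
  summable.\<close>

lemma dirichlet_mult_\<alpha>_bound:
  assumes \<phi>: "\<phi> \<in> test_functions U"
  obtains E where "\<And>n. dirichlet (\<lambda>z. \<phi> z * \<alpha> n (Suc (Suc k)) z) (\<lambda>z. \<phi> z * \<alpha> n (Suc (Suc k)) z) \<le> E * (1 / real (Suc n) ^ 2)"
proof -
  let ?f = "\<lambda>n z. \<phi> z * \<alpha> n (Suc (Suc k)) z"
  have sm: "smooth \<phi>" using \<phi> test_functions_smooth by blast
  obtain K where K: "compact K" "{z. \<phi> z \<noteq> 0} \<subseteq> K" using \<phi> by (rule test_functions_support)
  have "\<exists>G. \<forall>n z. \<bar>partials [b'] (?f n) z\<bar> \<le> G / Suc n" if b': "b' \<in> Basis" for b'
  proof -
    obtain G1 where G1: "\<And>n z. \<bar>partials [b'] \<phi> z * \<alpha> n (Suc (Suc k)) z\<bar> \<le> G1 / Suc n"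
      using mult_\<alpha>_bound[OF test_functions_partials1[OF \<phi> b']] by blast
    obtain G2 where G2: "\<And>n z. \<bar>((b' \<bullet> b) * \<phi> z) * \<alpha> n (Suc k) z\<bar> \<le> G2 / Suc n"
      using mult_\<alpha>_bound[OF test_functions_cmult[OF \<phi>]] by blast
    have "\<bar>partials [b'] (?f n) z\<bar> \<le> (G1 + G2) / Suc n" for n z
      unfolding partials1_mult_\<alpha>[OF sm] add_divide_distrib
      by (rule order_trans[OF abs_triangle_ineq add_mono[OF G1 G2]])
    then show ?thesis by blast
  qed
  then obtain G where G: "\<And>b' n z. b' \<in> Basis \<Longrightarrow> \<bar>partials [b'] (?f n) z\<bar> \<le> G b' / Suc n" by metis
  let ?E = "1 / (2 * pi) * ((\<Sum>b'\<in>Basis. (G b')\<^sup>2) * measure lborel K)"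
  have "dirichlet (?f n) (?f n) \<le> ?E * (1 / real (Suc n) ^ 2)" for n
  proof -
    have zero: "partials [b'] (?f n) z = 0" if "z \<notin> K" for b' z
      by (rule partials_zero_outside[OF _ compact_imp_closed[OF K(1)] that]) (use K(2) in auto)
    have "(\<Sum>b'\<in>Basis. partials [b'] (?f n) z * partials [b'] (?f n) z)
        \<le> (\<Sum>b'\<in>Basis. (G b')\<^sup>2) * (1 / real (Suc n) ^ 2) * indicator K z" for z
    proof (cases "z \<in> K")
      case True
      have "partials [b'] (?f n) z * partials [b'] (?f n) z \<le> (G b')\<^sup>2 * (1 / real (Suc n) ^ 2)" if "b' \<in> Basis" for b'
      proof -
        have "\<bar>partials [b'] (?f n) z\<bar>\<^sup>2 \<le> (G b' / Suc n)\<^sup>2" by (rule power_mono[OF G[OF that]]) simp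
        then show ?thesis by (simp add: power2_eq_square power_divide del: partials.simps(2) of_nat_Suc)
      qed
      then have "(\<Sum>b'\<in>Basis. partials [b'] (?f n) z * partials [b'] (?f n) z) \<le> (\<Sum>b'\<in>Basis. (G b')\<^sup>2 * (1 / real (Suc n) ^ 2))"
        by (rule sum_mono)
      then show ?thesis unfolding sum_distrib_right using True by (simp del: partials.simps(2) of_nat_Suc)
    next
      case False
      then show ?thesis using zero by (simp del: partials.simps(2))
    qed
    moreover have "integrable lborel (\<lambda>z. (\<Sum>b'\<in>Basis. (G b')\<^sup>2) * (1 / real (Suc n) ^ 2) * indicator K (z::complex))"
      using K(1) emeasure_compact_finite[OF K(1)] borel_compact[OF K(1)] by (intro integrable_mult_right integrable_real_indicator) auto
    ultimately have "(\<integral>z. (\<Sum>b'\<in>Basis. partials [b'] (?f n) z * partials [b'] (?f n) z) \<partial>lborel)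
        \<le> (\<integral>z. (\<Sum>b'\<in>Basis. (G b')\<^sup>2) * (1 / real (Suc n) ^ 2) * indicator K z \<partial>lborel)"
      by (intro integral_mono') (auto intro!: divide_nonneg_nonneg mult_nonneg_nonneg sum_nonneg simp del: partials.simps(2))
    also have "\<dots> = (\<Sum>b'\<in>Basis. (G b')\<^sup>2) * (1 / real (Suc n) ^ 2) * measure lborel K"
      by simp
    finally show ?thesis unfolding dirichlet_def by (simp add: field_simps del: of_nat_Suc partials.simps(2))
  qed
  then show ?thesis by (rule that)
qed

lemma laplacian_mult_\<alpha>:
  assumes "smooth \<phi>"
  shows "laplacian (\<lambda>z. \<phi> z * \<alpha> n (Suc (Suc k)) z) =
    (\<lambda>z. \<Sum>b'\<in>Basis. (partials [b', b'] \<phi> z * \<alpha> n (Suc (Suc k)) z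
       + (2 * (b' \<bullet> b)) * (partials [b'] \<phi> z * \<alpha> n (Suc k) z)) + (b' \<bullet> b)\<^sup>2 * (\<phi> z * \<alpha> n k z))"
  unfolding laplacian_def
proof (intro ext sum.cong refl)
  fix z and b' :: complex assume b': "b' \<in> Basis"
  have sm: "smooth (partials [b'] \<phi>)" by (rule smooth_partials1[OF assms b'])
  have sm2: "smooth (\<lambda>z. (b' \<bullet> b) * \<phi> z)" by (rule smooth_cmult[OF assms])
  have "partials [b', b'] (\<lambda>z. \<phi> z * \<alpha> n (Suc (Suc k)) z) z
     = partials [b'] (partials [b'] (\<lambda>z. \<phi> z * \<alpha> n (Suc (Suc k)) z)) z" by simp
  also have "\<dots> = partials [b'] (\<lambda>z. partials [b'] \<phi> z * \<alpha> n (Suc (Suc k)) z) z + partials [b'] (\<lambda>z. ((b' \<bullet> b) * \<phi> z) * \<alpha> n (Suc k) z) z"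
    unfolding partials1_mult_\<alpha>[OF assms]
    by (intro partials1_add smooth_differentiable smooth_mult smooth_\<alpha> sm sm2)
  also have "\<dots> = (partials [b'] (partials [b'] \<phi>) z * \<alpha> n (Suc (Suc k)) z + ((b' \<bullet> b) * partials [b'] \<phi> z) * \<alpha> n (Suc k) z)
      + ((b' \<bullet> b) * partials [b'] \<phi> z * \<alpha> n (Suc k) z + ((b' \<bullet> b) * ((b' \<bullet> b) * \<phi> z)) * \<alpha> n k z)"
    unfolding partials1_mult_\<alpha>[OF sm] partials1_mult_\<alpha>[OF sm2] partials1_cmult[OF smooth_differentiable[OF assms]] ..
  also have "\<dots> = (partials [b', b'] \<phi> z * \<alpha> n (Suc (Suc k)) z
       + (2 * (b' \<bullet> b)) * (partials [b'] \<phi> z * \<alpha> n (Suc k) z)) + (b' \<bullet> b)\<^sup>2 * (\<phi> z * \<alpha> n k z)"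
  proof -
    have "partials [b'] (partials [b'] \<phi>) z = partials [b', b'] \<phi> z" by simp
    then show ?thesis by (simp add: algebra_simps power2_eq_square del: partials.simps(2))
  qed
  finally show "partials [b', b'] (\<lambda>z. \<phi> z * \<alpha> n (Suc (Suc k)) z) z = (partials [b', b'] \<phi> z * \<alpha> n (Suc (Suc k)) z
       + (2 * (b' \<bullet> b)) * (partials [b'] \<phi> z * \<alpha> n (Suc k) z)) + (b' \<bullet> b)\<^sup>2 * (\<phi> z * \<alpha> n k z)" .
qed

text \<open>Solving for \<open>T (\<phi> \<alpha> n k)\<close> trades one level of \<open>\<alpha>\<close> for a Laplacian with small Dirichlet energy.\<close>

lemma distribution_mult_\<alpha>:
  assumes T: "T \<in> distributions U" and \<phi>: "\<phi> \<in> test_functions U"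
  shows "T (\<lambda>z. \<phi> z * \<alpha> n k z) = T (laplacian (\<lambda>z. \<phi> z * \<alpha> n (Suc (Suc k)) z))
    - (\<Sum>b'\<in>Basis. T (\<lambda>z. partials [b', b'] \<phi> z * \<alpha> n (Suc (Suc k)) z)
         + (2 * (b' \<bullet> b)) * T (\<lambda>z. partials [b'] \<phi> z * \<alpha> n (Suc k) z))"
proof -
  have t0: "(\<lambda>z. \<phi> z * \<alpha> n k z) \<in> test_functions U" by (intro test_functions_mult \<phi> smooth_\<alpha>)
  have t1: "(\<lambda>z. partials [b', b'] \<phi> z * \<alpha> n (Suc (Suc k)) z) \<in> test_functions U"
    "(\<lambda>z. partials [b'] \<phi> z * \<alpha> n (Suc k) z) \<in> test_functions U" if "b' \<in> Basis" for b'
    by (intro test_functions_mult test_functions_partials \<phi> smooth_\<alpha>; use that in simp)+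
  have t2: "(\<lambda>z. (2 * (b' \<bullet> b)) * (partials [b'] \<phi> z * \<alpha> n (Suc k) z)) \<in> test_functions U"
    "(\<lambda>z. (b' \<bullet> b)\<^sup>2 * (\<phi> z * \<alpha> n k z)) \<in> test_functions U" if "b' \<in> Basis" for b'
    by (intro test_functions_cmult t1 t0 that)+
  have t3: "(\<lambda>z. partials [b', b'] \<phi> z * \<alpha> n (Suc (Suc k)) z + (2 * (b' \<bullet> b)) * (partials [b'] \<phi> z * \<alpha> n (Suc k) z)) \<in> test_functions U"
    if "b' \<in> Basis" for b' by (intro test_functions_add t1 t2 that)
  have t4: "(\<lambda>z. (partials [b', b'] \<phi> z * \<alpha> n (Suc (Suc k)) z + (2 * (b' \<bullet> b)) * (partials [b'] \<phi> z * \<alpha> n (Suc k) z)) + (b' \<bullet> b)\<^sup>2 * (\<phi> z * \<alpha> n k z)) \<in> test_functions U"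
    if "b' \<in> Basis" for b' by (intro test_functions_add t3 t2 that)
  have "T (laplacian (\<lambda>z. \<phi> z * \<alpha> n (Suc (Suc k)) z)) =
     (\<Sum>b'\<in>Basis. T (\<lambda>z. (partials [b', b'] \<phi> z * \<alpha> n (Suc (Suc k)) z + (2 * (b' \<bullet> b)) * (partials [b'] \<phi> z * \<alpha> n (Suc k) z)) + (b' \<bullet> b)\<^sup>2 * (\<phi> z * \<alpha> n k z)))"
    unfolding laplacian_mult_\<alpha>[OF test_functions_smooth[OF \<phi>]]
    by (rule distribution_sum[OF T]) (use t4 in \<open>auto simp del: partials.simps(2)\<close>)
  also have "\<dots> = (\<Sum>b'\<in>Basis. (T (\<lambda>z. partials [b', b'] \<phi> z * \<alpha> n (Suc (Suc k)) z)
         + (2 * (b' \<bullet> b)) * T (\<lambda>z. partials [b'] \<phi> z * \<alpha> n (Suc k) z)) + (b' \<bullet> b)\<^sup>2 * T (\<lambda>z. \<phi> z * \<alpha> n k z))"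
    by (intro sum.cong refl)
      (simp only: distribution_add[OF T t3 t2(2)] distribution_add[OF T t1(1) t2(1)] distribution_cmult[OF T t1(2)] distribution_cmult[OF T t0])
  also have "\<dots> = (\<Sum>b'\<in>Basis. T (\<lambda>z. partials [b', b'] \<phi> z * \<alpha> n (Suc (Suc k)) z)
         + (2 * (b' \<bullet> b)) * T (\<lambda>z. partials [b'] \<phi> z * \<alpha> n (Suc k) z)) + (\<Sum>b'\<in>Basis. (b' \<bullet> b)\<^sup>2) * T (\<lambda>z. \<phi> z * \<alpha> n k z)"
    by (simp only: sum.distrib sum_distrib_right)
  \<comment> \<open>Only the direction across the line reaches level \<open>k\<close>, with
    coefficient \<open>1\<close>, so the equation can be solved for the term at this level.\<close>
  also have "(\<Sum>b'\<in>Basis. (b' \<bullet> b)\<^sup>2) = (\<Sum>b'\<in>Basis. if b' = b then 1 else 0)"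
    by (intro sum.cong refl) (use b in \<open>simp add: inner_Basis\<close>)
  also have "\<dots> = 1" using b by simp
  finally show ?thesis by simp
qed

text \<open>Second moments control the field only on Laplacians, and \<open>f * \<alpha> n 0\<close>
  is not one. For fixed \<open>\<omega>\<close> the level is therefore lowered step by step. Far
  above the order of \<open>h \<omega>\<close> on the support of \<open>f\<close> the limit is mere
  continuity; each descent adds a Laplacian term, whose energy is summable in \<open>n\<close>, and
  terms at the two next higher levels.\<close>

lemma gff_cutoff_tendsto_0:
  assumes gff: "gff M U h" and f: "f \<in> test_functions U"
  shows "AE \<omega> in M. (\<lambda>n. h \<omega> (\<lambda>z. f z * \<alpha> n 0 z)) \<longlonglongrightarrow> 0"
proof -
  have hm: "h \<in> M \<rightarrow>\<^sub>M distribution_space U" using gff unfolding gff_def by blast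
  obtain K where K: "compact K" "K \<subseteq> U" "{z. f z \<noteq> 0} \<subseteq> K" using f by (rule test_functions_support)
  have lapl: "AE \<omega> in M. (\<lambda>n. h \<omega> (laplacian (\<lambda>z. \<phi> z * \<alpha> n (Suc (Suc k)) z))) \<longlonglongrightarrow> 0"
    if \<phi>: "\<phi> \<in> test_functions U" for \<phi> k
  proof -
    obtain E where E: "\<And>n. dirichlet (\<lambda>z. \<phi> z * \<alpha> n (Suc (Suc k)) z) (\<lambda>z. \<phi> z * \<alpha> n (Suc (Suc k)) z) \<le> E * (1 / real (Suc n) ^ 2)"
      using dirichlet_mult_\<alpha>_bound[OF \<phi>] by blast
    have t: "(\<lambda>z. \<phi> z * \<alpha> n (Suc (Suc k)) z) \<in> test_functions U" for n by (intro test_functions_mult \<phi> smooth_\<alpha>)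
    show ?thesis
    proof (rule AE_tendsto_0_of_second_moments)
      show "(\<lambda>\<omega>. h \<omega> (laplacian (\<lambda>z. \<phi> z * \<alpha> n (Suc (Suc k)) z))) \<in> borel_measurable M" for n
        by (rule measurable_compose[OF hm measurable_eval_distribution[OF test_functions_laplacian[OF t]]])
      show "(\<integral>\<^sup>+\<omega>. ennreal ((h \<omega> (laplacian (\<lambda>z. \<phi> z * \<alpha> n (Suc (Suc k)) z)))\<^sup>2) \<partial>M) \<le> ennreal ((4 * pi\<^sup>2 * E) * (1 / real (Suc n) ^ 2))" for n
        unfolding gff_second_moment[OF gff t] mult.assoc by (intro ennreal_leI mult_left_mono) (use E in \<open>auto simp: mult.assoc\<close>)
    qed
  qed
  \<comment> \<open>The starting level depends on \<open>\<omega>\<close>, so the Laplacian terms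
    are controlled for all levels and all derivatives of \<open>f\<close> before
    \<open>\<omega>\<close> is fixed; these are countably many.\<close>
  have "AE \<omega> in M. \<forall>bs\<in>{bs. set bs \<subseteq> (Basis :: complex set)}. \<forall>k. (\<lambda>n. h \<omega> (laplacian (\<lambda>z. partials bs f z * \<alpha> n (Suc (Suc k)) z))) \<longlonglongrightarrow> 0"
    unfolding AE_ball_countable[OF countable_subset[OF _ countable_lists[OF countable_finite[OF finite_Basis]], of "{bs. set bs \<subseteq> Basis}" , unfolded lists_eq_set, OF subset_refl]] AE_all_countable
    using lapl test_functions_partials[OF f] by blast
  then show ?thesis
  proof (rule AE_mp, intro AE_I2 impI)
    fix \<omega> assume \<omega>: "\<omega> \<in> space M"
      and L: "\<forall>bs\<in>{bs. set bs \<subseteq> (Basis :: complex set)}. \<forall>k. (\<lambda>n. h \<omega> (laplacian (\<lambda>z. partials bs f z * \<alpha> n (Suc (Suc k)) z))) \<longlonglongrightarrow> 0"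
    have T: "h \<omega> \<in> distributions U" using measurable_space[OF hm \<omega>] space_distribution_space by blast
    obtain m where m: "\<And>g. (\<forall>n. g n \<in> test_functions U) \<Longrightarrow> (\<forall>n. {z. g n z \<noteq> 0} \<subseteq> K) \<Longrightarrow>
       (\<forall>bs. set bs \<subseteq> Basis \<longrightarrow> length bs \<le> m \<longrightarrow> uniform_limit UNIV (\<lambda>n. partials bs (g n)) (\<lambda>_. 0) sequentially) \<Longrightarrow>
       (\<lambda>n. h \<omega> (g n)) \<longlonglongrightarrow> 0" using distribution_finite_order[OF T K(1,2)] by blast
    let ?P = "\<lambda>k. \<forall>bs. set bs \<subseteq> Basis \<longrightarrow> (\<lambda>n. h \<omega> (\<lambda>z. partials bs f z * \<alpha> n k z)) \<longlonglongrightarrow> 0"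
    have base: "?P (Suc k)" if "k \<ge> m" for k
    proof (intro allI impI, rule m)
      fix bs :: "complex list" assume bs: "set bs \<subseteq> Basis"
      note t = test_functions_partials[OF f bs]
      show "\<forall>n. (\<lambda>z. partials bs f z * \<alpha> n (Suc k) z) \<in> test_functions U" by (intro allI test_functions_mult t smooth_\<alpha>)
      show "\<forall>n. {z. partials bs f z * \<alpha> n (Suc k) z \<noteq> 0} \<subseteq> K"
        using partials_zero_outside[OF K(3) compact_imp_closed[OF K(1)]] by fastforce
      show "\<forall>bs'. set bs' \<subseteq> Basis \<longrightarrow> length bs' \<le> m \<longrightarrow>
        uniform_limit UNIV (\<lambda>n. partials bs' (\<lambda>z. partials bs f z * \<alpha> n (Suc k) z)) (\<lambda>_. 0) sequentially"
        using that by (intro allI impI uniform_limit_partials_mult_\<alpha>[OF t]) auto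
    qed
    \<comment> \<open>The predicate speaks of all derivatives of \<open>f\<close>, since the
      recursion replaces a function by its first and second derivatives.\<close>
    have step: "?P k" if P: "?P (Suc k)" "?P (Suc (Suc k))" for k
    proof (intro allI impI)
      fix bs :: "complex list" assume bs: "set bs \<subseteq> Basis"
      have "(\<lambda>n. h \<omega> (\<lambda>z. partials (b' # b' # bs) f z * \<alpha> n (Suc (Suc k)) z)) \<longlonglongrightarrow> 0"
        "(\<lambda>n. h \<omega> (\<lambda>z. partials (b' # bs) f z * \<alpha> n (Suc k) z)) \<longlonglongrightarrow> 0" if "b' \<in> Basis" for b'
        using P bs that by (auto simp del: partials.simps(2))
      then have lim: "(\<lambda>n. h \<omega> (\<lambda>z. partials [b', b'] (partials bs f) z * \<alpha> n (Suc (Suc k)) z)) \<longlonglongrightarrow> 0"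
        "(\<lambda>n. h \<omega> (\<lambda>z. partials [b'] (partials bs f) z * \<alpha> n (Suc k) z)) \<longlonglongrightarrow> 0" if "b' \<in> Basis" for b'
        using that by auto
      have "(\<lambda>n. h \<omega> (laplacian (\<lambda>z. partials bs f z * \<alpha> n (Suc (Suc k)) z))
         - (\<Sum>b'\<in>Basis. h \<omega> (\<lambda>z. partials [b', b'] (partials bs f) z * \<alpha> n (Suc (Suc k)) z)
         + (2 * (b' \<bullet> b)) * h \<omega> (\<lambda>z. partials [b'] (partials bs f) z * \<alpha> n (Suc k) z))) \<longlonglongrightarrow>
         0 - (\<Sum>b'\<in>Basis. 0 + (2 * (b' \<bullet> b)) * 0)"
        using L bs by (intro tendsto_diff tendsto_sum tendsto_add tendsto_mult_left lim) auto
      then show "(\<lambda>n. h \<omega> (\<lambda>z. partials bs f z * \<alpha> n k z)) \<longlonglongrightarrow> 0"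
        unfolding distribution_mult_\<alpha>[OF T test_functions_partials[OF f bs]] by (simp del: partials.simps(2))
    qed
    \<comment> \<open>Two consecutive levels are carried along, as the recursion for level
      \<open>k\<close> uses levels \<open>k + 1\<close> and \<open>k + 2\<close>.\<close>
    have "?P (Suc m - j) \<and> ?P (Suc (Suc m - j))" if "j \<le> Suc m" for j
      using that
    proof (induction j)
      case 0 then show ?case using base[of m] base[of "Suc m"] by simp
    next
      case (Suc j)
      then have "Suc m - j = Suc (Suc m - Suc j)" by simp
      with Suc step[of "Suc m - Suc j"] show ?case by (simp del: partials.simps(2))
    qed
    from this[of "Suc m"] have "?P 0" by simp
    from this[rule_format, of "[]"] show "(\<lambda>n. h \<omega> (\<lambda>z. f z * \<alpha> n 0 z)) \<longlonglongrightarrow> 0" by simp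
  qed
qed

end

section \<open>Chains and internal metrics\<close>

definition chain_sum :: "('a \<times> 'a \<Rightarrow> 'b::comm_monoid_add) \<Rightarrow> 'a list \<Rightarrow> 'b" where
  "chain_sum c xs = (\<Sum>i<length xs - 1. c (xs ! i, xs ! Suc i))"

definition chains :: "'a set \<Rightarrow> 'a \<Rightarrow> 'a \<Rightarrow> 'a list set" where
  "chains Q x y = {xs \<in> lists Q. xs \<noteq> [] \<and> hd xs = x \<and> last xs = y}"

lemma chain_sum_simps [simp]:
  "chain_sum c [] = 0" "chain_sum c [x] = 0" "chain_sum c (x # y # zs) = c (x, y) + chain_sum c (y # zs)"
  by (simp_all add: chain_sum_def sum.lessThan_Suc_shift del: sum.lessThan_Suc)

lemma chain_sum_append: "chain_sum c (xs @ y # zs) = chain_sum c (xs @ [y]) + chain_sum c (y # zs)"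
proof (induction xs)
  case (Cons x xs)
  then show ?case by (cases xs) (auto simp: add.assoc)
qed simp

lemma chain_sum_map: "chain_sum c (map f [m..<Suc n]) = (\<Sum>i\<in>{m..<n}. c (f i, f (Suc i)))"
proof (cases "m \<le> n")
  case True
  have "chain_sum c (map f [m..<Suc n]) = (\<Sum>i<n - m. c (f (m + i), f (Suc (m + i))))"
    unfolding chain_sum_def by (intro sum.cong) (auto simp del: upt_Suc)
  also have "\<dots> = (\<Sum>i\<in>{m..<n}. c (f i, f (Suc i)))"
    using sum.shift_bounds_nat_ivl[of "\<lambda>i. c (f i, f (Suc i))" 0 m "n - m"] True
    by (simp add: atLeast0LessThan add.commute)
  finally show ?thesis .
qed simp

lemma chains_map:
  "chains Q x y = {map f [0..<Suc n] | f n. f 0 = x \<and> f n = y \<and> (\<forall>i\<le>n. f i \<in> Q)}"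
proof (intro equalityI subsetI)
  fix xs assume "xs \<in> chains Q x y"
  then have xs: "set xs \<subseteq> Q" "xs \<noteq> []" "hd xs = x" "last xs = y" by (auto simp: chains_def)
  then have "xs = map ((!) xs) [0..<Suc (length xs - 1)]" by (simp add: map_nth del: upt_Suc)
  moreover have "xs ! 0 = x" "xs ! (length xs - 1) = y" using xs by (auto simp: hd_conv_nth last_conv_nth)
  moreover have "\<forall>i\<le>length xs - 1. xs ! i \<in> Q"
  proof (intro allI impI)
    fix i assume "i \<le> length xs - 1"
    then have "i < length xs" using xs(2) by (cases xs) auto
    then show "xs ! i \<in> Q" using xs(1) nth_mem by blast
  qed
  ultimately show "xs \<in> {map f [0..<Suc n] | f n. f 0 = x \<and> f n = y \<and> (\<forall>i\<le>n. f i \<in> Q)}" by blast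
next
  fix xs assume "xs \<in> {map f [0..<Suc n] | f n. f 0 = x \<and> f n = y \<and> (\<forall>i\<le>n. f i \<in> Q)}"
  then obtain f n where f: "xs = map f [0..<Suc n]" "f 0 = x" "f n = y" "\<forall>i\<le>n. f i \<in> Q" by blast
  have "hd xs = x" using f by (simp add: hd_map del: upt_Suc)
  moreover have "last xs = y" using f by (simp add: last_map)
  moreover have "set xs \<subseteq> Q" using f(4) unfolding f(1) by (auto simp del: upt_Suc)
  ultimately show "xs \<in> chains Q x y" using f(1) by (auto simp: chains_def)
qed

lemma countable_chains: "countable Q \<Longrightarrow> countable (chains Q x y)"
  unfolding chains_def by (rule countable_subset[OF _ countable_lists]) auto

lemma chain_sum_mono:
  assumes "set xs \<subseteq> Q" "\<And>x y. x \<in> Q \<Longrightarrow> y \<in> Q \<Longrightarrow> c (x, y) \<le> (c' (x, y) :: 'b::ordered_comm_monoid_add)"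
  shows "chain_sum c xs \<le> chain_sum c' xs"
  using assms(1)
proof (induction xs rule: induct_list012)
  case (3 x y zs)
  then have "c (x, y) \<le> c' (x, y)" "chain_sum c (y # zs) \<le> chain_sum c' (y # zs)" using assms(2) by auto
  then show ?case by (simp add: add_mono)
qed auto

lemma le_chain_sum:
  fixes d :: "'a \<times> 'a \<Rightarrow> 'b::ordered_comm_monoid_add"
  assumes "xs \<in> chains Q x y" "\<And>x. x \<in> Q \<Longrightarrow> d (x, x) \<le> 0"
    and "\<And>x y z. x \<in> Q \<Longrightarrow> y \<in> Q \<Longrightarrow> z \<in> Q \<Longrightarrow> d (x, z) \<le> d (x, y) + d (y, z)"
  shows "d (x, y) \<le> chain_sum d xs"
proof -
  have "set xs \<subseteq> Q \<Longrightarrow> xs \<noteq> [] \<Longrightarrow> d (hd xs, last xs) \<le> chain_sum d xs"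
  proof (induction xs)
    case (Cons x xs)
    show ?case
    proof (cases xs)
      case Nil then show ?thesis using Cons assms(2) by simp
    next
      case (Cons y ys)
      then have IH: "d (y, last xs) \<le> chain_sum d xs" using Cons.IH Cons.prems by simp
      have "last xs \<in> Q" "x \<in> Q" "y \<in> Q" using Cons.prems Cons by (auto split: if_splits)
      then have "d (x, last xs) \<le> d (x, y) + d (y, last xs)" using assms(3) by blast
      also have "\<dots> \<le> d (x, y) + chain_sum d xs" by (rule add_left_mono[OF IH])
      finally show ?thesis using Cons by simp
    qed
  qed simp
  then show ?thesis using assms(1) unfolding chains_def by auto
qed

section \<open>Continuous metrics on compact sets\<close>

lemma compact_uniform:
  fixes K :: "'a::metric_space set" and P :: "'a \<Rightarrow> real \<Rightarrow> bool"
  assumes K: "compact K"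
    and loc: "\<And>u. u \<in> K \<Longrightarrow> \<exists>d>0. \<exists>r>0. \<forall>u'\<in>ball u d. u' \<in> K \<longrightarrow> P u' r"
    and mono: "\<And>u r r'. P u r \<Longrightarrow> 0 < r' \<Longrightarrow> r' \<le> r \<Longrightarrow> P u r'"
  shows "\<exists>r>0. \<forall>u\<in>K. P u r"
proof -
  obtain d r where dr: "\<And>u. u \<in> K \<Longrightarrow> d u > 0 \<and> r u > 0 \<and> (\<forall>u'\<in>ball u (d u). u' \<in> K \<longrightarrow> P u' (r u))"
    using loc by metis
  obtain F where F: "F \<subseteq> K" "finite F" "K \<subseteq> (\<Union>u\<in>F. ball u (d u))"
    by (rule compactE_image[OF K, of K "\<lambda>u. ball u (d u)"]) (use dr in force)+
  define R where "R = Min (insert 1 (r ` F))"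
  have "R > 0" unfolding R_def using F dr by (subst Min_gr_iff) auto
  moreover have "P u R" if u: "u \<in> K" for u
  proof -
    obtain v where v: "v \<in> F" "u \<in> ball v (d v)" using F(3) u by blast
    then have "P u (r v)" using dr F(1) u by blast
    moreover have "R \<le> r v" unfolding R_def using F v by (intro Min_le) auto
    ultimately show ?thesis using mono \<open>R > 0\<close> by blast
  qed
  ultimately show ?thesis by blast
qed

lemma ennreal_add_pos_less: "a < (b::ennreal) \<Longrightarrow> \<exists>e>0. a + e \<le> b"
  by (rule exI[of _ "b - a"]) (simp add: diff_gr0_ennreal diff_add_self_ennreal add.commute[of a] less_imp_le)

lemma ennreal_pos_real: 
  assumes "e > (0::ennreal)" obtains r where "r > 0" "ennreal r \<le> e"
proof (cases e)
  case (real r)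
  then show ?thesis using assms that[of r] by simp
next
  case top
  then show ?thesis using that[of 1] by simp
qed

lemma ennreal_half: 
  assumes "e > (0::ennreal)" obtains e' where "e' > 0" "e' + e' \<le> e"
proof -
  obtain r where r: "r > 0" "ennreal r \<le> e" using assms by (rule ennreal_pos_real)
  have "ennreal (r / 2) + ennreal (r / 2) = ennreal (r / 2 + r / 2)" using r(1) by (intro ennreal_plus[symmetric]) auto
  then have "ennreal (r / 2) + ennreal (r / 2) \<le> e" using r(2) by simp
  then show ?thesis using that[of "ennreal (r / 2)"] r(1) by simp
qed

lemma cmD:
  assumes "D \<in> continuous_metrics U"
  shows "D \<in> extensional (U \<times> U)" "x \<in> U \<Longrightarrow> y \<in> U \<Longrightarrow> D (x, y) = 0 \<longleftrightarrow> x = y"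
    "x \<in> U \<Longrightarrow> y \<in> U \<Longrightarrow> D (x, y) = D (y, x)"
    "x \<in> U \<Longrightarrow> y \<in> U \<Longrightarrow> z \<in> U \<Longrightarrow> D (x, z) \<le> D (x, y) + D (y, z)"
    "x \<in> U \<Longrightarrow> y \<in> U \<Longrightarrow> connected_component U x y \<Longrightarrow> D (x, y) < \<infinity>"
    "S \<subseteq> U \<Longrightarrow> openin (top_of_set U) S \<longleftrightarrow> (\<forall>x\<in>S. \<exists>e>0. \<forall>y\<in>U. D (x, y) < e \<longrightarrow> y \<in> S)"
proof -
  note * = assms[unfolded continuous_metrics_def mem_Collect_eq]
  show "D \<in> extensional (U \<times> U)" using * by (elim conjE)
  show "x \<in> U \<Longrightarrow> y \<in> U \<Longrightarrow> D (x, y) = 0 \<longleftrightarrow> x = y" by (rule *[THEN conjunct2, THEN conjunct1, THEN bspec, THEN bspec])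
  note * = *[THEN conjunct2, THEN conjunct2]
  show "x \<in> U \<Longrightarrow> y \<in> U \<Longrightarrow> D (x, y) = D (y, x)" by (rule *[THEN conjunct1, THEN bspec, THEN bspec])
  show "x \<in> U \<Longrightarrow> y \<in> U \<Longrightarrow> z \<in> U \<Longrightarrow> D (x, z) \<le> D (x, y) + D (y, z)" by (rule *[THEN conjunct2, THEN conjunct1, THEN bspec, THEN bspec, THEN bspec])
  note * = *[THEN conjunct2, THEN conjunct2]
  show "x \<in> U \<Longrightarrow> y \<in> U \<Longrightarrow> connected_component U x y \<Longrightarrow> D (x, y) < \<infinity>" by (rule *[THEN conjunct1, THEN bspec, THEN bspec, THEN mp])
  show "S \<subseteq> U \<Longrightarrow> openin (top_of_set U) S \<longleftrightarrow> (\<forall>x\<in>S. \<exists>e>0. \<forall>y\<in>U. D (x, y) < e \<longrightarrow> y \<in> S)"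
    by (rule *[THEN conjunct2, THEN spec, THEN mp])
qed

text \<open>The definition only compares topologies. Balls of \<open>D\<close> are open for
  \<open>D\<close> by the triangle inequality, hence relatively open in \<open>U\<close>.\<close>

lemma cm_continuous:
  assumes D: "D \<in> continuous_metrics U" and x: "x \<in> U" and e: "e > (0::ennreal)"
  shows "\<exists>d>0. \<forall>y\<in>U. dist x y < d \<longrightarrow> D (x, y) < e"
proof -
  let ?S = "{y \<in> U. D (x, y) < e}"
  have "openin (top_of_set U) ?S"
  proof (subst cmD(6)[OF D], blast, rule ballI)
    fix y assume y: "y \<in> ?S"
    then obtain r where r: "r > 0" "D (x, y) + r \<le> e" using ennreal_add_pos_less by blast
    have "z \<in> ?S" if "z \<in> U" "D (y, z) < r" for z
    proof -
      have "D (x, z) \<le> D (x, y) + D (y, z)" using cmD(4)[OF D] x y that by blast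
      also have "\<dots> < D (x, y) + r"
        using that(2) order.strict_trans2[OF conjunct2[OF y[unfolded mem_Collect_eq]] top_greatest]
        by (intro ennreal_add_left_cancel_less[THEN iffD2]) auto
      finally show ?thesis using r that by simp
    qed
    with r show "\<exists>e>0. \<forall>z\<in>U. D (y, z) < e \<longrightarrow> z \<in> ?S" by blast
  qed
  moreover have "x \<in> ?S" using cmD(2)[OF D x x] x e by simp
  ultimately obtain d where "d > 0" "ball x d \<inter> U \<subseteq> ?S" by (meson openin_contains_ball)
  then show ?thesis by (intro exI[of _ d]) (auto simp: subset_iff)
qed

lemma cm_separates:
  assumes D: "D \<in> continuous_metrics U" and x: "x \<in> U" and r: "r > (0::real)"
  shows "\<exists>e>0. \<forall>y\<in>U. D (x, y) < e \<longrightarrow> dist x y < r"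
proof -
  have "openin (top_of_set U) (U \<inter> ball x r)" by (simp add: openin_open_Int)
  then have "\<exists>e>0. \<forall>y\<in>U. D (x, y) < e \<longrightarrow> y \<in> U \<inter> ball x r"
    using cmD(6)[OF D, of "U \<inter> ball x r"] x r by auto
  then show ?thesis by auto
qed



section \<open>Internal metrics through chains of rational points\<close>

definition boundary_dist :: "'a set \<Rightarrow> 'a set \<Rightarrow> ('a \<times> 'a \<Rightarrow> ennreal) \<Rightarrow> 'a \<Rightarrow> ennreal" where
  "boundary_dist U V D u = (INF y\<in>U - V. D (u, y))"

definition local_step :: "'a set \<Rightarrow> 'a set \<Rightarrow> ('a \<times> 'a \<Rightarrow> ennreal) \<Rightarrow> 'a \<times> 'a \<Rightarrow> ennreal" where
  "local_step U V D = (\<lambda>(u, v). if D (u, v) < boundary_dist U V D u then D (u, v) else \<infinity>)"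

definition rational_points :: "complex set \<Rightarrow> complex set" where
  "rational_points U = {z \<in> U. Re z \<in> \<rat> \<and> Im z \<in> \<rat>}"

text \<open>For a length metric this is the internal metric on \<open>V\<close>; being a countable infimum it is measurable
  in \<open>D\<close>.\<close>

definition chain_metric :: "complex set \<Rightarrow> complex set \<Rightarrow> (complex \<times> complex \<Rightarrow> ennreal) \<Rightarrow> complex \<times> complex \<Rightarrow> ennreal" where
  "chain_metric U V D = (\<lambda>(x, y). INF xs\<in>chains (rational_points V) x y. chain_sum (local_step U V D) xs)"

lemma countable_rational_points: "countable (rational_points U)"
proof (rule countable_subset)
  show "rational_points U \<subseteq> (\<lambda>(a, b). Complex a b) ` (\<rat> \<times> \<rat>)"
    unfolding rational_points_def by (force simp: image_iff complex_eq_iff)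
  show "countable ((\<lambda>(a, b). Complex a b) ` (\<rat> \<times> \<rat>))"
    by (intro countable_image countable_SIGMA countable_rat)
qed

lemma rational_points_subset: "rational_points U \<subseteq> U"
  by (auto simp: rational_points_def)

lemma rational_points_dense:
  assumes "open U" "z \<in> U" "e > 0"
  shows "\<exists>q\<in>rational_points U. dist z q < e"
proof -
  obtain r where r: "r > 0" "ball z r \<subseteq> U" using assms open_contains_ball by blast
  define t where "t = min r e / 2"
  have t: "t > 0" using r assms by (simp add: t_def)
  obtain a where a: "a \<in> \<rat>" "Re z < a" "a < Re z + t" using Rats_dense_in_real[of "Re z" "Re z + t"] t by auto
  obtain b where b: "b \<in> \<rat>" "Im z < b" "b < Im z + t" using Rats_dense_in_real[of "Im z" "Im z + t"] t by auto
  have "dist z (Complex a b) \<le> \<bar>Re (z - Complex a b)\<bar> + \<bar>Im (z - Complex a b)\<bar>"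
    unfolding dist_norm by (rule cmod_le)
  also have "\<dots> < 2 * t" using a b by simp
  finally have d: "dist z (Complex a b) < min r e" by (simp add: t_def)
  then have "Complex a b \<in> U" using r by auto
  then show ?thesis using a b d by (intro bexI[of _ "Complex a b"]) (auto simp: rational_points_def)
qed

lemma cm_refl: "D \<in> continuous_metrics U \<Longrightarrow> x \<in> U \<Longrightarrow> D (x, x) = 0"
  using cmD(2) by blast

lemma boundary_dist_pos:
  assumes D: "D \<in> continuous_metrics U" and V: "open V" "V \<subseteq> U" "u \<in> V"
  shows "boundary_dist U V D u > 0"
proof -
  obtain r where r: "r > 0" "ball u r \<subseteq> V" using V open_contains_ball by blast
  obtain e where e: "e > 0" "\<forall>y\<in>U. D (u, y) < e \<longrightarrow> dist u y < r" using cm_separates[OF D _ r(1), of u] V by blast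
  have "e \<le> boundary_dist U V D u" unfolding boundary_dist_def
  proof (rule INF_greatest)
    fix y assume y: "y \<in> U - V"
    then show "e \<le> D (u, y)" using e(2) r(2) by (meson DiffD1 DiffD2 mem_ball not_le subsetD)
  qed
  with e show ?thesis by simp
qed

text \<open>This and the next lemma are the two moduli of continuity between \<open>D\<close> and
  the Euclidean metric, uniform for base points in a compact set. The second point ranges over all
  of \<open>U\<close>, because it may be moved off the compact set or lie beyond its
  boundary.\<close>

lemma cm_compact_scale:
  assumes D: "D \<in> continuous_metrics U" and K: "compact K" "K \<subseteq> U" and r: "r > 0"
  shows "\<exists>t>0. \<forall>u\<in>K. \<forall>v\<in>U. D (u, v) < ennreal t \<longrightarrow> dist u v < r"
proof (rule compact_uniform[OF K(1), where P="\<lambda>u t. \<forall>v\<in>U. D (u, v) < ennreal t \<longrightarrow> dist u v < r"])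
  fix u assume u: "u \<in> K"
  then have uU: "u \<in> U" using K by blast
  obtain e where e: "e > 0" "\<And>y. y \<in> U \<Longrightarrow> D (u, y) < e \<Longrightarrow> dist u y < r / 2" using cm_separates[OF D uU, of "r / 2"] r by auto
  obtain e' where e': "e' > 0" "e' + e' \<le> e" using e(1) by (rule ennreal_half)
  obtain d where d: "d > 0" "\<And>y. y \<in> U \<Longrightarrow> dist u y < d \<Longrightarrow> D (u, y) < e'" using cm_continuous[OF D uU e'(1)] by blast
  obtain t where t: "t > 0" "ennreal t \<le> e'" using e'(1) by (rule ennreal_pos_real)
  have "\<forall>u'\<in>ball u (min d (r / 2)). u' \<in> K \<longrightarrow> (\<forall>v\<in>U. D (u', v) < ennreal t \<longrightarrow> dist u' v < r)"
  proof (intro ballI impI)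
    fix u' v assume a: "u' \<in> ball u (min d (r / 2))" "u' \<in> K" "v \<in> U" "D (u', v) < ennreal t"
    have u': "u' \<in> U" using a K by blast
    have "D (u, v) \<le> D (u, u') + D (u', v)" using cmD(4)[OF D uU u' a(3)] .
    also have "\<dots> < e' + e'" using d(2)[OF u'] a t by (intro add_strict_mono) auto
    finally have "dist u v < r / 2" using e(2)[OF a(3)] e'(2) by simp
    moreover have "dist u u' < r / 2" using a by simp
    ultimately show "dist u' v < r" by (metis dist_commute dist_triangle_half_r)
  qed
  then show "\<exists>d>0. \<exists>t>0. \<forall>u'\<in>ball u d. u' \<in> K \<longrightarrow> (\<forall>v\<in>U. D (u', v) < ennreal t \<longrightarrow> dist u' v < r)"
    using d(1) t(1) r by (metis half_gt_zero min_less_iff_conj)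
next
  fix u t t' assume "\<forall>v\<in>U. D (u, v) < ennreal t \<longrightarrow> dist u v < r" "0 < t'" "t' \<le> t"
  then show "\<forall>v\<in>U. D (u, v) < ennreal t' \<longrightarrow> dist u v < r" by (meson ennreal_leI less_le_trans)
qed

lemma cm_compact_continuous:
  assumes U: "open U" and D: "D \<in> continuous_metrics U" and K: "compact K" "K \<subseteq> U" and e: "e > 0"
  shows "\<exists>r>0. \<forall>u\<in>K. \<forall>v. dist u v < r \<longrightarrow> v \<in> U \<and> D (u, v) < e"
proof (rule compact_uniform[OF K(1)])
  fix u assume u: "u \<in> K"
  then have uU: "u \<in> U" using K by blast
  obtain e' where e': "e' > 0" "e' + e' \<le> e" using e by (rule ennreal_half)
  obtain d where d: "d > 0" "\<And>y. y \<in> U \<Longrightarrow> dist u y < d \<Longrightarrow> D (u, y) < e'" using cm_continuous[OF D uU e'(1)] by blast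
  obtain d' where d': "d' > 0" "ball u d' \<subseteq> U" using U uU open_contains_ball by blast
  define r where "r = min d d' / 2"
  show "\<exists>d>0. \<exists>r>0. \<forall>u'\<in>ball u d. u' \<in> K \<longrightarrow> (\<forall>v. dist u' v < r \<longrightarrow> v \<in> U \<and> D (u', v) < e)"
  proof (intro exI[of _ r] conjI ballI impI allI)
    fix u' v assume a: "u' \<in> ball u r" "u' \<in> K" "dist u' v < r"
    have u': "u' \<in> U" using a K by blast
    have uv: "dist u v < min d d'" using a dist_triangle[of u v u'] unfolding r_def by simp
    then show v: "v \<in> U" using d' by auto
    have "dist u u' < d" using a d d' unfolding r_def by auto
    have "D (u', v) \<le> D (u', u) + D (u, v)" using cmD(4)[OF D u' uU v] .
    also have "D (u', u) = D (u, u')" using cmD(3)[OF D u' uU] .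
    also have "D (u, u') + D (u, v) < e' + e'" using d(2)[OF u' \<open>dist u u' < d\<close>] d(2)[OF v] uv by (intro add_strict_mono) auto
    finally show "D (u', v) < e" using e' by simp
  qed (use d d' in \<open>auto simp: r_def\<close>)
qed (meson less_le_trans)

text \<open>The points of a partition of the curve, moved to nearby rational points.\<close>

lemma chain_along_path:
  assumes U: "open U" and D: "D \<in> continuous_metrics U" and V: "open V" "V \<subseteq> U"
    and P: "path P" "path_image P \<subseteq> V" "pathstart P = x" "pathfinish P = y"
    and xy: "x \<in> rational_points V" "y \<in> rational_points V"
    and t: "t > (0::real)" and e: "e > (0::real)"
  obtains xs where "xs \<in> chains (rational_points V) x y"
    "\<And>i. i < length xs - 1 \<Longrightarrow> D (xs ! i, xs ! Suc i) < ennreal t"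
    "\<And>z. z \<in> set xs \<Longrightarrow> \<exists>p\<in>path_image P. D (p, z) < ennreal t"
    "chain_sum D xs \<le> metric_length D P + ennreal e"
proof -
  have K: "compact (path_image P)" using P(1) by (rule compact_path_image)
  obtain r where r: "r > 0" "\<And>u v. u \<in> path_image P \<Longrightarrow> dist u v < r \<Longrightarrow> v \<in> U \<and> D (u, v) < ennreal (t / 3)"
    using cm_compact_continuous[OF U D K order_trans[OF P(2) V(2)], of "ennreal (t / 3)"] t by auto
  have "uniformly_continuous_on {0..1} P"
    using P(1) by (simp add: path_def compact_uniformly_continuous)
  then obtain d where d: "d > 0" "\<And>s s'. s \<in> {0..1} \<Longrightarrow> s' \<in> {0..1} \<Longrightarrow> dist s' s < d \<Longrightarrow> dist (P s') (P s) < r"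
    using r(1) unfolding uniformly_continuous_on_def by metis
  obtain n0 where n0: "1 / real (Suc n0) < d" using d(1) nat_approx_posE by blast
  define n where "n = Suc n0"
  have n: "n > 0" "1 / real n < d" using n0 by (auto simp: n_def)
  define X where "X i = P (real i / real n)" for i
  have Xi: "X i \<in> path_image P" if "i \<le> n" for i
    unfolding X_def path_image_def using that n by (intro imageI) auto
  have X0: "X 0 = x" "X n = y" using P n by (auto simp: X_def pathstart_def pathfinish_def)
  \<comment> \<open>Moving both ends of a step costs \<open>2 * \<theta>\<close>. The bound
    \<open>t / 4\<close> keeps this below \<open>2 * t / 3\<close>, the room left by steps of length
    \<open>t / 3\<close>; the bound \<open>e / (2 * n)\<close> keeps the sum over \<open>n\<close>
    steps below \<open>e\<close>.\<close>
  define \<theta> where "\<theta> = min (t / 4) (e / (2 * n))"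
  have \<theta>: "\<theta> > 0" using t e n by (simp add: \<theta>_def)
  have "\<exists>q\<in>rational_points V. D (X i, q) < ennreal \<theta>" if i: "i \<le> n" for i
  proof -
    have XV: "X i \<in> V" "X i \<in> U" using Xi[OF i] P V by auto
    obtain d where "d > 0" "\<And>y. y \<in> U \<Longrightarrow> dist (X i) y < d \<Longrightarrow> D (X i, y) < ennreal \<theta>"
      using cm_continuous[OF D XV(2), of "ennreal \<theta>"] \<theta> by auto
    then show ?thesis using rational_points_dense[OF V(1) XV(1), of d] rational_points_subset[of V] V(2) by blast
  qed
  then obtain q where q: "\<And>i. i \<le> n \<Longrightarrow> q i \<in> rational_points V \<and> D (X i, q i) < ennreal \<theta>" by metis
  \<comment> \<open>The endpoints are rational already and must be kept, so only interior points of
    the partition are moved.\<close>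
  define Y where "Y i = (if i = 0 then x else if i = n then y else q i)" for i
  have Y: "Y i \<in> rational_points V" "D (X i, Y i) < ennreal \<theta>" if "i \<le> n" for i
    using q[OF that] xy \<theta> X0 cm_refl[OF D, of x] cm_refl[OF D, of y] rational_points_subset[of V] V(2)
    by (auto simp: Y_def)
  have YU: "Y i \<in> U" "X i \<in> U" if "i \<le> n" for i using Y[OF that] Xi[OF that] rational_points_subset[of V] V(2) P(2) by blast+
  have step: "D (Y i, Y (Suc i)) \<le> D (X (Suc i), X i) + ennreal (2 * \<theta>)" if i: "i < n" for i
  proof -
    note u = YU[of i] YU[of "Suc i"]
    have "D (Y i, Y (Suc i)) \<le> D (Y i, X i) + D (X i, Y (Suc i))" using cmD(4)[OF D] u i by simp
    also have "\<dots> \<le> D (Y i, X i) + (D (X i, X (Suc i)) + D (X (Suc i), Y (Suc i)))"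
      using cmD(4)[OF D] u i by (intro add_left_mono) simp
    also have "\<dots> = D (X i, Y i) + (D (X (Suc i), X i) + D (X (Suc i), Y (Suc i)))"
      using cmD(3)[OF D] u i by simp
    also have "\<dots> \<le> ennreal \<theta> + (D (X (Suc i), X i) + ennreal \<theta>)"
      using Y(2)[of i] Y(2)[of "Suc i"] i by (intro add_mono) auto
    also have "\<dots> = D (X (Suc i), X i) + (ennreal \<theta> + ennreal \<theta>)" by (simp only: ac_simps)
    also have "ennreal \<theta> + ennreal \<theta> = ennreal (\<theta> + \<theta>)" using \<theta> by (intro ennreal_plus[symmetric]) auto
    finally show ?thesis by simp
  qed
  let ?xs = "map Y [0..<Suc n]"
  show ?thesis
  proof (rule that[of ?xs])
    show "?xs \<in> chains (rational_points V) x y"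
      unfolding chains_map using Y(1) n by (intro CollectI exI[of _ Y] exI[of _ n]) (auto simp: Y_def)
    show "D (?xs ! i, ?xs ! Suc i) < ennreal t" if "i < length ?xs - 1" for i
    proof -
      have i: "i < n" using that by simp
      have "dist (real (Suc i) / n) (real i / n) < d"
        using n by (simp add: dist_real_def diff_divide_distrib[symmetric])
      then have "dist (X (Suc i)) (X i) < r" unfolding X_def using d(2)[of "real i / n" "real (Suc i) / n"] i by simp
      then have "D (X (Suc i), X i) < ennreal (t / 3)" using r(2)[OF Xi] i by simp
      then have "D (X (Suc i), X i) + ennreal (2 * \<theta>) < ennreal (t / 3) + ennreal (2 * (t / 3))"
        using \<theta> t by (intro add_strict_mono ennreal_lessI) (auto simp: \<theta>_def min_def)
      also have "\<dots> = ennreal t" using t by (subst ennreal_plus[symmetric]) auto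
      finally have "D (Y i, Y (Suc i)) < ennreal t" using step[OF i] by (rule order.strict_trans1[rotated])
      then show ?thesis using i by (simp del: upt_Suc)
    qed
    show "\<exists>p\<in>path_image P. D (p, z) < ennreal t" if z: "z \<in> set ?xs" for z
    proof -
      obtain i where i: "i \<le> n" "z = Y i" using z by (auto simp: less_Suc_eq_le simp del: upt_Suc)
      have "ennreal \<theta> \<le> ennreal t" using t by (intro ennreal_leI) (auto simp: \<theta>_def)
      then show ?thesis using Y(2)[OF i(1)] Xi[OF i(1)] i(2) by (intro bexI[of _ "X i"]) auto
    qed
    have "chain_sum D ?xs = (\<Sum>i<n. D (Y i, Y (Suc i)))" by (simp only: chain_sum_map atLeast0LessThan)
    also have "\<dots> \<le> (\<Sum>i<n. D (X (Suc i), X i) + ennreal (2 * \<theta>))" using step by (intro sum_mono) auto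
    also have "\<dots> = (\<Sum>i<n. D (X (Suc i), X i)) + ennreal (n * (2 * \<theta>))"
      using \<theta> by (simp add: sum.distrib ennreal_mult' ennreal_of_nat_eq_real_of_nat)
    also have "\<dots> \<le> metric_length D P + ennreal e"
    proof (intro add_mono ennreal_leI)
      show "(\<Sum>i<n. D (X (Suc i), X i)) \<le> metric_length D P"
        unfolding metric_length_def X_def
        by (rule SUP_upper2[of "(n, \<lambda>i. real i / real n)"]) (use n in \<open>auto simp: divide_strict_right_mono\<close>)
      have "\<theta> \<le> e / (2 * n)" by (simp add: \<theta>_def)
      then show "n * (2 * \<theta>) \<le> e" using n by (simp add: field_simps)
    qed
    finally show "chain_sum D ?xs \<le> metric_length D P + ennreal e" .
  qed
qed

section \<open>Lengths of curves and the internal metric\<close>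

lemma metric_length_ge_sum:
  "t 0 = 0 \<Longrightarrow> t n = 1 \<Longrightarrow> (\<And>i. i < n \<Longrightarrow> t i < t (Suc i)) \<Longrightarrow>
    (\<Sum>i<n. D (P (t (Suc i)), P (t i))) \<le> metric_length D P"
  unfolding metric_length_def by (rule SUP_upper2[of "(n, t)"]) auto

text \<open>Lengths are defined through strict partitions, but cutting a partition at the junction
  of two curves creates repeated times. They contribute \<open>0\<close> and are deleted.\<close>

lemma strict_partition_exists:
  fixes t :: "nat \<Rightarrow> real"
  assumes "t 0 = 0" "\<And>i. i < n \<Longrightarrow> t i \<le> t (Suc i)" "\<And>i. i \<le> n \<Longrightarrow> d (t i) (t i) = (0::ennreal)"
  shows "\<exists>m s. s 0 = (0::real) \<and> s m = t n \<and> (\<forall>i<m. s i < s (Suc i)) \<and>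
    (\<Sum>i<n. d (t (Suc i)) (t i)) = (\<Sum>i<m. d (s (Suc i)) (s i))"
  using assms
proof (induction n)
  case 0
  then show ?case by (intro exI[of _ 0] exI[of _ t]) auto
next
  case (Suc n)
  then obtain m s where s: "s 0 = 0" "s m = t n" "\<forall>i<m. s i < s (Suc i)"
    "(\<Sum>i<n. d (t (Suc i)) (t i)) = (\<Sum>i<m. d (s (Suc i)) (s i))"
    by auto
  show ?case
  proof (cases "t (Suc n) = t n")
    case True
    then show ?thesis using s Suc.prems(3)[of n] by (intro exI[of _ m] exI[of _ s]) auto
  next
    case False
    then have lt: "t n < t (Suc n)" using Suc.prems(2)[of n] by auto
    define s' where "s' i = (if i \<le> m then s i else t (Suc n))" for i
    have "(\<Sum>i<m. d (s' (Suc i)) (s' i)) = (\<Sum>i<m. d (s (Suc i)) (s i))"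
      by (intro sum.cong) (auto simp: s'_def)
    then have "(\<Sum>i<Suc n. d (t (Suc i)) (t i)) = (\<Sum>i<Suc m. d (s' (Suc i)) (s' i))"
      using s by (simp add: s'_def)
    then show ?thesis using s lt by (intro exI[of _ "Suc m"] exI[of _ s']) (auto simp: s'_def less_Suc_eq)
  qed
qed

lemma metric_length_ge_weak_sum:
  assumes "\<And>s. 0 \<le> s \<Longrightarrow> s \<le> 1 \<Longrightarrow> D (P s, P s) = 0"
    and t: "t 0 = 0" "t n = 1" "\<And>i. i < n \<Longrightarrow> t i \<le> t (Suc i)"
  shows "(\<Sum>i<n. D (P (t (Suc i)), P (t i))) \<le> metric_length D P"
proof -
  have "t i \<le> t j" if "i \<le> j" "j \<le> n" for i j
    using that(1)
  proof (induction rule: inc_induct)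
    case (step k)
    with t(3)[of k] that(2) show ?case by simp
  qed simp
  from this[of 0] this[of _ n] have "0 \<le> t i \<and> t i \<le> 1" if "i \<le> n" for i using t that by auto
  then have "\<exists>m s. s 0 = (0::real) \<and> s m = t n \<and> (\<forall>i<m. s i < s (Suc i)) \<and>
      (\<Sum>i<n. D (P (t (Suc i)), P (t i))) = (\<Sum>i<m. D (P (s (Suc i)), P (s i)))"
    using assms(1) t by (intro strict_partition_exists[of t n "\<lambda>a b. D (P a, P b)"]) auto
  then obtain m s where s: "s 0 = (0::real)" "s m = t n" "\<forall>i<m. s i < s (Suc i)"
    "(\<Sum>i<n. D (P (t (Suc i)), P (t i))) = (\<Sum>i<m. D (P (s (Suc i)), P (s i)))"
    by (elim exE conjE)
  show ?thesis unfolding s(4) by (rule metric_length_ge_sum) (use s(1-3) t(2) in auto)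
qed

lemma le_metric_length:
  assumes "\<And>s. 0 \<le> s \<Longrightarrow> s \<le> 1 \<Longrightarrow> D (P s, P s) = 0" "0 \<le> s" "s \<le> 1"
  shows "D (P s, P 0) \<le> metric_length D P"
proof -
  define t where "t i = (if i = 0 then 0 else if i = 1 then s else (1::real))" for i :: nat
  have "(\<Sum>i<2. D (P (t (Suc i)), P (t i))) \<le> metric_length D P"
    by (rule metric_length_ge_weak_sum) (use assms in \<open>auto simp: t_def\<close>)
  moreover have "D (P s, P 0) \<le> (\<Sum>i<2. D (P (t (Suc i)), P (t i)))"
    by (simp add: t_def numeral_2_eq_2)
  ultimately show ?thesis by simp
qed

lemma metric_length_const: "D (x, x) = 0 \<Longrightarrow> metric_length D (\<lambda>_. x) = 0"
proof -
  assume "D (x, x) = 0"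
  then have "metric_length D (\<lambda>_. x) \<le> 0"
    unfolding metric_length_def by (intro SUP_least) (simp add: case_prod_beta)
  then show ?thesis by simp
qed

lemma metric_length_joinpaths:
  assumes D: "D \<in> continuous_metrics U" and P: "path_image P \<subseteq> U" and Q: "path_image Q \<subseteq> U"
    and eq: "pathfinish P = pathstart Q"
  shows "metric_length D (P +++ Q) \<le> metric_length D P + metric_length D Q"
  unfolding metric_length_def[of D "P +++ Q"]
proof (rule SUP_least, clarify)
  fix n :: nat and t :: "nat \<Rightarrow> real"
  assume t: "t 0 = 0" "t n = 1" "\<forall>i<n. t i < t (Suc i)"
  \<comment> \<open>The times are clamped to the two halves of \<open>[0,1]\<close> and rescaled. A
    step within one half becomes trivial on the other curve; the one step across \<open>1/2\<close>
    is split at the junction by the triangle inequality.\<close>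
  define a where "a i = min (2 * t i) 1" for i
  define b where "b i = max (2 * t i - 1) 0" for i
  have PU: "P s \<in> U" "Q s \<in> U" if "0 \<le> s" "s \<le> 1" for s using P Q that by (auto simp: path_image_def)
  have refl: "D (P s, P s) = 0" "D (Q s, Q s) = 0" if "0 \<le> s" "s \<le> 1" for s
    using cm_refl[OF D] PU[OF that] by auto
  have le: "t i \<le> t j" if "i \<le> j" "j \<le> n" for i j
    using that(1)
  proof (induction rule: inc_induct)
    case (step k)
    then have "t k < t (Suc k)" using t(3) that(2) by simp
    with step show ?case by linarith
  qed simp
  have ti: "0 \<le> t i" "t i \<le> 1" if "i \<le> n" for i using le[of 0 i] le[of i n] that t by auto
  have "D ((P +++ Q) (t (Suc i)), (P +++ Q) (t i)) \<le> D (P (a (Suc i)), P (a i)) + D (Q (b (Suc i)), Q (b i))" if i: "i < n" for i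
  proof -
    have lt: "t i < t (Suc i)" and t01: "0 \<le> t i" "t i \<le> 1" "0 \<le> t (Suc i)" "t (Suc i) \<le> 1" using t(3) ti[of i] ti[of "Suc i"] i by auto
    consider "t (Suc i) \<le> 1/2" | "t i > 1/2" | "t i \<le> 1/2" "t (Suc i) > 1/2" by linarith
    then show ?thesis
    proof cases
      case 1 then show ?thesis using lt t01 refl by (simp add: joinpaths_def a_def b_def min_def max_def)
    next
      case 2 then show ?thesis using lt t01 refl by (simp add: joinpaths_def a_def b_def min_def max_def)
    next
      case 3
      have "D (Q (2 * t (Suc i) - 1), P (2 * t i)) \<le> D (Q (2 * t (Suc i) - 1), Q 0) + D (Q 0, P (2 * t i))"
        using cmD(4)[OF D] PU t01 3 by simp
      moreover have "Q 0 = P 1" using eq by (simp add: pathstart_def pathfinish_def)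
      ultimately show ?thesis using 3 t01 by (simp add: joinpaths_def a_def b_def min_def max_def add.commute)
    qed
  qed
  then have "(\<Sum>i<n. D ((P +++ Q) (t (Suc i)), (P +++ Q) (t i)))
     \<le> (\<Sum>i<n. D (P (a (Suc i)), P (a i)) + D (Q (b (Suc i)), Q (b i)))" by (intro sum_mono) auto
  also have "\<dots> = (\<Sum>i<n. D (P (a (Suc i)), P (a i))) + (\<Sum>i<n. D (Q (b (Suc i)), Q (b i)))" by (rule sum.distrib)
  also have "\<dots> \<le> metric_length D P + metric_length D Q"
    by (intro add_mono metric_length_ge_weak_sum refl) (use t in \<open>auto simp: a_def b_def min_def max_def less_imp_le\<close>)
  finally show "(\<Sum>i<n. D ((P +++ Q) (t (Suc i)), (P +++ Q) (t i))) \<le> metric_length D P + metric_length D Q" .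
qed

lemma metric_length_reversepath:
  assumes D: "D \<in> continuous_metrics U" and P: "path_image P \<subseteq> U"
  shows "metric_length D (reversepath P) \<le> metric_length D P"
  unfolding metric_length_def[of D "reversepath P"]
proof (rule SUP_least, clarify)
  fix n :: nat and t :: "nat \<Rightarrow> real"
  assume t: "t 0 = 0" "t n = 1" "\<forall>i<n. t i < t (Suc i)"
  have le: "t i \<le> t j" if "i \<le> j" "j \<le> n" for i j
    using that(1)
  proof (induction rule: inc_induct)
    case (step k)
    then have "t k < t (Suc k)" using t(3) that(2) by simp
    with step show ?case by linarith
  qed simp
  have ti: "0 \<le> t i" "t i \<le> 1" if "i \<le> n" for i using le[of 0 i] le[of i n] that t by auto
  define t' where "t' i = 1 - t (n - i)" for i
  have PU: "P s \<in> U" if "0 \<le> s" "s \<le> 1" for s using P that by (auto simp: path_image_def)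
  have "(\<Sum>i<n. D (reversepath P (t (Suc i)), reversepath P (t i))) = (\<Sum>i<n. D (P (1 - t i), P (1 - t (Suc i))))"
    using cmD(3)[OF D] PU ti by (intro sum.cong refl) (simp add: reversepath_def)
  also have "\<dots> = (\<Sum>i<n. D (P (1 - t (n - Suc i)), P (1 - t (Suc (n - Suc i)))))"
    by (rule sum.nat_diff_reindex[symmetric])
  also have "\<dots> = (\<Sum>i<n. D (P (t' (Suc i)), P (t' i)))"
    by (intro sum.cong refl) (simp add: t'_def Suc_diff_Suc)
  also have "\<dots> \<le> metric_length D P"
  proof (rule metric_length_ge_sum)
    fix i assume i: "i < n"
    then have "n - i = Suc (n - Suc i)" by simp
    moreover have "t (n - Suc i) < t (Suc (n - Suc i))" using t(3) i by simp
    ultimately show "t' i < t' (Suc i)" unfolding t'_def by simp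
  qed (use t in \<open>auto simp: t'_def\<close>)
  finally show "(\<Sum>i<n. D (reversepath P (t (Suc i)), reversepath P (t i))) \<le> metric_length D P" .
qed

lemma internal_metric_eq: "x \<in> V \<Longrightarrow> y \<in> V \<Longrightarrow> internal_metric D V (x, y) = (INF P\<in>curves_in V x y. metric_length D P)"
  by (simp add: internal_metric_def)

lemma internal_metric_ge:
  assumes D: "D \<in> continuous_metrics U" and V: "V \<subseteq> U" and xy: "x \<in> V" "y \<in> V"
  shows "D (x, y) \<le> internal_metric D V (x, y)"
  unfolding internal_metric_eq[OF xy]
proof (rule INF_greatest)
  fix P assume P: "P \<in> curves_in V x y"
  have "P s \<in> U" if "0 \<le> s" "s \<le> 1" for s
    using P that V by (auto simp: path_image_def curves_in_def image_subset_iff)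
  then have "D (P 1, P 0) \<le> metric_length D P" by (intro le_metric_length cm_refl[OF D]) auto
  moreover have "D (x, y) = D (y, x)" using cmD(3)[OF D, of x y] xy V by auto
  ultimately show "D (x, y) \<le> metric_length D P"
    using P by (auto simp: curves_in_def pathstart_def pathfinish_def)
qed

lemma internal_metric_refl:
  assumes "D \<in> continuous_metrics U" "V \<subseteq> U" "x \<in> V" shows "internal_metric D V (x, x) = 0"
proof -
  have "(\<lambda>_. x) \<in> curves_in V x x"
    using assms(3) by (auto simp: curves_in_def path_def path_image_def pathstart_def pathfinish_def)
  moreover have "metric_length D (\<lambda>_. x) = 0" using assms by (intro metric_length_const cm_refl[of D U]) auto
  ultimately have "internal_metric D V (x, x) \<le> 0"
    unfolding internal_metric_eq[OF assms(3) assms(3)] by (metis INF_lower)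
  then show ?thesis by simp
qed

lemma internal_metric_sym_le:
  assumes D: "D \<in> continuous_metrics U" and V: "V \<subseteq> U" and xy: "x \<in> V" "y \<in> V"
  shows "internal_metric D V (x, y) \<le> internal_metric D V (y, x)"
  unfolding internal_metric_eq[OF xy] internal_metric_eq[OF xy(2,1)]
proof (rule INF_greatest)
  fix P assume P: "P \<in> curves_in V y x"
  then have "reversepath P \<in> curves_in V x y" by (auto simp: curves_in_def)
  then have "(INF P\<in>curves_in V x y. metric_length D P) \<le> metric_length D (reversepath P)" by (rule INF_lower)
  also have "\<dots> \<le> metric_length D P" by (rule metric_length_reversepath[OF D]) (use P V in \<open>auto simp: curves_in_def\<close>)
  finally show "(INF P\<in>curves_in V x y. metric_length D P) \<le> metric_length D P" .
qed

lemma le_add_INF: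
  fixes a p :: ennreal
  assumes "\<And>q. q \<in> S \<Longrightarrow> a \<le> p + f q"
  shows "a \<le> p + (INF q\<in>S. f q)"
proof (cases "p = \<top>")
  case False
  have "a - p \<le> (INF q\<in>S. f q)"
    by (rule INF_greatest) (use assms False in \<open>simp add: ennreal_minus_le_iff\<close>)
  then show ?thesis using False by (simp add: ennreal_minus_le_iff)
qed simp

lemma internal_metric_triangle:
  assumes D: "D \<in> continuous_metrics U" and V: "V \<subseteq> U" and xyz: "x \<in> V" "y \<in> V" "z \<in> V"
  shows "internal_metric D V (x, z) \<le> internal_metric D V (x, y) + internal_metric D V (y, z)"
  unfolding internal_metric_eq[OF xyz(1,2)] internal_metric_eq[OF xyz(2,3)]
proof (rule le_add_INF, subst add.commute, rule le_add_INF)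
  fix P Q assume Q: "Q \<in> curves_in V y z" and P: "P \<in> curves_in V x y"
  have "P +++ Q \<in> curves_in V x z" using P Q path_image_join_subset[of P Q] by (auto simp: curves_in_def)
  then have "internal_metric D V (x, z) \<le> metric_length D (P +++ Q)"
    unfolding internal_metric_eq[OF xyz(1,3)] by (rule INF_lower)
  also have "\<dots> \<le> metric_length D P + metric_length D Q"
    by (rule metric_length_joinpaths[OF D]) (use P Q V in \<open>auto simp: curves_in_def\<close>)
  finally show "internal_metric D V (x, z) \<le> metric_length D Q + metric_length D P" by (simp add: add.commute)
qed

text \<open>Every point of a curve is within the length of the curve from its start, so a curve of
  length close to \<open>D (u, v)\<close> is too short to reach the complement of
  \<open>V\<close>.\<close>

lemma internal_metric_local:
  assumes D: "D \<in> continuous_metrics U" "length_metric U D" and V: "V \<subseteq> U" and uv: "u \<in> V" "v \<in> V"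
    and lt: "D (u, v) < boundary_dist U V D u"
  shows "internal_metric D V (u, v) \<le> D (u, v)"
proof (rule ennreal_le_epsilon)
  fix e :: real assume e: "e > 0"
  obtain r where r: "r > 0" "D (u, v) + r \<le> boundary_dist U V D u" using ennreal_add_pos_less[OF lt] by blast
  obtain s where s: "s > 0" "ennreal s \<le> r" using r(1) by (rule ennreal_pos_real)
  define e' where "e' = min e (s / 2)"
  have e': "e' > 0" "e' \<le> e" "e' < s" using e s by (auto simp: e'_def)
  obtain P where P: "P \<in> curves_in U u v" "metric_length D P \<le> D (u, v) + ennreal e'"
    using D(2) uv V e' unfolding length_metric_def by (meson ennreal_less_zero_iff subsetD)
  have PU: "P s \<in> U" if "0 \<le> s" "s \<le> 1" for s using P that by (auto simp: path_image_def curves_in_def)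
  have fin: "D (u, v) \<noteq> \<infinity>" using order.strict_trans2[OF lt top_greatest] by simp
  have "P \<sigma> \<in> V" if s01: "0 \<le> \<sigma>" "\<sigma> \<le> 1" for \<sigma>
  proof (rule ccontr)
    assume "P \<sigma> \<notin> V"
    then have "boundary_dist U V D u \<le> D (u, P \<sigma>)" unfolding boundary_dist_def using PU[OF s01] by (intro INF_lower) auto
    also have "\<dots> = D (P \<sigma>, P 0)" using cmD(3)[OF D(1), of u "P \<sigma>"] uv V PU[OF s01] P(1) by (auto simp: curves_in_def pathstart_def)
    also have "\<dots> \<le> metric_length D P" by (intro le_metric_length cm_refl[OF D(1) PU] s01)
    also have "\<dots> \<le> D (u, v) + ennreal e'" by (rule P(2))
    also have "\<dots> < D (u, v) + ennreal s" using fin e' by (subst ennreal_add_left_cancel_less) (auto simp: ennreal_lessI)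
    also have "\<dots> \<le> D (u, v) + r" using s by (intro add_left_mono)
    also have "\<dots> \<le> boundary_dist U V D u" by (rule r(2))
    finally show False by simp
  qed
  then have "P \<in> curves_in V u v" using P(1) by (auto simp: curves_in_def path_image_def)
  then have "internal_metric D V (u, v) \<le> metric_length D P" unfolding internal_metric_eq[OF uv] by (rule INF_lower)
  also have "\<dots> \<le> D (u, v) + ennreal e'" by (rule P(2))
  also have "\<dots> \<le> D (u, v) + ennreal e" using e' by (intro add_left_mono ennreal_leI)
  finally show "internal_metric D V (u, v) \<le> D (u, v) + ennreal e" .
qed

lemma internal_metric_continuous:
  assumes D: "D \<in> continuous_metrics U" "length_metric U D" and V: "open V" "V \<subseteq> U" and x: "x \<in> V" and e: "e > 0"
  shows "\<exists>d>0. \<forall>y\<in>V. dist x y < d \<longrightarrow> internal_metric D V (x, y) < e"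
proof -
  have "min e (boundary_dist U V D x) > 0" using e boundary_dist_pos[OF D(1) V x] by simp
  then obtain d where d: "d > 0" "\<And>y. y \<in> U \<Longrightarrow> dist x y < d \<Longrightarrow> D (x, y) < min e (boundary_dist U V D x)"
    using cm_continuous[OF D(1), of x] x V(2) by blast
  show ?thesis
  proof (intro exI[of _ d] conjI ballI impI d(1))
    fix y assume y: "y \<in> V" "dist x y < d"
    then have "D (x, y) < min e (boundary_dist U V D x)" using d(2)[of y] V(2) by auto
    then show "internal_metric D V (x, y) < e"
      using internal_metric_local[OF D V(2) x y(1)] by auto
  qed
qed

text \<open>Locality refers to the internal metric through \<open>metric_space_borel V\<close>, so
  it has to be an element of that space. Near each point the internal metric is controlled by
  \<open>D\<close>, which gives the topology; finiteness spreads from there over connected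
  components.\<close>

lemma internal_metric_continuous_metrics:
  assumes D: "D \<in> continuous_metrics U" "length_metric U D" and V: "open V" "V \<subseteq> U"
  shows "internal_metric D V \<in> continuous_metrics V"
proof -
  let ?I = "internal_metric D V"
  note sym = antisym[OF internal_metric_sym_le[OF D(1) V(2)] internal_metric_sym_le[OF D(1) V(2)]]
  have zero: "?I (x, y) = 0 \<longleftrightarrow> x = y" if "x \<in> V" "y \<in> V" for x y
  proof
    assume "?I (x, y) = 0"
    then have "D (x, y) = 0" using internal_metric_ge[OF D(1) V(2) that] by simp
    then show "x = y" using cmD(2)[OF D(1), of x y] that V by auto
  qed (use internal_metric_refl[OF D(1) V(2)] that in auto)
  have fin: "?I (x, y) < \<infinity>" if "x \<in> V" "y \<in> V" "connected_component V x y" for x y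
  proof -
    let ?S = "connected_component_set V x"
    have SV: "?S \<subseteq> V" by (rule connected_component_subset)
    have y: "y \<in> ?S" using that by simp
    show ?thesis
    proof (rule connected_induction_simple[of ?S x y "\<lambda>y. ?I (x, y) < \<infinity>"])
      show "connected ?S" by simp
      show "x \<in> ?S" using that by (simp add: connected_component_refl)
      show "y \<in> ?S" by (rule y)
      show "?I (x, x) < \<infinity>" using internal_metric_refl[OF D(1) V(2) that(1)] by simp
      fix a assume a: "a \<in> ?S"
      then have aV: "a \<in> V" using SV by blast
      obtain d where d: "d > 0" "\<And>y. y \<in> V \<Longrightarrow> dist a y < d \<Longrightarrow> ?I (a, y) < 1"
        using internal_metric_continuous[OF D V aV zero_less_one] by blast
      show "\<exists>T. openin (top_of_set ?S) T \<and> a \<in> T \<and> (\<forall>u\<in>T. \<forall>v\<in>T. ?I (x, u) < \<infinity> \<longrightarrow> ?I (x, v) < \<infinity>)"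
      proof (intro exI[of _ "?S \<inter> ball a d"] conjI ballI impI)
        show "openin (top_of_set ?S) (?S \<inter> ball a d)" by (simp add: openin_open_Int)
        show "a \<in> ?S \<inter> ball a d" using a d by simp
        fix u v assume uv: "u \<in> ?S \<inter> ball a d" "v \<in> ?S \<inter> ball a d" and f: "?I (x, u) < \<infinity>"
        have uV: "u \<in> V" "v \<in> V" using uv SV by auto
        have "?I (x, v) \<le> ?I (x, u) + ?I (u, v)" by (rule internal_metric_triangle[OF D(1) V(2) that(1) uV])
        also have "\<dots> \<le> ?I (x, u) + (?I (u, a) + ?I (a, v))"
          by (intro add_left_mono internal_metric_triangle[OF D(1) V(2) uV(1) aV uV(2)])
        also have "\<dots> \<le> ?I (x, u) + (1 + 1)"
          using sym[of u a] d(2)[of u] d(2)[of v] uv uV aV by (intro add_left_mono add_mono) auto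
        also have "\<dots> < \<infinity>" using f by (simp add: less_top)
        finally show "?I (x, v) < \<infinity>" .
      qed
    qed
  qed
  have top: "openin (top_of_set V) S \<longleftrightarrow> (\<forall>x\<in>S. \<exists>e>0. \<forall>y\<in>V. ?I (x, y) < e \<longrightarrow> y \<in> S)" if S: "S \<subseteq> V" for S
  proof
    assume "openin (top_of_set V) S"
    then have oS: "open S" using V(1) by (simp add: openin_open_eq)
    show "\<forall>x\<in>S. \<exists>e>0. \<forall>y\<in>V. ?I (x, y) < e \<longrightarrow> y \<in> S"
    proof
      fix x assume x: "x \<in> S"
      obtain r where r: "r > 0" "ball x r \<subseteq> S" using oS x open_contains_ball by blast
      obtain e where e: "e > 0" "\<And>y. y \<in> U \<Longrightarrow> D (x, y) < e \<Longrightarrow> dist x y < r"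
        using cm_separates[OF D(1) _ r(1), of x] x S V by blast
      have "y \<in> S" if "y \<in> V" "?I (x, y) < e" for y
      proof -
        have "D (x, y) < e" using internal_metric_ge[OF D(1) V(2), of x y] that x S by (auto intro: le_less_trans)
        then have "y \<in> ball x r" using e(2)[of y] that V by auto
        then show ?thesis using r by blast
      qed
      then show "\<exists>e>0. \<forall>y\<in>V. ?I (x, y) < e \<longrightarrow> y \<in> S" using e(1) by blast
    qed
  next
    assume R: "\<forall>x\<in>S. \<exists>e>0. \<forall>y\<in>V. ?I (x, y) < e \<longrightarrow> y \<in> S"
    have "open S" unfolding open_contains_ball
    proof
      fix x assume x: "x \<in> S"
      then obtain e where e: "e > 0" "\<And>y. y \<in> V \<Longrightarrow> ?I (x, y) < e \<Longrightarrow> y \<in> S" using R by blast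
      have xV: "x \<in> V" using x S by blast
      obtain d where d: "d > 0" "\<And>y. y \<in> V \<Longrightarrow> dist x y < d \<Longrightarrow> ?I (x, y) < e"
        using internal_metric_continuous[OF D V xV e(1)] by blast
      obtain r where r: "r > 0" "ball x r \<subseteq> V" using V(1) xV open_contains_ball by blast
      have "ball x (min d r) \<subseteq> S" using d e r by (auto simp: subset_iff)
      then show "\<exists>e>0. ball x e \<subseteq> S" using d r by (intro exI[of _ "min d r"]) auto
    qed
    then show "openin (top_of_set V) S" using S V(1) by (simp add: openin_open_eq)
  qed
  have "?I \<in> extensional (V \<times> V)" by (simp add: internal_metric_def)
  then show ?thesis
    unfolding continuous_metrics_def using zero sym internal_metric_triangle[OF D(1) V(2)] fin top
    by (intro CollectI conjI ballI allI impI)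
qed

text \<open>Along a chain of local steps the internal metric is at most the sum, by the triangle
  inequality. Conversely a curve in \<open>V\<close> is compact and keeps a positive distance from
  the complement of \<open>V\<close>, so all steps of a fine enough partition are local.\<close>

lemma internal_metric_eq_chain_metric:
  assumes U: "open U" and D: "D \<in> continuous_metrics U" "length_metric U D" and V: "open V" "V \<subseteq> U"
    and xy: "x \<in> rational_points V" "y \<in> rational_points V"
  shows "internal_metric D V (x, y) = chain_metric U V D (x, y)"
proof (rule antisym)
  have xyV: "x \<in> V" "y \<in> V" using xy rational_points_subset by auto
  show "internal_metric D V (x, y) \<le> chain_metric U V D (x, y)"
    unfolding chain_metric_def prod.case
  proof (rule INF_greatest)
    fix xs assume xs: "xs \<in> chains (rational_points V) x y"
    have "internal_metric D V (x, y) \<le> chain_sum (internal_metric D V) xs"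
    proof (rule le_chain_sum[OF xs])
      show "internal_metric D V (u, u) \<le> 0" if "u \<in> rational_points V" for u
        using internal_metric_refl[OF D(1) V(2)] that rational_points_subset[of V] by (simp add: subset_iff)
      show "internal_metric D V (u, w) \<le> internal_metric D V (u, v) + internal_metric D V (v, w)"
        if "u \<in> rational_points V" "v \<in> rational_points V" "w \<in> rational_points V" for u v w
        by (rule internal_metric_triangle[OF D(1) V(2)]) (use that rational_points_subset[of V] in blast)+
    qed
    also have "\<dots> \<le> chain_sum (local_step U V D) xs"
    proof (rule chain_sum_mono)
      show "set xs \<subseteq> V" using xs rational_points_subset[of V] by (auto simp: chains_def)
      show "internal_metric D V (u, v) \<le> local_step U V D (u, v)" if "u \<in> V" "v \<in> V" for u v
        using internal_metric_local[OF D V(2) that] by (simp add: local_step_def)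
    qed
    finally show "internal_metric D V (x, y) \<le> chain_sum (local_step U V D) xs" .
  qed
  show "chain_metric U V D (x, y) \<le> internal_metric D V (x, y)"
    unfolding internal_metric_eq[OF xyV]
  proof (rule INF_greatest)
    fix P assume "P \<in> curves_in V x y"
    then have P: "path P" "path_image P \<subseteq> V" "pathstart P = x" "pathfinish P = y" by (auto simp: curves_in_def)
    have K: "compact (path_image P)" using P(1) by (rule compact_path_image)
    have "\<exists>r>0. \<forall>u\<in>path_image P. \<forall>v. dist u v < r \<longrightarrow> v \<in> V"
    proof -
      obtain r where "r > 0" "(\<Union>u\<in>path_image P. ball u r) \<subseteq> V"
        using compact_subset_open_imp_ball_epsilon_subset[OF K V(1) P(2)] by blast
      then show ?thesis by (intro exI[of _ r]) (auto simp: UN_subset_iff subset_iff)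
    qed
    then obtain r where r: "r > 0" "\<And>u v. u \<in> path_image P \<Longrightarrow> dist u v < r \<Longrightarrow> v \<in> V" by blast
    obtain t where t: "t > 0" "\<And>u v. u \<in> path_image P \<Longrightarrow> v \<in> U \<Longrightarrow> D (u, v) < ennreal t \<Longrightarrow> dist u v < r"
      using cm_compact_scale[OF D(1) K order_trans[OF P(2) V(2)] r(1)] by blast
    show "chain_metric U V D (x, y) \<le> metric_length D P"
    proof (rule ennreal_le_epsilon)
      fix e :: real assume e: "e > 0"
      obtain xs where xs: "xs \<in> chains (rational_points V) x y"
        "\<And>i. i < length xs - 1 \<Longrightarrow> D (xs ! i, xs ! Suc i) < ennreal (t / 2)"
        "\<And>z. z \<in> set xs \<Longrightarrow> \<exists>p\<in>path_image P. D (p, z) < ennreal (t / 2)"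
        "chain_sum D xs \<le> metric_length D P + ennreal e"
        using chain_along_path[OF U D(1) V P xy _ e, of "t / 2"] t(1) by (metis half_gt_zero)
      have xsV: "set xs \<subseteq> V" using xs(1) rational_points_subset[of V] by (auto simp: chains_def)
      have "local_step U V D (xs ! i, xs ! Suc i) = D (xs ! i, xs ! Suc i)" if i: "i < length xs - 1" for i
      proof -
        have "xs ! i \<in> set xs" using i by simp
        then obtain p where p: "p \<in> path_image P" "D (p, xs ! i) < ennreal (t / 2)" and xi: "xs ! i \<in> V" using xs(3) xsV by blast
        \<comment> \<open>Chain points are within \<open>t / 2\<close> of the curve, so a point
          outside \<open>V\<close> within \<open>t / 2\<close> of one of them would be within
          \<open>t\<close> of the curve, contrary to the choice of \<open>t\<close>.\<close>
        have "ennreal (t / 2) \<le> boundary_dist U V D (xs ! i)"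
          unfolding boundary_dist_def
        proof (rule INF_greatest, rule ccontr)
          fix v assume v: "v \<in> U - V" and "\<not> ennreal (t / 2) \<le> D (xs ! i, v)"
          then have "D (p, xs ! i) + D (xs ! i, v) < ennreal (t / 2) + ennreal (t / 2)" using p by (intro add_strict_mono) auto
          also have "\<dots> = ennreal t" using t(1) by (subst ennreal_plus[symmetric]) auto
          finally have "D (p, v) < ennreal t"
            using cmD(4)[OF D(1), of p "xs ! i" v] p(1) P(2) V(2) xi v by (auto intro: le_less_trans)
          then show False using t(2)[OF p(1), of v] r(2)[OF p(1), of v] v by blast
        qed
        then have "D (xs ! i, xs ! Suc i) < boundary_dist U V D (xs ! i)" using xs(2)[OF i] by (rule order.strict_trans2[rotated])
        then show ?thesis by (simp add: local_step_def)
      qed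
      then have "chain_sum (local_step U V D) xs = chain_sum D xs" unfolding chain_sum_def by (intro sum.cong) auto
      then have "chain_metric U V D (x, y) \<le> chain_sum D xs"
        unfolding chain_metric_def prod.case using INF_lower[OF xs(1), of "chain_sum (local_step U V D)"] by simp
      with xs(4) show "chain_metric U V D (x, y) \<le> metric_length D P + ennreal e" by simp
    qed
  qed
qed

text \<open>A connected curve that starts in a relatively clopen part never leaves it. This is how
  the internal metric on a set with the cell boundaries removed contains the internal metric of each
  cell.\<close>

lemma internal_metric_relatively_clopen:
  assumes V: "open V" "V \<subseteq> W" "closure V \<inter> W \<subseteq> V" and xy: "x \<in> V" "y \<in> V"
  shows "internal_metric D W (x, y) = internal_metric D V (x, y)"
proof -
  have "P \<in> curves_in V x y" if P: "P \<in> curves_in W x y" for P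
  proof -
    have c: "connected (path_image P)" using P by (auto simp: curves_in_def intro: connected_path_image)
    have W: "path_image P \<subseteq> W" and ne: "V \<inter> path_image P \<noteq> {}"
      using P xy pathstart_in_path_image[of P] by (auto simp: curves_in_def)
    have "path_image P \<subseteq> V"
    proof (rule ccontr)
      assume "\<not> path_image P \<subseteq> V"
      then have "- closure V \<inter> path_image P \<noteq> {}" using W V(3) by blast
      moreover have "path_image P \<subseteq> V \<union> - closure V" using W V(3) by blast
      moreover have "V \<inter> - closure V \<inter> path_image P = {}" using closure_subset by blast
      ultimately show False using connectedD[OF c V(1), of "- closure V"] ne by blast
    qed
    then show ?thesis using P by (auto simp: curves_in_def)
  qed
  moreover have "curves_in V x y \<subseteq> curves_in W x y" using V(2) by (auto simp: curves_in_def)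
  ultimately have "curves_in W x y = curves_in V x y" by blast
  then show ?thesis using xy V(2) by (simp add: internal_metric_def subset_iff)
qed

section \<open>Measurability of distances and chain metrics\<close>

lemma space_metric_space_borel: "space (metric_space_borel U) = continuous_metrics U"
  unfolding metric_space_borel_def by (rule space_measure_of) (auto simp: openin_metric_topology)

lemma openin_sets_metric_space_borel: "openin (metric_topology U) W \<Longrightarrow> W \<in> sets (metric_space_borel U)"
  unfolding metric_space_borel_def by (subst sets_measure_of) (auto simp: openin_metric_topology)

lemma openin_eval_less:
  assumes "p \<in> U \<times> U" shows "openin (metric_topology U) {D \<in> continuous_metrics U. D p < a}"
  unfolding openin_metric_topology
proof (intro conjI ballI)
  fix D assume "D \<in> {D \<in> continuous_metrics U. D p < a}"
  then have D: "D \<in> continuous_metrics U" "D p < a" by auto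
  obtain r where r: "r > 0" "D p + r \<le> a" using ennreal_add_pos_less[OF D(2)] by blast
  obtain s where s: "s > 0" "ennreal s \<le> r" using r(1) by (rule ennreal_pos_real)
  have "D p \<noteq> \<top>" using order.strict_trans2[OF D(2) top_greatest] by simp
  then have "D p + ennreal (s / 2) < D p + ennreal s" using s by (subst ennreal_add_left_cancel_less) (auto intro: ennreal_lessI)
  also have "\<dots> \<le> D p + r" using s by (intro add_left_mono)
  also have "\<dots> \<le> a" by (rule r(2))
  finally have lt: "D p + ennreal (s / 2) < a" .
  have "metric_nbhd U D {p} (s / 2) \<subseteq> {D \<in> continuous_metrics U. D p < a}"
    using lt by (auto simp: metric_nbhd_def intro: le_less_trans)
  then show "\<exists>K e. compact K \<and> K \<subseteq> U \<times> U \<and> e > 0 \<and> metric_nbhd U D K e \<subseteq> {D \<in> continuous_metrics U. D p < a}"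
    using s assms by (intro exI[of _ "{p}"] exI[of _ "s / 2"]) auto
qed auto

lemma eval_less_sets: "p \<in> U \<times> U \<Longrightarrow> {D \<in> continuous_metrics U. D p < a} \<in> sets (metric_space_borel U)"
  using openin_sets_metric_space_borel[OF openin_eval_less] .

lemma measurable_eval_metric:
  assumes "p \<in> U \<times> U" shows "(\<lambda>D. D p) \<in> borel_measurable (metric_space_borel U)"
  by (rule borel_measurableI_less) (use eval_less_sets[OF assms] in \<open>simp add: space_metric_space_borel\<close>)

lemma INF_dense_eq:
  assumes D: "D \<in> continuous_metrics U" and u: "u \<in> U" and E: "E \<subseteq> S" "S \<subseteq> U" "S \<subseteq> closure E"
  shows "(INF y\<in>S. D (u, y)) = (INF y\<in>E. D (u, y))"
proof (rule antisym)
  show "(INF y\<in>S. D (u, y)) \<le> (INF y\<in>E. D (u, y))" by (rule INF_superset_mono[OF E(1)]) simp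
  show "(INF y\<in>E. D (u, y)) \<le> (INF y\<in>S. D (u, y))"
  proof (rule INF_greatest)
    fix y assume y: "y \<in> S"
    show "(INF y\<in>E. D (u, y)) \<le> D (u, y)"
    proof (rule ennreal_le_epsilon)
      fix e :: real assume e: "e > 0"
      have yU: "y \<in> U" using y E by blast
      obtain d where d: "d > 0" "\<And>z. z \<in> U \<Longrightarrow> dist y z < d \<Longrightarrow> D (y, z) < ennreal e"
        using cm_continuous[OF D yU, of "ennreal e"] e by auto
      obtain z where z: "z \<in> E" "dist z y < d" using y E(3) d(1) by (meson closure_approachable subsetD)
      have zU: "z \<in> U" using z E by blast
      have "(INF y\<in>E. D (u, y)) \<le> D (u, z)" by (rule INF_lower[OF z(1)])
      also have "\<dots> \<le> D (u, y) + D (y, z)" by (rule cmD(4)[OF D u yU zU])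
      also have "\<dots> \<le> D (u, y) + ennreal e" using d(2)[OF zU] z by (intro add_left_mono) (auto simp: dist_commute)
      finally show "(INF y\<in>E. D (u, y)) \<le> D (u, y) + ennreal e" .
    qed
  qed
qed

text \<open>The complement \<open>U - V\<close> may be thin and contain few rational points, so the
  infimum is reduced to an abstract countable dense subset.\<close>

lemma measurable_boundary_dist:
  assumes u: "u \<in> U" shows "(\<lambda>D. boundary_dist U V D u) \<in> borel_measurable (metric_space_borel U)"
proof -
  obtain E where E: "countable E" "E \<subseteq> U - V" "U - V \<subseteq> closure E" using separable by blast
  have "(\<lambda>D. INF y\<in>E. D (u, y)) \<in> borel_measurable (metric_space_borel U)"
    using E u by (intro borel_measurable_INF measurable_eval_metric) auto
  then show ?thesis
    by (rule subst[OF measurable_cong, rotated])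
       (auto simp: boundary_dist_def space_metric_space_borel INF_dense_eq[OF _ u E(2) _ E(3)])
qed

lemma measurable_chain_metric:
  assumes "V \<subseteq> U" shows "(\<lambda>D. chain_metric U V D p) \<in> borel_measurable (metric_space_borel U)"
proof -
  have step: "(\<lambda>D. local_step U V D (u, v)) \<in> borel_measurable (metric_space_borel U)" if "u \<in> V" "v \<in> V" for u v
  proof -
    have [measurable]: "(\<lambda>D. D (u, v)) \<in> borel_measurable (metric_space_borel U)"
      "(\<lambda>D. boundary_dist U V D u) \<in> borel_measurable (metric_space_borel U)"
      using that assms by (auto intro!: measurable_eval_metric measurable_boundary_dist)
    show ?thesis unfolding local_step_def prod.case by measurable
  qed
  have "(\<lambda>D. chain_sum (local_step U V D) xs) \<in> borel_measurable (metric_space_borel U)"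
    if xs: "xs \<in> chains (rational_points V) x y" for xs x y
  proof -
    have "xs ! i \<in> V" if "i < length xs" for i
      using xs nth_mem[OF that] rational_points_subset[of V] by (auto simp: chains_def)
    then show ?thesis unfolding chain_sum_def by (intro borel_measurable_sum step) auto
  qed
  then show ?thesis
    unfolding chain_metric_def case_prod_beta
    by (intro borel_measurable_INF countable_chains countable_rational_points)
qed

lemma continuous_metrics_eqI:
  assumes U: "open U" and D: "D \<in> continuous_metrics U" "D' \<in> continuous_metrics U"
    and eq: "\<And>p q. p \<in> rational_points U \<Longrightarrow> q \<in> rational_points U \<Longrightarrow> D (p, q) = D' (p, q)"
  shows "D = D'"
proof -
  have le: "D (x, y) \<le> D' (x, y)"
    if D: "D \<in> continuous_metrics U" "D' \<in> continuous_metrics U" and xy: "x \<in> U" "y \<in> U"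
      and eq: "\<And>p q. p \<in> rational_points U \<Longrightarrow> q \<in> rational_points U \<Longrightarrow> D (p, q) = D' (p, q)" for D D' x y
  proof (rule ennreal_le_epsilon)
    fix e :: real assume e: "e > 0"
    have "\<exists>p\<in>rational_points U. D (z, p) < ennreal (e / 4) \<and> D' (z, p) < ennreal (e / 4)" if z: "z \<in> U" for z
    proof -
      obtain d d' where "d > 0" "\<And>y. y \<in> U \<Longrightarrow> dist z y < d \<Longrightarrow> D (z, y) < ennreal (e / 4)"
        "d' > 0" "\<And>y. y \<in> U \<Longrightarrow> dist z y < d' \<Longrightarrow> D' (z, y) < ennreal (e / 4)"
        using cm_continuous[OF D(1) z, of "ennreal (e / 4)"] cm_continuous[OF D(2) z, of "ennreal (e / 4)"] e by auto
      then show ?thesis using rational_points_dense[OF U z, of "min d d'"] rational_points_subset[of U] by auto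
    qed
    then obtain p q where p: "p \<in> rational_points U" "D (x, p) < ennreal (e / 4)" "D' (x, p) < ennreal (e / 4)"
      and q: "q \<in> rational_points U" "D (y, q) < ennreal (e / 4)" "D' (y, q) < ennreal (e / 4)" using xy by metis
    have pq: "p \<in> U" "q \<in> U" using p q rational_points_subset[of U] by auto
    have "D (x, y) \<le> D (x, p) + (D (p, q) + D (q, y))"
      using cmD(4)[OF D(1) xy(1) pq(1) xy(2)] cmD(4)[OF D(1) pq xy(2)] by (meson add_left_mono order_trans)
    also have "\<dots> = D (x, p) + (D' (p, q) + D (y, q))" using eq[OF p(1) q(1)] cmD(3)[OF D(1) pq(2) xy(2)] by simp
    also have "D' (p, q) \<le> D' (p, x) + (D' (x, y) + D' (y, q))"
      using cmD(4)[OF D(2) pq(1) xy(1) pq(2)] cmD(4)[OF D(2) xy pq(2)] by (meson add_left_mono order_trans)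
    also have "D' (p, x) = D' (x, p)" by (rule cmD(3)[OF D(2) pq(1) xy(1)])
    finally have "D (x, y) \<le> D (x, p) + (D' (x, p) + (D' (x, y) + D' (y, q)) + D (y, q))"
      by (simp add: add_left_mono add_right_mono)
    also have "\<dots> \<le> ennreal (e / 4) + (ennreal (e / 4) + (D' (x, y) + ennreal (e / 4)) + ennreal (e / 4))"
      using p q by (intro add_mono) auto
    also have "\<dots> = D' (x, y) + ((ennreal (e / 4) + ennreal (e / 4)) + (ennreal (e / 4) + ennreal (e / 4)))"
      by (simp only: ac_simps)
    also have "(ennreal (e / 4) + ennreal (e / 4)) + (ennreal (e / 4) + ennreal (e / 4)) = ennreal ((e / 4 + e / 4) + (e / 4 + e / 4))"
      using e by (simp del: ennreal_plus add: ennreal_plus[symmetric])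
    finally show "D (x, y) \<le> D' (x, y) + ennreal e" by simp
  qed
  show ?thesis
  proof (rule extensionalityI[OF cmD(1)[OF D(1)] cmD(1)[OF D(2)]])
    fix p assume "p \<in> U \<times> U"
    then obtain x y where "p = (x, y)" "x \<in> U" "y \<in> U" by blast
    then show "D p = D' p" using le[OF D, of x y] le[OF D(2,1), of x y] eq by (auto intro: antisym)
  qed
qed

section \<open>The Efron--Stein inequality\<close>

lemma prob_integrable_bounded:
  fixes k :: "'a \<Rightarrow> real"
  assumes "prob_space Q" "k \<in> borel_measurable Q" "\<And>x. x \<in> space Q \<Longrightarrow> \<bar>k x\<bar> \<le> c"
  shows "integrable Q k"
proof -
  interpret prob_space Q by fact
  show ?thesis by (rule integrable_const_bound[where B=c]) (use assms(2,3) in auto)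
qed

text \<open>Instead of the conditional expectation over the other coordinates, any
  \<open>g i\<close> that ignores coordinate \<open>i\<close> may stand in the bound. Integrating
  out coordinate \<open>i\<close> splits the variance into the mean of the variance in that
  coordinate and the variance of the partial mean \<open>F\<close>. In the first term the mean is
  the best constant approximation, and \<open>g i\<close> is constant in that coordinate; the second
  is handled by induction, with the partial means \<open>G j\<close> of the remaining
  \<open>g j\<close>.\<close>

lemma efron_stein:
  fixes N :: "'i \<Rightarrow> 'a measure" and f :: "('i \<Rightarrow> 'a) \<Rightarrow> real"
  assumes N: "\<And>i. prob_space (N i)" and I: "finite I"
    and f: "f \<in> borel_measurable (PiM I N)" "\<And>\<zeta>. \<zeta> \<in> space (PiM I N) \<Longrightarrow> \<bar>f \<zeta>\<bar> \<le> B"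
    and g: "\<And>i. i \<in> I \<Longrightarrow> g i \<in> borel_measurable (PiM I N)"
      "\<And>i \<zeta>. i \<in> I \<Longrightarrow> \<zeta> \<in> space (PiM I N) \<Longrightarrow> \<bar>g i \<zeta>\<bar> \<le> B"
      "\<And>i \<zeta> x. i \<in> I \<Longrightarrow> \<zeta> \<in> space (PiM I N) \<Longrightarrow> x \<in> space (N i) \<Longrightarrow> g i (\<zeta>(i := x)) = g i \<zeta>"
  shows "(\<integral>\<zeta>. (f \<zeta> - (\<integral>\<zeta>. f \<zeta> \<partial>PiM I N))\<^sup>2 \<partial>PiM I N) \<le> (\<Sum>i\<in>I. \<integral>\<zeta>. (f \<zeta> - g i \<zeta>)\<^sup>2 \<partial>PiM I N)"
proof -
  interpret product_sigma_finite N
    using N by (simp add: product_sigma_finite_def prob_space_imp_sigma_finite)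
  have P: "prob_space (PiM J N)" for J by (rule prob_space_PiM[OF N])
  have sq: "\<bar>(a - b)\<^sup>2\<bar> \<le> (2 * B)\<^sup>2" if "\<bar>a\<bar> \<le> B" "\<bar>b\<bar> \<le> B" for a b :: real
  proof -
    have "\<bar>a - b\<bar> \<le> 2 * B" using that by linarith
    then have "\<bar>a - b\<bar>\<^sup>2 \<le> (2 * B)\<^sup>2" by (intro power_mono) auto
    then show ?thesis by simp
  qed
  show ?thesis
    using I f g
  proof (induction I arbitrary: f g rule: finite_induct)
    case empty
    interpret Q: prob_space "PiM {} N" by (rule P)
    have 1: "(\<integral>\<zeta>. f \<zeta> \<partial>PiM {} N) = (\<integral>\<zeta>. f (\<lambda>_. undefined) \<partial>PiM {} N)"
      by (rule Bochner_Integration.integral_cong) (auto simp: space_PiM PiE_empty_domain)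
    have "(\<integral>\<zeta>. (f \<zeta> - f (\<lambda>_. undefined))\<^sup>2 \<partial>PiM {} N) = (\<integral>\<zeta>. 0 \<partial>PiM {} N)"
      by (rule Bochner_Integration.integral_cong) (auto simp: space_PiM PiE_empty_domain)
    then show ?case unfolding 1 by (simp add: Q.prob_space)
  next
    case (insert i I)
    let ?J = "insert i I"
    interpret Q: prob_space "PiM I N" by (rule P)
    interpret Ni: prob_space "N i" by (rule N)
    note upd = measurable_compose[OF measurable_add_dim]
    have pair: "(\<lambda>(x, y). k (x(i := y))) \<in> borel_measurable (PiM I N \<Otimes>\<^sub>M N i)" if "k \<in> borel_measurable (PiM ?J N)" for k :: "_ \<Rightarrow> real"
      using measurable_compose[OF measurable_add_dim that] by (simp add: case_prod_beta)
    have sp: "x(i := y) \<in> space (PiM ?J N)" if "x \<in> space (PiM I N)" "y \<in> space (N i)" for x y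
      using that by (auto simp: space_PiM PiE_def extensional_def)
    have my: "(\<lambda>y. k (x(i := y))) \<in> borel_measurable (N i)" if "k \<in> borel_measurable (PiM ?J N)" "x \<in> space (PiM I N)" for k :: "_ \<Rightarrow> real" and x
      using measurable_compose[OF measurable_Pair1'[OF that(2)] pair[OF that(1)]] by simp
    have mI: "(\<lambda>x. \<integral>y. k (x(i := y)) \<partial>N i) \<in> borel_measurable (PiM I N)" if "k \<in> borel_measurable (PiM ?J N)" for k :: "_ \<Rightarrow> real"
      by (rule sigma_finite_measure.borel_measurable_lebesgue_integral[OF prob_space_imp_sigma_finite[OF N], where f="\<lambda>x y. k (x(i := y))"]) (rule pair[OF that])
    define F where "F x = (\<integral>y. f (x(i := y)) \<partial>N i)" for x
    define G where "G j x = (\<integral>y. g j (x(i := y)) \<partial>N i)" for j x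
    have b1: "\<bar>\<integral>y. k (x(i := y)) \<partial>N i\<bar> \<le> c" if k: "k \<in> borel_measurable (PiM ?J N)" "\<And>\<zeta>. \<zeta> \<in> space (PiM ?J N) \<Longrightarrow> \<bar>k \<zeta>\<bar> \<le> c" and x: "x \<in> space (PiM I N)" for k :: "_ \<Rightarrow> real" and c x
    proof -
      have "\<bar>\<integral>y. k (x(i := y)) \<partial>N i\<bar> \<le> (\<integral>y. \<bar>k (x(i := y))\<bar> \<partial>N i)"
        using integral_norm_bound[of "N i" "\<lambda>y. k (x(i := y))"] by simp
      also have "\<dots> \<le> (\<integral>y. c \<partial>N i)"
      proof (rule integral_mono)
        show "integrable (N i) (\<lambda>y. \<bar>k (x(i := y))\<bar>)"
          by (intro integrable_abs prob_integrable_bounded[OF N my[OF k(1) x], where c=c] k(2)[OF sp[OF x]])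
      qed (use k(2)[OF sp[OF x]] in auto)
      finally show ?thesis by (simp add: Ni.prob_space)
    qed
    have Fm1: "F \<in> borel_measurable (PiM I N)" unfolding F_def[abs_def] by (rule mI[OF insert.prems(1)])
    have Fm2: "\<bar>F x\<bar> \<le> B" if x: "x \<in> space (PiM I N)" for x
      unfolding F_def by (rule b1[OF insert.prems(1,2) x])
    note Fm = Fm1 Fm2
    have Gm1: "G j \<in> borel_measurable (PiM I N)" if "j \<in> I" for j
      unfolding G_def[abs_def] by (rule mI[OF insert.prems(3)]) (use that in simp)
    have Gm2: "\<bar>G j x\<bar> \<le> B" if "j \<in> I" "x \<in> space (PiM I N)" for j x
      unfolding G_def by (rule b1[OF insert.prems(3,4) that(2)]) (use that in simp_all)
    note Gm = Gm1 Gm2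
    have Gd: "G j (x(j := z)) = G j x" if j: "j \<in> I" and x: "x \<in> space (PiM I N)" and z: "z \<in> space (N j)" for j x z
      unfolding G_def
    proof (rule Bochner_Integration.integral_cong[OF refl])
      fix y assume y: "y \<in> space (N i)"
      have "(x(j := z))(i := y) = (x(i := y))(j := z)" using j insert.hyps by (auto simp: fun_eq_iff)
      then show "g j ((x(j := z))(i := y)) = g j (x(i := y))" using insert.prems(5)[OF insertI2[OF j] sp[OF x y] z] by metis
    qed
    note fun_upd_apply [simp del]
    have iJ: "integrable (PiM ?J N) (\<lambda>\<zeta>. (f \<zeta> - k \<zeta>)\<^sup>2)" if "k \<in> borel_measurable (PiM ?J N)" "\<And>\<zeta>. \<zeta> \<in> space (PiM ?J N) \<Longrightarrow> \<bar>k \<zeta>\<bar> \<le> B" for k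
      using insert.prems(1,2) that by (intro prob_integrable_bounded[OF P, where c="(2 * B)\<^sup>2"] sq) auto
    have fJ: "integrable (PiM ?J N) f" by (rule prob_integrable_bounded[OF P insert.prems(1,2)])
    have split: "(\<integral>\<zeta>. k \<zeta> \<partial>PiM ?J N) = (\<integral>x. (\<integral>y. k (x(i := y)) \<partial>N i) \<partial>PiM I N)" if "integrable (PiM ?J N) k" for k :: "_ \<Rightarrow> real"
      by (rule product_integral_insert[OF insert.hyps that])
    let ?m = "\<integral>\<zeta>. f \<zeta> \<partial>PiM ?J N"
    have m: "?m = (\<integral>x. F x \<partial>PiM I N)" unfolding F_def by (rule split[OF fJ])
    have mB: "\<bar>?m\<bar> \<le> B"
    proof -
      interpret QJ: prob_space "PiM ?J N" by (rule P)
      have "\<bar>?m\<bar> \<le> (\<integral>\<zeta>. \<bar>f \<zeta>\<bar> \<partial>PiM ?J N)"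
        using integral_norm_bound[of "PiM ?J N" f] by simp
      also have "\<dots> \<le> (\<integral>\<zeta>. B \<partial>PiM ?J N)" using fJ insert.prems(2) by (intro integral_mono) auto
      finally show ?thesis by (simp add: QJ.prob_space)
    qed
    have inner: "(\<integral>y. (f (x(i := y)) - c)\<^sup>2 \<partial>N i) = (\<integral>y. (f (x(i := y)) - F x)\<^sup>2 \<partial>N i) + (F x - c)\<^sup>2"
      if x: "x \<in> space (PiM I N)" for x c
    proof -
      have i1: "integrable (N i) (\<lambda>y. f (x(i := y)))" by (rule prob_integrable_bounded[OF N my[OF insert.prems(1) x], where c=B]) (rule insert.prems(2)[OF sp[OF x]])
      have i2: "integrable (N i) (\<lambda>y. (f (x(i := y)) - F x)\<^sup>2)"
        using my[OF insert.prems(1) x] insert.prems(2)[OF sp[OF x]] Fm(2)[OF x] by (intro prob_integrable_bounded[OF N, where c="(2 * B)\<^sup>2"] sq) auto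
      have "(\<integral>y. (f (x(i := y)) - c)\<^sup>2 \<partial>N i) = (\<integral>y. (f (x(i := y)) - F x)\<^sup>2 + (2 * (F x - c)) * (f (x(i := y)) - F x) + (F x - c)\<^sup>2 \<partial>N i)"
        by (intro Bochner_Integration.integral_cong refl) (simp add: power2_eq_square algebra_simps)
      also have "\<dots> = (\<integral>y. (f (x(i := y)) - F x)\<^sup>2 \<partial>N i) + (2 * (F x - c)) * ((\<integral>y. f (x(i := y)) \<partial>N i) - F x) + (F x - c)\<^sup>2"
        using i1 i2 by (simp add: Ni.prob_space)
      finally show ?thesis unfolding F_def by simp
    qed
    define V where "V x = (\<integral>y. (f (x(i := y)) - F x)\<^sup>2 \<partial>N i)" for x
    have inner': "(\<integral>y. (f (x(i := y)) - c)\<^sup>2 \<partial>N i) = V x + (F x - c)\<^sup>2" if "x \<in> space (PiM I N)" for x c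
      unfolding V_def by (rule inner[OF that])
    have Feq: "(\<lambda>x. \<integral>y. (f (x(i := y)) - c)\<^sup>2 \<partial>N i) \<in> borel_measurable (PiM I N)" for c
      by (rule mI) (use insert.prems(1) in measurable)
    have Vm: "V \<in> borel_measurable (PiM I N)"
    proof -
      have "(\<lambda>x. (\<integral>y. (f (x(i := y)) - 0)\<^sup>2 \<partial>N i) - (F x - 0)\<^sup>2) \<in> borel_measurable (PiM I N)"
        using Feq[of 0] Fm(1) by measurable
      then show ?thesis by (rule subst[OF measurable_cong, rotated]) (subst inner', simp_all)
    qed
    have V0: "0 \<le> V x" for x unfolding V_def by (rule integral_nonneg_AE) auto
    have Vb: "\<bar>V x\<bar> \<le> (2 * B)\<^sup>2" if x: "x \<in> space (PiM I N)" for x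
    proof -
      have "V x \<le> (\<integral>y. (f (x(i := y)) - 0)\<^sup>2 \<partial>N i)" unfolding inner'[OF x] by simp
      also have "\<dots> \<le> \<bar>\<integral>y. (f (x(i := y)) - 0)\<^sup>2 \<partial>N i\<bar>" by simp
      also have "\<dots> \<le> (2 * B)\<^sup>2"
      proof (rule b1[of "\<lambda>\<zeta>. (f \<zeta> - 0)\<^sup>2", OF _ _ x])
        show "(\<lambda>\<zeta>. (f \<zeta> - 0)\<^sup>2) \<in> borel_measurable (PiM ?J N)" using insert.prems(1) by measurable
        show "\<bar>(f \<zeta> - 0)\<^sup>2\<bar> \<le> (2 * B)\<^sup>2" if "\<zeta> \<in> space (PiM ?J N)" for \<zeta>
          using insert.prems(2)[OF that] by (intro sq) auto
      qed
      finally show ?thesis using V0 by simp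
    qed
    have Vi: "integrable (PiM I N) V" by (rule prob_integrable_bounded[OF P Vm Vb])
    have FiI: "integrable (PiM I N) (\<lambda>x. (F x - c)\<^sup>2)" if "\<bar>c\<bar> \<le> B" for c
      using Fm that by (intro prob_integrable_bounded[OF P, where c="(2 * B)\<^sup>2"] sq) auto
    have "(\<integral>\<zeta>. (f \<zeta> - ?m)\<^sup>2 \<partial>PiM ?J N) = (\<integral>x. (\<integral>y. (f (x(i := y)) - ?m)\<^sup>2 \<partial>N i) \<partial>PiM I N)"
      using mB by (intro split iJ) auto
    also have "\<dots> = (\<integral>x. V x + (F x - ?m)\<^sup>2 \<partial>PiM I N)"
      by (intro Bochner_Integration.integral_cong refl inner')
    also have "\<dots> = (\<integral>x. V x \<partial>PiM I N) + (\<integral>x. (F x - ?m)\<^sup>2 \<partial>PiM I N)"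
      using Vi FiI[OF mB] by (rule Bochner_Integration.integral_add)
    also have "(\<integral>x. V x \<partial>PiM I N) \<le> (\<integral>\<zeta>. (f \<zeta> - g i \<zeta>)\<^sup>2 \<partial>PiM ?J N)"
    proof -
      \<comment> \<open>A default value for coordinate \<open>i\<close>: since \<open>g i\<close>
        ignores it, \<open>g i\<close> becomes a measurable function of the other
        coordinates.\<close>
      obtain y0 where y0: "y0 \<in> space (N i)" using Ni.not_empty by blast
      have gm: "g i \<in> borel_measurable (PiM ?J N)" "\<And>\<zeta>. \<zeta> \<in> space (PiM ?J N) \<Longrightarrow> \<bar>g i \<zeta>\<bar> \<le> B" using insert.prems(3,4) by auto
      have gi: "g i (x(i := y)) = g i (x(i := y0))" if "x \<in> space (PiM I N)" "y \<in> space (N i)" for x y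
        using insert.prems(5)[OF insertI1 sp[OF that(1) y0] that(2)] unfolding fun_upd_upd .
      have eq: "(\<integral>y. (f (x(i := y)) - g i (x(i := y)))\<^sup>2 \<partial>N i) = V x + (F x - g i (x(i := y0)))\<^sup>2" if x: "x \<in> space (PiM I N)" for x
        unfolding inner'[OF x, symmetric] using gi[OF x] by (intro Bochner_Integration.integral_cong refl) auto
      have "(\<lambda>x. g i (x(i := y0))) \<in> borel_measurable (PiM I N)"
        using measurable_compose[OF measurable_Pair2'[OF y0] pair[OF gm(1)]] by simp
      then have "integrable (PiM I N) (\<lambda>x. (F x - g i (x(i := y0)))\<^sup>2)"
        using Fm gm(2)[OF sp[OF _ y0]] by (intro prob_integrable_bounded[OF P, where c="(2 * B)\<^sup>2"] sq) auto
      then have "(\<integral>x. V x \<partial>PiM I N) \<le> (\<integral>x. V x + (F x - g i (x(i := y0)))\<^sup>2 \<partial>PiM I N)"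
        using Vi by (intro integral_mono) auto
      also have "\<dots> = (\<integral>x. (\<integral>y. (f (x(i := y)) - g i (x(i := y)))\<^sup>2 \<partial>N i) \<partial>PiM I N)"
        using eq by (intro Bochner_Integration.integral_cong refl) auto
      also have "\<dots> = (\<integral>\<zeta>. (f \<zeta> - g i \<zeta>)\<^sup>2 \<partial>PiM ?J N)"
        using gm by (intro split[symmetric] iJ) auto
      finally show ?thesis .
    qed
    also have "(\<integral>x. (F x - ?m)\<^sup>2 \<partial>PiM I N) \<le> (\<Sum>j\<in>I. \<integral>\<zeta>. (f \<zeta> - g j \<zeta>)\<^sup>2 \<partial>PiM ?J N)"
    proof -
      have "(\<integral>x. (F x - ?m)\<^sup>2 \<partial>PiM I N) \<le> (\<Sum>j\<in>I. \<integral>x. (F x - G j x)\<^sup>2 \<partial>PiM I N)"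
        unfolding m by (rule insert.IH[OF Fm Gm Gd])
      also have "\<dots> \<le> (\<Sum>j\<in>I. \<integral>\<zeta>. (f \<zeta> - g j \<zeta>)\<^sup>2 \<partial>PiM ?J N)"
      proof (rule sum_mono)
        fix j assume j: "j \<in> I"
        have gm: "g j \<in> borel_measurable (PiM ?J N)" "\<And>\<zeta>. \<zeta> \<in> space (PiM ?J N) \<Longrightarrow> \<bar>g j \<zeta>\<bar> \<le> B" using insert.prems(3,4) j by auto
        \<comment> \<open>The square of a mean is at most the mean of the square; the difference is
          the variance of \<open>f - g j\<close> in the coordinate that is integrated out.\<close>
        have jensen: "(F x - G j x)\<^sup>2 \<le> (\<integral>y. (f (x(i := y)) - g j (x(i := y)))\<^sup>2 \<partial>N i)" if x: "x \<in> space (PiM I N)" for x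
        proof -
          let ?u = "\<lambda>y. f (x(i := y)) - g j (x(i := y))"
          have i1: "integrable (N i) (\<lambda>y. f (x(i := y)))" by (rule prob_integrable_bounded[OF N my[OF insert.prems(1) x], where c=B]) (rule insert.prems(2)[OF sp[OF x]])
          have i2: "integrable (N i) (\<lambda>y. g j (x(i := y)))" by (rule prob_integrable_bounded[OF N my[OF gm(1) x], where c=B]) (rule gm(2)[OF sp[OF x]])
          have i3: "integrable (N i) (\<lambda>y. (?u y)\<^sup>2)"
            using my[OF insert.prems(1) x] my[OF gm(1) x] insert.prems(2)[OF sp[OF x]] gm(2)[OF sp[OF x]] by (intro prob_integrable_bounded[OF N, where c="(2 * B)\<^sup>2"] sq) auto
          have e: "(\<integral>y. ?u y \<partial>N i) = F x - G j x" unfolding F_def G_def using i1 i2 by (rule Bochner_Integration.integral_diff)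
          have "Ni.variance ?u \<ge> 0" by (rule Ni.variance_positive)
          then show ?thesis using Ni.variance_eq[of ?u] i1 i2 i3 unfolding e by simp
        qed
        have mm: "(\<lambda>x. \<integral>y. (f (x(i := y)) - g j (x(i := y)))\<^sup>2 \<partial>N i) \<in> borel_measurable (PiM I N)"
          by (rule mI[of "\<lambda>\<zeta>. (f \<zeta> - g j \<zeta>)\<^sup>2"]) (use insert.prems(1) gm(1) in measurable)
        have "(\<integral>x. (F x - G j x)\<^sup>2 \<partial>PiM I N) \<le> (\<integral>x. (\<integral>y. (f (x(i := y)) - g j (x(i := y)))\<^sup>2 \<partial>N i) \<partial>PiM I N)"
        proof (rule integral_mono[OF _ _ jensen])
          show "integrable (PiM I N) (\<lambda>x. (F x - G j x)\<^sup>2)"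
            using Fm Gm[OF j] by (intro prob_integrable_bounded[OF P, where c="(2 * B)\<^sup>2"] sq) auto
          show "integrable (PiM I N) (\<lambda>x. \<integral>y. (f (x(i := y)) - g j (x(i := y)))\<^sup>2 \<partial>N i)"
          proof (rule prob_integrable_bounded[OF P mm])
            show "\<bar>\<integral>y. (f (x(i := y)) - g j (x(i := y)))\<^sup>2 \<partial>N i\<bar> \<le> (2 * B)\<^sup>2" if "x \<in> space (PiM I N)" for x
              by (rule b1[of "\<lambda>\<zeta>. (f \<zeta> - g j \<zeta>)\<^sup>2", OF _ _ that]) (use insert.prems(1,2) gm sq in auto)
          qed
        qed
        also have "\<dots> = (\<integral>\<zeta>. (f \<zeta> - g j \<zeta>)\<^sup>2 \<partial>PiM ?J N)" using gm by (intro split[symmetric] iJ) auto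
        finally show "(\<integral>x. (F x - G j x)\<^sup>2 \<partial>PiM I N) \<le> (\<integral>\<zeta>. (f \<zeta> - g j \<zeta>)\<^sup>2 \<partial>PiM ?J N)" .
      qed
      finally show ?thesis .
    qed
    finally show ?case using insert.hyps by simp
  qed
qed

section \<open>Conditional independence of disjoint cells\<close>

text \<open>Dynkin's argument for an integrand of either sign: the sets over which \<open>u\<close>
  integrates to \<open>0\<close> are closed under complements, as the whole space is one of them,
  and under countable disjoint unions.\<close>

lemma integral_indicator_0_sigma_sets:
  fixes u :: "'a \<Rightarrow> real"
  assumes u: "integrable M u" and C: "Int_stable \<C>" "\<C> \<subseteq> sets M" "space M \<in> \<C>"
    and 0: "\<And>c. c \<in> \<C> \<Longrightarrow> (\<integral>x. indicator c x * u x \<partial>M) = 0"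
    and c: "c \<in> sigma_sets (space M) \<C>"
  shows "(\<integral>x. indicator c x * u x \<partial>M) = 0"
proof -
  have CP: "\<C> \<subseteq> Pow (space M)" using C(2) sets.sets_into_space by blast
  have sub: "sigma_sets (space M) \<C> \<subseteq> sets M" by (rule sets.sigma_sets_subset[OF C(2)])
  have int: "integrable M (\<lambda>x. indicator c x * u x)" if "c \<in> sets M" for c
    using integrable_mult_indicator[OF that u] by simp
  show ?thesis using C(1) CP c
  proof (induction c rule: sigma_sets_induct_disjoint)
    case (basic A) then show ?case by (rule 0)
  next
    case empty then show ?case by simp
  next
    case (compl A)
    then have A: "A \<in> sets M" using sub by blast
    have "(\<integral>x. indicator (space M - A) x * u x \<partial>M) = (\<integral>x. indicator (space M) x * u x - indicator A x * u x \<partial>M)"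
      using sets.sets_into_space[OF A] by (intro Bochner_Integration.integral_cong refl) (auto simp: indicator_def)
    also have "\<dots> = 0" using int[OF A] int[OF sets.top] compl(2) 0[OF C(3)] by (simp add: Bochner_Integration.integral_diff)
    finally show ?case .
  next
    case (union A)
    then have A: "\<And>i. A i \<in> sets M" using sub by blast
    have "set_integrable M (\<Union>i. A i) u"
      unfolding set_integrable_def using int[of "\<Union>i. A i"] A by simp
    then have "(LINT x:(\<Union>i. A i)|M. u x) = (\<Sum>i. (LINT x:(A i)|M. u x))"
      using union(1) by (intro lebesgue_integral_countable_add A) (auto simp: disjoint_family_on_def)
    then show ?case using union(3) by (simp add: set_lebesgue_integral_def)
  qed
qed

lemma cond_exp_indicator_kernel:
  assumes M: "prob_space M" and X: "X \<in> M \<rightarrow>\<^sub>M S" and Y: "Y \<in> M \<rightarrow>\<^sub>M T"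
    and \<kappa>: "conditional_law M S X T Y \<kappa>" and A: "A \<in> sets T"
  shows "AE \<omega> in M. real_cond_exp M (vimage_algebra (space M) X S) (indicator (Y -` A \<inter> space M)) \<omega> = measure (\<kappa> (X \<omega>)) A"
    and "(\<lambda>\<omega>. measure (\<kappa> (X \<omega>)) A) \<in> borel_measurable (vimage_algebra (space M) X S)"
    and "subalgebra M (vimage_algebra (space M) X S)"
proof -
  interpret prob_space M by fact
  let ?S = "vimage_algebra (space M) X S"
  have Xsp: "X \<in> space M \<rightarrow> space S" using measurable_space[OF X] by auto
  have sets: "sets ?S = {X -` B \<inter> space M | B. B \<in> sets S}" by (rule sets_vimage_algebra2[OF Xsp])
  show sub: "subalgebra M ?S" unfolding subalgebra_def using sets X by (auto intro: measurable_sets)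
  have \<kappa>m: "\<kappa> \<in> S \<rightarrow>\<^sub>M subprob_algebra T" using \<kappa> unfolding conditional_law_def by (auto intro: measurable_prob_algebraD)
  have "(\<lambda>x. measure (\<kappa> x) A) \<in> borel_measurable S"
    by (rule measurable_compose[OF \<kappa>m measurable_measure_subprob_algebra[OF A]])
  then show m: "(\<lambda>\<omega>. measure (\<kappa> (X \<omega>)) A) \<in> borel_measurable ?S"
    by (rule measurable_compose[OF measurable_vimage_algebra1[OF Xsp]])
  have a: "Y -` A \<inter> space M \<in> sets M" using Y A by (rule measurable_sets)
  interpret finite_measure_subalgebra M ?S by unfold_locales (rule sub)
  have mM: "(\<lambda>\<omega>. measure (\<kappa> (X \<omega>)) A) \<in> borel_measurable M" by (rule measurable_from_subalg[OF sub m])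
  have p: "prob_space (\<kappa> (X \<omega>))" if "\<omega> \<in> space M" for \<omega>
    using \<kappa> Xsp that unfolding conditional_law_def by (auto simp: space_prob_algebra dest!: measurable_space)
  have int: "integrable M (\<lambda>\<omega>. measure (\<kappa> (X \<omega>)) A)"
    by (rule integrable_const_bound[where B=1]) (use mM p prob_space.prob_le_1 in \<open>auto intro!: AE_I2\<close>)
  show "AE \<omega> in M. real_cond_exp M ?S (indicator (Y -` A \<inter> space M)) \<omega> = measure (\<kappa> (X \<omega>)) A"
  proof (rule real_cond_exp_charact)
    fix c assume "c \<in> sets ?S"
    then obtain B where B: "B \<in> sets S" "c = X -` B \<inter> space M" using sets by auto
    have "(\<integral>\<omega>\<in>c. indicator (Y -` A \<inter> space M) \<omega> \<partial>M) = (\<integral>\<omega>. indicator {\<omega> \<in> space M. X \<omega> \<in> B \<and> Y \<omega> \<in> A} \<omega> \<partial>M)"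
      unfolding set_lebesgue_integral_def B(2) by (intro Bochner_Integration.integral_cong refl) (auto simp: indicator_def)
    also have "\<dots> = measure M {\<omega> \<in> space M. X \<omega> \<in> B \<and> Y \<omega> \<in> A}"
      by simp (rule arg_cong[where f=prob], auto)
    also have "\<dots> = (\<integral>\<omega>. indicator B (X \<omega>) * measure (\<kappa> (X \<omega>)) A \<partial>M)"
      using \<kappa> A B(1) unfolding conditional_law_def by blast
    also have "\<dots> = (\<integral>\<omega>\<in>c. measure (\<kappa> (X \<omega>)) A \<partial>M)"
      unfolding set_lebesgue_integral_def B(2) by (intro Bochner_Integration.integral_cong refl) (auto simp: indicator_def)
    finally show "(\<integral>\<omega>\<in>c. indicator (Y -` A \<inter> space M) \<omega> \<partial>M) = (\<integral>\<omega>\<in>c. measure (\<kappa> (X \<omega>)) A \<partial>M)" .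
  next
    show "integrable M (indicator (Y -` A \<inter> space M) :: _ \<Rightarrow> real)" using a by (simp add: emeasure_eq_measure)
  qed (use int m in auto)
qed

text \<open>In the application \<open>\<beta>\<close> is the conditional probability of
  \<open>B\<close> given the field on a part of \<open>U\<close> only. Both equations can be checked
  only on a convenient intersection-stable family; since this family generates the field up to null
  sets, they extend to all events of \<open>X\<close>. The second then says that
  \<open>\<beta>\<close> is also the conditional probability of \<open>B\<close> given
  \<open>X\<close>, and the first that given \<open>X\<close> the event \<open>A\<close> factors
  off.\<close>

lemma kernel_product:
  fixes \<beta> :: "'w \<Rightarrow> real"
  assumes M: "prob_space M" and X: "X \<in> M \<rightarrow>\<^sub>M S" and Y: "Y \<in> M \<rightarrow>\<^sub>M T"
    and \<kappa>: "conditional_law M S X T Y \<kappa>" and A: "A \<in> sets T" and B: "B \<in> sets T"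
    and \<beta>: "\<beta> \<in> borel_measurable (vimage_algebra (space M) X S)" "integrable M \<beta>"
    and C: "Int_stable \<C>" "\<C> \<subseteq> sets M" "space M \<in> \<C>"
    and eqA: "\<And>c. c \<in> \<C> \<Longrightarrow> (\<integral>\<omega>. indicator c \<omega> * (indicator (Y -` (A \<inter> B) \<inter> space M) \<omega> - indicator (Y -` A \<inter> space M) \<omega> * \<beta> \<omega>) \<partial>M) = 0"
    and eqB: "\<And>c. c \<in> \<C> \<Longrightarrow> (\<integral>\<omega>. indicator c \<omega> * (indicator (Y -` B \<inter> space M) \<omega> - \<beta> \<omega>) \<partial>M) = 0"
    and gen: "\<And>s. s \<in> sets S \<Longrightarrow> \<exists>J\<in>sigma_sets (space M) \<C>. AE \<omega> in M. X \<omega> \<in> s \<longleftrightarrow> \<omega> \<in> J"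
  shows "AE \<omega> in M. measure (\<kappa> (X \<omega>)) (A \<inter> B) = measure (\<kappa> (X \<omega>)) A * measure (\<kappa> (X \<omega>)) B"
proof -
  interpret prob_space M by fact
  let ?S = "vimage_algebra (space M) X S"
  note ck = cond_exp_indicator_kernel[OF M X Y \<kappa>]
  have sub: "subalgebra M ?S" by (rule ck(3)[OF A])
  interpret finite_measure_subalgebra M ?S by unfold_locales (rule sub)
  have Xsp: "X \<in> space M \<rightarrow> space S" using measurable_space[OF X] by auto
  have sets: "sets ?S = {X -` B \<inter> space M | B. B \<in> sets S}" by (rule sets_vimage_algebra2[OF Xsp])
  have evs: "Y -` A \<inter> space M \<in> sets M" "Y -` B \<inter> space M \<in> sets M" "Y -` (A \<inter> B) \<inter> space M \<in> sets M"
    using Y A B by (auto intro!: measurable_sets)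
  have \<beta>M: "\<beta> \<in> borel_measurable M" by (rule measurable_from_subalg[OF sub \<beta>(1)])
  have iA\<beta>: "integrable M (\<lambda>\<omega>. indicator (Y -` A \<inter> space M) \<omega> * \<beta> \<omega>)"
    using integrable_mult_indicator[OF evs(1) \<beta>(2)] by simp
  have zero: "(\<integral>\<omega>. indicator (X -` s \<inter> space M) \<omega> * u \<omega> \<partial>M) = 0"
    if u: "integrable M u" "\<And>c. c \<in> \<C> \<Longrightarrow> (\<integral>\<omega>. indicator c \<omega> * u \<omega> \<partial>M) = 0" and s: "s \<in> sets S" for u :: "_ \<Rightarrow> real" and s
  proof -
    obtain J where J: "J \<in> sigma_sets (space M) \<C>" "AE \<omega> in M. X \<omega> \<in> s \<longleftrightarrow> \<omega> \<in> J" using gen[OF s] by blast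
    have JM: "J \<in> sets M" using sets.sigma_sets_subset[OF C(2)] J(1) by blast
    have "(\<integral>\<omega>. indicator (X -` s \<inter> space M) \<omega> * u \<omega> \<partial>M) = (\<integral>\<omega>. indicator J \<omega> * u \<omega> \<partial>M)"
    proof (rule integral_cong_AE)
      have "X -` s \<inter> space M \<in> sets M" using X s by (rule measurable_sets)
      then show "(\<lambda>\<omega>. indicator (X -` s \<inter> space M) \<omega> * u \<omega>) \<in> borel_measurable M" using u(1) by (intro borel_measurable_times) auto
      show "(\<lambda>\<omega>. indicator J \<omega> * u \<omega>) \<in> borel_measurable M" using u(1) JM by (intro borel_measurable_times) auto
      show "AE \<omega> in M. indicator (X -` s \<inter> space M) \<omega> * u \<omega> = indicator J \<omega> * u \<omega>"
        using J(2) AE_space by eventually_elim (auto simp: indicator_def)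
    qed
    also have "\<dots> = 0" by (rule integral_indicator_0_sigma_sets[OF u(1) C u(2) J(1)])
    finally show ?thesis .
  qed
  have i1: "integrable M (\<lambda>\<omega>. indicator (Y -` (A \<inter> B) \<inter> space M) \<omega> - indicator (Y -` A \<inter> space M) \<omega> * \<beta> \<omega>)"
    using evs iA\<beta> by (intro Bochner_Integration.integrable_diff) (auto simp: emeasure_eq_measure)
  have i2: "integrable M (\<lambda>\<omega>. indicator (Y -` B \<inter> space M) \<omega> - \<beta> \<omega>)"
    using evs \<beta>(2) by (intro Bochner_Integration.integrable_diff) (auto simp: emeasure_eq_measure)
  have cB: "AE \<omega> in M. real_cond_exp M ?S (indicator (Y -` B \<inter> space M)) \<omega> = \<beta> \<omega>"
  proof (rule real_cond_exp_charact)
    fix c assume "c \<in> sets ?S"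
    then obtain s where s: "s \<in> sets S" "c = X -` s \<inter> space M" using sets by auto
    have cM: "c \<in> sets M" using X s by (auto intro: measurable_sets)
    have "(\<integral>\<omega>. indicator c \<omega> * indicator (Y -` B \<inter> space M) \<omega> - indicator c \<omega> * \<beta> \<omega> \<partial>M) = 0"
      using zero[OF i2 eqB s(1)] s(2) by (simp add: right_diff_distrib)
    moreover have "integrable M (\<lambda>\<omega>. indicator c \<omega> * indicator (Y -` B \<inter> space M) \<omega> :: real)" "integrable M (\<lambda>\<omega>. indicator c \<omega> * \<beta> \<omega>)"
      using integrable_mult_indicator[OF cM, of "indicator (Y -` B \<inter> space M) :: _ \<Rightarrow> real"] integrable_mult_indicator[OF cM \<beta>(2)] evs by (simp_all add: emeasure_eq_measure)
    ultimately show "(\<integral>\<omega>\<in>c. indicator (Y -` B \<inter> space M) \<omega> \<partial>M) = (\<integral>\<omega>\<in>c. \<beta> \<omega> \<partial>M)"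
      unfolding set_lebesgue_integral_def by simp
  qed (use evs \<beta> in \<open>auto simp: emeasure_eq_measure\<close>)
  have cA: "AE \<omega> in M. real_cond_exp M ?S (indicator (Y -` (A \<inter> B) \<inter> space M)) \<omega> = \<beta> \<omega> * real_cond_exp M ?S (indicator (Y -` A \<inter> space M)) \<omega>"
  proof (rule real_cond_exp_charact)
    have i\<beta>A: "integrable M (\<lambda>\<omega>. \<beta> \<omega> * indicator (Y -` A \<inter> space M) \<omega>)" using iA\<beta> by (simp add: mult.commute)
    fix c assume c: "c \<in> sets ?S"
    then obtain s where s: "s \<in> sets S" "c = X -` s \<inter> space M" using sets by auto
    have cM: "c \<in> sets M" using X s by (auto intro: measurable_sets)
    have ic: "integrable M (\<lambda>\<omega>. indicator c \<omega> * (\<beta> \<omega> * indicator (Y -` A \<inter> space M) \<omega>))"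
      using integrable_mult_indicator[OF cM i\<beta>A] by simp
    have "(\<integral>\<omega>. indicator c \<omega> * indicator (Y -` (A \<inter> B) \<inter> space M) \<omega> - indicator c \<omega> * (\<beta> \<omega> * indicator (Y -` A \<inter> space M) \<omega>) \<partial>M) = 0"
      using zero[OF i1 eqA s(1)] s(2) by (simp add: right_diff_distrib mult.commute mult.left_commute)
    moreover have "integrable M (\<lambda>\<omega>. indicator c \<omega> * indicator (Y -` (A \<inter> B) \<inter> space M) \<omega> :: real)"
      using integrable_mult_indicator[OF cM, of "indicator (Y -` (A \<inter> B) \<inter> space M) :: _ \<Rightarrow> real"] evs by (simp add: emeasure_eq_measure)
    ultimately have "(\<integral>\<omega>. indicator c \<omega> * indicator (Y -` (A \<inter> B) \<inter> space M) \<omega> \<partial>M) = (\<integral>\<omega>. (indicator c \<omega> * \<beta> \<omega>) * indicator (Y -` A \<inter> space M) \<omega> \<partial>M)"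
      using ic by (simp add: mult.assoc)
    also have "\<dots> = (\<integral>\<omega>. (indicator c \<omega> * \<beta> \<omega>) * real_cond_exp M ?S (indicator (Y -` A \<inter> space M)) \<omega> \<partial>M)"
      by (rule real_cond_exp_intg(2)[symmetric]) (use ic c \<beta>(1) evs in \<open>auto simp: mult.assoc intro!: borel_measurable_times\<close>)
    finally show "(\<integral>\<omega>\<in>c. indicator (Y -` (A \<inter> B) \<inter> space M) \<omega> \<partial>M) = (\<integral>\<omega>\<in>c. \<beta> \<omega> * real_cond_exp M ?S (indicator (Y -` A \<inter> space M)) \<omega> \<partial>M)"
      unfolding set_lebesgue_integral_def by (simp add: mult.assoc)
  next
    show "integrable M (\<lambda>\<omega>. \<beta> \<omega> * real_cond_exp M ?S (indicator (Y -` A \<inter> space M)) \<omega>)"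
      by (rule real_cond_exp_intg(1)) (use iA\<beta> \<beta>(1) evs in \<open>auto simp: mult.commute\<close>)
  qed (use evs \<beta>(1) in \<open>auto simp: emeasure_eq_measure\<close>)
  show ?thesis
    using cA cB ck(1)[OF A] ck(1)[OF B] ck(1)[OF sets.Int[OF A B]]
    by eventually_elim (simp add: mult.commute)
qed

text \<open>Conditional independence in integrated form: once \<open>F\<close> is known, an event of
  \<open>H\<close> carries no further information on \<open>b\<close>, so the indicator of
  \<open>b\<close> may be replaced by its conditional expectation given \<open>F\<close> even under
  the indicator of \<open>e\<close>.\<close>

lemma cond_indep_integral:
  assumes M: "prob_space M" and ci: "cond_indep_algebras M F G H"
    and b: "b \<in> sets G" and S: "S \<in> sets F" and e: "e \<in> sets H"
  shows "(\<integral>\<omega>. indicator S \<omega> * indicator (b \<inter> e) \<omega> \<partial>M) =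
    (\<integral>\<omega>. indicator S \<omega> * (indicator e \<omega> * real_cond_exp M F (indicator b) \<omega>) \<partial>M)"
proof -
  interpret prob_space M by fact
  have sub: "subalgebra M F" "subalgebra M G" "subalgebra M H" using ci unfolding cond_indep_algebras_def by blast+
  interpret finite_measure_subalgebra M F by unfold_locales (rule sub(1))
  let ?\<beta> = "real_cond_exp M F (indicator b)"
  have bM: "b \<in> sets M" "e \<in> sets M" "S \<in> sets M" using sub b e S unfolding subalgebra_def by blast+
  have i\<beta>: "integrable M ?\<beta>" using bM by (intro real_cond_exp_int) (simp add: emeasure_eq_measure)
  have "(\<integral>\<omega>. indicator S \<omega> * indicator (b \<inter> e) \<omega> \<partial>M) = (\<integral>\<omega>. indicator S \<omega> * real_cond_exp M F (indicator (b \<inter> e)) \<omega> \<partial>M)"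
    by (rule real_cond_exp_intg(2)[symmetric]) (use bM S integrable_mult_indicator[of S M "indicator (b \<inter> e) :: _ \<Rightarrow> real"] in \<open>auto simp: emeasure_eq_measure\<close>)
  also have "\<dots> = (\<integral>\<omega>. indicator S \<omega> * (?\<beta> \<omega> * real_cond_exp M F (indicator e) \<omega>) \<partial>M)"
  proof (rule integral_cong_AE)
    have "AE \<omega> in M. real_cond_exp M F (indicator (b \<inter> e)) \<omega> = ?\<beta> \<omega> * real_cond_exp M F (indicator e) \<omega>"
      using ci b e unfolding cond_indep_algebras_def by blast
    then show "AE \<omega> in M. indicator S \<omega> * real_cond_exp M F (indicator (b \<inter> e)) \<omega> = indicator S \<omega> * (?\<beta> \<omega> * real_cond_exp M F (indicator e) \<omega>)"
      by eventually_elim simp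
  qed (use bM in \<open>auto intro!: borel_measurable_times\<close>)
  also have "\<dots> = (\<integral>\<omega>. (indicator S \<omega> * ?\<beta> \<omega>) * real_cond_exp M F (indicator e) \<omega> \<partial>M)" by (simp add: mult.assoc)
  also have "\<dots> = (\<integral>\<omega>. (indicator S \<omega> * ?\<beta> \<omega>) * indicator e \<omega> \<partial>M)"
  proof (rule real_cond_exp_intg(2))
    have "integrable M (\<lambda>\<omega>. indicator (S \<inter> e) \<omega> * ?\<beta> \<omega>)" using integrable_mult_indicator[of "S \<inter> e", OF _ i\<beta>] bM by simp
    then show "integrable M (\<lambda>\<omega>. (indicator S \<omega> * ?\<beta> \<omega>) * indicator e \<omega>)" by (simp add: indicator_inter_arith ac_simps)
  qed (use bM S in \<open>auto intro!: borel_measurable_times\<close>)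
  finally show ?thesis by (simp add: ac_simps)
qed

text \<open>The field tested against a function that charges a line is only almost surely a limit of
  the field off the line. Measurability therefore has to be taken up to null sets of
  \<open>M\<close>, and these events still form a sigma-algebra.\<close>

definition null_extension :: "'w measure \<Rightarrow> 'w measure \<Rightarrow> 'w measure" where
  "null_extension M J = sigma (space M) {A \<in> sets M. \<exists>B\<in>sets J. AE \<omega> in M. \<omega> \<in> A \<longleftrightarrow> \<omega> \<in> B}"

lemma space_null_extension [simp]: "space (null_extension M J) = space M"
  unfolding null_extension_def by (rule space_measure_of) (use sets.sets_into_space in auto)

lemma sets_null_extension:
  assumes J: "subalgebra M J"
  shows "sets (null_extension M J) = {A \<in> sets M. \<exists>B\<in>sets J. AE \<omega> in M. \<omega> \<in> A \<longleftrightarrow> \<omega> \<in> B}" (is "_ = ?A")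
proof -
  have sp: "space J = space M" using J by (simp add: subalgebra_def)
  have "sigma_algebra (space M) ?A"
    unfolding sigma_algebra_iff2
  proof (intro conjI ballI allI impI)
    show "?A \<subseteq> Pow (space M)" using sets.sets_into_space by auto
    show "{} \<in> ?A" by (auto intro!: bexI[of _ "{}"])
  next
    fix A assume "A \<in> ?A"
    then obtain B where B: "A \<in> sets M" "B \<in> sets J" "AE \<omega> in M. \<omega> \<in> A \<longleftrightarrow> \<omega> \<in> B" by blast
    have "AE \<omega> in M. \<omega> \<in> space M - A \<longleftrightarrow> \<omega> \<in> space M - B" using B(3) by eventually_elim auto
    moreover have "space M - B \<in> sets J" using B(2) sp by (metis sets.compl_sets)
    ultimately show "space M - A \<in> ?A" using B(1) by blast
  next
    fix A :: "nat \<Rightarrow> _" assume "range A \<subseteq> ?A"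
    then have "\<forall>i. A i \<in> sets M \<and> (\<exists>B\<in>sets J. AE \<omega> in M. \<omega> \<in> A i \<longleftrightarrow> \<omega> \<in> B)" by blast
    then obtain B where B: "\<And>i. A i \<in> sets M" "\<And>i. B i \<in> sets J" "\<And>i. AE \<omega> in M. \<omega> \<in> A i \<longleftrightarrow> \<omega> \<in> B i" by metis
    have "AE \<omega> in M. \<forall>i. \<omega> \<in> A i \<longleftrightarrow> \<omega> \<in> B i" using B(3) by (simp add: AE_all_countable)
    then have "AE \<omega> in M. \<omega> \<in> (\<Union>i. A i) \<longleftrightarrow> \<omega> \<in> (\<Union>i. B i)" by eventually_elim auto
    moreover have "(\<Union>i. B i) \<in> sets J" using B(2) by blast
    moreover have "(\<Union>i. A i) \<in> sets M" using B(1) by blast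
    ultimately show "(\<Union>i. A i) \<in> ?A" by blast
  qed
  then show ?thesis unfolding null_extension_def by (rule sigma_algebra.sets_measure_of_eq)
qed

lemma measurable_null_extension:
  assumes J: "subalgebra M J" and f: "f \<in> J \<rightarrow>\<^sub>M N" shows "f \<in> null_extension M J \<rightarrow>\<^sub>M N"
proof (rule measurableI)
  have sp: "space J = space M" using J by (simp add: subalgebra_def)
  show "f x \<in> space N" if "x \<in> space (null_extension M J)" for x using measurable_space[OF f] that sp by simp
  fix A assume A: "A \<in> sets N"
  have "f -` A \<inter> space M \<in> sets J" using measurable_sets[OF f A] sp by simp
  moreover from this have "f -` A \<inter> space M \<in> sets M" using J unfolding subalgebra_def by blast
  ultimately show "f -` A \<inter> space (null_extension M J) \<in> sets (null_extension M J)"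
    unfolding sets_null_extension[OF J] space_null_extension by blast
qed

lemma borel_measurable_null_extension_limit:
  fixes f :: "'w \<Rightarrow> real"
  assumes J: "subalgebra M J" and X: "\<And>n. X n \<in> borel_measurable (null_extension M J)"
    and f: "f \<in> borel_measurable M" and lim: "AE \<omega> in M. (\<lambda>n. X n \<omega>) \<longlonglongrightarrow> f \<omega>"
  shows "f \<in> borel_measurable (null_extension M J)"
proof (rule measurableI)
  define g where "g \<omega> = lim (\<lambda>n. X n \<omega>)" for \<omega>
  have g: "g \<in> borel_measurable (null_extension M J)" unfolding g_def[abs_def] by (rule borel_measurable_lim_metric[OF X])
  have fg: "AE \<omega> in M. f \<omega> = g \<omega>" using lim by eventually_elim (simp add: g_def limI)
  fix A :: "real set" assume A: "A \<in> sets borel"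
  obtain B where B: "B \<in> sets J" "AE \<omega> in M. \<omega> \<in> g -` A \<inter> space M \<longleftrightarrow> \<omega> \<in> B"
    using measurable_sets[OF g A] unfolding sets_null_extension[OF J] by auto
  have "AE \<omega> in M. \<omega> \<in> f -` A \<inter> space M \<longleftrightarrow> \<omega> \<in> B" using B(2) fg by eventually_elim auto
  then show "f -` A \<inter> space (null_extension M J) \<in> sets (null_extension M J)"
    unfolding sets_null_extension[OF J] using measurable_sets[OF f A] B(1) by auto
qed auto

text \<open>Disjoint open sets split a compact support into two compact pieces: \<open>K - W\<close>
  is compact and lies in \<open>V\<close>. The indicator of \<open>V\<close> is thus locally
  constant wherever it matters and preserves smoothness.\<close>

lemma test_functions_restrict:
  assumes V: "open V" "open W" "V \<inter> W = {}" and f: "f \<in> test_functions (V \<union> W)"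
  shows "(\<lambda>z. indicator V z * f z) \<in> test_functions V"
proof -
  have der: "((\<lambda>z. indicator V z * g z) has_derivative (\<lambda>v. indicator V z * frechet_derivative g (at z) v)) (at z)"
    if g: "g \<in> test_functions (V \<union> W)" for g z
  proof (cases "z \<in> V")
    case True
    have "(g has_derivative frechet_derivative g (at z)) (at z)" by (rule smooth_has_derivative[OF test_functions_smooth[OF g]])
    then have "((\<lambda>z. indicator V z * g z) has_derivative frechet_derivative g (at z)) (at z)"
      by (rule has_derivative_transform_within_open[OF _ V(1) True]) simp
    then show ?thesis using True by simp
  next
    case False
    obtain K where K: "compact K" "K \<subseteq> V \<union> W" "{z. g z \<noteq> 0} \<subseteq> K" using g by (rule test_functions_support)
    have "((\<lambda>z. indicator V z * g z) has_derivative (\<lambda>_. 0)) (at z)"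
    proof (rule has_derivative_transform_within_open[of "\<lambda>_. 0" _ _ _ "W \<union> - K"])
      show "open (W \<union> - K)" using V(2) compact_imp_closed[OF K(1)] by auto
      show "z \<in> W \<union> - K" using K(2) False by blast
      show "0 = indicator V w * g w" if "w \<in> W \<union> - K" for w using that V(3) K(3) by (auto simp: indicator_def)
    qed simp
    then show ?thesis using False by simp
  qed
  have "smooth (\<lambda>z. indicator V z * f z)"
  proof (rule smooth_coinduct[where \<C>="{\<lambda>z. indicator V z * g z | g. g \<in> test_functions (V \<union> W)}"])
    fix k assume "k \<in> {\<lambda>z. indicator V z * g z :: real | g. g \<in> test_functions (V \<union> W)}"
    then obtain g where k: "k = (\<lambda>z. indicator V z * g z)" and g: "g \<in> test_functions (V \<union> W)" by blast
    have d: "k differentiable at z" for z unfolding k using der[OF g] differentiableI by blast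
    have p: "partials [b] k = (\<lambda>z. indicator V z * partials [b] g z)" for b
      unfolding k by (rule ext, subst partials1_eqI[OF der[OF g]]) simp
    show "(\<forall>z. k differentiable at z) \<and> (\<forall>b\<in>Basis. partials [b] k \<in> {\<lambda>z. indicator V z * g z | g. g \<in> test_functions (V \<union> W)})"
    proof (intro conjI allI ballI d)
      fix b :: complex assume b: "b \<in> Basis"
      show "partials [b] k \<in> {\<lambda>z. indicator V z * g z | g. g \<in> test_functions (V \<union> W)}"
        unfolding p using test_functions_partials1[OF g b] by blast
    qed
  qed (use f in blast)
  moreover obtain K where K: "compact K" "K \<subseteq> V \<union> W" "{z. f z \<noteq> 0} \<subseteq> K" using f by (rule test_functions_support)
  have "compact (K - W)" using K(1) V(2) by (rule compact_diff)
  moreover have "K - W \<subseteq> V" "{z. indicator V z * f z \<noteq> 0} \<subseteq> K - W" using K V(3) by (auto simp: indicator_def)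
  ultimately show ?thesis unfolding test_functions_iff by blast
qed

definition coordinate_line :: "complex \<times> real \<Rightarrow> complex set" where
  "coordinate_line = (\<lambda>(b, s). {z. z \<bullet> b = s})"

lemma (in cutoffs) test_functions_off_line:
  assumes one: "\<And>n x. \<bar>x\<bar> \<le> 1 / Suc n \<Longrightarrow> A n 0 x = 1" and f: "f \<in> test_functions W"
  shows "(\<lambda>z. f z * (1 + (-1) * \<alpha> n 0 z)) \<in> test_functions (W - coordinate_line (b, s))"
proof -
  obtain K where K: "compact K" "K \<subseteq> W" "{z. f z \<noteq> 0} \<subseteq> K" using f by (rule test_functions_support)
  let ?O = "{z. \<bar>z \<bullet> b - s\<bar> < 1 / Suc n}"
  have "open ?O" by (intro open_Collect_less continuous_intros)
  then have "compact (K - ?O)" by (rule compact_diff[OF K(1)])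
  moreover have "K - ?O \<subseteq> W - coordinate_line (b, s)" using K(2) by (auto simp: coordinate_line_def)
  moreover have "{z. f z * (1 + (-1) * \<alpha> n 0 z) \<noteq> 0} \<subseteq> K - ?O" using K(3) one by (auto simp: \<alpha>_def less_imp_le)
  moreover have "smooth (\<lambda>z. f z * (1 + (-1) * \<alpha> n 0 z))"
    by (intro smooth_mult smooth_add smooth_const smooth_\<alpha> test_functions_smooth[OF f])
  ultimately show ?thesis unfolding test_functions_iff by blast
qed

text \<open>The field tested against \<open>f\<close> times a cutoff around the lines tends to \<open>0\<close>, so \<open>f\<close> may be replaced by test
  functions vanishing near the lines.\<close>

lemma gff_measurable_off_lines:
  assumes gff: "gff M U h" and J: "subalgebra M J" and L: "finite L" "L \<subseteq> Basis \<times> UNIV"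
    and W: "W \<subseteq> U"
    and off: "\<And>f. f \<in> test_functions (W - (\<Union>l\<in>L. coordinate_line l)) \<Longrightarrow> (\<lambda>\<omega>. h \<omega> f) \<in> borel_measurable (null_extension M J)"
    and f: "f \<in> test_functions W"
  shows "(\<lambda>\<omega>. h \<omega> f) \<in> borel_measurable (null_extension M J)"
  using L W off f
proof (induction L arbitrary: W f rule: finite_induct)
  case empty
  then show ?case by simp
next
  case (insert l L)
  obtain b s where l: "l = (b, s)" "b \<in> Basis" using insert.prems(1) by auto
  have hm: "h \<in> M \<rightarrow>\<^sub>M distribution_space U" using gff unfolding gff_def by blast
  have hf: "(\<lambda>\<omega>. h \<omega> g) \<in> borel_measurable M" if "g \<in> test_functions U" for g
    using measurable_compose[OF hm measurable_eval_distribution[OF that]] .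
  obtain A c where A: "\<And>n k. smooth1 (A n k)" "\<And>n k x. (A n (Suc k) has_real_derivative A n k x) (at x)"
    "\<And>n k x. \<bar>A n (Suc k) x\<bar> \<le> c * \<bar>x\<bar> ^ k / Suc n"
    "\<And>n x. \<bar>x\<bar> \<le> 1 / Suc n \<Longrightarrow> A n 0 x = 1" "c > 0" using cutoff_family by blast
  interpret cutoffs A c b s by unfold_locales (use A l in auto)
  have fU: "f \<in> test_functions U" using insert.prems(2,4) test_functions_mono by blast
  have t: "(\<lambda>z. f z * (1 + (-1) * \<alpha> n 0 z)) \<in> test_functions (W - coordinate_line l)" for n
    unfolding l by (rule test_functions_off_line[OF A(4) insert.prems(4)])
  have eq: "W - (\<Union>l\<in>insert l L. coordinate_line l) = W - coordinate_line l - (\<Union>l\<in>L. coordinate_line l)" by auto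
  have IH: "(\<lambda>\<omega>. h \<omega> g) \<in> borel_measurable (null_extension M J)" if "g \<in> test_functions (W - coordinate_line l)" for g
  proof (rule insert.IH[of "W - coordinate_line l"])
    show "L \<subseteq> Basis \<times> UNIV" using insert.prems(1) by simp
    show "W - coordinate_line l \<subseteq> U" using insert.prems(2) by blast
    show "g \<in> test_functions (W - coordinate_line l)" by (rule that)
    show "(\<lambda>\<omega>. h \<omega> f) \<in> borel_measurable (null_extension M J)"
      if "f \<in> test_functions (W - coordinate_line l - (\<Union>l\<in>L. coordinate_line l))" for f
      by (rule insert.prems(3)) (use that eq in simp)
  qed
  have lim: "AE \<omega> in M. (\<lambda>n. h \<omega> (\<lambda>z. f z * (1 + (-1) * \<alpha> n 0 z))) \<longlonglongrightarrow> h \<omega> f"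
    using gff_cutoff_tendsto_0[OF gff fU] AE_space
  proof eventually_elim
    case (elim \<omega>)
    have T: "h \<omega> \<in> distributions U" using measurable_space[OF hm elim(2)] space_distribution_space by blast
    have ta: "(\<lambda>z. f z * \<alpha> n 0 z) \<in> test_functions U" for n by (intro test_functions_mult fU smooth_\<alpha>)
    have "h \<omega> (\<lambda>z. f z * (1 + (-1) * \<alpha> n 0 z)) = h \<omega> f + (-1) * h \<omega> (\<lambda>z. f z * \<alpha> n 0 z)" for n
    proof -
      have "(\<lambda>z. f z * (1 + (-1) * \<alpha> n 0 z)) = (\<lambda>z. f z + (-1) * (f z * \<alpha> n 0 z))" by (auto simp: algebra_simps)
      then show ?thesis by (simp only: distribution_add[OF T fU test_functions_cmult[OF ta]] distribution_cmult[OF T ta])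
    qed
    moreover have "(\<lambda>n. h \<omega> f + (-1) * h \<omega> (\<lambda>z. f z * \<alpha> n 0 z)) \<longlonglongrightarrow> h \<omega> f + (-1) * 0"
      by (intro tendsto_intros elim)
    ultimately show ?case by simp
  qed
  show ?case by (rule borel_measurable_null_extension_limit[OF J IH[OF t] hf[OF fU] lim])
qed

section \<open>Cells and the conditional independence of their internal metrics\<close>

abbreviation cell :: "complex \<times> complex \<Rightarrow> complex set" where
  "cell j \<equiv> box (fst j) (snd j)"

text \<open>Strict upper bounds for finitely many distances inside each cell. For one cell such
  events are closed under intersection and generate what is to be known about its internal metric;
  with the rational thresholds of \<open>cell_constraints\<close> there are only countably many of
  them.\<close>

definition chain_event ::
    "complex set \<Rightarrow> (complex \<times> complex) set \<Rightarrow> (complex \<times> complex \<Rightarrow> ((complex \<times> complex) \<times> real) set)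
      \<Rightarrow> (complex \<times> complex \<Rightarrow> ennreal) set" where
  "chain_event U J \<F> = {E \<in> continuous_metrics U. \<forall>j\<in>J. \<forall>(p, r)\<in>\<F> j. chain_metric U (cell j) E p < ennreal r}"

definition cell_constraints :: "complex \<times> complex \<Rightarrow> ((complex \<times> complex) \<times> real) set set" where
  "cell_constraints j = {F. finite F \<and> F \<subseteq> (rational_points (cell j) \<times> rational_points (cell j)) \<times> \<rat>}"

lemma chain_event_sets:
  assumes J: "finite J" "\<And>j. j \<in> J \<Longrightarrow> cell j \<subseteq> U" "\<And>j. j \<in> J \<Longrightarrow> \<F> j \<in> cell_constraints j"
  shows "chain_event U J \<F> \<in> sets (metric_space_borel U)"
proof -
  have "{E \<in> space (metric_space_borel U). \<forall>j\<in>J. \<forall>x\<in>\<F> j. chain_metric U (cell j) E (fst x) < ennreal (snd x)} \<in> sets (metric_space_borel U)"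
  proof (rule sets.sets_Collect_finite_All[OF _ J(1)])
    fix j assume j: "j \<in> J"
    have [measurable]: "(\<lambda>E. chain_metric U (cell j) E p) \<in> borel_measurable (metric_space_borel U)" for p
      by (rule measurable_chain_metric[OF J(2)[OF j]])
    have fin: "finite (\<F> j)" using J(3)[OF j] by (simp add: cell_constraints_def)
    show "{E \<in> space (metric_space_borel U). \<forall>x\<in>\<F> j. chain_metric U (cell j) E (fst x) < ennreal (snd x)} \<in> sets (metric_space_borel U)"
      by (rule sets.sets_Collect_finite_All[OF _ fin]) measurable
  qed
  then show ?thesis by (simp add: chain_event_def space_metric_space_borel case_prod_beta)
qed

lemma frontier_cell_subset_lines:
  "frontier (cell j) \<subseteq> (\<Union>l\<in>{(1, Re (fst j)), (1, Re (snd j)), (\<i>, Im (fst j)), (\<i>, Im (snd j))}. coordinate_line l)"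
proof (cases "cell j = {}")
  case False
  then have "frontier (cell j) = cbox (fst j) (snd j) - cell j" by (simp add: frontier_box)
  then show ?thesis
    by (auto simp: box_def cbox_def Basis_complex_def coordinate_line_def)
qed simp

locale local_metric_coupling =
  fixes M :: "'w measure" and U :: "complex set"
    and h :: "'w \<Rightarrow> (complex \<Rightarrow> real) \<Rightarrow> real"
    and D :: "'w \<Rightarrow> complex \<times> complex \<Rightarrow> ennreal"
    and \<kappa> :: "((complex \<Rightarrow> real) \<Rightarrow> real) \<Rightarrow> (complex \<times> complex \<Rightarrow> ennreal) measure"
  assumes U: "open U" "connected U"
    and gff: "gff M U h"
    and D_measurable: "D \<in> M \<rightarrow>\<^sub>M metric_space_borel U"
    and length: "\<forall>\<omega>\<in>space M. length_metric U (D \<omega>)"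
    and local: "local_metric M U h D"
    and kernel: "conditional_law M (distribution_space U) h (metric_space_borel U) D \<kappa>"
begin

lemma M: "prob_space M" and h_measurable: "h \<in> M \<rightarrow>\<^sub>M distribution_space U"
  using gff unfolding gff_def by blast+

lemma D_metric: "\<omega> \<in> space M \<Longrightarrow> D \<omega> \<in> continuous_metrics U"
  using measurable_space[OF D_measurable] space_metric_space_borel by blast

text \<open>Each cell is relatively clopen in \<open>W\<close>, so inside the cell its chain metric
  is the internal metric on \<open>W\<close>, which is what the sigma-algebra of locality
  provides.\<close>

lemma chain_event_in_algebra:
  assumes W: "open W" "W \<subseteq> U" and J: "finite J" "\<And>j. j \<in> J \<Longrightarrow> cell j \<subseteq> W" "\<And>j. j \<in> J \<Longrightarrow> closure (cell j) \<inter> W \<subseteq> cell j"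
    and F: "\<And>j. j \<in> J \<Longrightarrow> \<F> j \<in> cell_constraints j"
  shows "D -` chain_event U J \<F> \<inter> space M \<in> sets (internal_metric_algebra M D W)"
proof -
  let ?A = "internal_metric_algebra M D W"
  have sp: "space ?A = space M" by (simp add: internal_metric_algebra_def)
  have 1: "{\<omega> \<in> space M. chain_metric U (cell j) (D \<omega>) p < a} \<in> sets ?A"
    if j: "j \<in> J" and p: "p \<in> rational_points (cell j) \<times> rational_points (cell j)" for j p a
  proof -
    obtain x y where xy: "p = (x, y)" "x \<in> rational_points (cell j)" "y \<in> rational_points (cell j)" using p by blast
    have xyc: "x \<in> cell j" "y \<in> cell j" using xy rational_points_subset[of "cell j"] by auto
    have pW: "p \<in> W \<times> W" using xyc xy J(2)[OF j] by auto
    have "{\<omega> \<in> space M. chain_metric U (cell j) (D \<omega>) p < a} = (\<lambda>\<omega>. internal_metric (D \<omega>) W) -` {E \<in> continuous_metrics W. E p < a} \<inter> space M"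
    proof -
      have "internal_metric (D \<omega>) W \<in> continuous_metrics W" "chain_metric U (cell j) (D \<omega>) p = internal_metric (D \<omega>) W p" if \<omega>: "\<omega> \<in> space M" for \<omega>
      proof -
        note D = D_metric[OF \<omega>] length[rule_format, OF \<omega>]
        show "internal_metric (D \<omega>) W \<in> continuous_metrics W" by (rule internal_metric_continuous_metrics[OF D W])
        have "chain_metric U (cell j) (D \<omega>) (x, y) = internal_metric (D \<omega>) (cell j) (x, y)"
          using J(2)[OF j] W(2) by (intro internal_metric_eq_chain_metric[symmetric] U D xy open_box) auto
        also have "\<dots> = internal_metric (D \<omega>) W (x, y)"
          by (intro internal_metric_relatively_clopen[symmetric] open_box J(2,3)[OF j] xyc)
        finally show "chain_metric U (cell j) (D \<omega>) p = internal_metric (D \<omega>) W p" using xy by simp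
      qed
      then show ?thesis by auto
    qed
    then show ?thesis unfolding internal_metric_algebra_def using in_vimage_algebra[OF eval_less_sets[OF pW]] by simp
  qed
  have "D -` chain_event U J \<F> \<inter> space M = {\<omega> \<in> space ?A. \<forall>j\<in>J. \<forall>x\<in>\<F> j. chain_metric U (cell j) (D \<omega>) (fst x) < ennreal (snd x)}"
    using D_metric sp by (auto simp: chain_event_def case_prod_beta)
  also have "\<dots> \<in> sets ?A"
  proof (rule sets.sets_Collect_finite_All[OF _ J(1)])
    fix j assume j: "j \<in> J"
    have fin: "finite (\<F> j)" and sub: "\<F> j \<subseteq> (rational_points (cell j) \<times> rational_points (cell j)) \<times> \<rat>" using F[OF j] by (auto simp: cell_constraints_def)
    show "{\<omega> \<in> space ?A. \<forall>x\<in>\<F> j. chain_metric U (cell j) (D \<omega>) (fst x) < ennreal (snd x)} \<in> sets ?A"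
    proof (rule sets.sets_Collect_finite_All[OF _ fin])
      fix x assume "x \<in> \<F> j"
      then have "fst x \<in> rational_points (cell j) \<times> rational_points (cell j)" using sub by auto
      from 1[OF j this] show "{\<omega> \<in> space ?A. chain_metric U (cell j) (D \<omega>) (fst x) < ennreal (snd x)} \<in> sets ?A" using sp by simp
    qed
  qed
  finally show ?thesis .
qed

lemma field_algebra_space: "space (field_algebra M h V) = space M"
  by (simp add: field_algebra_def)

lemma field_algebra_measurable:
  assumes "f \<in> test_functions V" shows "(\<lambda>\<omega>. h \<omega> f) \<in> borel_measurable (field_algebra M h V)"
proof -
  have "(\<lambda>\<omega>. restrict (h \<omega>) (test_functions V)) \<in> field_algebra M h V \<rightarrow>\<^sub>M (\<Pi>\<^sub>M f\<in>test_functions V. (borel :: real measure))"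
    unfolding field_algebra_def by (rule measurable_vimage_algebra1) (auto simp: space_PiM)
  from measurable_compose[OF this measurable_component_singleton[OF assms]] show ?thesis using assms by simp
qed

lemma field_algebra_subset:
  assumes "space N = space M" "\<And>f. f \<in> test_functions V \<Longrightarrow> (\<lambda>\<omega>. h \<omega> f) \<in> borel_measurable N"
  shows "sets (field_algebra M h V) \<subseteq> sets N"
  unfolding field_algebra_def
proof (rule sets_image_in_sets[OF assms(1)])
  show "(\<lambda>\<omega>. restrict (h \<omega>) (test_functions V)) \<in> N \<rightarrow>\<^sub>M (\<Pi>\<^sub>M f\<in>test_functions V. borel)"
    using assms(2) by (intro measurable_restrict) auto
qed

lemma h_measurable_field:
  assumes "f \<in> test_functions U"
  shows "(\<lambda>\<omega>. h \<omega> f) \<in> borel_measurable (vimage_algebra (space M) h (distribution_space U))"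
  by (rule measurable_compose[OF measurable_vimage_algebra1 measurable_eval_distribution[OF assms]])
     (use measurable_space[OF h_measurable] in auto)

lemma field_algebra_closed_supset:
  assumes "V \<subseteq> U" "V \<subseteq> K"
  shows "sets (field_algebra M h V) \<subseteq> sets (field_algebra_closed M U h K)"
proof
  fix S assume S: "S \<in> sets (field_algebra M h V)"
  have "S \<in> sets (field_algebra M h (U \<inter> (\<Union>z\<in>K. ball z e)))" if e: "e > 0" for e
  proof -
    have VW: "V \<subseteq> U \<inter> (\<Union>z\<in>K. ball z e)" using assms e by force
    have "sets (field_algebra M h V) \<subseteq> sets (field_algebra M h (U \<inter> (\<Union>z\<in>K. ball z e)))"
    proof (rule field_algebra_subset[OF field_algebra_space])
      fix f assume "f \<in> test_functions V"
      then have "f \<in> test_functions (U \<inter> (\<Union>z\<in>K. ball z e))" using test_functions_mono[OF VW] by blast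
      then show "(\<lambda>\<omega>. h \<omega> f) \<in> borel_measurable (field_algebra M h (U \<inter> (\<Union>z\<in>K. ball z e)))"
        by (rule field_algebra_measurable)
    qed
    then show ?thesis using S by blast
  qed
  moreover have "(\<Inter>e\<in>{0<..}. sets (field_algebra M h (U \<inter> (\<Union>z\<in>K. ball z e)))) \<subseteq> Pow (space M)"
  proof -
    have "sets (field_algebra M h (U \<inter> (\<Union>z\<in>K. ball z 1))) \<subseteq> Pow (space M)"
      using sets.space_closed field_algebra_space by metis
    then show ?thesis by (intro INF_lower2[of 1]) auto
  qed
  ultimately show "S \<in> sets (field_algebra_closed M U h K)"
    unfolding field_algebra_closed_def by (subst sets_measure_of) auto
qed

text \<open>Locality is applied to the region \<open>V\<close> around the other cells, obtained by
  removing from \<open>U\<close> the closed cell \<open>i\<close> and all cell boundaries. The other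
  cells are relatively clopen in \<open>V\<close>, while cell \<open>i\<close> is relatively clopen
  in \<open>U - closure V\<close>, so both families of internal metrics are covered by one instance
  of locality. It conditions on the field on \<open>V\<close> alone; the field on cell
  \<open>i\<close> is on the other side of the independence and can be joined to the condition, and
  the two together give all of \<open>h\<close> up to null sets.\<close>

lemma kernel_cell_product:
  assumes J: "finite J" "i \<notin> J" and sub: "\<And>j. j \<in> insert i J \<Longrightarrow> cell j \<subseteq> U"
    and disj: "\<And>j k. j \<in> insert i J \<Longrightarrow> k \<in> insert i J \<Longrightarrow> j \<noteq> k \<Longrightarrow> cell j \<inter> cell k = {}"
    and F: "\<And>j. j \<in> insert i J \<Longrightarrow> \<F> j \<in> cell_constraints j"
  shows "AE \<omega> in M. measure (\<kappa> (h \<omega>)) (chain_event U (insert i J) \<F>) =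
    measure (\<kappa> (h \<omega>)) (chain_event U {i} \<F>) * measure (\<kappa> (h \<omega>)) (chain_event U J \<F>)"
proof -
  interpret prob_space M by (rule M)
  let ?I = "insert i J"
  define V where "V = U - (closure (cell i) \<union> (\<Union>j\<in>?I. frontier (cell j)))"
  define L where "L = (\<Union>j\<in>?I. {(1, Re (fst j)), (1, Re (snd j)), (\<i>, Im (fst j)), (\<i>, Im (snd j))})"
  have L: "finite L" "L \<subseteq> Basis \<times> UNIV" using J(1) by (auto simp: L_def Basis_complex_def)
  have front: "(\<Union>j\<in>?I. frontier (cell j)) \<subseteq> (\<Union>l\<in>L. coordinate_line l)"
    unfolding L_def using frontier_cell_subset_lines by blast
  have clfr: "closed (\<Union>j\<in>?I. frontier (cell j))" using J(1) by (intro closed_UN) auto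
  have V: "open V" "V \<subseteq> U" unfolding V_def using clfr by (auto intro!: open_Diff U)
  have iU: "cell i \<subseteq> U" using sub by blast
  have iV: "cell i \<inter> V = {}" unfolding V_def using closure_subset by blast
  have iclV: "cell i \<inter> closure V = {}" using open_Int_closure_eq_empty[OF open_box, of "fst i" "snd i" V] iV by simp
  have cover: "U - (\<Union>l\<in>L. coordinate_line l) \<subseteq> V \<union> cell i"
  proof
    fix z assume z: "z \<in> U - (\<Union>l\<in>L. coordinate_line l)"
    then have nf: "z \<notin> (\<Union>j\<in>?I. frontier (cell j))" using front by blast
    show "z \<in> V \<union> cell i"
    proof (cases "z \<in> closure (cell i)")
      case True
      then have "z \<in> cell i" using nf by (auto simp: frontier_def interior_open[OF open_box])
      then show ?thesis by blast
    next
      case False then show ?thesis using z nf by (auto simp: V_def)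
    qed
  qed
  have cellV: "cell j \<subseteq> V" if j: "j \<in> J" for j
  proof -
    have ji: "j \<noteq> i" "j \<in> ?I" using j J(2) by auto
    have "cell j \<inter> closure (cell i) = {}" using disj[OF ji(2) _ ji(1)] open_Int_closure_eq_empty[OF open_box, of "fst j" "snd j" "cell i"] by simp
    moreover have "cell j \<inter> frontier (cell k) = {}" if k: "k \<in> ?I" for k
    proof (cases "k = j")
      case True then show ?thesis by (auto simp: frontier_def interior_open[OF open_box])
    next
      case False
      then have "cell j \<inter> closure (cell k) = {}" using disj[OF ji(2) k] open_Int_closure_eq_empty[OF open_box, of "fst j" "snd j" "cell k"] by simp
      then show ?thesis by (auto simp: frontier_def)
    qed
    ultimately show ?thesis unfolding V_def using sub[OF ji(2)] by blast
  qed
  have clopV: "closure (cell j) \<inter> V \<subseteq> cell j" if j: "j \<in> J" for j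
    using j unfolding V_def by (auto simp: frontier_def interior_open[OF open_box])
  \<comment> \<open>Suppose \<open>z\<close> is in the closed cell, outside the cell and not in
    \<open>closure V\<close>. Every neighbourhood of \<open>z\<close> contains open pieces outside
    the closed cell, and a small one avoids \<open>V\<close>; such a piece would lie in the finite
    union of the cell boundaries, which has empty interior.\<close>
  have clopi: "closure (cell i) \<inter> (U - closure V) \<subseteq> cell i"
  proof
    fix z assume z: "z \<in> closure (cell i) \<inter> (U - closure V)"
    show "z \<in> cell i"
    proof (rule ccontr)
      assume "z \<notin> cell i"
      have int: "interior (\<Union>j\<in>?I. frontier (cell j)) = {}"
      proof -
        have "interior (\<Union>j\<in>K. frontier (cell j)) = {}" if "finite K" for K :: "(complex \<times> complex) set"
          using that
        proof (induction K rule: finite_induct)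
          case (insert k K)
          have "interior (frontier (cell k)) = {}"
          proof -
            let ?O = "interior (frontier (cell k))"
            have "?O \<inter> cell k = {}" using interior_subset[of "frontier (cell k)"] by (auto simp: frontier_def interior_open[OF open_box])
            then have "?O \<inter> closure (cell k) = {}" by (simp only: open_Int_closure_eq_empty[OF open_interior])
            moreover have "?O \<subseteq> closure (cell k)" using interior_subset[of "frontier (cell k)"] by (auto simp: frontier_def)
            ultimately show ?thesis by blast
          qed
          then show ?case
            using interior_closed_Un_empty_interior[OF frontier_closed insert.IH, of "cell k"] by simp
        qed simp
        then show ?thesis using J(1) by blast
      qed
      have "interior (closure (cell i)) = cell i" using convex_interior_closure[of "cell i"] by (simp add: interior_open[OF open_box])
      then have "z \<notin> interior (closure (cell i))" using \<open>z \<notin> cell i\<close> by simp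
      then have zc: "z \<in> closure (- closure (cell i))" by (simp add: closure_complement)
      obtain W where W: "open W" "z \<in> W" "W \<inter> V = {}" "W \<subseteq> U"
        using z U by (intro that[of "U - closure V"]) (use closure_subset in \<open>auto intro: open_Diff\<close>)
      let ?W = "W \<inter> - closure (cell i)"
      have "?W \<noteq> {}" using zc W(1,2) by (meson closure_iff_nhds_not_empty disjoint_iff open_Int_closure_eq_empty)
      moreover have "open ?W" using W(1) by auto
      ultimately have "\<not> ?W \<subseteq> (\<Union>j\<in>?I. frontier (cell j))" using int interior_maximal[of ?W] by blast
      then show False using W(3,4) unfolding V_def by blast
    qed
  qed
  let ?F = "field_algebra M h V" and ?Fi = "field_algebra M h (cell i)"
  let ?G = "internal_metric_algebra M D V" and ?Gi = "internal_metric_algebra M D (U - closure V)"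
  let ?H = "join_algebra (field_algebra_closed M U h (U - V)) ?Gi"
  have ci: "cond_indep_algebras M ?F ?G ?H" using local V unfolding local_metric_def by blast
  have sF: "subalgebra M ?F" and sH: "subalgebra M ?H" using ci unfolding cond_indep_algebras_def by blast+
  interpret F: finite_measure_subalgebra M ?F by unfold_locales (rule sF)
  define A where "A = chain_event U {i} \<F>"
  define B where "B = chain_event U J \<F>"
  have AB: "A \<in> sets (metric_space_borel U)" "B \<in> sets (metric_space_borel U)"
    unfolding A_def B_def using J(1) sub F by (intro chain_event_sets; simp)+
  have Bev: "D -` B \<inter> space M \<in> sets ?G" unfolding B_def
    by (rule chain_event_in_algebra[OF V J(1) cellV clopV]) (use F in auto)
  have Aev: "D -` A \<inter> space M \<in> sets ?Gi" unfolding A_def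
  proof (rule chain_event_in_algebra)
    show "open (U - closure V)" using U by (intro open_Diff) auto
    show "cell j \<subseteq> U - closure V" if "j \<in> {i}" for j using that iclV iU by blast
    show "closure (cell j) \<inter> (U - closure V) \<subseteq> cell j" if "j \<in> {i}" for j using that clopi by blast
  qed (use F in auto)
  have spFc: "space (field_algebra_closed M U h (U - V)) = space M"
    unfolding field_algebra_closed_def
    by (rule space_measure_of, rule INF_lower2[of 1]) (use sets.space_closed[of "field_algebra M h _"] field_algebra_space in auto)
  have joinP: "sets (field_algebra_closed M U h (U - V)) \<union> sets ?Gi \<subseteq> Pow (space M)"
    using sets.space_closed[of "field_algebra_closed M U h (U - V)"] sets.space_closed[of ?Gi] spFc by (auto simp: internal_metric_algebra_def)
  have setsH: "sets ?H = sigma_sets (space M) (sets (field_algebra_closed M U h (U - V)) \<union> sets ?Gi)"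
    unfolding join_algebra_def spFc using joinP by (rule sets_measure_of)
  have FiH: "S \<in> sets ?H" if "S \<in> sets ?Fi" for S
  proof -
    have "cell i \<subseteq> U - V" using iU iV by blast
    then have "S \<in> sets (field_algebra_closed M U h (U - V))" using field_algebra_closed_supset[OF iU, of "U - V"] that by blast
    then show ?thesis unfolding setsH by (intro sigma_sets.Basic) simp
  qed
  have AH: "D -` A \<inter> space M \<in> sets ?H" unfolding setsH using Aev by (intro sigma_sets.Basic) simp
  \<comment> \<open>The conditional probability of \<open>B\<close> given the field on
    \<open>V\<close>; it is a function of \<open>h\<close>, which is what
    \<open>kernel_product\<close> requires.\<close>
  define \<beta> where "\<beta> = real_cond_exp M ?F (indicator (D -` B \<inter> space M))"
  have bM: "D -` B \<inter> space M \<in> sets M" "D -` A \<inter> space M \<in> sets M" using D_measurable AB by (auto intro: measurable_sets)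
  have \<beta>F: "\<beta> \<in> borel_measurable ?F" unfolding \<beta>_def by simp
  have \<beta>i: "integrable M \<beta>" unfolding \<beta>_def by (intro F.real_cond_exp_int) (use bM in \<open>simp add: emeasure_eq_measure\<close>)
  let ?\<Sigma> = "vimage_algebra (space M) h (distribution_space U)"
  have \<beta>\<Sigma>: "\<beta> \<in> borel_measurable ?\<Sigma>"
  proof (rule measurable_from_subalg[OF _ \<beta>F])
    show "subalgebra ?\<Sigma> ?F" unfolding subalgebra_def
      using field_algebra_subset[of ?\<Sigma> V] h_measurable_field test_functions_mono[OF V(2)] by (auto simp: field_algebra_space)
  qed
  \<comment> \<open>Intersections of an event of the field on \<open>V\<close> with an event of the
    field on cell \<open>i\<close>: stable under intersection, and generating the field up to null
    sets because only finitely many lines are missing.\<close>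
  define \<C> where "\<C> = {S1 \<inter> S2 | S1 S2. S1 \<in> sets ?F \<and> S2 \<in> sets ?Fi}"
  have memC: "S1 \<inter> S2 \<in> \<C>" if "S1 \<in> sets ?F" "S2 \<in> sets ?Fi" for S1 S2
    unfolding \<C>_def by (rule CollectI, rule exI[of _ S1], rule exI[of _ S2]) (use that in simp)
  have SFM: "S \<in> sets M" if "S \<in> sets ?F" for S using sF that unfolding subalgebra_def by (meson subsetD)
  have SHM: "S \<in> sets M" if "S \<in> sets ?H" for S using sH that unfolding subalgebra_def by (meson subsetD)
  have topF: "space M \<in> sets ?F" "space M \<in> sets ?Fi" using sets.top[of ?F] sets.top[of ?Fi] unfolding field_algebra_space .
  have CM: "\<C> \<subseteq> sets M"
  proof
    fix c assume "c \<in> \<C>"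
    then obtain S1 S2 where "S1 \<in> sets ?F" "S2 \<in> sets ?Fi" "c = S1 \<inter> S2" unfolding \<C>_def by (elim CollectE exE conjE)
    then show "c \<in> sets M" using SFM SHM FiH by (simp add: sets.Int)
  qed
  have Cspace: "space M \<in> \<C>" using memC[OF topF] by simp
  have Cint: "Int_stable \<C>"
  proof (rule Int_stableI)
    fix a b assume "a \<in> \<C>" "b \<in> \<C>"
    then obtain S1 S2 T1 T2 where S: "S1 \<in> sets ?F" "S2 \<in> sets ?Fi" "T1 \<in> sets ?F" "T2 \<in> sets ?Fi" "a = S1 \<inter> S2" "b = T1 \<inter> T2"
      unfolding \<C>_def by (elim CollectE exE conjE)
    have "a \<inter> b = (S1 \<inter> T1) \<inter> (S2 \<inter> T2)" unfolding S by (simp only: Int_ac)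
    moreover have "(S1 \<inter> T1) \<inter> (S2 \<inter> T2) \<in> \<C>" using S by (intro memC sets.Int)
    ultimately show "a \<inter> b \<in> \<C>" by simp
  qed
  \<comment> \<open>The event \<open>S1\<close> belongs to the condition, and \<open>S2\<close>,
    like \<open>a\<close>, to the side of the complement of \<open>V\<close>; so
    \<open>S2 \<inter> a\<close> plays the role of a single event there. Taking for \<open>a\<close>
    the event of \<open>A\<close> or the whole space yields the two equations of
    \<open>kernel_product\<close>.\<close>
  have key: "(\<integral>\<omega>. indicator (S1 \<inter> S2) \<omega> * (indicator (D -` B \<inter> space M \<inter> a) \<omega> - indicator a \<omega> * \<beta> \<omega>) \<partial>M) = 0"
    if S: "S1 \<in> sets ?F" "S2 \<in> sets ?Fi" and a: "a \<in> sets ?H" for S1 S2 a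
  proof -
    have e: "S2 \<inter> a \<in> sets ?H" using FiH[OF S(2)] a by (rule sets.Int)
    have sM: "S1 \<in> sets M" "S2 \<inter> a \<in> sets M" using SFM[OF S(1)] SHM[OF e] .
    have "(\<integral>\<omega>. indicator (S1 \<inter> S2) \<omega> * (indicator (D -` B \<inter> space M \<inter> a) \<omega> - indicator a \<omega> * \<beta> \<omega>) \<partial>M)
       = (\<integral>\<omega>. indicator S1 \<omega> * indicator (D -` B \<inter> space M \<inter> (S2 \<inter> a)) \<omega> - indicator S1 \<omega> * (indicator (S2 \<inter> a) \<omega> * \<beta> \<omega>) \<partial>M)"
      by (intro Bochner_Integration.integral_cong refl) (auto simp: indicator_def)
    also have "\<dots> = (\<integral>\<omega>. indicator S1 \<omega> * indicator (D -` B \<inter> space M \<inter> (S2 \<inter> a)) \<omega> \<partial>M) - (\<integral>\<omega>. indicator S1 \<omega> * (indicator (S2 \<inter> a) \<omega> * \<beta> \<omega>) \<partial>M)"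
    proof (rule Bochner_Integration.integral_diff)
      have "integrable M (indicator (S1 \<inter> (D -` B \<inter> space M \<inter> (S2 \<inter> a))) :: _ \<Rightarrow> real)"
        using sM bM by (simp add: emeasure_eq_measure)
      then show "integrable M (\<lambda>\<omega>. indicator S1 \<omega> * indicator (D -` B \<inter> space M \<inter> (S2 \<inter> a)) \<omega> :: real)"
        by (simp add: indicator_inter_arith[abs_def])
      show "integrable M (\<lambda>\<omega>. indicator S1 \<omega> * (indicator (S2 \<inter> a) \<omega> * \<beta> \<omega>))"
        using integrable_mult_indicator[OF sM(1) integrable_mult_indicator[OF sM(2) \<beta>i]] by simp
    qed
    also have "\<dots> = 0"
      using cond_indep_integral[OF M ci Bev S(1) e] unfolding \<beta>_def by simp
    finally show ?thesis .
  qed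
  have gen: "\<exists>Q\<in>sigma_sets (space M) \<C>. AE \<omega> in M. h \<omega> \<in> s \<longleftrightarrow> \<omega> \<in> Q" if s: "s \<in> sets (distribution_space U)" for s
  proof -
    define N where "N = sigma (space M) \<C>"
    have CP: "\<C> \<subseteq> Pow (space M)" using CM sets.space_closed by blast
    have setsN: "sets N = sigma_sets (space M) \<C>" unfolding N_def using CP by (rule sets_measure_of)
    have spN: "space N = space M" unfolding N_def using CP by (rule space_measure_of)
    have sN: "subalgebra M N" unfolding subalgebra_def spN setsN using sets.sigma_sets_subset[OF CM] by simp
    have FN: "S \<in> sets N" if "S \<in> sets ?F" for S
    proof -
      have "S = S \<inter> space M" using sets.sets_into_space[OF that] unfolding field_algebra_space by (simp add: Int_absorb2)
      then have "S \<in> \<C>" using memC[OF that topF(2)] by simp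
      then show ?thesis unfolding setsN by (rule sigma_sets.Basic)
    qed
    have FiN: "S \<in> sets N" if "S \<in> sets ?Fi" for S
    proof -
      have "S = space M \<inter> S" using sets.sets_into_space[OF that] unfolding field_algebra_space by (simp add: Int_absorb1)
      then have "S \<in> \<C>" using memC[OF topF(1) that] by simp
      then show ?thesis unfolding setsN by (rule sigma_sets.Basic)
    qed
    have subN: "subalgebra N ?F" "subalgebra N ?Fi" using FN FiN by (auto simp: subalgebra_def spN field_algebra_space)
    \<comment> \<open>Off the lines a test function is the sum of its parts in \<open>V\<close> and
      in cell \<open>i\<close>, so the field against it is a sum of two measurable terms; the lines
      are then filled in up to null sets.\<close>
    have hN: "(\<lambda>\<omega>. h \<omega> f) \<in> borel_measurable (null_extension M N)" if f: "f \<in> test_functions U" for f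
    proof (rule gff_measurable_off_lines[OF gff sN L order_refl _ f])
      fix g assume "g \<in> test_functions (U - (\<Union>l\<in>L. coordinate_line l))"
      then have g: "g \<in> test_functions (V \<union> cell i)" using test_functions_mono[OF cover] by blast
      have Vi: "V \<inter> cell i = {}" using iV by blast
      have g1: "(\<lambda>z. indicator V z * g z) \<in> test_functions V"
        by (rule test_functions_restrict[OF V(1) open_box Vi g])
      have g2: "(\<lambda>z. indicator (cell i) z * g z) \<in> test_functions (cell i)"
        by (rule test_functions_restrict[OF open_box V(1)]) (use g Vi in \<open>auto simp: Un_commute Int_commute\<close>)
      have split: "g = (\<lambda>z. indicator V z * g z + indicator (cell i) z * g z)"
      proof
        fix z
        obtain K where "K \<subseteq> V \<union> cell i" "{z. g z \<noteq> 0} \<subseteq> K" using g by (rule test_functions_support)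
        then show "g z = indicator V z * g z + indicator (cell i) z * g z" using Vi by (auto simp: indicator_def)
      qed
      have gU: "(\<lambda>z. indicator V z * g z) \<in> test_functions U" "(\<lambda>z. indicator (cell i) z * g z) \<in> test_functions U"
        using g1 g2 test_functions_mono V(2) iU by blast+
      have "(\<lambda>\<omega>. h \<omega> (\<lambda>z. indicator V z * g z) + h \<omega> (\<lambda>z. indicator (cell i) z * g z)) \<in> borel_measurable N"
        by (intro borel_measurable_add measurable_from_subalg[OF subN(1) field_algebra_measurable[OF g1]] measurable_from_subalg[OF subN(2) field_algebra_measurable[OF g2]])
      moreover have "h \<omega> g = h \<omega> (\<lambda>z. indicator V z * g z) + h \<omega> (\<lambda>z. indicator (cell i) z * g z)" if "\<omega> \<in> space M" for \<omega>
      proof -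
        have "h \<omega> \<in> distributions U" using measurable_space[OF h_measurable that] space_distribution_space by blast
        from distribution_add[OF this gU] split show ?thesis by simp
      qed
      ultimately have "(\<lambda>\<omega>. h \<omega> g) \<in> borel_measurable N" by (subst measurable_cong) (auto simp: spN)
      then show "(\<lambda>\<omega>. h \<omega> g) \<in> borel_measurable (null_extension M N)" by (rule measurable_null_extension[OF sN])
    qed
    have "h \<in> null_extension M N \<rightarrow>\<^sub>M distribution_space U"
      by (rule measurable_distribution_spaceI[OF _ hN]) (use measurable_space[OF h_measurable] space_distribution_space in auto)
    from measurable_sets[OF this s] obtain Q where Q: "Q \<in> sets N" "AE \<omega> in M. \<omega> \<in> h -` s \<inter> space M \<longleftrightarrow> \<omega> \<in> Q"
      unfolding sets_null_extension[OF sN] by auto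
    have "AE \<omega> in M. h \<omega> \<in> s \<longleftrightarrow> \<omega> \<in> Q" using Q(2) AE_space by eventually_elim auto
    with Q(1) show ?thesis unfolding setsN by blast
  qed
  have "AE \<omega> in M. measure (\<kappa> (h \<omega>)) (A \<inter> B) = measure (\<kappa> (h \<omega>)) A * measure (\<kappa> (h \<omega>)) B"
  proof (rule kernel_product[OF M h_measurable D_measurable kernel AB \<beta>\<Sigma> \<beta>i Cint CM Cspace _ _ gen])
    fix c assume "c \<in> \<C>"
    then obtain S1 S2 where S: "S1 \<in> sets ?F" "S2 \<in> sets ?Fi" "c = S1 \<inter> S2" unfolding \<C>_def by (elim CollectE exE conjE)
    have eq: "D -` (A \<inter> B) \<inter> space M = D -` B \<inter> space M \<inter> (D -` A \<inter> space M)" by blast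
    show "(\<integral>\<omega>. indicator c \<omega> * (indicator (D -` (A \<inter> B) \<inter> space M) \<omega> - indicator (D -` A \<inter> space M) \<omega> * \<beta> \<omega>) \<partial>M) = 0"
      unfolding eq S(3) by (rule key[OF S(1,2) AH])
    have top: "space M \<in> sets ?H" by (rule FiH[OF topF(2)])
    have "(\<integral>\<omega>. indicator c \<omega> * (indicator (D -` B \<inter> space M) \<omega> - \<beta> \<omega>) \<partial>M)
       = (\<integral>\<omega>. indicator (S1 \<inter> S2) \<omega> * (indicator (D -` B \<inter> space M \<inter> space M) \<omega> - indicator (space M) \<omega> * \<beta> \<omega>) \<partial>M)"
      unfolding S(3) by (intro Bochner_Integration.integral_cong refl) (auto simp: indicator_def)
    then show "(\<integral>\<omega>. indicator c \<omega> * (indicator (D -` B \<inter> space M) \<omega> - \<beta> \<omega>) \<partial>M) = 0"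
      using key[OF S(1,2) top] by simp
  qed
  moreover have "chain_event U ?I \<F> = A \<inter> B" unfolding A_def B_def chain_event_def by blast
  ultimately show ?thesis unfolding A_def B_def by simp
qed

lemma kernel_cells_independent:
  assumes J: "finite J" and sub: "\<And>j. j \<in> J \<Longrightarrow> cell j \<subseteq> U"
    and disj: "\<And>j k. j \<in> J \<Longrightarrow> k \<in> J \<Longrightarrow> j \<noteq> k \<Longrightarrow> cell j \<inter> cell k = {}"
    and F: "\<And>j. j \<in> J \<Longrightarrow> \<F> j \<in> cell_constraints j"
  shows "AE \<omega> in M. measure (\<kappa> (h \<omega>)) (chain_event U J \<F>) = (\<Prod>j\<in>J. measure (\<kappa> (h \<omega>)) (chain_event U {j} \<F>))"
  using assms
proof (induction J rule: finite_induct)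
  case empty
  have "measure (\<kappa> (h \<omega>)) (chain_event U {} \<F>) = 1" if "\<omega> \<in> space M" for \<omega>
  proof -
    have "\<kappa> (h \<omega>) \<in> space (prob_algebra (metric_space_borel U))"
      using kernel measurable_space[OF h_measurable that] unfolding conditional_law_def by (auto dest: measurable_space)
    then have p: "prob_space (\<kappa> (h \<omega>))" "sets (\<kappa> (h \<omega>)) = sets (metric_space_borel U)" by (auto simp: space_prob_algebra)
    have "space (\<kappa> (h \<omega>)) = continuous_metrics U" using sets_eq_imp_space_eq[OF p(2)] space_metric_space_borel by simp
    then show ?thesis using prob_space.prob_space[OF p(1)] by (simp add: chain_event_def)
  qed
  then show ?case by (auto intro: AE_I2)
next
  case (insert i J)
  have 1: "AE \<omega> in M. measure (\<kappa> (h \<omega>)) (chain_event U (insert i J) \<F>) =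
    measure (\<kappa> (h \<omega>)) (chain_event U {i} \<F>) * measure (\<kappa> (h \<omega>)) (chain_event U J \<F>)"
    by (rule kernel_cell_product[OF insert.hyps]) (use insert.prems in blast)+
  have 2: "AE \<omega> in M. measure (\<kappa> (h \<omega>)) (chain_event U J \<F>) = (\<Prod>j\<in>J. measure (\<kappa> (h \<omega>)) (chain_event U {j} \<F>))"
    by (rule insert.IH) (use insert.prems in blast)+
  from 1 2 show ?case by eventually_elim (use insert.hyps in simp)
qed

end

section \<open>Approximation by functions of independent cells\<close>

lemma sum_at_most_one:
  fixes a :: real
  assumes "finite J" "a \<ge> 0" "\<And>i j. i \<in> J \<Longrightarrow> j \<in> J \<Longrightarrow> P i \<Longrightarrow> P j \<Longrightarrow> i = j"
  shows "(\<Sum>j\<in>J. if P j then a else 0) \<le> a"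
proof (cases "\<exists>i\<in>J. P i")
  case True
  then obtain i where i: "i \<in> J" "P i" by blast
  have "P j \<longleftrightarrow> j = i" if "j \<in> J" for j using assms(3)[of j i] i that by blast
  then have "(\<Sum>j\<in>J. if P j then a else 0) = (\<Sum>j\<in>J. if j = i then a else 0)"
    by (intro sum.cong) simp_all
  then show ?thesis using assms(1) i by simp
next
  case False
  then have "(\<Sum>j\<in>J. if P j then a else 0) = (\<Sum>j\<in>J. 0)" by (intro sum.cong) simp_all
  then show ?thesis using assms(2) by simp
qed

definition chain_inf :: "'a set \<Rightarrow> ('a \<times> 'a \<Rightarrow> real) \<Rightarrow> 'a \<Rightarrow> 'a \<Rightarrow> real" where
  "chain_inf Q k x y = (INF xs\<in>chains Q x y. chain_sum k xs)"

lemma two_chain: "x \<in> Q \<Longrightarrow> y \<in> Q \<Longrightarrow> [x, y] \<in> chains Q x y"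
  by (simp add: chains_def)

lemma chain_sum_nonneg:
  fixes k :: "'a \<times> 'a \<Rightarrow> real"
  assumes "xs \<in> chains Q x y" "\<And>p. p \<in> Q \<times> Q \<Longrightarrow> 0 \<le> k p" shows "0 \<le> chain_sum k xs"
proof -
  have "set xs \<subseteq> Q" using assms(1) by (auto simp: chains_def)
  then have "chain_sum (\<lambda>_. 0) xs \<le> chain_sum k xs" using assms(2) by (intro chain_sum_mono) auto
  then show ?thesis by (simp add: chain_sum_def)
qed

lemma chain_inf_le:
  assumes "xs \<in> chains Q x y" "\<And>p. p \<in> Q \<times> Q \<Longrightarrow> 0 \<le> k p"
  shows "chain_inf Q k x y \<le> chain_sum k xs"
  unfolding chain_inf_def
  by (rule cINF_lower[OF bdd_belowI2[of _ 0] assms(1)]) (rule chain_sum_nonneg[OF _ assms(2)])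

lemma chain_inf_greatest:
  assumes "x \<in> Q" "y \<in> Q" "\<And>xs. xs \<in> chains Q x y \<Longrightarrow> a \<le> chain_sum k xs"
  shows "a \<le> chain_inf Q k x y"
  unfolding chain_inf_def by (rule cINF_greatest[OF _ assms(3)]) (use two_chain[OF assms(1,2)] in blast)

lemma chain_inf_approx:
  fixes e :: real
  assumes "x \<in> Q" "y \<in> Q" "e > 0"
  obtains xs where "xs \<in> chains Q x y" "chain_sum k xs < chain_inf Q k x y + e"
proof -
  have "\<exists>xs\<in>chains Q x y. chain_sum k xs < chain_inf Q k x y + e"
  proof (rule ccontr)
    assume "\<not> ?thesis"
    then have "chain_inf Q k x y + e \<le> chain_inf Q k x y" using assms by (intro chain_inf_greatest) auto
    then show False using assms by simp
  qed
  then show ?thesis using that by blast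
qed

text \<open>Only the part of a nearly optimal chain inside the cell \<open>c j\<close> becomes more expensive when \<open>k\<close> is
  replaced by \<open>k' j\<close>, and that part costs at most about \<open>C \<delta>\<close>, as it could be bypassed by one step.\<close>

lemma sum_square_increments_le:
  fixes k d0 :: "'a \<times> 'a \<Rightarrow> real" and k' :: "'j \<Rightarrow> 'a \<times> 'a \<Rightarrow> real" and c :: "'j \<Rightarrow> 'a set"
  assumes zw: "z \<in> Q" "w \<in> Q" and J: "finite J" and C: "C \<ge> 1" and \<delta>: "\<delta> \<ge> 0"
    and disj: "\<And>i j. i \<in> J \<Longrightarrow> j \<in> J \<Longrightarrow> i \<noteq> j \<Longrightarrow> c i \<inter> c j = {}"
    and k0: "\<And>x y. x \<in> Q \<Longrightarrow> y \<in> Q \<Longrightarrow> 0 \<le> k (x, y)"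
    and k1: "\<And>x y. x \<in> Q \<Longrightarrow> y \<in> Q \<Longrightarrow> k (x, y) \<le> C * d0 (x, y)"
    and k2: "\<And>x y. x \<in> Q \<Longrightarrow> y \<in> Q \<Longrightarrow> d0 (x, y) \<le> C * k (x, y)"
    and k3: "\<And>j x y. j \<in> J \<Longrightarrow> x \<in> Q \<Longrightarrow> y \<in> Q \<Longrightarrow> k (x, y) \<le> k' j (x, y)"
    and k4: "\<And>j x y. j \<in> J \<Longrightarrow> x \<in> Q \<Longrightarrow> y \<in> Q \<Longrightarrow> k' j (x, y) \<le> C * d0 (x, y)"
    and k5: "\<And>j x y. j \<in> J \<Longrightarrow> x \<in> Q \<Longrightarrow> y \<in> Q \<Longrightarrow> \<not> (x \<in> c j \<and> y \<in> c j) \<Longrightarrow> k' j (x, y) = k (x, y)"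
    and small: "\<And>j x y. j \<in> J \<Longrightarrow> x \<in> Q \<Longrightarrow> y \<in> Q \<Longrightarrow> x \<in> c j \<Longrightarrow> y \<in> c j \<Longrightarrow> d0 (x, y) \<le> \<delta>"
  shows "(\<Sum>j\<in>J. (chain_inf Q k z w - chain_inf Q (k' j) z w)\<^sup>2) \<le> C ^ 6 * \<delta> * d0 (z, w)"
proof -
  let ?X = "chain_inf Q k z w" and ?Y = "\<lambda>j. chain_inf Q (k' j) z w"
  have k0': "0 \<le> k p" if "p \<in> Q \<times> Q" for p using k0 that by (cases p) simp
  have k'0: "0 \<le> k' j p" if "j \<in> J" "p \<in> Q \<times> Q" for j p
    using k0[of "fst p" "snd p"] k3[OF that(1), of "fst p" "snd p"] that(2) by (simp add: mem_Times_iff)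
  have XY: "?X \<le> ?Y j" if j: "j \<in> J" for j
  proof (rule chain_inf_greatest[OF zw])
    fix xs assume xs: "xs \<in> chains Q z w"
    have "?X \<le> chain_sum k xs" by (rule chain_inf_le[OF xs k0'])
    also have "\<dots> \<le> chain_sum (k' j) xs" by (rule chain_sum_mono[of _ Q]) (use xs k3[OF j] in \<open>auto simp: chains_def\<close>)
    finally show "?X \<le> chain_sum (k' j) xs" .
  qed
  have X0: "0 \<le> ?X" by (rule chain_inf_greatest[OF zw]) (rule chain_sum_nonneg[OF _ k0'])
  have XB: "?X \<le> C * d0 (z, w)"
  proof -
    have "?X \<le> chain_sum k [z, w]" by (rule chain_inf_le[OF two_chain[OF zw] k0'])
    with k1[OF zw] show ?thesis by simp
  qed
  \<comment> \<open>The slack \<open>e\<close> of a nearly optimal chain is kept explicit and sent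
    to \<open>0\<close> at the end, because the infimum over chains need not be attained.\<close>
  have main: "(\<Sum>j\<in>J. (?X - ?Y j)\<^sup>2) \<le> (e + C\<^sup>2 * (e + C * \<delta>)) * (real (card J) * e + C\<^sup>2 * (?X + e))" if e: "e > 0" for e :: real
  proof -
    obtain xs where xs: "xs \<in> chains Q z w" "chain_sum k xs < ?X + e" by (rule chain_inf_approx[OF zw e])
    obtain x n where x: "xs = map x [0..<Suc n]" "x 0 = z" "x n = w" "\<And>i. i \<le> n \<Longrightarrow> x i \<in> Q"
      using xs(1) unfolding chains_map by blast
    have sum: "chain_sum q xs = (\<Sum>i<n. q (x i, x (Suc i)))" for q :: "_ \<Rightarrow> real" unfolding x(1) chain_sum_map by (simp add: atLeast0LessThan)
    \<comment> \<open>The part of the cost of the chain that is paid on steps inside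
      \<open>c j\<close>. Only these steps change their price under \<open>k' j\<close>, and the new
      price is at most \<open>C * d0\<close>, hence at most \<open>C\<^sup>2\<close> times the old
      one.\<close>
    define S where "S j = (\<Sum>i<n. if x i \<in> c j \<and> x (Suc i) \<in> c j then k (x i, x (Suc i)) else 0)" for j
    have kx: "0 \<le> k (x i, x (Suc i))" if "i < n" for i using k0 x(4) that by simp
    have S0: "0 \<le> S j" for j unfolding S_def using kx by (intro sum_nonneg) auto
    have 1: "?Y j - ?X \<le> e + C\<^sup>2 * S j" if j: "j \<in> J" for j
    proof -
      have "?Y j \<le> chain_sum (k' j) xs" by (rule chain_inf_le[OF xs(1) k'0[OF j]])
      also have "\<dots> \<le> (\<Sum>i<n. k (x i, x (Suc i)) + C\<^sup>2 * (if x i \<in> c j \<and> x (Suc i) \<in> c j then k (x i, x (Suc i)) else 0))"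
        unfolding sum
      proof (rule sum_mono)
        fix i assume "i \<in> {..<n}"
        then have xi: "x i \<in> Q" "x (Suc i) \<in> Q" using x(4) by auto
        have "k' j (x i, x (Suc i)) \<le> C * d0 (x i, x (Suc i))" by (rule k4[OF j xi])
        also have "\<dots> \<le> C * (C * k (x i, x (Suc i)))" using k2[OF xi] C by (intro mult_left_mono) auto
        finally have "k' j (x i, x (Suc i)) \<le> C\<^sup>2 * k (x i, x (Suc i))" by (simp add: power2_eq_square mult.assoc)
        then show "k' j (x i, x (Suc i)) \<le> k (x i, x (Suc i)) + C\<^sup>2 * (if x i \<in> c j \<and> x (Suc i) \<in> c j then k (x i, x (Suc i)) else 0)"
          using k5[OF j xi] k0[OF xi] by auto
      qed
      also have "\<dots> = chain_sum k xs + C\<^sup>2 * S j" unfolding S_def sum by (simp add: sum.distrib sum_distrib_left)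
      finally show ?thesis using xs(2) by simp
    qed
    have 2: "(\<Sum>j\<in>J. S j) \<le> ?X + e"
    proof -
      have "(\<Sum>j\<in>J. S j) = (\<Sum>i<n. \<Sum>j\<in>J. if x i \<in> c j \<and> x (Suc i) \<in> c j then k (x i, x (Suc i)) else 0)"
        unfolding S_def by (rule sum.swap)
      also have "\<dots> \<le> (\<Sum>i<n. k (x i, x (Suc i)))"
        using disj kx by (intro sum_mono sum_at_most_one[OF J]) blast+
      finally show ?thesis using xs(2) unfolding sum by simp
    qed
    \<comment> \<open>Between its first and its last visit to \<open>c j\<close> the chain can be
      shortcut by a single step of cost at most \<open>C * \<delta>\<close>. As the chain is optimal
      up to \<open>e\<close>, what it spends in between exceeds this by at most
      \<open>e\<close>.\<close>
    have 3: "S j \<le> e + C * \<delta>" if j: "j \<in> J" for j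
    proof (cases "{i. i \<le> n \<and> x i \<in> c j} = {}")
      case True
      then have "S j = (\<Sum>i<n. 0)" unfolding S_def by (intro sum.cong) auto
      then show ?thesis using e C \<delta> by simp
    next
      case False
      let ?I = "{i. i \<le> n \<and> x i \<in> c j}"
      define a where "a = Min ?I"
      define b where "b = Max ?I"
      have fin: "finite ?I" by simp
      have a: "a \<le> n" "x a \<in> c j" using Min_in[OF fin False] by (auto simp: a_def)
      have b: "b \<le> n" "x b \<in> c j" using Max_in[OF fin False] by (auto simp: b_def)
      have ab: "a \<le> b" using Min_le[OF fin Max_in[OF fin False]] by (simp add: a_def b_def)
      have ge: "a \<le> i" "i \<le> b" if "i \<le> n" "x i \<in> c j" for i using that Min_le[OF fin] Max_ge[OF fin] by (auto simp: a_def b_def)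
      have "S j = (\<Sum>i\<in>{0..<n}. if x i \<in> c j \<and> x (Suc i) \<in> c j then k (x i, x (Suc i)) else 0)" by (simp add: S_def atLeast0LessThan)
      also have "\<dots> = (\<Sum>i\<in>{a..<b}. if x i \<in> c j \<and> x (Suc i) \<in> c j then k (x i, x (Suc i)) else 0)"
      proof (rule sum.mono_neutral_right)
        show "\<forall>i\<in>{0..<n} - {a..<b}. (if x i \<in> c j \<and> x (Suc i) \<in> c j then k (x i, x (Suc i)) else 0) = 0"
        proof
          fix i assume i: "i \<in> {0..<n} - {a..<b}"
          then have "\<not> (x i \<in> c j \<and> x (Suc i) \<in> c j)" using ge(1)[of i] ge(2)[of "Suc i"] by fastforce
          then show "(if x i \<in> c j \<and> x (Suc i) \<in> c j then k (x i, x (Suc i)) else 0) = 0" by (rule if_not_P)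
        qed
      qed (use b in auto)
      also have "\<dots> \<le> (\<Sum>i\<in>{a..<b}. k (x i, x (Suc i)))" using kx b by (intro sum_mono) auto
      finally have Sab: "S j \<le> (\<Sum>i\<in>{a..<b}. k (x i, x (Suc i)))" .
      let ?ys = "map x [0..<a] @ x a # map x [b..<Suc n]"
      have bn: "map x [b..<Suc n] = x b # map x [Suc b..<Suc n]" using b(1) by (simp add: upt_conv_Cons del: upt_Suc)
      have ys: "?ys \<in> chains Q z w"
      proof -
        have "hd ?ys = z" using x(2) by (cases a) (auto simp: upt_conv_Cons simp del: upt_Suc)
        moreover have "last ?ys = w" using b(1) x(3) by (simp add: last_map)
        moreover have "set ?ys \<subseteq> Q" using x(4) a(1) by (auto simp del: upt_Suc)
        ultimately show ?thesis by (simp add: chains_def lists_eq_set del: upt_Suc)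
      qed
      have "chain_sum k ?ys = chain_sum k (map x [0..<Suc a]) + chain_sum k (x a # map x [b..<Suc n])"
        by (subst chain_sum_append) simp
      also have "chain_sum k (x a # map x [b..<Suc n]) = k (x a, x b) + chain_sum k (map x [b..<Suc n])"
        unfolding bn by simp
      finally have ysum: "chain_sum k ?ys = (\<Sum>i\<in>{0..<a}. k (x i, x (Suc i))) + (k (x a, x b) + (\<Sum>i\<in>{b..<n}. k (x i, x (Suc i))))"
        by (simp only: chain_sum_map)
      have "k (x a, x b) \<le> C * d0 (x a, x b)" using k1 x(4) a b by simp
      also have "\<dots> \<le> C * \<delta>" using small[OF j x(4)[OF a(1)] x(4)[OF b(1)] a(2) b(2)] C by (intro mult_left_mono) auto
      finally have kab: "k (x a, x b) \<le> C * \<delta>" .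
      have "?X \<le> chain_sum k ?ys" by (rule chain_inf_le[OF ys k0'])
      moreover have "(\<Sum>i<n. k (x i, x (Suc i))) = (\<Sum>i\<in>{0..<a}. k (x i, x (Suc i))) + (\<Sum>i\<in>{a..<b}. k (x i, x (Suc i))) + (\<Sum>i\<in>{b..<n}. k (x i, x (Suc i)))"
        using ab b(1) by (simp add: sum.atLeastLessThan_concat atLeast0LessThan[symmetric])
      ultimately show ?thesis using Sab kab xs(2) unfolding ysum sum by linarith
    qed
    \<comment> \<open>One factor of the square is bounded uniformly through the shortcut; the other
      is kept, because its sum over all cells is controlled by the total cost of the chain.\<close>
    have "(?X - ?Y j)\<^sup>2 \<le> (e + C\<^sup>2 * (e + C * \<delta>)) * (e + C\<^sup>2 * S j)" if j: "j \<in> J" for j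
    proof -
      have "(?X - ?Y j)\<^sup>2 = (?Y j - ?X) * (?Y j - ?X)" by (simp add: power2_eq_square algebra_simps)
      also have "\<dots> \<le> (e + C\<^sup>2 * (e + C * \<delta>)) * (e + C\<^sup>2 * S j)"
      proof (rule mult_mono)
        have "C\<^sup>2 * S j \<le> C\<^sup>2 * (e + C * \<delta>)" by (rule mult_left_mono[OF 3[OF j]]) simp
        with 1[OF j] show "?Y j - ?X \<le> e + C\<^sup>2 * (e + C * \<delta>)" by linarith
      qed (use 1[OF j] XY[OF j] e C \<delta> in auto)
      finally show ?thesis .
    qed
    then have "(\<Sum>j\<in>J. (?X - ?Y j)\<^sup>2) \<le> (\<Sum>j\<in>J. (e + C\<^sup>2 * (e + C * \<delta>)) * (e + C\<^sup>2 * S j))" by (rule sum_mono)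
    also have "\<dots> = (e + C\<^sup>2 * (e + C * \<delta>)) * (real (card J) * e + C\<^sup>2 * (\<Sum>j\<in>J. S j))"
      by (simp add: sum_distrib_left[symmetric] sum.distrib)
    also have "\<dots> \<le> (e + C\<^sup>2 * (e + C * \<delta>)) * (real (card J) * e + C\<^sup>2 * (?X + e))"
      using 2 e C \<delta> by (intro mult_left_mono add_left_mono) auto
    finally show ?thesis .
  qed
  \<comment> \<open>In the limit the two factors are \<open>C ^ 3 * \<delta>\<close> and
    \<open>C\<^sup>2 * ?X\<close>; with \<open>?X \<le> C * d0 (z, w)\<close> this accounts for the
    sixth power of \<open>C\<close>.\<close>
  have "((\<lambda>e::real. (e + C\<^sup>2 * (e + C * \<delta>)) * (real (card J) * e + C\<^sup>2 * (?X + e))) \<longlongrightarrow> (0 + C\<^sup>2 * (0 + C * \<delta>)) * (real (card J) * 0 + C\<^sup>2 * (?X + 0))) (at_right 0)"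
    by (intro tendsto_intros)
  then have "(\<Sum>j\<in>J. (?X - ?Y j)\<^sup>2) \<le> (0 + C\<^sup>2 * (0 + C * \<delta>)) * (real (card J) * 0 + C\<^sup>2 * (?X + 0))"
    by (rule tendsto_lowerbound) (auto simp: eventually_at_right_field intro!: exI[of _ 1] main)
  also have "\<dots> = (C ^ 5 * \<delta>) * ?X" by (simp add: power2_eq_square eval_nat_numeral)
  also have "\<dots> \<le> (C ^ 5 * \<delta>) * (C * d0 (z, w))" using XB C \<delta> by (intro mult_left_mono) auto
  finally show ?thesis by (simp add: eval_nat_numeral algebra_simps)
qed

section \<open>The cells as independent coordinates\<close>

definition cell_space :: "complex \<times> complex \<Rightarrow> (complex \<times> complex \<Rightarrow> ennreal) measure" where
  "cell_space j = (\<Pi>\<^sub>M p\<in>rational_points (cell j) \<times> rational_points (cell j). (borel :: ennreal measure))"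

text \<open>The default \<open>0\<close> for cells outside \<open>U\<close> makes the map measurable
  for every index, so that its law is a probability measure for all \<open>j\<close>, as the product
  measures and \<open>efron_stein\<close> demand of the whole family.\<close>

definition cell_metric :: "complex set \<Rightarrow> complex \<times> complex \<Rightarrow> (complex \<times> complex \<Rightarrow> ennreal) \<Rightarrow> complex \<times> complex \<Rightarrow> ennreal" where
  "cell_metric U j E = (\<lambda>p\<in>rational_points (cell j) \<times> rational_points (cell j). if cell j \<subseteq> U then chain_metric U (cell j) E p else 0)"

lemma measurable_cell_metric: "cell_metric U j \<in> metric_space_borel U \<rightarrow>\<^sub>M cell_space j"
  unfolding cell_metric_def cell_space_def
proof (rule measurable_restrict)
  fix p
  show "(\<lambda>E. if cell j \<subseteq> U then chain_metric U (cell j) E p else 0) \<in> borel_measurable (metric_space_borel U)"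
    by (cases "cell j \<subseteq> U") (simp_all add: measurable_chain_metric)
qed

lemma Int_stable_chain_events: "Int_stable {chain_event U {j} \<F> |\<F>. \<F> j \<in> cell_constraints j}"
proof (rule Int_stableI)
  fix A B assume "A \<in> {chain_event U {j} \<F> |\<F>. \<F> j \<in> cell_constraints j}" "B \<in> {chain_event U {j} \<F> |\<F>. \<F> j \<in> cell_constraints j}"
  then obtain F G where FG: "A = chain_event U {j} F" "F j \<in> cell_constraints j" "B = chain_event U {j} G" "G j \<in> cell_constraints j" by blast
  have "A \<inter> B = chain_event U {j} (\<lambda>_. F j \<union> G j)" unfolding FG chain_event_def by blast
  moreover have "F j \<union> G j \<in> cell_constraints j" using FG by (simp add: cell_constraints_def)
  ultimately show "A \<inter> B \<in> {chain_event U {j} \<F> |\<F>. \<F> j \<in> cell_constraints j}" by (intro CollectI exI[of _ "\<lambda>_. F j \<union> G j"]) simp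
qed

text \<open>An upper bound by an arbitrary \<open>a\<close> is a countable union of upper bounds by
  rational thresholds, and each of these is a chain event with a single constraint.\<close>

lemma cell_metric_sigma_chain_events:
  assumes j: "cell j \<subseteq> U"
  shows "cell_metric U j \<in> sigma (continuous_metrics U) {chain_event U {j} \<F> |\<F>. \<F> j \<in> cell_constraints j} \<rightarrow>\<^sub>M cell_space j"
    (is "_ \<in> sigma _ ?G \<rightarrow>\<^sub>M _")
  unfolding cell_metric_def cell_space_def
proof (rule measurable_restrict)
  fix p assume p: "p \<in> rational_points (cell j) \<times> rational_points (cell j)"
  have G: "?G \<subseteq> Pow (continuous_metrics U)" by (auto simp: chain_event_def)
  let ?S = "sigma (continuous_metrics U) ?G"
  have 1: "{E \<in> continuous_metrics U. chain_metric U (cell j) E p < ennreal r} \<in> sets ?S" if r: "r \<in> \<rat>" for r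
  proof -
    have "{E \<in> continuous_metrics U. chain_metric U (cell j) E p < ennreal r} = chain_event U {j} (\<lambda>_. {(p, r)})"
      by (simp add: chain_event_def)
    moreover have "{(p, r)} \<in> cell_constraints j" using p r by (simp add: cell_constraints_def)
    ultimately have "{E \<in> continuous_metrics U. chain_metric U (cell j) E p < ennreal r} \<in> ?G" by (intro CollectI exI[of _ "\<lambda>_. {(p, r)}"]) simp
    then show ?thesis using G by (simp add: sigma_sets.Basic)
  qed
  have "(\<lambda>E. chain_metric U (cell j) E p) \<in> borel_measurable ?S"
  proof (rule borel_measurableI_less)
    fix a :: ennreal
    have "{E \<in> space ?S. chain_metric U (cell j) E p < a} = (\<Union>r\<in>{r \<in> \<rat>. ennreal r \<le> a}. {E \<in> continuous_metrics U. chain_metric U (cell j) E p < ennreal r})"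
    proof (intro equalityI subsetI)
      fix E assume "E \<in> {E \<in> space ?S. chain_metric U (cell j) E p < a}"
      then have E: "E \<in> continuous_metrics U" "chain_metric U (cell j) E p < a" using G by (auto simp: space_measure_of)
      obtain b where b: "chain_metric U (cell j) E p < b" "b < a" using dense[OF E(2)] by blast
      obtain x where x: "chain_metric U (cell j) E p = ennreal x" "x \<ge> 0" using b(1) by (cases "chain_metric U (cell j) E p") auto
      have "\<exists>y. b = ennreal y \<and> 0 \<le> y" using b(2) by (cases b) auto
      then obtain y where y: "b = ennreal y" "0 \<le> y" by blast
      have "x < y" using b(1) x y by (simp add: ennreal_less_iff)
      then obtain r where r: "r \<in> \<rat>" "x < r" "r < y" using Rats_dense_in_real by blast
      have "ennreal r \<le> a" using r y b(2) by (meson ennreal_leI less_imp_le order_trans)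
      moreover have "chain_metric U (cell j) E p < ennreal r" using x r by (simp add: ennreal_lessI)
      ultimately show "E \<in> (\<Union>r\<in>{r \<in> \<rat>. ennreal r \<le> a}. {E \<in> continuous_metrics U. chain_metric U (cell j) E p < ennreal r})" using r E by blast
    qed (use G in \<open>auto simp: space_measure_of dest: order.strict_trans2\<close>)
    also have "\<dots> \<in> sets ?S" by (intro sets.countable_UN' countable_subset[OF _ countable_rat]) (use 1 in auto)
    finally show "{E \<in> space ?S. chain_metric U (cell j) E p < a} \<in> sets ?S" .
  qed
  then show "(\<lambda>E. if cell j \<subseteq> U then chain_metric U (cell j) E p else 0) \<in> borel_measurable ?S" using j by simp
qed

text \<open>The product formula on intersection-stable generators gives independence of the cells,
  which is equality of the joint law with the product of the marginals. The empty family is treated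
  directly, since that criterion is stated for a nonempty index set.\<close>

lemma distr_cells_eq_PiM:
  assumes \<mu>: "prob_space \<mu>" "sets \<mu> = sets (metric_space_borel U)"
    and J: "finite J" "\<And>j. j \<in> J \<Longrightarrow> cell j \<subseteq> U"
    and prod: "\<And>I \<F>. I \<subseteq> J \<Longrightarrow> (\<And>j. j \<in> I \<Longrightarrow> \<F> j \<in> cell_constraints j) \<Longrightarrow>
      measure \<mu> (chain_event U I \<F>) = (\<Prod>j\<in>I. measure \<mu> (chain_event U {j} \<F>))"
  shows "distr \<mu> (PiM J cell_space) (\<lambda>E. \<lambda>j\<in>J. cell_metric U j E) = PiM J (\<lambda>j. distr \<mu> (cell_space j) (cell_metric U j))"
proof -
  interpret prob_space \<mu> by (rule \<mu>)
  have sp: "space \<mu> = continuous_metrics U" using sets_eq_imp_space_eq[OF \<mu>(2)] space_metric_space_borel by simp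
  have meas: "cell_metric U j \<in> \<mu> \<rightarrow>\<^sub>M cell_space j" for j using measurable_cell_metric \<mu>(2) by (simp cong: measurable_cong_sets)
  show ?thesis
  proof (cases "J = {}")
    case True
    show ?thesis unfolding True
    proof (rule measure_eqI)
      fix A assume A: "A \<in> sets (distr \<mu> (PiM {} cell_space) (\<lambda>E. \<lambda>j\<in>{}. cell_metric U j E))"
      then have "A = {} \<or> A = {\<lambda>_. undefined}" by (auto simp: sets_PiM_empty)
      then show "emeasure (distr \<mu> (PiM {} cell_space) (\<lambda>E. \<lambda>j\<in>{}. cell_metric U j E)) A = emeasure (PiM {} (\<lambda>j. distr \<mu> (cell_space j) (cell_metric U j))) A"
      proof
        assume "A = {\<lambda>_. undefined}"
        moreover have "(\<lambda>E. \<lambda>j\<in>{}. cell_metric U j E) -` {\<lambda>_. undefined} \<inter> space \<mu> = space \<mu>" by (auto simp: restrict_def)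
        ultimately show ?thesis using A by (subst emeasure_distr[OF measurable_restrict]) (auto simp: emeasure_space_1 PiM_empty emeasure_count_space)
      qed simp
    qed (simp add: sets_PiM_empty)
  next
    case False
    let ?G = "\<lambda>j. {chain_event U {j} \<F> |\<F>. \<F> j \<in> cell_constraints j}"
    have "indep_sets ?G J"
    proof (rule indep_setsI)
      fix j assume "j \<in> J" then show "?G j \<subseteq> events" using chain_event_sets[of "{j}" U] J(2) \<mu>(2) by auto
    next
      fix A I assume I: "I \<noteq> {}" "I \<subseteq> J" "finite I" "\<forall>j\<in>I. A j \<in> ?G j"
      then obtain F where F: "\<And>j. j \<in> I \<Longrightarrow> A j = chain_event U {j} (F j) \<and> F j j \<in> cell_constraints j" by (auto dest!: bchoice)
      have eq: "A j = chain_event U {j} (\<lambda>j. F j j)" if "j \<in> I" for j using F[OF that] by (simp add: chain_event_def)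
      have "(\<Inter>j\<in>I. A j) = (\<Inter>j\<in>I. chain_event U {j} (\<lambda>j. F j j))" using eq by (rule INF_cong[OF refl])
      also have "\<dots> = chain_event U I (\<lambda>j. F j j)" using I(1) by (auto simp: chain_event_def)
      finally have "prob (\<Inter>j\<in>I. A j) = prob (chain_event U I (\<lambda>j. F j j))" by simp
      also have "\<dots> = (\<Prod>j\<in>I. prob (chain_event U {j} (\<lambda>j. F j j)))" using F by (intro prod I) blast
      also have "\<dots> = (\<Prod>j\<in>I. prob (A j))" using eq by simp
      finally show "prob (\<Inter>j\<in>I. A j) = (\<Prod>j\<in>I. prob (A j))" .
    qed
    then have 1: "indep_sets (\<lambda>j. sigma_sets (space \<mu>) (?G j)) J" by (rule indep_sets_sigma[OF _ Int_stable_chain_events])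
    have "indep_sets (\<lambda>j. {cell_metric U j -` A \<inter> space \<mu> |A. A \<in> sets (cell_space j)}) J"
    proof (rule indep_sets_mono_sets[OF 1], rule subsetI)
      fix j B assume j: "j \<in> J" and "B \<in> {cell_metric U j -` A \<inter> space \<mu> |A. A \<in> sets (cell_space j)}"
      then obtain A where A: "B = cell_metric U j -` A \<inter> space \<mu>" "A \<in> sets (cell_space j)" by blast
      have G: "?G j \<subseteq> Pow (continuous_metrics U)" by (auto simp: chain_event_def)
      have "B \<in> sets (sigma (continuous_metrics U) (?G j))"
        using measurable_sets[OF cell_metric_sigma_chain_events[OF J(2)[OF j]] A(2)] G unfolding A(1) sp by (simp add: space_measure_of)
      then show "B \<in> sigma_sets (space \<mu>) (?G j)" using G by (simp add: sp)
    qed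
    then have "indep_vars cell_space (cell_metric U) J" using meas by (simp add: indep_vars_def2)
    then show ?thesis by (subst (asm) indep_vars_iff_distr_eq_PiM[OF False]) (rule meas)
  qed
qed

text \<open>In place of \<open>E\<close> one may use the internal metric of the cell containing both points if it is smaller than \<open>C * D\<^sub>0\<close>,
  and \<open>C * D\<^sub>0\<close> otherwise. This depends on \<open>E\<close> only through the cells.\<close>

definition cell_cost :: "real \<Rightarrow> (complex \<times> complex \<Rightarrow> ennreal) \<Rightarrow> (complex \<times> complex) set
    \<Rightarrow> (complex \<times> complex \<Rightarrow> complex \<times> complex \<Rightarrow> ennreal) \<Rightarrow> complex \<times> complex \<Rightarrow> real" where
  "cell_cost C D\<^sub>0 J \<zeta> = (\<lambda>(x, y). enn2real (min (ennreal C * D\<^sub>0 (x, y)) (INF j\<in>{j \<in> J. x \<in> cell j \<and> y \<in> cell j}. \<zeta> j (x, y))))"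

lemma cell_cost_nonneg: "0 \<le> cell_cost C D\<^sub>0 J \<zeta> p"
  by (simp add: cell_cost_def case_prod_beta)

lemma cell_cost_le: 
  assumes "C \<ge> 0" "D\<^sub>0 p < \<infinity>" shows "cell_cost C D\<^sub>0 J \<zeta> p \<le> C * enn2real (D\<^sub>0 p)"
proof -
  have "ennreal C * D\<^sub>0 p < \<top>" using assms by (simp add: ennreal_mult_less_top)
  then have "cell_cost C D\<^sub>0 J \<zeta> p \<le> enn2real (ennreal C * D\<^sub>0 p)" unfolding cell_cost_def case_prod_beta by (intro enn2real_mono) auto
  then show ?thesis using assms by (simp add: enn2real_mult)
qed

lemma cell_cost_antimono: 
  assumes "D\<^sub>0 p < \<infinity>" "J' \<subseteq> J" shows "cell_cost C D\<^sub>0 J \<zeta> p \<le> cell_cost C D\<^sub>0 J' \<zeta> p"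
proof -
  have "ennreal C * D\<^sub>0 p < \<top>" using assms by (simp add: ennreal_mult_less_top)
  then show ?thesis unfolding cell_cost_def case_prod_beta using assms(2) 
    by (intro enn2real_mono min.mono INF_superset_mono) (auto simp: min_less_iff_disj)
qed

lemma cell_cost_remove:
  assumes "\<not> (x \<in> cell j \<and> y \<in> cell j)" shows "cell_cost C D\<^sub>0 (J - {j}) \<zeta> (x, y) = cell_cost C D\<^sub>0 J \<zeta> (x, y)"
proof -
  have "{i \<in> J - {j}. x \<in> cell i \<and> y \<in> cell i} = {i \<in> J. x \<in> cell i \<and> y \<in> cell i}" using assms by auto
  then show ?thesis by (simp add: cell_cost_def)
qed

lemma measurable_cell_cost:
  assumes J': "J' \<subseteq> J" "finite J" and xy: "x \<in> rational_points U" "y \<in> rational_points U"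
  shows "(\<lambda>\<zeta>. cell_cost C D\<^sub>0 J' \<zeta> (x, y)) \<in> borel_measurable (PiM J cell_space)"
proof -
  have "(\<lambda>\<zeta>. \<zeta> j (x, y)) \<in> borel_measurable (PiM J cell_space)" if "j \<in> {j \<in> J'. x \<in> cell j \<and> y \<in> cell j}" for j
  proof (rule measurable_compose[where g="\<lambda>\<xi>. \<xi> (x, y)"])
    show "(\<lambda>\<zeta>. \<zeta> j) \<in> PiM J cell_space \<rightarrow>\<^sub>M cell_space j" using that J' by (intro measurable_component_singleton) auto
    show "(\<lambda>\<xi>. \<xi> (x, y)) \<in> borel_measurable (cell_space j)" unfolding cell_space_def
      using that xy by (intro measurable_component_singleton) (auto simp: rational_points_def)
  qed
  then have [measurable]: "(\<lambda>\<zeta>. INF j\<in>{j \<in> J'. x \<in> cell j \<and> y \<in> cell j}. \<zeta> j (x, y)) \<in> borel_measurable (PiM J cell_space)"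
    using finite_subset[OF J'] by (intro borel_measurable_INF) (auto intro: countable_finite)
  show ?thesis unfolding cell_cost_def prod.case by measurable
qed

lemma measurable_chain_inf:
  assumes Q: "countable Q" and k: "\<And>x y. x \<in> Q \<Longrightarrow> y \<in> Q \<Longrightarrow> (\<lambda>\<zeta>. k \<zeta> (x, y)) \<in> borel_measurable N"
  shows "(\<lambda>\<zeta>. chain_inf Q (k \<zeta>) z w) \<in> borel_measurable N"
  unfolding chain_inf_def
proof (rule borel_measurable_cINF_real[OF countable_chains[OF Q]])
  fix xs assume "xs \<in> chains Q z w"
  then have "set xs \<subseteq> Q" by (simp add: chains_def lists_eq_set)
  then show "(\<lambda>\<zeta>. chain_sum (k \<zeta>) xs) \<in> borel_measurable N"
    unfolding chain_sum_def by (intro borel_measurable_sum k) (auto intro: subsetD[OF _ nth_mem])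
qed

text \<open>The situation after the field has been fixed: \<open>C\<close> and
  \<open>D\<^sub>0\<close> are deterministic, and the only randomness left is that of the metric
  \<open>E\<close>.\<close>

locale metric_bound =
  fixes U :: "complex set" and C :: real and D\<^sub>0 :: "complex \<times> complex \<Rightarrow> ennreal"
  assumes U: "open U" "connected U" and C: "C \<ge> 1" and D\<^sub>0: "D\<^sub>0 \<in> continuous_metrics U"
begin

definition equivalent :: "(complex \<times> complex \<Rightarrow> ennreal) \<Rightarrow> bool" where
  "equivalent E \<longleftrightarrow> E \<in> continuous_metrics U \<and>
     (\<forall>x\<in>U. \<forall>y\<in>U. E (x, y) \<le> ennreal C * D\<^sub>0 (x, y) \<and> D\<^sub>0 (x, y) \<le> ennreal C * E (x, y))"

lemma finite_metric: "E \<in> continuous_metrics U \<Longrightarrow> x \<in> U \<Longrightarrow> y \<in> U \<Longrightarrow> E (x, y) < \<infinity>"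
  using cmD(5)[of E U x y] connected_iff_connected_component[of U] U(2) by blast

lemma equivalent_real:
  assumes "equivalent E" "x \<in> U" "y \<in> U"
  shows "enn2real (E (x, y)) \<le> C * enn2real (D\<^sub>0 (x, y))" "enn2real (D\<^sub>0 (x, y)) \<le> C * enn2real (E (x, y))"
proof -
  have E: "E \<in> continuous_metrics U" "E (x, y) \<le> ennreal C * D\<^sub>0 (x, y)" "D\<^sub>0 (x, y) \<le> ennreal C * E (x, y)" using assms by (auto simp: equivalent_def)
  note fin = finite_metric[OF E(1) assms(2,3)] finite_metric[OF D\<^sub>0 assms(2,3)]
  show "enn2real (E (x, y)) \<le> C * enn2real (D\<^sub>0 (x, y))"
    using enn2real_mono[OF E(2)] fin C by (simp add: ennreal_mult_less_top enn2real_mult)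
  show "enn2real (D\<^sub>0 (x, y)) \<le> C * enn2real (E (x, y))"
    using enn2real_mono[OF E(3)] fin C by (simp add: ennreal_mult_less_top enn2real_mult)
qed

lemma le_chain_metric:
  assumes E: "E \<in> continuous_metrics U" and V: "V \<subseteq> U" and xy: "x \<in> rational_points V" "y \<in> rational_points V"
  shows "E (x, y) \<le> chain_metric U V E (x, y)"
  unfolding chain_metric_def prod.case
proof (rule INF_greatest)
  fix xs assume xs: "xs \<in> chains (rational_points V) x y"
  have "E (x, y) \<le> chain_sum E xs"
  proof (rule le_chain_sum[OF xs])
    fix x assume "x \<in> rational_points V" then show "E (x, x) \<le> 0" using cm_refl[OF E, of x] V rational_points_subset[of V] by auto
  next
    fix x y z assume "x \<in> rational_points V" "y \<in> rational_points V" "z \<in> rational_points V"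
    then show "E (x, z) \<le> E (x, y) + E (y, z)" using cmD(4)[OF E, of x y z] V rational_points_subset[of V] by auto
  qed
  also have "\<dots> \<le> chain_sum (local_step U V E) xs"
    using xs by (intro chain_sum_mono[of _ "rational_points V"]) (auto simp: chains_def local_step_def)
  finally show "E (x, y) \<le> chain_sum (local_step U V E) xs" .
qed

lemma le_cell_cost:
  assumes E: "equivalent E" and J: "\<And>j. j \<in> J \<Longrightarrow> cell j \<subseteq> U" "J' \<subseteq> J" and xy: "x \<in> rational_points U" "y \<in> rational_points U"
  shows "enn2real (E (x, y)) \<le> cell_cost C D\<^sub>0 J' (\<lambda>j\<in>J. cell_metric U j E) (x, y)"
  unfolding cell_cost_def prod.case
proof (rule enn2real_mono)
  have xyU: "x \<in> U" "y \<in> U" using xy rational_points_subset by auto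
  have EU: "E \<in> continuous_metrics U" using E by (simp add: equivalent_def)
  show "E (x, y) \<le> min (ennreal C * D\<^sub>0 (x, y)) (INF j\<in>{j \<in> J'. x \<in> cell j \<and> y \<in> cell j}. (\<lambda>j\<in>J. cell_metric U j E) j (x, y))"
  proof (rule min.boundedI)
    show "E (x, y) \<le> ennreal C * D\<^sub>0 (x, y)" using E xyU by (simp add: equivalent_def)
    show "E (x, y) \<le> (INF j\<in>{j \<in> J'. x \<in> cell j \<and> y \<in> cell j}. (\<lambda>j\<in>J. cell_metric U j E) j (x, y))"
    proof (rule INF_greatest)
      fix j assume j: "j \<in> {j \<in> J'. x \<in> cell j \<and> y \<in> cell j}"
      then have jJ: "j \<in> J" using J(2) by blast
      note jJ = jJ J(1)[OF jJ]
      have R: "x \<in> rational_points (cell j)" "y \<in> rational_points (cell j)" using j xy by (auto simp: rational_points_def)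
      show "E (x, y) \<le> (\<lambda>j\<in>J. cell_metric U j E) j (x, y)"
        using le_chain_metric[OF EU jJ(2) R] jJ R by (simp add: cell_metric_def)
    qed
  qed
  have "ennreal C * D\<^sub>0 (x, y) < \<top>" using finite_metric[OF D\<^sub>0 xyU] C by (simp add: ennreal_mult_less_top)
  then show "min (ennreal C * D\<^sub>0 (x, y)) (INF j\<in>{j \<in> J'. x \<in> cell j \<and> y \<in> cell j}. (\<lambda>j\<in>J. cell_metric U j E) j (x, y)) < \<top>"
    by (simp add: min_less_iff_disj)
qed

lemma cell_cost_le_local:
  assumes E: "E \<in> continuous_metrics U" and j: "j \<in> J" "cell j \<subseteq> U" and xy: "x \<in> rational_points (cell j)" "y \<in> rational_points (cell j)"
    and less: "E (x, y) < boundary_dist U (cell j) E x"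
  shows "cell_cost C D\<^sub>0 J (\<lambda>j\<in>J. cell_metric U j E) (x, y) \<le> enn2real (E (x, y))"
  unfolding cell_cost_def prod.case
proof (rule enn2real_mono)
  have xyc: "x \<in> cell j" "y \<in> cell j" using xy rational_points_subset[of "cell j"] by auto
  have "chain_metric U (cell j) E (x, y) \<le> chain_sum (local_step U (cell j) E) [x, y]"
    unfolding chain_metric_def prod.case by (rule INF_lower) (rule two_chain[OF xy])
  also have "\<dots> = E (x, y)" using less by (simp add: local_step_def)
  finally have "(\<lambda>j\<in>J. cell_metric U j E) j (x, y) \<le> E (x, y)" using j xy by (simp add: cell_metric_def)
  then have "(INF j\<in>{j \<in> J. x \<in> cell j \<and> y \<in> cell j}. (\<lambda>j\<in>J. cell_metric U j E) j (x, y)) \<le> E (x, y)"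
    using j xyc by (intro INF_lower2[of j]) auto
  then show "min (ennreal C * D\<^sub>0 (x, y)) (INF j\<in>{j \<in> J. x \<in> cell j \<and> y \<in> cell j}. (\<lambda>j\<in>J. cell_metric U j E) j (x, y)) \<le> E (x, y)"
    by (rule min.coboundedI2)
  show "E (x, y) < \<top>" using finite_metric[OF E, of x y] xyc j(2) by auto
qed

definition cell_approx :: "(complex \<times> complex) set \<Rightarrow> complex \<Rightarrow> complex \<Rightarrow> (complex \<times> complex \<Rightarrow> ennreal) \<Rightarrow> real" where
  "cell_approx J z w E = chain_inf (rational_points U) (cell_cost C D\<^sub>0 J (\<lambda>j\<in>J. cell_metric U j E)) z w"

lemma chain_inf_cell_cost_bounds:
  assumes zw: "z \<in> rational_points U" "w \<in> rational_points U"
  shows "0 \<le> chain_inf (rational_points U) (cell_cost C D\<^sub>0 J \<zeta>) z w"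
    "chain_inf (rational_points U) (cell_cost C D\<^sub>0 J \<zeta>) z w \<le> C * enn2real (D\<^sub>0 (z, w))"
proof -
  show "0 \<le> chain_inf (rational_points U) (cell_cost C D\<^sub>0 J \<zeta>) z w"
    by (rule chain_inf_greatest[OF zw]) (rule chain_sum_nonneg[OF _ cell_cost_nonneg])
  have "chain_inf (rational_points U) (cell_cost C D\<^sub>0 J \<zeta>) z w \<le> chain_sum (cell_cost C D\<^sub>0 J \<zeta>) [z, w]"
    by (rule chain_inf_le[OF two_chain[OF zw] cell_cost_nonneg])
  also have "\<dots> \<le> C * enn2real (D\<^sub>0 (z, w))"
    using finite_metric[OF D\<^sub>0, of z w] subsetD[OF rational_points_subset zw(1)] subsetD[OF rational_points_subset zw(2)] C
    by (auto intro!: cell_cost_le)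
  finally show "chain_inf (rational_points U) (cell_cost C D\<^sub>0 J \<zeta>) z w \<le> C * enn2real (D\<^sub>0 (z, w))" .
qed

lemma measurable_cell_approx: 
  assumes "finite J" shows "cell_approx J z w \<in> borel_measurable (metric_space_borel U)"
proof -
  have 1: "(\<lambda>E. \<lambda>j\<in>J. cell_metric U j E) \<in> metric_space_borel U \<rightarrow>\<^sub>M PiM J cell_space"
    by (rule measurable_restrict) (rule measurable_cell_metric)
  have 2: "(\<lambda>\<zeta>. chain_inf (rational_points U) (cell_cost C D\<^sub>0 J \<zeta>) z w) \<in> borel_measurable (PiM J cell_space)"
    by (intro measurable_chain_inf countable_rational_points measurable_cell_cost[OF subset_refl assms])
  show ?thesis using measurable_compose[OF 1 2] unfolding cell_approx_def .
qed

lemma le_cell_approx: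
  assumes E: "equivalent E" and J: "\<And>j. j \<in> J \<Longrightarrow> cell j \<subseteq> U" and zw: "z \<in> rational_points U" "w \<in> rational_points U"
  shows "enn2real (E (z, w)) \<le> cell_approx J z w E"
  unfolding cell_approx_def
proof (rule chain_inf_greatest[OF zw])
  let ?Q = "rational_points U"
  have EU: "E \<in> continuous_metrics U" using E by (simp add: equivalent_def)
  have QU: "x \<in> ?Q \<Longrightarrow> x \<in> U" for x using rational_points_subset by auto
  fix xs assume xs: "xs \<in> chains ?Q z w"
  have "enn2real (E (z, w)) \<le> chain_sum (\<lambda>p. enn2real (E p)) xs"
  proof (rule le_chain_sum[OF xs])
    fix x assume "x \<in> ?Q" then show "enn2real (E (x, x)) \<le> 0" using cm_refl[OF EU QU, of x] by simp
  next
    fix x y z assume "x \<in> ?Q" "y \<in> ?Q" "z \<in> ?Q"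
    then have xyz: "x \<in> U" "y \<in> U" "z \<in> U" using QU by auto
    have "enn2real (E (x, z)) \<le> enn2real (E (x, y) + E (y, z))"
      using cmD(4)[OF EU xyz] finite_metric[OF EU] xyz by (intro enn2real_mono) auto
    also have "\<dots> = enn2real (E (x, y)) + enn2real (E (y, z))" using finite_metric[OF EU] xyz by (intro enn2real_plus) auto
    finally show "enn2real (E (x, z)) \<le> enn2real (E (x, y)) + enn2real (E (y, z))" .
  qed
  also have "\<dots> \<le> chain_sum (cell_cost C D\<^sub>0 J (\<lambda>j\<in>J. cell_metric U j E)) xs"
    using xs by (intro chain_sum_mono[of _ ?Q] le_cell_cost[OF E J]) (auto simp: chains_def)
  finally show "enn2real (E (z, w)) \<le> chain_sum (cell_cost C D\<^sub>0 J (\<lambda>j\<in>J. cell_metric U j E)) xs" .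
qed

text \<open>In Efron--Stein the comparison function for cell \<open>j\<close> is the same infimum
  with that cell dropped, so that steps inside it cost \<open>C * D\<^sub>0\<close>. The sum of the
  squared differences is bounded for almost every single \<open>E\<close>, not only in mean, so the
  number of cells does not enter.\<close>

lemma cell_approx_variance:
  assumes \<mu>: "prob_space \<mu>" "sets \<mu> = sets (metric_space_borel U)" and equiv: "AE E in \<mu>. equivalent E"
    and J: "finite J" "\<And>j. j \<in> J \<Longrightarrow> cell j \<subseteq> U" "\<And>i j. i \<in> J \<Longrightarrow> j \<in> J \<Longrightarrow> i \<noteq> j \<Longrightarrow> cell i \<inter> cell j = {}"
    and prod: "\<And>I \<F>. I \<subseteq> J \<Longrightarrow> (\<And>j. j \<in> I \<Longrightarrow> \<F> j \<in> cell_constraints j) \<Longrightarrow>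
      measure \<mu> (chain_event U I \<F>) = (\<Prod>j\<in>I. measure \<mu> (chain_event U {j} \<F>))"
    and small: "\<delta> \<ge> 0" "\<And>j x y. j \<in> J \<Longrightarrow> x \<in> cell j \<Longrightarrow> y \<in> cell j \<Longrightarrow> enn2real (D\<^sub>0 (x, y)) \<le> \<delta>"
    and zw: "z \<in> rational_points U" "w \<in> rational_points U"
  shows "(\<integral>E. (cell_approx J z w E - (\<integral>E. cell_approx J z w E \<partial>\<mu>))\<^sup>2 \<partial>\<mu>) \<le> C ^ 6 * \<delta> * enn2real (D\<^sub>0 (z, w))"
proof -
  interpret prob_space \<mu> by (rule \<mu>)
  let ?Q = "rational_points U" and ?d = "\<lambda>p. enn2real (D\<^sub>0 p)"
  let ?P = "PiM J cell_space" and ?N = "\<lambda>j. distr \<mu> (cell_space j) (cell_metric U j)"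
  let ?Z = "\<lambda>E. \<lambda>j\<in>J. cell_metric U j E"
  let ?f = "\<lambda>\<zeta>. chain_inf ?Q (cell_cost C D\<^sub>0 J \<zeta>) z w" and ?g = "\<lambda>j \<zeta>. chain_inf ?Q (cell_cost C D\<^sub>0 (J - {j}) \<zeta>) z w"
  let ?B = "C * ?d (z, w)"
  have meas: "cell_metric U j \<in> \<mu> \<rightarrow>\<^sub>M cell_space j" for j using measurable_cell_metric \<mu>(2) by (simp cong: measurable_cong_sets)
  have N: "prob_space (?N j)" for j by (rule prob_space_distr[OF meas])
  have Z[measurable]: "?Z \<in> \<mu> \<rightarrow>\<^sub>M ?P" by (rule measurable_restrict) (rule meas)
  have distr: "distr \<mu> ?P ?Z = PiM J ?N" by (rule distr_cells_eq_PiM[OF \<mu> J(1,2) prod])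
  have sets: "sets (PiM J ?N) = sets ?P" by (rule sets_PiM_cong) simp_all
  have f[measurable]: "?f \<in> borel_measurable ?P"
    by (intro measurable_chain_inf countable_rational_points measurable_cell_cost[OF subset_refl J(1)])
  have g[measurable]: "?g j \<in> borel_measurable ?P" for j
    by (intro measurable_chain_inf countable_rational_points measurable_cell_cost[OF Diff_subset J(1)])
  have B: "\<bar>chain_inf ?Q (cell_cost C D\<^sub>0 I \<zeta>) z w\<bar> \<le> ?B" for I \<zeta> using chain_inf_cell_cost_bounds[OF zw, of I \<zeta>] by simp
  have "(\<integral>\<zeta>. (?f \<zeta> - (\<integral>\<zeta>. ?f \<zeta> \<partial>PiM J ?N))\<^sup>2 \<partial>PiM J ?N) \<le> (\<Sum>j\<in>J. \<integral>\<zeta>. (?f \<zeta> - ?g j \<zeta>)\<^sup>2 \<partial>PiM J ?N)"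
  proof (rule efron_stein[OF N J(1)])
    show "?f \<in> borel_measurable (PiM J ?N)" "\<And>j. ?g j \<in> borel_measurable (PiM J ?N)"
      using f g sets by (simp_all cong: measurable_cong_sets)
    show "\<bar>?f \<zeta>\<bar> \<le> ?B" "\<bar>?g j \<zeta>\<bar> \<le> ?B" for \<zeta> j by (rule B)+
    show "?g j (\<zeta>(j := x)) = ?g j \<zeta>" for j \<zeta> x
    proof -
      have "cell_cost C D\<^sub>0 (J - {j}) (\<zeta>(j := x)) = cell_cost C D\<^sub>0 (J - {j}) \<zeta>"
        unfolding cell_cost_def by (intro ext) (auto intro!: arg_cong[where f=enn2real] arg_cong2[where f=min] INF_cong split: prod.split)
      then show ?thesis by simp
    qed
  qed
  then have 1: "(\<integral>E. (cell_approx J z w E - (\<integral>E. cell_approx J z w E \<partial>\<mu>))\<^sup>2 \<partial>\<mu>) \<le> (\<Sum>j\<in>J. \<integral>E. (?f (?Z E) - ?g j (?Z E))\<^sup>2 \<partial>\<mu>)"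
    unfolding distr[symmetric] cell_approx_def by (simp add: integral_distr)
  have sq: "\<bar>(?f \<zeta> - ?g j \<zeta>)\<^sup>2\<bar> \<le> (2 * ?B)\<^sup>2" for j \<zeta>
  proof -
    have "\<bar>?f \<zeta> - ?g j \<zeta>\<bar> \<le> 2 * ?B" using B[of J \<zeta>] B[of "J - {j}" \<zeta>] by linarith
    then have "\<bar>?f \<zeta> - ?g j \<zeta>\<bar>\<^sup>2 \<le> (2 * ?B)\<^sup>2" by (intro power_mono) auto
    then show ?thesis by simp
  qed
  have int: "integrable \<mu> (\<lambda>E. (?f (?Z E) - ?g j (?Z E))\<^sup>2)" for j
    by (rule prob_integrable_bounded[OF \<mu>(1) _ sq]) measurable
  have "(\<Sum>j\<in>J. \<integral>E. (?f (?Z E) - ?g j (?Z E))\<^sup>2 \<partial>\<mu>) = (\<integral>E. (\<Sum>j\<in>J. (?f (?Z E) - ?g j (?Z E))\<^sup>2) \<partial>\<mu>)"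
    by (rule Bochner_Integration.integral_sum[symmetric]) (rule int)
  also have "\<dots> \<le> (\<integral>E. C ^ 6 * \<delta> * ?d (z, w) \<partial>\<mu>)"
  proof (rule integral_mono_AE)
    show "integrable \<mu> (\<lambda>E. \<Sum>j\<in>J. (?f (?Z E) - ?g j (?Z E))\<^sup>2)" by (rule Bochner_Integration.integrable_sum) (rule int)
    show "integrable \<mu> (\<lambda>E. C ^ 6 * \<delta> * ?d (z, w))" by simp
    show "AE E in \<mu>. (\<Sum>j\<in>J. (?f (?Z E) - ?g j (?Z E))\<^sup>2) \<le> C ^ 6 * \<delta> * ?d (z, w)"
      using equiv
    proof eventually_elim
      case (elim E)
      have QU: "x \<in> ?Q \<Longrightarrow> x \<in> U" for x using rational_points_subset by auto
      have fin: "x \<in> ?Q \<Longrightarrow> y \<in> ?Q \<Longrightarrow> D\<^sub>0 (x, y) < \<infinity>" for x y by (rule finite_metric[OF D\<^sub>0 QU QU])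
      show ?case
      proof (rule sum_square_increments_le[of z ?Q w J C \<delta> cell _ ?d, OF zw J(1) C small(1) J(3)])
        fix x y assume xy: "x \<in> ?Q" "y \<in> ?Q"
        show "0 \<le> cell_cost C D\<^sub>0 J (?Z E) (x, y)" by (rule cell_cost_nonneg)
        show "cell_cost C D\<^sub>0 J (?Z E) (x, y) \<le> C * ?d (x, y)" using C by (intro cell_cost_le fin xy) simp
        have "?d (x, y) \<le> C * enn2real (E (x, y))" by (rule equivalent_real(2)[OF elim QU QU, OF xy])
        also have "\<dots> \<le> C * cell_cost C D\<^sub>0 J (?Z E) (x, y)" using C by (intro mult_left_mono le_cell_cost[OF elim J(2) subset_refl xy]) auto
        finally show "?d (x, y) \<le> C * cell_cost C D\<^sub>0 J (?Z E) (x, y)" .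
        fix j assume j: "j \<in> J"
        show "cell_cost C D\<^sub>0 J (?Z E) (x, y) \<le> cell_cost C D\<^sub>0 (J - {j}) (?Z E) (x, y)" by (rule cell_cost_antimono[of D\<^sub>0, OF fin[OF xy] Diff_subset])
        show "cell_cost C D\<^sub>0 (J - {j}) (?Z E) (x, y) \<le> C * ?d (x, y)" using C by (intro cell_cost_le fin xy) simp
        show "cell_cost C D\<^sub>0 (J - {j}) (?Z E) (x, y) = cell_cost C D\<^sub>0 J (?Z E) (x, y)" if "\<not> (x \<in> cell j \<and> y \<in> cell j)"
          by (rule cell_cost_remove) (rule that)
        show "?d (x, y) \<le> \<delta>" if "x \<in> cell j" "y \<in> cell j" by (rule small(2)[OF j that])
      qed
    qed
  qed
  also have "\<dots> = C ^ 6 * \<delta> * ?d (z, w)" by (simp add: prob_space)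
  finally show ?thesis using 1 by linarith
qed

end

section \<open>Shifted grids\<close>

text \<open>A consequence of being a length metric with countable quantifiers only, so that it
  defines a measurable set and passes to the conditional law. The order matters: the compact set
  \<open>K m\<close> is fixed before the bound \<open>1 / Suc l\<close> on the steps, so that a mesh
  size chosen in terms of \<open>K m\<close> can still dictate how short the steps must be.\<close>

definition chain_approximable :: "complex set \<Rightarrow> (nat \<Rightarrow> complex set) \<Rightarrow> (complex \<times> complex \<Rightarrow> ennreal) \<Rightarrow> bool" where
  "chain_approximable U K E \<longleftrightarrow> (\<forall>z\<in>rational_points U. \<forall>w\<in>rational_points U. \<forall>n :: nat. \<exists>m. \<forall>l :: nat.
     \<exists>xs\<in>chains (rational_points (U \<inter> K m)) z w.
       (\<forall>i\<in>{..<length xs - 1}. E (xs ! i, xs ! Suc i) < ennreal (1 / real (Suc l))) \<and> chain_sum E xs \<le> E (z, w) + ennreal (1 / real (Suc n)))"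

lemma chain_approximable_sets:
  "{E \<in> space (metric_space_borel U). chain_approximable U K E} \<in> sets (metric_space_borel U)"
  unfolding chain_approximable_def
proof (rule sets.sets_Collect_countable_All'[OF _ countable_rational_points], rule sets.sets_Collect_countable_All'[OF _ countable_rational_points],
    rule sets.sets_Collect_countable_All, rule sets.sets_Collect_countable_Ex, rule sets.sets_Collect_countable_All)
  fix z w n m and l :: nat
  assume zw: "z \<in> rational_points U" "w \<in> rational_points U"
  have E: "(\<lambda>E. E (x, y)) \<in> borel_measurable (metric_space_borel U)" if "x \<in> rational_points U" "y \<in> rational_points U" for x y
    using that rational_points_subset[of U] by (intro measurable_eval_metric) auto
  have 1: "{E \<in> space (metric_space_borel U). (\<forall>i\<in>{..<length xs - 1}. E (xs ! i, xs ! Suc i) < ennreal (1 / real (Suc l))) \<and> chain_sum E xs \<le> E (z, w) + ennreal (1 / real (Suc n))} \<in> sets (metric_space_borel U)"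
    if xs: "xs \<in> chains (rational_points (U \<inter> K m)) z w" for xs
  proof (rule sets.sets_Collect_conj)
    have nth: "xs ! i \<in> rational_points U" if "i < length xs" for i
      using xs nth_mem[OF that] by (auto simp: chains_def rational_points_def)
    have e[measurable]: "(\<lambda>E. E (xs ! i, xs ! Suc i)) \<in> borel_measurable (metric_space_borel U)" if "i < length xs - 1" for i
      using that by (intro E nth) auto
    show "{E \<in> space (metric_space_borel U). \<forall>i\<in>{..<length xs - 1}. E (xs ! i, xs ! Suc i) < ennreal (1 / real (Suc l))} \<in> sets (metric_space_borel U)"
      by (rule sets.sets_Collect_finite_All) (use e in \<open>auto intro!: borel_measurable_less\<close>)
    have [measurable]: "(\<lambda>E. chain_sum E xs) \<in> borel_measurable (metric_space_borel U)"
      unfolding chain_sum_def by (intro borel_measurable_sum e) auto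
    have [measurable]: "(\<lambda>E. E (z, w)) \<in> borel_measurable (metric_space_borel U)" by (rule E[OF zw])
    show "{E \<in> space (metric_space_borel U). chain_sum E xs \<le> E (z, w) + ennreal (1 / real (Suc n))} \<in> sets (metric_space_borel U)" by measurable
  qed
  show "{E \<in> space (metric_space_borel U). \<exists>xs\<in>chains (rational_points (U \<inter> K m)) z w.
      (\<forall>i\<in>{..<length xs - 1}. E (xs ! i, xs ! Suc i) < ennreal (1 / real (Suc l))) \<and> chain_sum E xs \<le> E (z, w) + ennreal (1 / real (Suc n))} \<in> sets (metric_space_borel U)"
    by (rule sets.sets_Collect_countable_Ex'[OF 1 countable_chains[OF countable_rational_points]])
qed

lemma length_metric_chain_approximable:
  assumes U: "open U" and E: "E \<in> continuous_metrics U" "length_metric U E"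
    and K: "\<And>m. K m \<subseteq> interior (K (Suc m))" "\<And>L. compact L \<Longrightarrow> L \<subseteq> U \<Longrightarrow> \<exists>N. \<forall>m\<ge>N. L \<subseteq> K m"
  shows "chain_approximable U K E"
  unfolding chain_approximable_def
proof (intro ballI allI)
  fix z w and n :: nat
  assume zw: "z \<in> rational_points U" "w \<in> rational_points U"
  have zwU: "z \<in> U" "w \<in> U" using zw rational_points_subset[of U] by auto
  define e :: real where "e = 1 / real (Suc n) / 2"
  have e: "e > 0" by (simp add: e_def)
  obtain P where P: "P \<in> curves_in U z w" "metric_length E P \<le> E (z, w) + ennreal e"
    using E(2) zwU e unfolding length_metric_def by blast
  have P': "path P" "path_image P \<subseteq> U" "pathstart P = z" "pathfinish P = w" using P(1) by (auto simp: curves_in_def)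
  obtain m where m: "path_image P \<subseteq> K m" using K(2)[OF compact_path_image[OF P'(1)] P'(2)] by blast
  \<comment> \<open>An open set is required to move partition points to rational ones; the interior
    of the next compact set contains the curve and keeps the moved points in
    \<open>K (Suc m)\<close>.\<close>
  define V where "V = U \<inter> interior (K (Suc m))"
  have V: "open V" "V \<subseteq> U" "path_image P \<subseteq> V" using U m K(1)[of m] P'(2) by (auto simp: V_def)
  have zwV: "z \<in> rational_points V" "w \<in> rational_points V"
    using zw V(3) pathstart_in_path_image[of P] pathfinish_in_path_image[of P] P'(3,4) by (auto simp: rational_points_def)
  have "\<exists>xs\<in>chains (rational_points (U \<inter> K (Suc m))) z w.
      (\<forall>i\<in>{..<length xs - 1}. E (xs ! i, xs ! Suc i) < ennreal (1 / real (Suc l))) \<and> chain_sum E xs \<le> E (z, w) + ennreal (1 / real (Suc n))" for l :: nat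
  proof -
    have l: "1 / real (Suc l) > 0" by simp
    show ?thesis
    proof (rule chain_along_path[OF U E(1) V(1,2) P'(1) V(3) P'(3,4) zwV l e])
    fix xs assume xs: "xs \<in> chains (rational_points V) z w" "\<And>i. i < length xs - 1 \<Longrightarrow> E (xs ! i, xs ! Suc i) < ennreal (1 / real (Suc l))"
        "chain_sum E xs \<le> metric_length E P + ennreal e"
    have "rational_points V \<subseteq> rational_points (U \<inter> K (Suc m))" 
      unfolding V_def rational_points_def using interior_subset[of "K (Suc m)"] by blast
    then have 1: "xs \<in> chains (rational_points (U \<inter> K (Suc m))) z w" using xs(1) by (simp add: chains_def lists_eq_set) blast
    have "chain_sum E xs \<le> E (z, w) + ennreal e + ennreal e" by (rule order_trans[OF xs(3) add_right_mono[OF P(2)]])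
    also have "\<dots> = E (z, w) + (ennreal e + ennreal e)" by (rule add.assoc)
    also have "ennreal e + ennreal e = ennreal (e + e)" using e by (intro ennreal_plus[symmetric]) auto
    also have "e + e = 1 / real (Suc n)" by (simp add: e_def field_simps)
    finally show ?thesis using xs(2) by (intro bexI[OF _ 1] conjI ballI) simp_all
    qed
  qed
  then show "\<exists>m. \<forall>l :: nat. \<exists>xs\<in>chains (rational_points (U \<inter> K m)) z w.
      (\<forall>i\<in>{..<length xs - 1}. E (xs ! i, xs ! Suc i) < ennreal (1 / real (Suc l))) \<and> chain_sum E xs \<le> E (z, w) + ennreal (1 / real (Suc n))" by blast
qed

text \<open>In the coordinates \<open>N * z - s (1 + \<i>)\<close> the cells are the open unit
  squares with integer corners: mesh \<open>1 / N\<close>, shifted by \<open>s / N\<close> in both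
  directions.\<close>

definition grid_cell :: "nat \<Rightarrow> real \<Rightarrow> int \<times> int \<Rightarrow> complex \<times> complex" where
  "grid_cell N s = (\<lambda>(a, b). (Complex ((a + s) / N) ((b + s) / N), Complex ((a + 1 + s) / N) ((b + 1 + s) / N)))"

lemma mem_grid_cell:
  assumes "N > 0"
  shows "z \<in> cell (grid_cell N s (a, b)) \<longleftrightarrow> a < N * Re z - s \<and> N * Re z - s < a + 1 \<and> b < N * Im z - s \<and> N * Im z - s < b + 1"
  using assms by (simp add: grid_cell_def in_box_complex_iff field_simps)

lemma grid_cell_disjoint:
  assumes "N > 0" "z \<in> cell (grid_cell N s p)" "z \<in> cell (grid_cell N s q)" shows "p = q"
proof -
  obtain a b a' b' where p: "p = (a, b)" "q = (a', b')" by (cases p, cases q)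
  have "real_of_int a < a' + 1" "real_of_int a' < a + 1" "real_of_int b < b' + 1" "real_of_int b' < b + 1"
    using assms(2,3) unfolding p mem_grid_cell[OF assms(1)] by linarith+
  then have "a = a'" "b = b'" by linarith+
  then show ?thesis by (simp add: p)
qed

text \<open>Applied to \<open>N * Re z - s\<close> or \<open>N * Im z - s\<close>, this says that
  \<open>z\<close> is at distance at least \<open>\<epsilon> / N\<close> from all vertical or
  horizontal lines of the grid.\<close>

definition far_from_integers :: "real \<Rightarrow> real \<Rightarrow> bool" where
  "far_from_integers \<epsilon> x \<longleftrightarrow> (\<forall>n::int. \<epsilon> \<le> \<bar>x - n\<bar>)"

lemma far_from_integersD:
  fixes x \<epsilon> :: real
  assumes "far_from_integers \<epsilon> x" shows "\<lfloor>x\<rfloor> + \<epsilon> \<le> x" "x + \<epsilon> \<le> \<lfloor>x\<rfloor> + 1"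
  using assms[unfolded far_from_integers_def, rule_format, of "\<lfloor>x\<rfloor>"] assms[unfolded far_from_integers_def, rule_format, of "\<lfloor>x\<rfloor> + 1"]
    of_int_floor_le[of x] floor_less_cancel[of x] real_of_int_floor_add_one_gt[of x] by (auto simp: abs_if split: if_splits)

text \<open>Modulo \<open>1\<close> different shifts \<open>i / k\<close> are at least
  \<open>1 / k\<close> apart, while two shifts that both bring \<open>x\<close> within
  \<open>1 / (3 k)\<close> of an integer would be less than \<open>2 / (3 k)\<close> apart.\<close>

lemma near_integer_unique:
  fixes k :: nat
  assumes k: "k > 0" and i: "i < k" "\<not> far_from_integers (1 / (3 * real k)) (x - i / k)"
    and j: "j < k" "\<not> far_from_integers (1 / (3 * real k)) (x - j / k)"
  shows "i = j"
proof -
  obtain m n :: int where mn: "\<bar>x - i / k - m\<bar> < 1 / (3 * real k)" "\<bar>x - j / k - n\<bar> < 1 / (3 * real k)"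
    using i(2) j(2) unfolding far_from_integers_def by (auto simp: not_le)
  have lt: "\<bar>(real i / k + m) - (real j / k + n)\<bar> < 2 / (3 * real k)" using mn by (auto simp: abs_if split: if_splits)
  \<comment> \<open>After multiplication by \<open>k\<close> the difference is an integer of
    absolute value below \<open>1\<close>, hence \<open>0\<close>; together with
    \<open>\<bar>j - i\<bar> < k\<close> this forces \<open>i = j\<close>.\<close>
  have "\<bar>of_int (int i - int j + (m - n) * int k) :: real\<bar> = \<bar>((real i / k + m) - (real j / k + n)) * k\<bar>"
    using k by (intro arg_cong[where f=abs]) (simp add: field_simps)
  also have "\<dots> = \<bar>(real i / k + m) - (real j / k + n)\<bar> * k" by (simp add: abs_mult)
  also have "\<dots> < 2 / (3 * real k) * k" using k by (intro mult_strict_right_mono lt) auto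
  also have "\<dots> = 2 / 3" using k by simp
  finally have "\<bar>of_int (int i - int j + (m - n) * int k) :: real\<bar> < 1" by simp
  then have "int i - int j + (m - n) * int k = 0" by linarith
  then have eq: "int j - int i = (m - n) * int k" by linarith
  have "\<bar>int j - int i\<bar> < int k" using i j by linarith
  then have "\<bar>m - n\<bar> * int k < 1 * int k" unfolding eq by (simp add: abs_mult)
  then have "m - n = 0" using k by (simp only: mult_less_cancel_right) linarith
  then show ?thesis using eq by simp
qed

section \<open>Finite grids and the average over their shifts\<close>

context metric_bound
begin

text \<open>Indices up to \<open>N\<^sup>2\<close> with mesh \<open>1 / N\<close> reach coordinates
  of size about \<open>N\<close>, so the finite grids exhaust the plane. Squares that leave
  \<open>U\<close> or are too large for \<open>D\<^sub>0\<close> are dropped, which only means that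
  steps in them are charged \<open>C * D\<^sub>0\<close>; near a given compact subset of
  \<open>U\<close> this no longer occurs for large \<open>N\<close>.\<close>

definition grid :: "real \<Rightarrow> nat \<Rightarrow> real \<Rightarrow> (complex \<times> complex) set" where
  "grid \<delta> N s = {c \<in> grid_cell N s ` ({- (int N)\<^sup>2..(int N)\<^sup>2} \<times> {- (int N)\<^sup>2..(int N)\<^sup>2}).
     cell c \<subseteq> U \<and> (\<forall>x\<in>cell c. \<forall>y\<in>cell c. enn2real (D\<^sub>0 (x, y)) \<le> \<delta>)}"

lemma finite_grid: "finite (grid \<delta> N s)"
  unfolding grid_def by auto

lemma grid_disjoint:
  assumes "N > 0" "c \<in> grid \<delta> N s" "c' \<in> grid \<delta> N s" "c \<noteq> c'" shows "cell c \<inter> cell c' = {}"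
proof (rule ccontr)
  assume "cell c \<inter> cell c' \<noteq> {}"
  then obtain z where z: "z \<in> cell c" "z \<in> cell c'" by blast
  obtain p q where "c = grid_cell N s p" "c' = grid_cell N s q" using assms(2,3) by (auto simp: grid_def)
  then show False using grid_cell_disjoint[OF assms(1), of z s p q] z assms(4) by auto
qed

text \<open>A short step can only be blocked by a cell boundary close to its starting point, and of the \<open>k\<close> shifted
  grids at most two have a boundary there: one with a vertical and one with a horizontal line.\<close>

lemma sum_cell_cost_step:
  fixes k N :: nat
  assumes E: "equivalent E" and k: "k > 0" and N: "N > 0" and uv: "u \<in> rational_points U" "v \<in> rational_points U"
    and t: "\<And>y. y \<in> U \<Longrightarrow> E (u, y) < t \<Longrightarrow> dist u y < 1 / (3 * real k * real N)" "E (u, v) < t"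
    and bounded: "norm u + 2 \<le> N"
    and fine: "\<And>y. dist u y < 2 / N \<Longrightarrow> y \<in> U \<and> D\<^sub>0 (u, y) < ennreal (\<delta> / 2)" and \<delta>: "\<delta> > 0"
  shows "(\<Sum>i<k. cell_cost C D\<^sub>0 (grid \<delta> N (i / k)) (\<lambda>j\<in>grid \<delta> N (i / k). cell_metric U j E) (u, v))
    \<le> (k + 2 * C\<^sup>2) * enn2real (E (u, v))"
proof -
  let ?e = "enn2real (E (u, v))" and ?far = "\<lambda>(x::real) (i::nat). far_from_integers (1 / (3 * real k)) (real N * x - real i / real k)"
  let ?c = "\<lambda>i::nat. cell_cost C D\<^sub>0 (grid \<delta> N (i / k)) (\<lambda>j\<in>grid \<delta> N (i / k). cell_metric U j E) (u, v)"
  have EU: "E \<in> continuous_metrics U" using E by (simp add: equivalent_def)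
  have uvU: "u \<in> U" "v \<in> U" using uv rational_points_subset[of U] by auto
  \<comment> \<open>The price in any case: \<open>C * D\<^sub>0\<close> for the step, and
    \<open>D\<^sub>0 \<le> C * E\<close>.\<close>
  have bad: "?c i \<le> C\<^sup>2 * ?e" for i
  proof -
    have "?c i \<le> C * enn2real (D\<^sub>0 (u, v))" using C finite_metric[OF D\<^sub>0 uvU] by (intro cell_cost_le) auto
    also have "\<dots> \<le> C * (C * ?e)" using C by (intro mult_left_mono equivalent_real(2)[OF E uvU]) auto
    finally show ?thesis by (simp add: power2_eq_square mult.assoc)
  qed
  have good: "?c i \<le> ?e" if far: "?far (Re u) i" "?far (Im u) i" and i: "i < k" for i
  proof -
    let ?s = "real i / k"
    define a b where "a = \<lfloor>N * Re u - ?s\<rfloor>" and "b = \<lfloor>N * Im u - ?s\<rfloor>"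
    define c where "c = grid_cell N ?s (a, b)"
    have s: "0 \<le> ?s" "?s \<le> 1" using i by auto
    note ab = far_from_integersD[OF far(1), folded a_def] far_from_integersD[OF far(2), folded b_def]
    have k3: "1 / (3 * real k) > 0" using k by simp
    \<comment> \<open>All grid lines are at distance at least \<open>1 / (3 k N)\<close> from
      \<open>u\<close> in each coordinate, so a point closer than that lies in the same square. By
      the choice of \<open>t\<close> this covers all points with \<open>E\<close>-distance below
      \<open>t\<close>, which makes the step local in that cell.\<close>
    have near: "y \<in> cell c" if y: "dist u y < 1 / (3 * real k * real N)" for y
    proof -
      have *: "\<bar>Re u - Re y\<bar> < 1 / (3 * real k * real N)" "\<bar>Im u - Im y\<bar> < 1 / (3 * real k * real N)"
        using y abs_Re_le_cmod[of "u - y"] abs_Im_le_cmod[of "u - y"] by (auto simp: dist_norm)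
      have "\<bar>Re u - Re y\<bar> * N < 1 / (3 * real k * real N) * N" "\<bar>Im u - Im y\<bar> * N < 1 / (3 * real k * real N) * N"
        by (rule mult_strict_right_mono, rule *, use N in simp)+
      moreover have "1 / (3 * real k * N) * N = 1 / (3 * real k)" using N k by simp
      moreover have "\<bar>x - y\<bar> * real N = \<bar>N * x - N * y\<bar>" for x y :: real by (simp add: abs_mult[of "real N", simplified, symmetric] algebra_simps)
      ultimately have "\<bar>N * Re u - N * Re y\<bar> < 1 / (3 * real k)" "\<bar>N * Im u - N * Im y\<bar> < 1 / (3 * real k)" by simp_all
      then show ?thesis unfolding c_def mem_grid_cell[OF N] using ab by (auto simp: abs_less_iff)
    qed
    have uc: "u \<in> cell c" by (rule near) (use k N in simp)
    have cb: "dist u y < 2 / N" if y: "y \<in> cell c" for y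
    proof -
      have "\<bar>N * Re u - N * Re y\<bar> < 1" "\<bar>N * Im u - N * Im y\<bar> < 1"
        using uc y unfolding c_def mem_grid_cell[OF N] by linarith+
      then have "\<bar>Re u - Re y\<bar> < 1 / N" "\<bar>Im u - Im y\<bar> < 1 / N"
        using N by (auto simp: abs_less_iff field_simps)
      then show ?thesis using cmod_le[of "u - y"] by (simp add: dist_norm)
    qed
    have "\<bar>real_of_int a\<bar> \<le> N * norm u + 2" "\<bar>real_of_int b\<bar> \<le> N * norm u + 2"
    proof -
      have "\<bar>N * Re u\<bar> \<le> N * norm u" "\<bar>N * Im u\<bar> \<le> N * norm u"
        using abs_Re_le_cmod[of u] abs_Im_le_cmod[of u] by (simp_all add: abs_mult mult_left_mono)
      then show "\<bar>real_of_int a\<bar> \<le> N * norm u + 2" "\<bar>real_of_int b\<bar> \<le> N * norm u + 2" using ab s k3 by linarith+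
    qed
    \<comment> \<open>The index of the square containing \<open>u\<close> stays within the range of
      the finite grid; the \<open>2\<close> absorbs the rounding and the shift.\<close>
    moreover have "N * norm u + 2 \<le> (real N)\<^sup>2"
    proof -
      have "2 \<le> N * 2" using N by simp
      then have "N * norm u + 2 \<le> N * (norm u + 2)" by (simp add: algebra_simps)
      also have "\<dots> \<le> N * real N" using bounded by (intro mult_left_mono) auto
      finally show ?thesis by (simp add: power2_eq_square)
    qed
    ultimately have "\<bar>real_of_int a\<bar> \<le> real_of_int ((int N)\<^sup>2)" "\<bar>real_of_int b\<bar> \<le> real_of_int ((int N)\<^sup>2)" by simp_all
    then have "\<bar>a\<bar> \<le> (int N)\<^sup>2" "\<bar>b\<bar> \<le> (int N)\<^sup>2" by (simp_all only: of_int_abs[symmetric] of_int_le_iff)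
    then have "c \<in> grid_cell N ?s ` ({- (int N)\<^sup>2..(int N)\<^sup>2} \<times> {- (int N)\<^sup>2..(int N)\<^sup>2})" unfolding c_def by (intro imageI) (simp add: abs_le_iff)
    moreover have "enn2real (D\<^sub>0 (x, y)) \<le> \<delta>" if xy: "x \<in> cell c" "y \<in> cell c" for x y
    proof -
      have f: "x \<in> U" "D\<^sub>0 (u, x) < ennreal (\<delta> / 2)" "y \<in> U" "D\<^sub>0 (u, y) < ennreal (\<delta> / 2)" using fine[OF cb] xy by auto
      have "D\<^sub>0 (x, y) \<le> D\<^sub>0 (u, x) + D\<^sub>0 (u, y)" using cmD(4)[OF D\<^sub>0 f(1) uvU(1) f(3)] cmD(3)[OF D\<^sub>0 f(1) uvU(1)] by simp
      also have "\<dots> \<le> ennreal (\<delta> / 2) + ennreal (\<delta> / 2)" using f by (intro add_mono) auto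
      also have "\<dots> = ennreal \<delta>" using \<delta> by (subst ennreal_plus[symmetric]) auto
      finally have "enn2real (D\<^sub>0 (x, y)) \<le> enn2real (ennreal \<delta>)" by (intro enn2real_mono) auto
      then show ?thesis using \<delta> by simp
    qed
    moreover have cU: "cell c \<subseteq> U" using fine[OF cb] by blast
    ultimately have c: "c \<in> grid \<delta> N ?s" unfolding grid_def by blast
    have "v \<in> cell c" by (rule near) (rule t(1)[OF uvU(2) t(2)])
    moreover have "E (u, v) < boundary_dist U (cell c) E u"
    proof -
      have "t \<le> boundary_dist U (cell c) E u" unfolding boundary_dist_def
      proof (rule INF_greatest)
        fix y assume "y \<in> U - cell c"
        then show "t \<le> E (u, y)" using near[of y] t(1)[of y] by (meson DiffE not_le)
      qed
      with t(2) show ?thesis by (rule order.strict_trans2)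
    qed
    ultimately show ?thesis using uc uv by (intro cell_cost_le_local[OF EU c cU]) (auto simp: rational_points_def)
  qed
  \<comment> \<open>The surcharge for a shift with a line near \<open>u\<close>, counted separately
    for vertical and horizontal lines. Each kind concerns at most one shift, whence the constant
    \<open>k + 2 * C\<^sup>2\<close>.\<close>
  let ?b = "\<lambda>x (i::nat). if \<not> ?far x i then C\<^sup>2 * ?e else 0"
  have nn: "0 \<le> C\<^sup>2 * ?e" "0 \<le> ?e" by simp_all
  have b: "(\<Sum>i<k. ?b x i) \<le> C\<^sup>2 * ?e" for x
  proof (rule sum_at_most_one[where P="\<lambda>i. \<not> ?far x i", OF finite_lessThan nn(1)])
    fix i j assume "i \<in> {..<k}" "j \<in> {..<k}" "\<not> ?far x i" "\<not> ?far x j"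
    then show "i = j" using near_integer_unique[OF k, of i "N * x" j] by simp
  qed
  have "(\<Sum>i<k. ?c i) \<le> (\<Sum>i<k. ?e + ?b (Re u) i + ?b (Im u) i)"
  proof (rule sum_mono)
    fix i assume "i \<in> {..<k}"
    then have i: "i < k" by simp
    show "?c i \<le> ?e + ?b (Re u) i + ?b (Im u) i"
    proof (cases "?far (Re u) i \<and> ?far (Im u) i")
      case True
      then show ?thesis using good[of i] i by simp
    next
      case False
      then have "C\<^sup>2 * ?e \<le> ?b (Re u) i + ?b (Im u) i" using nn by auto
      then show ?thesis using bad[of i] nn(2) by linarith
    qed
  qed
  also have "\<dots> = k * ?e + (\<Sum>i<k. ?b (Re u) i) + (\<Sum>i<k. ?b (Im u) i)" by (simp add: sum.distrib)
  also have "\<dots> \<le> k * ?e + C\<^sup>2 * ?e + C\<^sup>2 * ?e"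
    by (intro add_mono b order_refl)
  finally show ?thesis by (simp add: algebra_simps)
qed

text \<open>One and the same chain is used for all \<open>k\<close> grids. After exchanging the sums
  over shifts and steps, each step is paid \<open>k + 2 * C\<^sup>2\<close> times instead of
  \<open>k\<close> times, although different grids are blocked at different steps.\<close>

lemma sum_cell_approx_le:
  fixes k :: nat
  assumes E: "equivalent E" "chain_approximable U K E" and K: "\<And>m. compact (K m)" "\<And>m. K m \<subseteq> U"
    and k: "k > 0" and \<delta>: "\<delta> > 0" and e: "(e::real) > 0" and zw: "z \<in> rational_points U" "w \<in> rational_points U"
  shows "\<forall>\<^sub>F N in sequentially. (\<Sum>i<k. cell_approx (grid \<delta> N (i / k)) z w E) \<le> (k + 2 * C\<^sup>2) * (enn2real (E (z, w)) + e)"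
proof -
  let ?Q = "rational_points U"
  have EU: "E \<in> continuous_metrics U" using E by (simp add: equivalent_def)
  have zwU: "z \<in> U" "w \<in> U" using zw rational_points_subset[of U] by auto
  have ex: "\<exists>n::nat. 1 / real (Suc n) \<le> x" if "x > 0" for x :: real
    using reals_Archimedean[OF that] by (simp only: inverse_eq_divide) (blast intro: less_imp_le)
  obtain n :: nat where n: "1 / real (Suc n) \<le> e" using ex[OF e] by blast
  obtain m where m: "\<And>l :: nat. \<exists>xs\<in>chains (rational_points (U \<inter> K m)) z w.
       (\<forall>i\<in>{..<length xs - 1}. E (xs ! i, xs ! Suc i) < ennreal (1 / real (Suc l))) \<and> chain_sum E xs \<le> E (z, w) + ennreal (1 / real (Suc n))"
    using E(2) zw unfolding chain_approximable_def by meson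
  obtain r where r: "r > 0" "\<And>u v. u \<in> K m \<Longrightarrow> dist u v < r \<Longrightarrow> v \<in> U \<and> D\<^sub>0 (u, v) < ennreal (\<delta> / 2)"
    using cm_compact_continuous[OF U(1) D\<^sub>0 K, of "ennreal (\<delta> / 2)" m] \<delta> by auto
  obtain R where R: "\<And>u. u \<in> K m \<Longrightarrow> norm u \<le> R" using compact_imp_bounded[OF K(1)[of m]] unfolding bounded_iff by blast
  show ?thesis
    using eventually_gt_at_top[of "nat \<lceil>2 / r\<rceil>"] eventually_gt_at_top[of "nat \<lceil>R + 2\<rceil>"]
  proof eventually_elim
    case (elim N)
    have N: "N > 0" "2 / N < r" "R + 2 \<le> N" 
    proof -
      show 0: "N > 0" using elim by simp
      have "2 / r < N" using elim(1) by linarith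
      then show "2 / N < r" using r(1) 0 by (simp add: field_simps)
      show "R + 2 \<le> N" using elim(2) by linarith
    qed
    have "1 / (3 * real k * N) > 0" using k N by simp
    \<comment> \<open>The last choices in the order \<open>K m\<close>, \<open>N\<close>,
      \<open>t\<close>, \<open>l\<close>: the steps have to be short compared with the mesh
      \<open>1 / N\<close>, and \<open>N\<close> was chosen from the compact set alone.\<close>
    then obtain t where t: "t > 0" "\<And>u v. u \<in> K m \<Longrightarrow> v \<in> U \<Longrightarrow> E (u, v) < ennreal t \<Longrightarrow> dist u v < 1 / (3 * real k * N)"
      using cm_compact_scale[OF EU K, of _ m] by blast
    obtain l :: nat where l: "1 / real (Suc l) \<le> t" using ex[OF t(1)] by blast
    obtain xs where xs: "xs \<in> chains (rational_points (U \<inter> K m)) z w"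
       "\<And>i. i < length xs - 1 \<Longrightarrow> E (xs ! i, xs ! Suc i) < ennreal (1 / real (Suc l))" "chain_sum E xs \<le> E (z, w) + ennreal (1 / real (Suc n))"
      using m[of l] by auto
    have xsQ: "xs \<in> chains ?Q z w" using xs(1) by (auto simp: chains_def rational_points_def)
    have nth: "xs ! i \<in> ?Q" "xs ! i \<in> K m" "xs ! i \<in> U" if "i < length xs" for i
      using xs(1) nth_mem[OF that] by (auto simp: chains_def rational_points_def)
    let ?d = "\<lambda>p. enn2real (E p)"
    let ?c = "\<lambda>i::nat. cell_cost C D\<^sub>0 (grid \<delta> N (i / k)) (\<lambda>j\<in>grid \<delta> N (i / k). cell_metric U j E)"
    have "(\<Sum>i<k. cell_approx (grid \<delta> N (i / k)) z w E) \<le> (\<Sum>i<k. chain_sum (?c i) xs)"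
      unfolding cell_approx_def by (intro sum_mono chain_inf_le[OF xsQ] cell_cost_nonneg)
    also have "\<dots> = (\<Sum>l<length xs - 1. \<Sum>i<k. ?c i (xs ! l, xs ! Suc l))" unfolding chain_sum_def by (rule sum.swap)
    also have "\<dots> \<le> (\<Sum>l<length xs - 1. (k + 2 * C\<^sup>2) * ?d (xs ! l, xs ! Suc l))"
    proof (rule sum_mono)
      fix q assume "q \<in> {..<length xs - 1}"
      then have q: "q < length xs" "Suc q < length xs" "q < length xs - 1" by auto
      note n1 = nth[OF q(1)] and n2 = nth[OF q(2)]
      show "(\<Sum>i<k. ?c i (xs ! q, xs ! Suc q)) \<le> (k + 2 * C\<^sup>2) * ?d (xs ! q, xs ! Suc q)"
      proof (rule sum_cell_cost_step[OF E(1) k N(1) n1(1) n2(1)])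
        show "dist (xs ! q) y < 1 / (3 * real k * real N)" if "y \<in> U" "E (xs ! q, y) < ennreal t" for y
          by (rule t(2)[OF n1(2) that])
        show "E (xs ! q, xs ! Suc q) < ennreal t" using xs(2)[OF q(3)] ennreal_leI[OF l] by (simp add: add.commute order.strict_trans2)
        show "norm (xs ! q) + 2 \<le> N" using R[OF n1(2)] N(3) by linarith
        show "y \<in> U \<and> D\<^sub>0 (xs ! q, y) < ennreal (\<delta> / 2)" if "dist (xs ! q) y < 2 / N" for y
          by (rule r(2)[OF n1(2)]) (use that N(2) in linarith)
      qed (rule \<delta>)
    qed
    also have "\<dots> = (k + 2 * C\<^sup>2) * (\<Sum>l<length xs - 1. ?d (xs ! l, xs ! Suc l))" by (rule sum_distrib_left[symmetric])
    also have "\<dots> \<le> (k + 2 * C\<^sup>2) * (?d (z, w) + e)"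
    proof (rule mult_left_mono)
      have fin: "E (xs ! l, xs ! Suc l) < \<top>" if "l < length xs - 1" for l
        using xs(2)[OF that] order.strict_trans2[OF _ top_greatest] by blast
      have "ennreal (\<Sum>l<length xs - 1. ?d (xs ! l, xs ! Suc l)) = chain_sum E xs"
        unfolding chain_sum_def by (subst sum_ennreal[symmetric]) (auto intro!: sum.cong simp: fin)
      also have "\<dots> \<le> E (z, w) + ennreal (1 / real (Suc n))" by (rule xs(3))
      also have "\<dots> \<le> E (z, w) + ennreal e" by (intro add_left_mono ennreal_leI n)
      also have "\<dots> = ennreal (?d (z, w)) + ennreal e" using finite_metric[OF EU zwU] by simp
      also have "\<dots> = ennreal (?d (z, w) + e)" using e by (subst ennreal_plus) auto
      finally show "(\<Sum>l<length xs - 1. ?d (xs ! l, xs ! Suc l)) \<le> ?d (z, w) + e" using e by (subst (asm) ennreal_le_iff) auto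
    qed simp
    finally show ?case .
  qed
qed

end

section \<open>Distances are constant given the field\<close>

definition rational_cells :: "complex set \<Rightarrow> (complex \<times> complex) set" where
  "rational_cells U = {j. cell j \<subseteq> U \<and> fst j \<in> rational_points UNIV \<and> snd j \<in> rational_points UNIV}"

text \<open>The product formula for all finite families of rational cells at once, as a property of
  a single measure, so that it can be used after one null set of fields has been discarded.\<close>

definition cells_independent :: "complex set \<Rightarrow> (complex \<times> complex \<Rightarrow> ennreal) measure \<Rightarrow> bool" where
  "cells_independent U \<mu> \<longleftrightarrow> (\<forall>J \<F>. finite J \<longrightarrow> J \<subseteq> rational_cells U \<longrightarrow> pairwise (\<lambda>i j. cell i \<inter> cell j = {}) J \<longrightarrow>
     (\<forall>j\<in>J. \<F> j \<in> cell_constraints j) \<longrightarrow> measure \<mu> (chain_event U J \<F>) = (\<Prod>j\<in>J. measure \<mu> (chain_event U {j} \<F>)))"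

context metric_bound
begin

lemma grid_subset_rational_cells:
  assumes "s \<in> \<rat>" shows "grid \<delta> N s \<subseteq> rational_cells U"
  using assms by (auto simp: grid_def rational_cells_def rational_points_def grid_cell_def)

text \<open>Averaging over the shifted grids makes the approximation by functions of independent variables good in mean, while
  their variances are small.\<close>

lemma distance_almost_constant:
  assumes \<mu>: "prob_space \<mu>" "sets \<mu> = sets (metric_space_borel U)" and equiv: "AE E in \<mu>. equivalent E"
    and approx: "AE E in \<mu>. chain_approximable U K E" and K: "\<And>m. compact (K m)" "\<And>m. K m \<subseteq> U"
    and indep: "cells_independent U \<mu>" and zw: "z \<in> rational_points U" "w \<in> rational_points U" and \<eta>: "\<eta> > 0"
  shows "\<exists>m. (\<integral>E. \<bar>enn2real (E (z, w)) - m\<bar> \<partial>\<mu>) \<le> 3 * \<eta>"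
proof -
  interpret prob_space \<mu> by (rule \<mu>)
  let ?X = "\<lambda>E::complex \<times> complex \<Rightarrow> ennreal. enn2real (E (z, w))"
  define d where "d = enn2real (D\<^sub>0 (z, w))"
  have d: "0 \<le> d" by (simp add: d_def)
  have zwU: "z \<in> U" "w \<in> U" using zw rational_points_subset[of U] by auto
  \<comment> \<open>Chosen so that the bound \<open>C ^ 6 * \<delta> * d\<close> on the variance is
    at most \<open>\<eta>\<^sup>2\<close>; \<open>d + 1\<close> avoids a division by
    \<open>0\<close> when \<open>z = w\<close>.\<close>
  define \<delta> where "\<delta> = \<eta>\<^sup>2 / (C ^ 6 * (d + 1))"
  have \<delta>: "\<delta> > 0" "C ^ 6 * \<delta> * d \<le> \<eta>\<^sup>2"
  proof -
    have C6: "C ^ 6 > 0" using C by simp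
    show "\<delta> > 0" using \<eta> d C6 by (simp add: \<delta>_def)
    have "C ^ 6 * \<delta> * d = \<eta>\<^sup>2 * (d / (d + 1))" using C6 by (simp add: \<delta>_def)
    also have "\<dots> \<le> \<eta>\<^sup>2 * 1" using d by (intro mult_left_mono) auto
    finally show "C ^ 6 * \<delta> * d \<le> \<eta>\<^sup>2" by simp
  qed
  \<comment> \<open>With the bound \<open>(k + 2 * C\<^sup>2) * (X + \<eta> / 2)\<close> for the sum
    over the shifts, the excess over \<open>k * X\<close> is
    \<open>k * \<eta> / 2 + 2 * C\<^sup>2 * (X + \<eta> / 2)\<close>. As
    \<open>X \<le> C * d\<close>, this \<open>k\<close> brings it below
    \<open>k * \<eta>\<close>.\<close>
  define k where "k = Suc (nat \<lceil>4 * C\<^sup>2 * (C * d + \<eta> / 2) / \<eta>\<rceil>)"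
  have k: "k > 0" "4 * C\<^sup>2 * (C * d + \<eta> / 2) \<le> k * \<eta>"
  proof -
    show "k > 0" by (simp add: k_def)
    have "4 * C\<^sup>2 * (C * d + \<eta> / 2) / \<eta> \<le> k" unfolding k_def by linarith
    then show "4 * C\<^sup>2 * (C * d + \<eta> / 2) \<le> k * \<eta>" using \<eta> by (simp add: pos_divide_le_eq)
  qed
  let ?J = "\<lambda>N (i::nat). grid \<delta> N (real i / real k)"
  let ?Y = "\<lambda>N i E. cell_approx (?J N i) z w E"
  have X[measurable]: "?X \<in> borel_measurable \<mu>"
    using measurable_eval_metric[of "(z, w)" U] zwU \<mu>(2) by (auto cong: measurable_cong_sets)
  have Y[measurable]: "?Y N i \<in> borel_measurable \<mu>" for N i
    using measurable_cell_approx[OF finite_grid, of \<delta> N "real i / real k" z w] \<mu>(2) by (simp cong: measurable_cong_sets)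
  have Yb: "0 \<le> ?Y N i E" "?Y N i E \<le> C * d" for N i E
    unfolding cell_approx_def d_def by (rule chain_inf_cell_cost_bounds[OF zw])+
  have cellU: "j \<in> ?J N i \<Longrightarrow> cell j \<subseteq> U" for j N i by (simp add: grid_def)
  have XY: "AE E in \<mu>. \<forall>N i. ?X E \<le> ?Y N i E"
    using equiv
  proof eventually_elim
    case (elim E)
    then show ?case by (intro allI le_cell_approx[OF _ cellU zw])
  qed
  have Xb: "AE E in \<mu>. \<bar>?X E\<bar> \<le> C * d"
    using equiv by eventually_elim (use equivalent_real(1)[OF _ zwU] in \<open>simp add: d_def\<close>)
  have iX[simp]: "integrable \<mu> ?X" by (rule integrable_const_bound[where B="C * d"]) (use Xb in auto)
  have iY[simp]: "integrable \<mu> (?Y N i)" for N i by (rule integrable_const_bound[where B="C * d"]) (use Yb[of N i] in auto)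
  \<comment> \<open>How large \<open>N\<close> has to be depends on \<open>E\<close>. The excess
    over \<open>k * \<eta>\<close> vanishes eventually for almost every \<open>E\<close> and is
    bounded, so its mean tends to \<open>0\<close> and a single \<open>N\<close> can be
    fixed.\<close>
  let ?A = "\<lambda>N E. \<Sum>i<k. ?Y N i E - ?X E" and ?h = "\<lambda>N E. max 0 ((\<Sum>i<k. ?Y N i E - ?X E) - k * \<eta>)"
  have lim: "(\<lambda>N. \<integral>E. ?h N E \<partial>\<mu>) \<longlonglongrightarrow> (\<integral>E. 0 \<partial>\<mu>)"
  proof (rule integral_dominated_convergence[where w="\<lambda>_. k * (C * d)"])
    show "AE E in \<mu>. (\<lambda>N. ?h N E) \<longlonglongrightarrow> 0"
      using equiv approx Xb
    proof eventually_elim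
      case (elim E)
      have "\<forall>\<^sub>F N in sequentially. (\<Sum>i<k. ?Y N i E) \<le> (k + 2 * C\<^sup>2) * (?X E + \<eta> / 2)"
        using \<eta> by (intro sum_cell_approx_le[OF elim(1,2) K k(1) \<delta>(1) _ zw]) simp
      then have "\<forall>\<^sub>F N in sequentially. ?h N E = 0"
      proof eventually_elim
        case (elim N)
        have "C\<^sup>2 * ?X E \<le> C\<^sup>2 * (C * d)" using \<open>\<bar>?X E\<bar> \<le> C * d\<close> by (intro mult_left_mono) auto
        then have "?A N E \<le> k * \<eta>" using elim k(2) by (simp add: sum_subtractf algebra_simps)
        then show ?case by simp
      qed
      then show ?case by (rule tendsto_eventually)
    qed
    show "AE E in \<mu>. norm (?h N E) \<le> k * (C * d)" for N
    proof (rule AE_I2)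
      fix E
      have "?A N E \<le> (\<Sum>i<k. C * d)" using Yb(2)[of N _ E] by (intro sum_mono) (simp add: add_increasing2 diff_le_eq)
      moreover have "0 \<le> k * \<eta>" "0 \<le> k * (C * d)" using \<eta> C d by auto
      ultimately show "norm (?h N E) \<le> k * (C * d)" by simp
    qed
  qed simp_all
  have "\<forall>\<^sub>F N in sequentially. (\<integral>E. ?h N E \<partial>\<mu>) < k * \<eta>"
    using order_tendstoD(2)[OF lim, of "k * \<eta>"] k \<eta> by simp
  then obtain N where N: "(\<integral>E. ?h N E \<partial>\<mu>) < k * \<eta>" "N > 0"
    using eventually_happens[OF eventually_conj[OF _ eventually_gt_at_top[of 0]]] sequentially_bot by blast
  have iA: "integrable \<mu> (?A N)" by (intro Bochner_Integration.integrable_sum Bochner_Integration.integrable_diff iX iY)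
  have ih: "integrable \<mu> (?h N)" by (intro integrable_max integrable_const Bochner_Integration.integrable_diff iA)
  have "(\<Sum>i<k. \<integral>E. ?Y N i E - ?X E \<partial>\<mu>) = (\<integral>E. ?A N E \<partial>\<mu>)"
    by (rule Bochner_Integration.integral_sum[symmetric]) (intro Bochner_Integration.integrable_diff iX iY)
  also have "\<dots> \<le> (\<integral>E. k * \<eta> + ?h N E \<partial>\<mu>)"
    by (intro integral_mono iA Bochner_Integration.integrable_add integrable_const ih) auto
  also have "\<dots> = k * \<eta> + (\<integral>E. ?h N E \<partial>\<mu>)" using ih by (simp add: prob_space)
  also have "\<dots> < k * \<eta> + k * \<eta>" by (rule add_strict_left_mono[OF N(1)])
  also have "\<dots> = (\<Sum>i<k. 2 * \<eta>)" by simp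
  finally have less: "(\<Sum>i<k. \<integral>E. ?Y N i E - ?X E \<partial>\<mu>) < (\<Sum>i<k. 2 * \<eta>)" .
  \<comment> \<open>If the mean errors of the \<open>k\<close> grids add up to less than
    \<open>2 * k * \<eta>\<close>, one of them is at most \<open>2 * \<eta>\<close>. From here on
    only this grid is used.\<close>
  have "\<exists>i<k. (\<integral>E. ?Y N i E - ?X E \<partial>\<mu>) \<le> 2 * \<eta>"
  proof (rule ccontr)
    assume "\<not> ?thesis"
    then have "(\<Sum>i<k. 2 * \<eta>) \<le> (\<Sum>i<k. \<integral>E. ?Y N i E - ?X E \<partial>\<mu>)" by (intro sum_mono) force
    with less show False by linarith
  qed
  then obtain i where i: "i < k" "(\<integral>E. ?Y N i E - ?X E \<partial>\<mu>) \<le> 2 * \<eta>" by blast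
  define m where "m = (\<integral>E. ?Y N i E \<partial>\<mu>)"
  have "(\<integral>E. (?Y N i E - m)\<^sup>2 \<partial>\<mu>) \<le> C ^ 6 * \<delta> * d"
    unfolding m_def d_def
  proof (rule cell_approx_variance[OF \<mu> equiv finite_grid cellU _ _ _ _ zw])
    show "cell a \<inter> cell b = {}" if "a \<in> ?J N i" "b \<in> ?J N i" "a \<noteq> b" for a b
      by (rule grid_disjoint[OF N(2) that])
    then have dis: "pairwise (\<lambda>i j. cell i \<inter> cell j = {}) (?J N i)" by (simp add: pairwise_def)
    show "measure \<mu> (chain_event U I \<F>) = (\<Prod>j\<in>I. measure \<mu> (chain_event U {j} \<F>))"
      if I: "I \<subseteq> ?J N i" "\<And>j. j \<in> I \<Longrightarrow> \<F> j \<in> cell_constraints j" for I \<F>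
    proof -
      have "real i / real k \<in> \<rat>" by simp
      then have "I \<subseteq> rational_cells U" using I(1) grid_subset_rational_cells by blast
      then show ?thesis using indep I finite_subset[OF I(1) finite_grid] pairwise_subset[OF dis I(1)] unfolding cells_independent_def by blast
    qed
    show "enn2real (D\<^sub>0 (x, y)) \<le> \<delta>" if "j \<in> ?J N i" "x \<in> cell j" "y \<in> cell j" for j x y
      using that by (simp add: grid_def)
  qed (use \<delta> in auto)
  then have var: "(\<integral>E. (?Y N i E - m)\<^sup>2 \<partial>\<mu>) \<le> \<eta>\<^sup>2" using \<delta>(2) by linarith
  have mb: "\<bar>m\<bar> \<le> C * d"
  proof -
    have "\<bar>m\<bar> \<le> (\<integral>E. \<bar>?Y N i E\<bar> \<partial>\<mu>)" unfolding m_def using integral_norm_bound[of \<mu> "?Y N i"] by simp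
    also have "\<dots> \<le> (\<integral>E. C * d \<partial>\<mu>)" using Yb[of N i] by (intro integral_mono integrable_const integrable_abs iY) simp
    finally show ?thesis by (simp add: prob_space)
  qed
  have isq: "integrable \<mu> (\<lambda>E. (?Y N i E - m)\<^sup>2)"
  proof (rule integrable_const_bound[where B="(2 * (C * d))\<^sup>2"], rule AE_I2)
    fix E
    have "\<bar>?Y N i E - m\<bar> \<le> 2 * (C * d)" using mb Yb[of N i E] by linarith
    then have "\<bar>?Y N i E - m\<bar>\<^sup>2 \<le> (2 * (C * d))\<^sup>2" by (rule power_mono) simp
    then show "norm ((?Y N i E - m)\<^sup>2) \<le> (2 * (C * d))\<^sup>2" by simp
  qed measurable
  have "(\<integral>E. \<bar>?X E - m\<bar> \<partial>\<mu>) \<le> (\<integral>E. (?Y N i E - ?X E) + (\<eta> / 2 + (?Y N i E - m)\<^sup>2 / (2 * \<eta>)) \<partial>\<mu>)"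
  proof (rule integral_mono_AE)
    show "integrable \<mu> (\<lambda>E. \<bar>?X E - m\<bar>)" by (intro integrable_abs Bochner_Integration.integrable_diff iX integrable_const)
    show "integrable \<mu> (\<lambda>E. (?Y N i E - ?X E) + (\<eta> / 2 + (?Y N i E - m)\<^sup>2 / (2 * \<eta>)))"
      by (intro Bochner_Integration.integrable_add Bochner_Integration.integrable_diff integrable_divide iX iY integrable_const isq)
    show "AE E in \<mu>. \<bar>?X E - m\<bar> \<le> (?Y N i E - ?X E) + (\<eta> / 2 + (?Y N i E - m)\<^sup>2 / (2 * \<eta>))"
      using XY
    proof eventually_elim
      case (elim E)
      \<comment> \<open>The inequality of arithmetic and geometric means replaces the
        Cauchy--Schwarz inequality. With variance at most \<open>\<eta>\<^sup>2\<close> the two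
        terms integrate to at most \<open>\<eta> / 2\<close> each, and the one-sided error of the
        grid adds \<open>2 * \<eta>\<close>.\<close>
      have "\<bar>?Y N i E - m\<bar> \<le> (\<eta>\<^sup>2 + \<bar>?Y N i E - m\<bar>\<^sup>2) / (2 * \<eta>)"
        using sum_squares_bound[of \<eta> "\<bar>?Y N i E - m\<bar>"] \<eta> by (subst pos_le_divide_eq) (auto simp only: mult_ac)
      also have "\<dots> = \<eta> / 2 + (?Y N i E - m)\<^sup>2 / (2 * \<eta>)"
        using \<eta> unfolding power2_abs add_divide_distrib by (simp add: power2_eq_square)
      finally have "\<bar>?Y N i E - m\<bar> \<le> \<eta> / 2 + (?Y N i E - m)\<^sup>2 / (2 * \<eta>)" .
      then show ?case using elim[rule_format, of N i] by linarith
    qed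
  qed
  also have "\<dots> = (\<integral>E. ?Y N i E - ?X E \<partial>\<mu>) + (\<eta> / 2 + (\<integral>E. (?Y N i E - m)\<^sup>2 \<partial>\<mu>) / (2 * \<eta>))"
    using isq by (simp add: prob_space)
  also have "\<dots> \<le> 2 * \<eta> + (\<eta> / 2 + \<eta>\<^sup>2 / (2 * \<eta>))"
    using i(2) var \<eta> by (intro add_mono divide_right_mono) auto
  also have "\<dots> = 3 * \<eta>" using \<eta> by (simp add: power2_eq_square)
  finally show ?thesis by blast
qed

lemma AE_distance_constant:
  assumes \<mu>: "prob_space \<mu>" "sets \<mu> = sets (metric_space_borel U)" and equiv: "AE E in \<mu>. equivalent E"
    and approx: "AE E in \<mu>. chain_approximable U K E" and K: "\<And>m. compact (K m)" "\<And>m. K m \<subseteq> U"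
    and indep: "cells_independent U \<mu>" and zw: "z \<in> rational_points U" "w \<in> rational_points U"
  shows "\<exists>c. AE E in \<mu>. E (z, w) = c"
proof -
  interpret prob_space \<mu> by (rule \<mu>)
  let ?X = "\<lambda>E::complex \<times> complex \<Rightarrow> ennreal. enn2real (E (z, w))"
  have zwU: "z \<in> U" "w \<in> U" using zw rational_points_subset[of U] by auto
  have X[measurable]: "?X \<in> borel_measurable \<mu>"
    using measurable_eval_metric[of "(z, w)" U] zwU \<mu>(2) by (auto cong: measurable_cong_sets)
  have "AE E in \<mu>. norm (?X E) \<le> C * enn2real (D\<^sub>0 (z, w))"
    using equiv by eventually_elim (use equivalent_real(1)[OF _ zwU] in simp)
  then have iX: "integrable \<mu> ?X" by (rule integrable_const_bound) measurable
  define c where "c = (\<integral>E. ?X E \<partial>\<mu>)"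
  have iXm: "integrable \<mu> (\<lambda>E. \<bar>?X E - m\<bar>)" for m by (intro integrable_abs Bochner_Integration.integrable_diff iX integrable_const)
  have "(\<integral>E. \<bar>?X E - c\<bar> \<partial>\<mu>) \<le> 0"
  proof (rule field_le_epsilon)
    fix e :: real assume e: "e > 0"
    \<comment> \<open>Replacing \<open>m\<close> by the mean at most doubles the mean deviation, so
      the choice \<open>e / 6\<close> yields \<open>2 * 3 * (e / 6) = e\<close>.\<close>
    then obtain m where m: "(\<integral>E. \<bar>?X E - m\<bar> \<partial>\<mu>) \<le> 3 * (e / 6)"
      using distance_almost_constant[OF \<mu> equiv approx K indep zw, of "e / 6"] by auto
    have "c - m = (\<integral>E. ?X E - m \<partial>\<mu>)" using iX by (simp add: c_def prob_space)
    then have cm: "\<bar>c - m\<bar> \<le> (\<integral>E. \<bar>?X E - m\<bar> \<partial>\<mu>)" using integral_norm_bound[of \<mu> "\<lambda>E. ?X E - m"] by simp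
    have "(\<integral>E. \<bar>?X E - c\<bar> \<partial>\<mu>) \<le> (\<integral>E. \<bar>?X E - m\<bar> + \<bar>c - m\<bar> \<partial>\<mu>)"
      by (intro integral_mono iXm Bochner_Integration.integrable_add integrable_const) linarith
    also have "\<dots> = (\<integral>E. \<bar>?X E - m\<bar> \<partial>\<mu>) + \<bar>c - m\<bar>" using iXm by (simp add: prob_space)
    finally show "(\<integral>E. \<bar>?X E - c\<bar> \<partial>\<mu>) \<le> 0 + e" using cm m by linarith
  qed
  moreover have "0 \<le> (\<integral>E. \<bar>?X E - c\<bar> \<partial>\<mu>)" by (rule integral_nonneg_AE) simp
  ultimately have "(\<integral>E. \<bar>?X E - c\<bar> \<partial>\<mu>) = 0" by linarith
  then have "AE E in \<mu>. \<bar>?X E - c\<bar> = 0" by (subst (asm) integral_nonneg_eq_0_iff_AE[OF iXm]) auto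
  with equiv have "AE E in \<mu>. E (z, w) = ennreal c"
  proof eventually_elim
    case (elim E)
    then have "E (z, w) < \<top>" using finite_metric[OF _ zwU, of E] by (simp add: equivalent_def)
    then have "E (z, w) = ennreal (?X E)" by simp
    also have "?X E = c" using elim(2) by simp
    finally show ?case .
  qed
  then show ?thesis by blast
qed

end

section \<open>Determination by the field\<close>

lemma countable_cell_constraints: "countable (cell_constraints j)"
  unfolding cell_constraints_def
  by (intro countable_Collect_finite_subset countable_SIGMA countable_rational_points countable_rat)

lemma countable_rational_cells: "countable (rational_cells U)"
  by (rule countable_subset[of _ "rational_points UNIV \<times> rational_points UNIV"])
    (auto simp: rational_cells_def mem_Times_iff intro!: countable_SIGMA countable_rational_points)

text \<open>A way of saying that \<open>\<mu>\<close> is a point mass by countably many conditions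
  on the measures of fixed events. In this form the set of fields for which it holds is
  measurable.\<close>

definition zero_one_distances :: "complex set \<Rightarrow> (complex \<times> complex \<Rightarrow> ennreal) measure \<Rightarrow> bool" where
  "zero_one_distances U \<mu> \<longleftrightarrow> (\<forall>p\<in>rational_points U \<times> rational_points U. \<forall>r\<in>\<rat>.
     measure \<mu> {E \<in> continuous_metrics U. E p < ennreal r} \<in> {0, 1})"

lemma ennreal_eqI_rational_cuts:
  assumes "\<And>r. r \<in> \<rat> \<Longrightarrow> (x::ennreal) < ennreal r \<longleftrightarrow> y < ennreal r" shows "x = y"
proof -
  have "y \<le> x" if *: "\<And>r. r \<in> \<rat> \<Longrightarrow> x < ennreal r \<Longrightarrow> y < ennreal r" for x y :: ennreal
  proof (cases x)
    case (real a)
    show ?thesis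
    proof (rule ennreal_le_epsilon)
      fix e :: real assume "e > 0"
      then obtain r where r: "r \<in> \<rat>" "a < r" "r < a + e" using Rats_dense_in_real[of a "a + e"] by auto
      have "y < ennreal r" using real r by (intro * ) (auto simp: ennreal_less_iff)
      also have "\<dots> \<le> ennreal (a + e)" using r by (intro ennreal_leI) simp
      also have "\<dots> = x + ennreal e" using real \<open>e > 0\<close> by simp
      finally show "y \<le> x + ennreal e" by simp
    qed
  qed simp
  then show ?thesis using assms by (intro antisym) blast+
qed

text \<open>Almost every \<open>E\<close> lies below exactly those rational thresholds that have
  probability \<open>1\<close>. Any such \<open>E\<close> can serve as the atom, since the
  thresholds determine the distances between rational points, and these determine a continuous
  metric.\<close>

lemma zero_one_distances_point_mass:
  assumes U: "open U" and \<mu>: "prob_space \<mu>" "sets \<mu> = sets (metric_space_borel U)" and "zero_one_distances U \<mu>"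
  shows "\<exists>x\<in>continuous_metrics U. AE E in \<mu>. E = x"
proof -
  interpret prob_space \<mu> by (rule \<mu>)
  let ?Q = "rational_points U"
  let ?B = "\<lambda>p r. {E \<in> continuous_metrics U. E p < ennreal r}"
  have sp: "space \<mu> = continuous_metrics U" using sets_eq_imp_space_eq[OF \<mu>(2)] space_metric_space_borel by simp
  have B: "?B p r \<in> events" if "p \<in> ?Q \<times> ?Q" for p r
    unfolding \<mu>(2) using that rational_points_subset[of U] by (intro eval_less_sets) auto
  have "AE E in \<mu>. \<forall>p\<in>?Q \<times> ?Q. \<forall>r\<in>\<rat>. E \<in> continuous_metrics U \<and> (E p < ennreal r \<longleftrightarrow> prob (?B p r) = 1)"
  proof (subst AE_ball_countable)
    show "countable (?Q \<times> ?Q)" by (intro countable_SIGMA countable_rational_points)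
    show "\<forall>p\<in>?Q \<times> ?Q. AE E in \<mu>. \<forall>r\<in>\<rat>. E \<in> continuous_metrics U \<and> (E p < ennreal r \<longleftrightarrow> prob (?B p r) = 1)"
    proof (intro ballI, subst AE_ball_countable[OF countable_rat], intro ballI)
      fix p and r :: real assume p: "p \<in> ?Q \<times> ?Q" and r: "r \<in> \<rat>"
      have "prob (?B p r) = 0 \<or> prob (?B p r) = 1" using assms(4) p r unfolding zero_one_distances_def by blast
      then show "AE E in \<mu>. E \<in> continuous_metrics U \<and> (E p < ennreal r \<longleftrightarrow> prob (?B p r) = 1)"
      proof
        assume 0: "prob (?B p r) = 0"
        then have "AE E in \<mu>. E \<notin> ?B p r" using B[OF p] by (intro AE_not_in) (simp add: null_sets_def emeasure_eq_measure)
        then show ?thesis using AE_space by eventually_elim (use 0 sp in auto)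
      next
        assume 1: "prob (?B p r) = 1"
        then have "AE E in \<mu>. E \<in> ?B p r" using B[OF p] by (simp add: prob_eq_1)
        then show ?thesis using AE_space by eventually_elim (use 1 sp in auto)
      qed
    qed
  qed
  with AE_space have ae: "AE E in \<mu>. E \<in> continuous_metrics U \<and> (\<forall>p\<in>?Q \<times> ?Q. \<forall>r\<in>\<rat>. E p < ennreal r \<longleftrightarrow> prob (?B p r) = 1)"
    (is "AE E in \<mu>. ?P E") by eventually_elim (use sp in auto)
  have "\<exists>x. ?P x"
  proof (rule ccontr)
    assume neg: "\<not> ?thesis"
    have "AE E in \<mu>. False" using ae by eventually_elim (use neg in blast)
    then show False by simp
  qed
  then obtain x where x: "?P x" by blast
  have "E = x" if "?P E" for E
  proof (rule continuous_metrics_eqI[OF U])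
    fix p q assume "p \<in> ?Q" "q \<in> ?Q"
    then have pq: "(p, q) \<in> ?Q \<times> ?Q" by simp
    show "E (p, q) = x (p, q)"
    proof (rule ennreal_eqI_rational_cuts)
      fix r :: real assume r: "r \<in> \<rat>"
      show "E (p, q) < ennreal r \<longleftrightarrow> x (p, q) < ennreal r" using that x pq r by blast
    qed
  qed (use that x in blast)+
  with ae have "AE E in \<mu>. E = x" by (rule eventually_mono)
  with x show ?thesis by blast
qed

lemma zero_one_distancesI:
  assumes \<mu>: "prob_space \<mu>" "sets \<mu> = sets (metric_space_borel U)"
    and c: "\<And>z w. z \<in> rational_points U \<Longrightarrow> w \<in> rational_points U \<Longrightarrow> \<exists>c. AE E in \<mu>. E (z, w) = c"
  shows "zero_one_distances U \<mu>"
  unfolding zero_one_distances_def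
proof (intro ballI)
  interpret prob_space \<mu> by (rule \<mu>)
  fix p and r :: real assume p: "p \<in> rational_points U \<times> rational_points U"
  let ?B = "{E \<in> continuous_metrics U. E p < ennreal r}"
  have sp: "space \<mu> = continuous_metrics U" using sets_eq_imp_space_eq[OF \<mu>(2)] space_metric_space_borel by simp
  have B: "?B \<in> events"
    unfolding \<mu>(2) using p rational_points_subset[of U] by (intro eval_less_sets) auto
  obtain a where a: "AE E in \<mu>. E p = a" using c[of "fst p" "snd p"] p by (auto simp: mem_Times_iff)
  show "prob ?B \<in> {0, 1}"
  proof (cases "a < ennreal r")
    case True
    have "AE E in \<mu>. E \<in> ?B" using a AE_space by eventually_elim (use True sp in auto)
    then show ?thesis using B by (simp add: prob_eq_1)
  next
    case False
    have "AE E in \<mu>. E \<notin> ?B" using a AE_space by eventually_elim (use False sp in auto)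
    then have "prob ?B = prob {}" using B by (intro finite_measure_eq_AE) auto
    then show ?thesis by simp
  qed
qed

section \<open>From the conditional law back to the coupling\<close>

context local_metric_coupling
begin

lemma kernel_measurable: "\<kappa> \<in> distribution_space U \<rightarrow>\<^sub>M prob_algebra (metric_space_borel U)"
  using kernel unfolding conditional_law_def by blast

lemma kernel_prob:
  assumes "T \<in> space (distribution_space U)"
  shows "prob_space (\<kappa> T)" "sets (\<kappa> T) = sets (metric_space_borel U)" "space (\<kappa> T) = continuous_metrics U"
proof -
  have "\<kappa> T \<in> space (prob_algebra (metric_space_borel U))" by (rule measurable_space[OF kernel_measurable assms])
  then show p: "prob_space (\<kappa> T)" "sets (\<kappa> T) = sets (metric_space_borel U)" by (auto simp: space_prob_algebra)
  show "space (\<kappa> T) = continuous_metrics U" using sets_eq_imp_space_eq[OF p(2)] space_metric_space_borel by simp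
qed

lemma h_space: "\<omega> \<in> space M \<Longrightarrow> h \<omega> \<in> space (distribution_space U)"
  by (rule measurable_space[OF h_measurable])

lemma measurable_kernel_measure:
  "B \<in> sets (metric_space_borel U) \<Longrightarrow> (\<lambda>T. measure (\<kappa> T) B) \<in> borel_measurable (distribution_space U)"
  using measurable_compose[OF measurable_prob_algebraD[OF kernel_measurable] measurable_measure_subprob_algebra] by simp

lemma joint_law:
  assumes "A \<in> sets (distribution_space U)" "B \<in> sets (metric_space_borel U)"
  shows "measure M {\<omega> \<in> space M. h \<omega> \<in> A \<and> D \<omega> \<in> B} = (\<integral>\<omega>. indicator A (h \<omega>) * measure (\<kappa> (h \<omega>)) B \<partial>M)"
  using kernel assms unfolding conditional_law_def by blast

text \<open>The mean of the conditional probabilities of \<open>B\<close> is the probability that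
  \<open>D\<close> lies in \<open>B\<close>, namely \<open>1\<close>; as none of them exceeds
  \<open>1\<close>, almost all are equal to \<open>1\<close>. This carries properties of all
  \<open>D \<omega>\<close> over to the conditional law.\<close>

lemma AE_kernel:
  assumes B: "B \<in> sets (metric_space_borel U)" and D: "\<And>\<omega>. \<omega> \<in> space M \<Longrightarrow> D \<omega> \<in> B"
  shows "AE \<omega> in M. AE E in \<kappa> (h \<omega>). E \<in> B"
proof -
  interpret prob_space M by (rule M)
  have m[measurable]: "(\<lambda>\<omega>. measure (\<kappa> (h \<omega>)) B) \<in> borel_measurable M" by (rule measurable_compose[OF h_measurable measurable_kernel_measure[OF B]])
  have le: "measure (\<kappa> (h \<omega>)) B \<le> 1" if "\<omega> \<in> space M" for \<omega> using prob_space.prob_le_1[OF kernel_prob(1)[OF h_space[OF that]]] .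
  have int: "integrable M (\<lambda>\<omega>. measure (\<kappa> (h \<omega>)) B)"
    by (rule prob_integrable_bounded[OF M m, of 1]) (use le in simp)
  have "1 = measure M {\<omega> \<in> space M. h \<omega> \<in> space (distribution_space U) \<and> D \<omega> \<in> B}"
  proof -
    have "{\<omega> \<in> space M. h \<omega> \<in> space (distribution_space U) \<and> D \<omega> \<in> B} = space M" using h_space D by blast
    then show ?thesis by (simp add: prob_space)
  qed
  also have "\<dots> = (\<integral>\<omega>. indicator (space (distribution_space U)) (h \<omega>) * measure (\<kappa> (h \<omega>)) B \<partial>M)" by (rule joint_law[OF sets.top B])
  also have "\<dots> = (\<integral>\<omega>. measure (\<kappa> (h \<omega>)) B \<partial>M)" by (rule Bochner_Integration.integral_cong) (auto simp: h_space)
  finally have "(\<integral>\<omega>. 1 - measure (\<kappa> (h \<omega>)) B \<partial>M) = 0" using int by (simp add: prob_space)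
  then have "AE \<omega> in M. 1 - measure (\<kappa> (h \<omega>)) B = 0"
    using int le by (subst (asm) integral_nonneg_eq_0_iff_AE) auto
  then show ?thesis using AE_space
  proof eventually_elim
    case (elim \<omega>)
    interpret K: prob_space "\<kappa> (h \<omega>)" by (rule kernel_prob(1)[OF h_space[OF elim(2)]])
    have "B \<in> K.events" using B kernel_prob(2)[OF h_space[OF elim(2)]] by simp
    then show ?case using elim(1) by (simp add: K.prob_eq_1)
  qed
qed

lemma AE_cells_independent: "AE \<omega> in M. cells_independent U (\<kappa> (h \<omega>))"
proof -
  let ?J = "{J. finite J \<and> J \<subseteq> rational_cells U}"
  have "AE \<omega> in M. \<forall>J\<in>?J. \<forall>\<F>\<in>PiE J cell_constraints. pairwise (\<lambda>i j. cell i \<inter> cell j = {}) J \<longrightarrow>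
      measure (\<kappa> (h \<omega>)) (chain_event U J \<F>) = (\<Prod>j\<in>J. measure (\<kappa> (h \<omega>)) (chain_event U {j} \<F>))"
  proof (subst AE_ball_countable)
    show "countable ?J" by (rule countable_Collect_finite_subset[OF countable_rational_cells])
    show "\<forall>J\<in>?J. AE \<omega> in M. \<forall>\<F>\<in>PiE J cell_constraints. pairwise (\<lambda>i j. cell i \<inter> cell j = {}) J \<longrightarrow>
      measure (\<kappa> (h \<omega>)) (chain_event U J \<F>) = (\<Prod>j\<in>J. measure (\<kappa> (h \<omega>)) (chain_event U {j} \<F>))"
    proof
      fix J assume J: "J \<in> ?J"
      show "AE \<omega> in M. \<forall>\<F>\<in>PiE J cell_constraints. pairwise (\<lambda>i j. cell i \<inter> cell j = {}) J \<longrightarrow>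
        measure (\<kappa> (h \<omega>)) (chain_event U J \<F>) = (\<Prod>j\<in>J. measure (\<kappa> (h \<omega>)) (chain_event U {j} \<F>))"
      proof (subst AE_ball_countable)
        show "countable (PiE J cell_constraints)" using J by (intro countable_PiE countable_cell_constraints) simp
        show "\<forall>\<F>\<in>PiE J cell_constraints. AE \<omega> in M. pairwise (\<lambda>i j. cell i \<inter> cell j = {}) J \<longrightarrow>
          measure (\<kappa> (h \<omega>)) (chain_event U J \<F>) = (\<Prod>j\<in>J. measure (\<kappa> (h \<omega>)) (chain_event U {j} \<F>))"
        proof
          fix \<F> assume F: "\<F> \<in> PiE J cell_constraints"
          show "AE \<omega> in M. pairwise (\<lambda>i j. cell i \<inter> cell j = {}) J \<longrightarrow>
            measure (\<kappa> (h \<omega>)) (chain_event U J \<F>) = (\<Prod>j\<in>J. measure (\<kappa> (h \<omega>)) (chain_event U {j} \<F>))"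
          proof (cases "pairwise (\<lambda>i j. cell i \<inter> cell j = {}) J")
            case True
            have "AE \<omega> in M. measure (\<kappa> (h \<omega>)) (chain_event U J \<F>) = (\<Prod>j\<in>J. measure (\<kappa> (h \<omega>)) (chain_event U {j} \<F>))"
            proof (rule kernel_cells_independent)
              show "finite J" using J by simp
              show "cell j \<subseteq> U" if "j \<in> J" for j using J that by (auto simp: rational_cells_def)
              show "cell i \<inter> cell j = {}" if "i \<in> J" "j \<in> J" "i \<noteq> j" for i j by (rule pairwiseD[OF True that])
              show "\<F> j \<in> cell_constraints j" if "j \<in> J" for j by (rule PiE_mem[OF F that])
            qed
            then show ?thesis by eventually_elim simp
          qed simp
        qed
      qed
    qed
  qed
  then show ?thesis
  proof eventually_elim
    case (elim \<omega>)
    show ?case unfolding cells_independent_def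
    proof (intro allI impI)
      fix J \<F> assume J: "finite J" "J \<subseteq> rational_cells U" "pairwise (\<lambda>i j. cell i \<inter> cell j = {}) J" "\<forall>j\<in>J. \<F> j \<in> cell_constraints j"
      \<comment> \<open>Constraints outside \<open>J\<close> have no influence, and only extensional
        choices on \<open>J\<close> form a countable set over which a common null set was
        taken.\<close>
      have 1: "chain_event U I \<F> = chain_event U I (restrict \<F> J)" if "I \<subseteq> J" for I using that by (auto simp: chain_event_def)
      have "restrict \<F> J \<in> PiE J cell_constraints" using J(4) by auto
      then have "measure (\<kappa> (h \<omega>)) (chain_event U J (restrict \<F> J)) = (\<Prod>j\<in>J. measure (\<kappa> (h \<omega>)) (chain_event U {j} (restrict \<F> J)))"
        using elim J(1-3) by blast
      then show "measure (\<kappa> (h \<omega>)) (chain_event U J \<F>) = (\<Prod>j\<in>J. measure (\<kappa> (h \<omega>)) (chain_event U {j} \<F>))"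
        using 1[OF subset_refl] 1[of "{_}"] by simp
    qed
  qed
qed

text \<open>The product measure is invariant under exchanging the two samples, so the bound holds in
  both directions. By Fubini almost every first sample is comparable in both directions to almost
  every second one, and any such first sample is taken as \<open>D\<^sub>0\<close>.\<close>

lemma equivalent_of_iid_bound:
  fixes \<mu> :: "(complex \<times> complex \<Rightarrow> ennreal) measure"
  assumes \<mu>: "prob_space \<mu>" "space \<mu> = continuous_metrics U" and c: "c \<ge> 1"
    and bound: "AE (D1, D2) in \<mu> \<Otimes>\<^sub>M \<mu>. \<forall>z\<in>U. \<forall>w\<in>U. D2 (z, w) \<le> ennreal c * D1 (z, w)"
  obtains D\<^sub>0 where "metric_bound U c D\<^sub>0" "AE E in \<mu>. metric_bound.equivalent U c D\<^sub>0 E"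
proof -
  interpret prob_space \<mu> by (rule \<mu>)
  interpret P: pair_sigma_finite \<mu> \<mu> ..
  let ?le = "\<lambda>D1 D2 :: complex \<times> complex \<Rightarrow> ennreal. \<forall>z\<in>U. \<forall>w\<in>U. D2 (z, w) \<le> ennreal c * D1 (z, w)"
  have b: "AE p in \<mu> \<Otimes>\<^sub>M \<mu>. ?le (fst p) (snd p)" using bound by (simp add: case_prod_beta)
  have 1: "AE D1 in \<mu>. AE D2 in \<mu>. ?le D1 D2" using P.AE_pair[OF b] by simp
  have "AE p in \<mu> \<Otimes>\<^sub>M \<mu>. ?le (snd p) (fst p)"
  proof -
    have "AE p in distr (\<mu> \<Otimes>\<^sub>M \<mu>) (\<mu> \<Otimes>\<^sub>M \<mu>) (\<lambda>(x, y). (y, x)). ?le (fst p) (snd p)"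
      by (subst P.distr_pair_swap[symmetric]) (rule b)
    from AE_distrD[OF measurable_pair_swap' this] show ?thesis by (simp add: case_prod_beta)
  qed
  then have 2: "AE D1 in \<mu>. AE D2 in \<mu>. ?le D2 D1" using P.AE_pair[of "\<lambda>p. ?le (snd p) (fst p)"] by simp
  have 3: "AE D1 in \<mu>. D1 \<in> continuous_metrics U \<and> (AE D2 in \<mu>. ?le D1 D2) \<and> (AE D2 in \<mu>. ?le D2 D1)"
    using 1 2 AE_space by eventually_elim (use \<mu>(2) in simp)
  have "\<exists>D1. D1 \<in> continuous_metrics U \<and> (AE D2 in \<mu>. ?le D1 D2) \<and> (AE D2 in \<mu>. ?le D2 D1)"
  proof (rule ccontr)
    assume neg: "\<not> ?thesis"
    have "AE E in \<mu>. False" using 3 by eventually_elim (use neg in blast)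
    then show False by simp
  qed
  then obtain D\<^sub>0 where D\<^sub>0: "D\<^sub>0 \<in> continuous_metrics U" "AE E in \<mu>. ?le D\<^sub>0 E" "AE E in \<mu>. ?le E D\<^sub>0" by blast
  have mb: "metric_bound U c D\<^sub>0" by standard (use U c D\<^sub>0 in auto)
  have "AE E in \<mu>. metric_bound.equivalent U c D\<^sub>0 E"
    using D\<^sub>0(2,3) AE_space
  proof eventually_elim
    case (elim E)
    then show ?case unfolding metric_bound.equivalent_def[OF mb] using \<mu>(2) by blast
  qed
  with mb show ?thesis using that by blast
qed

lemma AE_zero_one_distances:
  assumes C: "\<forall>T\<in>space (distribution_space U). C T > 1"
    and bound: "AE \<omega> in M. AE (D1, D2) in \<kappa> (h \<omega>) \<Otimes>\<^sub>M \<kappa> (h \<omega>).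
           \<forall>z\<in>U. \<forall>w\<in>U. D2 (z, w) \<le> ennreal (C (h \<omega>)) * D1 (z, w)"
  shows "AE \<omega> in M. zero_one_distances U (\<kappa> (h \<omega>))"
proof -
  obtain K :: "nat \<Rightarrow> complex set" where K: "\<And>n. compact (K n)" "\<And>n. K n \<subseteq> U" "\<And>n. K n \<subseteq> interior (K (Suc n))"
      "\<Union>(range K) = U" "\<And>L. compact L \<Longrightarrow> L \<subseteq> U \<Longrightarrow> \<exists>N. \<forall>n\<ge>N. L \<subseteq> K n"
    using open_Union_compact_subsets[OF U(1)] by metis
  have "AE \<omega> in M. AE E in \<kappa> (h \<omega>). E \<in> {E \<in> space (metric_space_borel U). chain_approximable U K E}"
  proof (rule AE_kernel[OF chain_approximable_sets])
    fix \<omega> assume \<omega>: "\<omega> \<in> space M"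
    have "chain_approximable U K (D \<omega>)"
      by (rule length_metric_chain_approximable[OF U(1) D_metric[OF \<omega>] length[rule_format, OF \<omega>] K(3,5)])
    then show "D \<omega> \<in> {E \<in> space (metric_space_borel U). chain_approximable U K E}"
      using D_metric[OF \<omega>] by (simp add: space_metric_space_borel)
  qed
  then show ?thesis using bound AE_cells_independent AE_space
  proof eventually_elim
    case (elim \<omega>)
    note T = h_space[OF elim(4)]
    have approx: "AE E in \<kappa> (h \<omega>). chain_approximable U K E" using elim(1) by eventually_elim simp
    have c: "1 \<le> C (h \<omega>)" using C T by (simp add: less_imp_le)
    obtain D\<^sub>0 where D\<^sub>0: "metric_bound U (C (h \<omega>)) D\<^sub>0" "AE E in \<kappa> (h \<omega>). metric_bound.equivalent U (C (h \<omega>)) D\<^sub>0 E"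
      using equivalent_of_iid_bound[OF kernel_prob(1,3)[OF T] c elim(2)] by blast
    show ?case
      by (rule zero_one_distancesI[OF kernel_prob(1,2)[OF T]])
         (rule metric_bound.AE_distance_constant[OF D\<^sub>0(1) kernel_prob(1,2)[OF T] D\<^sub>0(2) approx K(1,2) elim(3)])
  qed
qed

text \<open>The atom of \<open>\<kappa> T\<close> depends measurably on \<open>T\<close>, because it
  lies in \<open>A\<close> exactly when \<open>\<kappa> T\<close> gives \<open>A\<close> measure
  \<open>1\<close>. The joint law then shows that \<open>D\<close> and the atom belong to the same
  sets of a countable separating family, almost surely.\<close>

lemma kernel_point_mass_determines:
  assumes point: "AE \<omega> in M. zero_one_distances U (\<kappa> (h \<omega>))"
  shows "\<exists>F \<in> distribution_space U \<rightarrow>\<^sub>M metric_space_borel U. AE \<omega> in M. D \<omega> = F (h \<omega>)"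
proof -
  interpret prob_space M by (rule M)
  let ?S = "distribution_space U" and ?N = "metric_space_borel U" and ?Q = "rational_points U"
  define G where "G = {T \<in> space ?S. zero_one_distances U (\<kappa> T)}"
  have G: "G \<in> sets ?S"
    unfolding G_def zero_one_distances_def
  proof (rule sets.sets_Collect_countable_All'[OF sets.sets_Collect_countable_All'[OF _ countable_rat]])
    show "countable (?Q \<times> ?Q)" by (intro countable_SIGMA countable_rational_points)
    fix p and r :: real assume "p \<in> ?Q \<times> ?Q"
    then have "{E \<in> continuous_metrics U. E p < ennreal r} \<in> sets ?N" using rational_points_subset[of U] by (intro eval_less_sets) auto
    note [measurable] = measurable_kernel_measure[OF this]
    show "{T \<in> space ?S. measure (\<kappa> T) {E \<in> continuous_metrics U. E p < ennreal r} \<in> {0, 1}} \<in> sets ?S" by measurable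
  qed
  obtain \<omega>\<^sub>0 where \<omega>\<^sub>0: "\<omega>\<^sub>0 \<in> space M" using not_empty by blast
  have "\<forall>T\<in>G. \<exists>x\<in>continuous_metrics U. AE E in \<kappa> T. E = x"
    using zero_one_distances_point_mass[OF U(1) kernel_prob(1,2)] by (simp add: G_def)
  then obtain f where f: "\<And>T. T \<in> G \<Longrightarrow> f T \<in> continuous_metrics U \<and> (AE E in \<kappa> T. E = f T)" by metis
  \<comment> \<open>Off \<open>G\<close> any continuous metric on \<open>U\<close> would do as a
    constant value; a value of \<open>D\<close> supplies one.\<close>
  define F where "F T = (if T \<in> G then f T else D \<omega>\<^sub>0)" for T
  have FG: "measure (\<kappa> T) A = (if F T \<in> A then 1 else 0)" if T: "T \<in> G" and A: "A \<in> sets ?N" for T A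
  proof -
    have TS: "T \<in> space ?S" using T by (simp add: G_def)
    interpret K: prob_space "\<kappa> T" by (rule kernel_prob(1)[OF TS])
    have A': "A \<in> K.events" using A kernel_prob(2)[OF TS] by simp
    have ae: "AE E in \<kappa> T. E = F T" using f[OF T] T by (simp add: F_def)
    show ?thesis
    proof (cases "F T \<in> A")
      case True
      have "AE E in \<kappa> T. E \<in> A" using ae by eventually_elim (use True in simp)
      then show ?thesis using True A' by (simp add: K.prob_eq_1)
    next
      case False
      have "AE E in \<kappa> T. E \<notin> A" using ae by eventually_elim (use False in simp)
      then have "K.prob A = K.prob {}" using A' by (intro K.finite_measure_eq_AE) auto
      then show ?thesis using False by simp
    qed
  qed
  have Fm: "F \<in> ?S \<rightarrow>\<^sub>M ?N"
  proof (rule measurableI)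
    fix T assume "T \<in> space ?S"
    then show "F T \<in> space ?N" using f[of T] D_metric[OF \<omega>\<^sub>0] by (simp add: F_def space_metric_space_borel)
  next
    fix A assume A: "A \<in> sets ?N"
    have "F -` A \<inter> space ?S = {T \<in> space ?S. T \<in> G \<and> measure (\<kappa> T) A = 1} \<union> (if D \<omega>\<^sub>0 \<in> A then space ?S - G else {})"
      using FG[OF _ A] by (auto simp: F_def G_def split: if_splits)
    moreover have "{T \<in> space ?S. T \<in> G \<and> measure (\<kappa> T) A = 1} \<in> sets ?S"
      using measurable_kernel_measure[OF A] G by measurable
    ultimately show "F -` A \<inter> space ?S \<in> sets ?S" using G by auto
  qed
  \<comment> \<open>Test the joint law on the fields whose atom lies outside \<open>B\<close>: there
    the conditional probability of \<open>B\<close> is \<open>0\<close>, so \<open>D\<close> almost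
    surely avoids \<open>B\<close> as well.\<close>
  have FD: "AE \<omega> in M. h \<omega> \<in> G \<longrightarrow> D \<omega> \<in> B \<longrightarrow> F (h \<omega>) \<in> B" if B: "B \<in> sets ?N" for B
  proof -
    let ?A = "G - F -` B \<inter> space ?S"
    have A: "?A \<in> sets ?S" using G measurable_sets[OF Fm B] by blast
    have "measure M {\<omega> \<in> space M. h \<omega> \<in> ?A \<and> D \<omega> \<in> B} = (\<integral>\<omega>. indicator ?A (h \<omega>) * measure (\<kappa> (h \<omega>)) B \<partial>M)" by (rule joint_law[OF A B])
    also have "\<dots> = (\<integral>\<omega>. 0 \<partial>M)"
      by (rule Bochner_Integration.integral_cong) (auto simp: FG[OF _ B] G_def split: split_indicator)
    finally have 0: "prob {\<omega> \<in> space M. h \<omega> \<in> ?A \<and> D \<omega> \<in> B} = 0" by simp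
    have ev: "{\<omega> \<in> space M. h \<omega> \<in> ?A \<and> D \<omega> \<in> B} \<in> events"
    proof -
      have "{\<omega> \<in> space M. h \<omega> \<in> ?A \<and> D \<omega> \<in> B} = (h -` ?A \<inter> space M) \<inter> (D -` B \<inter> space M)" by blast
      then show ?thesis using measurable_sets[OF h_measurable A] measurable_sets[OF D_measurable B] by simp
    qed
    have "AE \<omega> in M. \<omega> \<notin> {\<omega> \<in> space M. h \<omega> \<in> ?A \<and> D \<omega> \<in> B}"
      using 0 ev by (intro AE_not_in) (simp add: null_sets_def emeasure_eq_measure)
    then show ?thesis using AE_space by eventually_elim (auto simp: G_def)
  qed
  let ?B = "\<lambda>p r. {E \<in> continuous_metrics U. E p < ennreal r}"
  have B: "?B p r \<in> sets ?N" if "p \<in> ?Q \<times> ?Q" for p r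
    using that rational_points_subset[of U] by (intro eval_less_sets) auto
  \<comment> \<open>The implication is applied to each distance event and to its complement, which
    turns it into an equivalence.\<close>
  have eq: "AE \<omega> in M. \<forall>p\<in>?Q \<times> ?Q. \<forall>r\<in>\<rat>. h \<omega> \<in> G \<longrightarrow> (D \<omega> \<in> ?B p r \<longleftrightarrow> F (h \<omega>) \<in> ?B p r)"
  proof (subst AE_ball_countable)
    show "countable (?Q \<times> ?Q)" by (intro countable_SIGMA countable_rational_points)
    show "\<forall>p\<in>?Q \<times> ?Q. AE \<omega> in M. \<forall>r\<in>\<rat>. h \<omega> \<in> G \<longrightarrow> (D \<omega> \<in> ?B p r \<longleftrightarrow> F (h \<omega>) \<in> ?B p r)"
    proof (intro ballI, subst AE_ball_countable[OF countable_rat], intro ballI)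
      fix p and r :: real assume p: "p \<in> ?Q \<times> ?Q"
      have c: "space ?N - ?B p r \<in> sets ?N" using B[OF p, of r] by blast
      show "AE \<omega> in M. h \<omega> \<in> G \<longrightarrow> (D \<omega> \<in> ?B p r \<longleftrightarrow> F (h \<omega>) \<in> ?B p r)"
        using FD[OF B[OF p, of r]] FD[OF c] AE_space
      proof eventually_elim
        case (elim \<omega>)
        then show ?case using D_metric[OF elim(3)] unfolding space_metric_space_borel by blast
      qed
    qed
  qed
  have "AE \<omega> in M. D \<omega> = F (h \<omega>)"
    using eq point AE_space
  proof eventually_elim
    case (elim \<omega>)
    have hG: "h \<omega> \<in> G" using elim(2) h_space[OF elim(3)] by (simp add: G_def)
    have DF: "D \<omega> \<in> continuous_metrics U" "F (h \<omega>) \<in> continuous_metrics U" using D_metric[OF elim(3)] f[OF hG] hG by (auto simp: F_def)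
    show ?case
    proof (rule continuous_metrics_eqI[OF U(1) DF])
      fix p q assume "p \<in> ?Q" "q \<in> ?Q"
      then have pq: "(p, q) \<in> ?Q \<times> ?Q" by simp
      show "D \<omega> (p, q) = F (h \<omega>) (p, q)"
      proof (rule ennreal_eqI_rational_cuts)
        fix r :: real assume r: "r \<in> \<rat>"
        show "D \<omega> (p, q) < ennreal r \<longleftrightarrow> F (h \<omega>) (p, q) < ennreal r" using elim(1)[rule_format, OF pq r hG] DF by simp
      qed
    qed
  qed
  with Fm show ?thesis by blast
qed

lemma kernel_point_mass_pairs:
  assumes point: "AE \<omega> in M. zero_one_distances U (\<kappa> (h \<omega>))"
  shows "AE \<omega> in M. AE (D1, D2) in \<kappa> (h \<omega>) \<Otimes>\<^sub>M \<kappa> (h \<omega>). D1 = D2"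
  using point AE_space
proof eventually_elim
  case (elim \<omega>)
  note T = h_space[OF elim(2)]
  let ?\<mu> = "\<kappa> (h \<omega>)"
  interpret K: prob_space ?\<mu> by (rule kernel_prob(1)[OF T])
  obtain x where "AE E in ?\<mu>. E = x" using zero_one_distances_point_mass[OF U(1) kernel_prob(1,2)[OF T] elim(1)] by blast
  \<comment> \<open>The pairs of different metrics are enclosed in two measurable null strips, since
    at least one of two different metrics differs from the atom.\<close>
  then obtain N where N: "{E \<in> space ?\<mu>. E \<noteq> x} \<subseteq> N" "emeasure ?\<mu> N = 0" "N \<in> K.events" by (rule AE_E) 
  show ?case
  proof (rule AE_I)
    show "{p \<in> space (?\<mu> \<Otimes>\<^sub>M ?\<mu>). \<not> (case p of (D1, D2) \<Rightarrow> D1 = D2)} \<subseteq> N \<times> space ?\<mu> \<union> space ?\<mu> \<times> N"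
      using N(1) by (auto simp: space_pair_measure)
    show "N \<times> space ?\<mu> \<union> space ?\<mu> \<times> N \<in> sets (?\<mu> \<Otimes>\<^sub>M ?\<mu>)" using N(3) by (intro sets.Un pair_measureI sets.top)
    have "N \<times> space ?\<mu> \<in> null_sets (?\<mu> \<Otimes>\<^sub>M ?\<mu>)" "space ?\<mu> \<times> N \<in> null_sets (?\<mu> \<Otimes>\<^sub>M ?\<mu>)"
      using N by (auto simp: null_sets_def K.emeasure_pair_measure_Times)
    then show "emeasure (?\<mu> \<Otimes>\<^sub>M ?\<mu>) (N \<times> space ?\<mu> \<union> space ?\<mu> \<times> N) = 0" using null_sets.Un by blast
  qed
qed

end

theorem theorem1p7:
  fixes M :: "'w measure" and U :: "complex set"
    and h :: "'w \<Rightarrow> (complex \<Rightarrow> real) \<Rightarrow> real"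
    and D :: "'w \<Rightarrow> complex \<times> complex \<Rightarrow> ennreal"
    and \<kappa> :: "((complex \<Rightarrow> real) \<Rightarrow> real) \<Rightarrow> (complex \<times> complex \<Rightarrow> ennreal) measure"
    and C :: "((complex \<Rightarrow> real) \<Rightarrow> real) \<Rightarrow> real"
  assumes "open U" and "connected U"
    and "gff M U h"
    and "D \<in> M \<rightarrow>\<^sub>M metric_space_borel U"
    and "\<forall>\<omega>\<in>space M. length_metric U (D \<omega>)"
    and "local_metric M U h D"
    and "conditional_law M (distribution_space U) h (metric_space_borel U) D \<kappa>"
    and "C \<in> borel_measurable (distribution_space U)"
    and "\<forall>T\<in>space (distribution_space U). C T > 1"
    and "AE \<omega> in M. AE (D1, D2) in \<kappa> (h \<omega>) \<Otimes>\<^sub>M \<kappa> (h \<omega>).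
           \<forall>z\<in>U. \<forall>w\<in>U. D2 (z, w) \<le> ennreal (C (h \<omega>)) * D1 (z, w)"
  shows "(\<exists>F \<in> distribution_space U \<rightarrow>\<^sub>M metric_space_borel U. AE \<omega> in M. D \<omega> = F (h \<omega>)) \<and>
         (AE \<omega> in M. AE (D1, D2) in \<kappa> (h \<omega>) \<Otimes>\<^sub>M \<kappa> (h \<omega>).
           \<forall>z\<in>U. \<forall>w\<in>U. D2 (z, w) \<le> D1 (z, w))"
proof -
  interpret local_metric_coupling M U h D \<kappa> by standard (fact assms)+
  note point_mass = AE_zero_one_distances[OF assms(9,10)]
  have "AE \<omega> in M. AE (D1, D2) in \<kappa> (h \<omega>) \<Otimes>\<^sub>M \<kappa> (h \<omega>).
      \<forall>z\<in>U. \<forall>w\<in>U. D2 (z, w) \<le> D1 (z, w)"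
    using kernel_point_mass_pairs[OF point_mass]
  proof eventually_elim
    case (elim \<omega>)
    then show ?case by eventually_elim auto
  qed
  with kernel_point_mass_determines[OF point_mass] show ?thesis by (rule conjI)
qed


end
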